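(* Assume that $A,\hat A,A_1,\hat A_1\in L^\infty(0,T;\mathbb R^{n\times n})$, $B,\hat B,B_1,\hat B_1\in L^\infty(0,T;\mathbb R^{n\times m})$, $Q,\hat Q\in L^\infty(0,T;\mathcal S^n)$, $R,\hat R\in L^\infty(0,T;\mathcal S^m)$, $G,\hat G\in\mathcal S^n$, and that for some $\delta>0$, $$Q(s)\ge0,\quad Q(s)+\hat Q(s)\ge0,\quad R(s)\ge\delta I,\quad R(s)+\hat R(s)\ge\delta I,\quad s\in[0,T];\qquad G\ge0,\quad G+\hat G\ge0.$$ Let $x\in\mathbb R^n$. Then the unique adapted solution $(\bar X(\cdot),\bar u(\cdot),Y(\cdot),Z(\cdot))$ of the mean-field forward-backward stochastic differential equation (time variable $s$ suppressed) $$\begin{cases} d\bar X=\big(A\bar X+B\bar u+\hat A\,\mathbb E[\bar X]+\hat B\,\mathbb E[\bar u]\big)ds+\big(A_1\bar X+B_1\bar u+\hat A_1\mathbb E[\bar X]+\hat B_1\mathbb E[\bar u]\big)dW(s),\\ dY=-\big(A^TY+A_1^TZ+Q\bar X+\hat A^T\mathbb E[Y]+\hat A_1^T\mathbb E[Z]+\hat Q\,\mathbb E[\bar X]\big)ds+Z\,dW(s),\\ \bar X(0)=x,\qquad Y(T)=G\bar X(T)+\hat G\,\mathbb E[\bar X(T)],\\ R\bar u+\hat R\,\mathbb E[\bar u]+B^TY+B_1^TZ+\hat B^T\mathbb E[Y]+\hat B_1^T\mathbb E[Z]=0\end{cases}$$ admits the representation $$\begin{cases}\bar u=-K_0^{-1}(B^TP+B_1^TPA_1)\big(\bar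 X-\mathbb E[\bar X]\big)-K_1^{-1}\big[(B+\hat B)^T\Pi+(B_1+\hat B_1)^TP(A_1+\hat A_1)\big]\mathbb E[\bar X],\\ Y=P\big(\bar X-\mathbb E[\bar X]\big)+\Pi\,\mathbb E[\bar X],\\ Z=\big[PA_1-PB_1K_0^{-1}(B^TP+B_1^TPA_1)\big]\big(\bar X-\mathbb E[\bar X]\big)\\ \qquad+\big[P(A_1+\hat A_1)-P(B_1+\hat B_1)K_1^{-1}\big((B+\hat B)^T\Pi+(B_1+\hat B_1)^TP(A_1+\hat A_1)\big)\big]\mathbb E[\bar X],\end{cases}$$ where $$K_0=R+B_1^TPB_1,\qquad K_1=R+\hat R+(B_1+\hat B_1)^TP(B_1+\hat B_1),$$ and $P(\cdot)$ and $\Pi(\cdot)$ are solutions of the Riccati equations $$\begin{cases}P'+PA+A^TP+A_1^TPA_1+Q-(PB+A_1^TPB_1)K_0^{-1}(B^TP+B_1^TPA_1)=0,\quad s\in[0,T],\\ P(T)=G,\end{cases}$$ and $$\begin{cases}\Pi'+\Pi\big[(A+\hat A)-(B+\hat B)K_1^{-1}(B_1+\hat B_1)^TP(A_1+\hat A_1)\big]\\ \quad+\big[(A+\hat A)^T-(A_1+\hat A_1)^TP(B_1+\hat B_1)K_1^{-1}(B+\hat B)^T\big]\Pi-\Pi(B+\hat B)K_1^{-1}(B+\hat B)^T\Pi\\ \quad+(A_1+\hat A_1)^T\big[P-P(B_1+\hat B_1)K_1^{-1}(B_1+\hat B_1)^TP\big](A_1+\hat A_1)+Q+\hat Q=0,\quad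 s\in[0,T],\\ \Pi(T)=G+\hat G,\end{cases}$$ respectively. Finally, $\bar X(\cdot)$ solves the closed-loop system $$\begin{cases} d\bar X=\Big\{\big[A-BK_0^{-1}(B^TP+B_1^TPA_1)\big]\big(\bar X-\mathbb E[\bar X]\big)\\ \qquad+\big[(A+\hat A)-(B+\hat B)K_1^{-1}\big((B+\hat B)^T\Pi+(B_1+\hat B_1)^TP(A_1+\hat A_1)\big)\big]\mathbb E[\bar X]\Big\}ds\\ \quad+\Big\{\big[A_1-B_1K_0^{-1}(B^TP+B_1^TPA_1)\big]\big(\bar X-\mathbb E[\bar X]\big)\\ \qquad+\big[(A_1+\hat A_1)-(B_1+\hat B_1)K_1^{-1}\big((B+\hat B)^T\Pi+(B_1+\hat B_1)^TP(A_1+\hat A_1)\big)\big]\mathbb E[\bar X]\Big\}dW(s),\\ \bar X(0)=x.\end{cases}$$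
   Context: Let $T>0$ and let $(\Omega,\mathcal F,\mathbb P,\mathbb F)$ be a complete filtered probability space carrying a one-dimensional standard Brownian motion $W$, where $\mathbb F=\{\mathcal F_t\}_{t\ge0}$ is the natural filtration of $W$ augmented by all $\mathbb P$-null sets. $\mathcal S^k$ is the set of symmetric $k\times k$ real matrices, and inequalities between symmetric matrices are in the positive semidefinite order. All coefficients $A,\hat A,A_1,\hat A_1,B,\hat B,B_1,\hat B_1,Q,\hat Q,R,\hat R,G,\hat G$ are deterministic. $L^2_{\mathbb F}(0,T;H)$ is the set of $\mathbb F$-adapted $H$-valued processes $\varphi$ with $\mathbb E\int_0^T|\varphi(s)|^2ds<\infty$; $\mathcal U[0,T]=L^2_{\mathbb F}(0,T;\mathbb R^m)$; $\hat{\mathcal X}[0,T]$ is the set of $\mathbb F$-adapted $\mathbb R^n$-valued processes $X$ with continuous paths and $\mathbb E[\sup_{s\in[0,T]}|X(s)|^2]<\infty$. An adapted solution of the forward-backward system is a 4-tuple $(\bar X,\bar u,Y,Z)\in\hat{\mathcal X}[0,T]\times\mathcal U[0,T]\times\hat{\mathcal X}[0,T]\times L^2_{\mathbb F}(0,T;\mathbb R^n)$ of $\mathbb F$-adapted processes satisfying it (the last relation for almost every $s$, almost surely). Under the stated hypotheses this system has exactly one adapted solution. A solution of a Riccati equation is an absolutely continuous $\mathcal S^n$-valued function on $[0,T]$ satisfying the equation for almost every $s$ and the terminal condition (the matrices $K_0,K_1$ occurring in it being invertible). The prime denotes $d/ds$. *)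

theory Defs
  imports "HOL-Probability.Probability"
begin

section \<open>Matrices and coefficient functions\<close>

definition loewner_le :: "real^'k^'k \<Rightarrow> real^'k^'k \<Rightarrow> bool" where
  "loewner_le M N \<longleftrightarrow> transpose M = M \<and> transpose N = N \<and> (\<forall>v. v \<bullet> (M *v v) \<le> v \<bullet> (N *v v))"

definition Linfty :: "real \<Rightarrow> (real \<Rightarrow> 'b::euclidean_space) \<Rightarrow> bool" where
  "Linfty T f \<longleftrightarrow> f \<in> borel_measurable (lebesgue_on {0..T}) \<and>
     (\<exists>C. AE s in lebesgue_on {0..T}. norm (f s) \<le> C)"

definition Linfty_sym :: "real \<Rightarrow> (real \<Rightarrow> real^'k^'k) \<Rightarrow> bool" where
  "Linfty_sym T f \<longleftrightarrow> Linfty T f \<and> (AE s in lebesgue_on {0..T}. transpose (f s) = f s)"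

text \<open>Absolute continuity of a function on a compact interval, in the classical
  \<open>\<epsilon>\<close>-\<open>\<delta>\<close> sense (the library has the notion for measures only).\<close>

definition abs_continuous_on_Icc :: "real \<Rightarrow> real \<Rightarrow> (real \<Rightarrow> 'b::real_normed_vector) \<Rightarrow> bool" where
  "abs_continuous_on_Icc l r f \<longleftrightarrow>
     (\<forall>\<epsilon>>0. \<exists>\<delta>>0. \<forall>(N::nat) a b.
        (\<forall>i<N. l \<le> a i \<and> a i \<le> b i \<and> b i \<le> r) \<longrightarrow>
        disjoint_family_on (\<lambda>i. {a i<..<b i}) {..<N} \<longrightarrow>
        (\<Sum>i<N. b i - a i) < \<delta> \<longrightarrow>
        (\<Sum>i<N. norm (f (b i) - f (a i))) < \<epsilon>)"


section \<open>Brownian motion and its augmented natural filtration\<close>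

definition natural_events :: "'w measure \<Rightarrow> (real \<Rightarrow> 'w \<Rightarrow> real) \<Rightarrow> real \<Rightarrow> 'w set set" where
  "natural_events M W t = {W r -` S \<inter> space M | r S. 0 \<le> r \<and> r \<le> t \<and> S \<in> sets borel}"

definition augmented_filtration :: "'w measure \<Rightarrow> (real \<Rightarrow> 'w \<Rightarrow> real) \<Rightarrow> real \<Rightarrow> 'w measure" where
  "augmented_filtration M W t = sigma (space M) (natural_events M W t \<union> null_sets M)"

lemma filtration_augmented_filtration: "filtration (space M) (augmented_filtration M W)"
proof -
  have sub: "natural_events M W t \<union> null_sets M \<subseteq> Pow (space M)" for t
    using sets.sets_into_space by (fastforce simp: natural_events_def null_sets_def)
  have mono: "natural_events M W i \<subseteq> natural_events M W j" if "i \<le> j" for i j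
    using that by (force simp: natural_events_def)
  show ?thesis
  proof
    show "space (augmented_filtration M W i) = space M" for i
      unfolding augmented_filtration_def by (rule space_measure_of[OF sub])
    show "sets (augmented_filtration M W i) \<le> sets (augmented_filtration M W j)" if "i \<le> j" for i j
      unfolding augmented_filtration_def sets_measure_of[OF sub]
      using mono[OF that] by (intro sigma_sets_mono') blast
  qed
qed

locale standard_brownian_motion = prob_space M for M :: "'w measure" +
  fixes W :: "real \<Rightarrow> 'w \<Rightarrow> real"
  assumes measurable_W: "\<And>t. 0 \<le> t \<Longrightarrow> W t \<in> borel_measurable M"
    and W_zero: "AE \<omega> in M. W 0 \<omega> = 0"
    and W_continuous: "AE \<omega> in M. continuous_on {0..} (\<lambda>t. W t \<omega>)"
    and W_gaussian: "\<And>s t. 0 \<le> s \<Longrightarrow> s < t \<Longrightarrow>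
      distributed M lborel (\<lambda>\<omega>. W t \<omega> - W s \<omega>) (\<lambda>x. ennreal (normal_density 0 (sqrt (t - s)) x))"
    and W_indep: "\<And>s t. 0 \<le> s \<Longrightarrow> s < t \<Longrightarrow>
      indep_set (sigma_sets (space M) (natural_events M W s))
        {(\<lambda>\<omega>. W t \<omega> - W s \<omega>) -` S \<inter> space M | S. S \<in> sets borel}"


section \<open>Spaces of processes\<close>

text \<open>Processes on \<open>[0,T]\<close> are functions \<open>real \<Rightarrow> 'w \<Rightarrow> 'b\<close> whose values outside
  \<open>[0,T]\<close> are irrelevant.\<close>

definition adapted :: "'w measure \<Rightarrow> (real \<Rightarrow> 'w \<Rightarrow> real) \<Rightarrow> real \<Rightarrow> (real \<Rightarrow> 'w \<Rightarrow> 'b::euclidean_space) \<Rightarrow> bool" where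
  "adapted M W T \<phi> \<longleftrightarrow> (\<forall>s\<in>{0..T}. \<phi> s \<in> borel_measurable (augmented_filtration M W s))"

definition L2F :: "'w measure \<Rightarrow> (real \<Rightarrow> 'w \<Rightarrow> real) \<Rightarrow> real \<Rightarrow> (real \<Rightarrow> 'w \<Rightarrow> 'b::euclidean_space) \<Rightarrow> bool" where
  "L2F M W T \<phi> \<longleftrightarrow>
     adapted M W T \<phi> \<and>
     (\<lambda>(s, \<omega>). \<phi> s \<omega>) \<in> borel_measurable (lebesgue_on {0..T} \<Otimes>\<^sub>M M) \<and>
     (\<integral>\<^sup>+\<omega>. (\<integral>\<^sup>+s. ennreal ((norm (\<phi> s \<omega>))\<^sup>2) \<partial>lebesgue_on {0..T}) \<partial>M) < \<infinity>"

definition state_space :: "'w measure \<Rightarrow> (real \<Rightarrow> 'w \<Rightarrow> real) \<Rightarrow> real \<Rightarrow> (real \<Rightarrow> 'w \<Rightarrow> 'b::euclidean_space) \<Rightarrow> bool" where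
  "state_space M W T X \<longleftrightarrow>
     adapted M W T X \<and>
     (\<forall>\<omega>\<in>space M. continuous_on {0..T} (\<lambda>s. X s \<omega>)) \<and>
     (\<integral>\<^sup>+\<omega>. (SUP s\<in>{0..T}. ennreal ((norm (X s \<omega>))\<^sup>2)) \<partial>M) < \<infinity>"

definition mean :: "'w measure \<Rightarrow> (real \<Rightarrow> 'w \<Rightarrow> 'b::euclidean_space) \<Rightarrow> real \<Rightarrow> 'b" where
  "mean M \<phi> s = (\<integral>\<omega>. \<phi> s \<omega> \<partial>M)"


section \<open>The Ito integral\<close>

definition simple_integrand ::
  "'w measure \<Rightarrow> (real \<Rightarrow> 'w \<Rightarrow> real) \<Rightarrow> real \<Rightarrow> nat \<Rightarrow> (nat \<Rightarrow> real) \<Rightarrow> (nat \<Rightarrow> 'w \<Rightarrow> 'b::euclidean_space) \<Rightarrow> bool" where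
  "simple_integrand M W T N \<tau> \<xi> \<longleftrightarrow>
     0 \<le> \<tau> 0 \<and> (\<forall>i<N. \<tau> i \<le> \<tau> (Suc i)) \<and> \<tau> N \<le> T \<and>
     (\<forall>i<N. \<xi> i \<in> borel_measurable (augmented_filtration M W (\<tau> i))) \<and>
     (\<exists>C. \<forall>i<N. \<forall>\<omega>\<in>space M. norm (\<xi> i \<omega>) \<le> C)"

definition simple_process ::
  "nat \<Rightarrow> (nat \<Rightarrow> real) \<Rightarrow> (nat \<Rightarrow> 'w \<Rightarrow> 'b::euclidean_space) \<Rightarrow> real \<Rightarrow> 'w \<Rightarrow> 'b" where
  "simple_process N \<tau> \<xi> s \<omega> = (\<Sum>i<N. indicator {\<tau> i<..\<tau> (Suc i)} s *\<^sub>R \<xi> i \<omega>)"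

definition simple_ito ::
  "(real \<Rightarrow> 'w \<Rightarrow> real) \<Rightarrow> nat \<Rightarrow> (nat \<Rightarrow> real) \<Rightarrow> (nat \<Rightarrow> 'w \<Rightarrow> 'b::euclidean_space) \<Rightarrow> real \<Rightarrow> 'w \<Rightarrow> 'b" where
  "simple_ito W N \<tau> \<xi> t \<omega> =
     (\<Sum>i<N. (W (min (\<tau> (Suc i)) t) \<omega> - W (min (\<tau> i) t) \<omega>) *\<^sub>R \<xi> i \<omega>)"

text \<open>\<open>I\<close> is a version of the process \<open>t \<mapsto> \<integral>\<^sub>0\<^sup>t \<phi> dW\<close>: the mean-square limit, for each
  \<open>t\<close>, of the elementary integrals of simple processes converging to \<open>\<phi>\<close> in
  \<open>L\<^sup>2([0,T] \<times> \<Omega>)\<close>.  It determines \<open>I t\<close> up to null sets for each \<open>t\<close>.\<close>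

definition has_ito_integral ::
  "'w measure \<Rightarrow> (real \<Rightarrow> 'w \<Rightarrow> real) \<Rightarrow> real \<Rightarrow> (real \<Rightarrow> 'w \<Rightarrow> 'b::euclidean_space) \<Rightarrow> (real \<Rightarrow> 'w \<Rightarrow> 'b) \<Rightarrow> bool" where
  "has_ito_integral M W T \<phi> I \<longleftrightarrow>
     L2F M W T \<phi> \<and>
     (\<forall>t\<in>{0..T}. I t \<in> borel_measurable M) \<and>
     (\<exists>(N :: nat \<Rightarrow> nat) \<tau> \<xi>.
        (\<forall>k. simple_integrand M W T (N k) (\<tau> k) (\<xi> k)) \<and>
        (\<lambda>k. \<integral>\<^sup>+\<omega>. (\<integral>\<^sup>+s. ennreal ((norm (\<phi> s \<omega> - simple_process (N k) (\<tau> k) (\<xi> k) s \<omega>))\<^sup>2)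
               \<partial>lebesgue_on {0..T}) \<partial>M) \<longlonglongrightarrow> 0 \<and>
        (\<forall>t\<in>{0..T}.
          (\<lambda>k. \<integral>\<^sup>+\<omega>. ennreal ((norm (I t \<omega> - simple_ito W (N k) (\<tau> k) (\<xi> k) t \<omega>))\<^sup>2) \<partial>M)
            \<longlonglongrightarrow> 0))"

text \<open>\<open>dX = b ds + \<sigma> dW\<close> on \<open>[0,T]\<close>.\<close>

definition ito_differential ::
  "'w measure \<Rightarrow> (real \<Rightarrow> 'w \<Rightarrow> real) \<Rightarrow> real \<Rightarrow> (real \<Rightarrow> 'w \<Rightarrow> 'b::euclidean_space)
    \<Rightarrow> (real \<Rightarrow> 'w \<Rightarrow> 'b) \<Rightarrow> (real \<Rightarrow> 'w \<Rightarrow> 'b) \<Rightarrow> bool" where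
  "ito_differential M W T X b \<sigma> \<longleftrightarrow>
     (\<exists>I. has_ito_integral M W T \<sigma> I \<and>
        (AE \<omega> in M. integrable (lebesgue_on {0..T}) (\<lambda>s. b s \<omega>) \<and>
           (\<forall>t\<in>{0..T}. X t \<omega> = X 0 \<omega> + (\<integral>s. b s \<omega> \<partial>lebesgue_on {0..t}) + I t \<omega>)))"


section \<open>The mean-field system\<close>

text \<open>The suffix \<open>h\<close> stands for the hat.\<close>

record ('n, 'm) mf_coeffs =
  cA :: "real \<Rightarrow> real^'n^'n"
  cAh :: "real \<Rightarrow> real^'n^'n"
  cA1 :: "real \<Rightarrow> real^'n^'n"
  cA1h :: "real \<Rightarrow> real^'n^'n"
  cB :: "real \<Rightarrow> real^'m^'n"
  cBh :: "real \<Rightarrow> real^'m^'n"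
  cB1 :: "real \<Rightarrow> real^'m^'n"
  cB1h :: "real \<Rightarrow> real^'m^'n"
  cQ :: "real \<Rightarrow> real^'n^'n"
  cQh :: "real \<Rightarrow> real^'n^'n"
  cR :: "real \<Rightarrow> real^'m^'m"
  cRh :: "real \<Rightarrow> real^'m^'m"
  cG :: "real^'n^'n"
  cGh :: "real^'n^'n"

definition mf_fbsde_solution ::
  "'w measure \<Rightarrow> (real \<Rightarrow> 'w \<Rightarrow> real) \<Rightarrow> real \<Rightarrow> ('n::finite, 'm::finite) mf_coeffs \<Rightarrow> real^'n \<Rightarrow>
   (real \<Rightarrow> 'w \<Rightarrow> real^'n) \<Rightarrow> (real \<Rightarrow> 'w \<Rightarrow> real^'m) \<Rightarrow> (real \<Rightarrow> 'w \<Rightarrow> real^'n) \<Rightarrow> (real \<Rightarrow> 'w \<Rightarrow> real^'n) \<Rightarrow> bool" where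
  "mf_fbsde_solution M W T c x X u Y Z \<longleftrightarrow>
     state_space M W T X \<and> L2F M W T u \<and> state_space M W T Y \<and> L2F M W T Z \<and>
     ito_differential M W T X
       (\<lambda>s \<omega>. cA c s *v X s \<omega> + cB c s *v u s \<omega> + cAh c s *v mean M X s + cBh c s *v mean M u s)
       (\<lambda>s \<omega>. cA1 c s *v X s \<omega> + cB1 c s *v u s \<omega> + cA1h c s *v mean M X s + cB1h c s *v mean M u s) \<and>
     ito_differential M W T Y
       (\<lambda>s \<omega>. - (transpose (cA c s) *v Y s \<omega> + transpose (cA1 c s) *v Z s \<omega> + cQ c s *v X s \<omega>
               + transpose (cAh c s) *v mean M Y s + transpose (cA1h c s) *v mean M Z s
               + cQh c s *v mean M X s))
       Z \<and>
     (AE \<omega> in M. X 0 \<omega> = x) \<and>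
     (AE \<omega> in M. Y T \<omega> = cG c *v X T \<omega> + cGh c *v mean M X T) \<and>
     (AE \<omega> in M. AE s in lebesgue_on {0..T}.
        cR c s *v u s \<omega> + cRh c s *v mean M u s
        + transpose (cB c s) *v Y s \<omega> + transpose (cB1 c s) *v Z s \<omega>
        + transpose (cBh c s) *v mean M Y s + transpose (cB1h c s) *v mean M Z s = 0)"


section \<open>Riccati equations\<close>

definition K0 :: "('n::finite, 'm::finite) mf_coeffs \<Rightarrow> (real \<Rightarrow> real^'n^'n) \<Rightarrow> real \<Rightarrow> real^'m^'m" where
  "K0 c P s = cR c s + transpose (cB1 c s) ** P s ** cB1 c s"

definition K1 :: "('n::finite, 'm::finite) mf_coeffs \<Rightarrow> (real \<Rightarrow> real^'n^'n) \<Rightarrow> real \<Rightarrow> real^'m^'m" where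
  "K1 c P s = cR c s + cRh c s + transpose (cB1 c s + cB1h c s) ** P s ** (cB1 c s + cB1h c s)"

definition riccati_P_solution ::
  "real \<Rightarrow> ('n::finite, 'm::finite) mf_coeffs \<Rightarrow> (real \<Rightarrow> real^'n^'n) \<Rightarrow> bool" where
  "riccati_P_solution T c P \<longleftrightarrow>
     (\<forall>s\<in>{0..T}. transpose (P s) = P s) \<and>
     abs_continuous_on_Icc 0 T P \<and>
     (AE s in lebesgue_on {0..T}. invertible (K0 c P s) \<and>
       (\<exists>P'. (P has_vector_derivative P') (at s within {0..T}) \<and>
         P' + P s ** cA c s + transpose (cA c s) ** P s + transpose (cA1 c s) ** P s ** cA1 c s + cQ c s
         - (P s ** cB c s + transpose (cA1 c s) ** P s ** cB1 c s) ** matrix_inv (K0 c P s)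
           ** (transpose (cB c s) ** P s + transpose (cB1 c s) ** P s ** cA1 c s) = 0)) \<and>
     P T = cG c"

definition riccati_Pi_solution ::
  "real \<Rightarrow> ('n::finite, 'm::finite) mf_coeffs \<Rightarrow> (real \<Rightarrow> real^'n^'n) \<Rightarrow> (real \<Rightarrow> real^'n^'n) \<Rightarrow> bool" where
  "riccati_Pi_solution T c P PI \<longleftrightarrow>
     (\<forall>s\<in>{0..T}. transpose (PI s) = PI s) \<and>
     abs_continuous_on_Icc 0 T PI \<and>
     (AE s in lebesgue_on {0..T}. invertible (K1 c P s) \<and>
       (\<exists>PI'. (PI has_vector_derivative PI') (at s within {0..T}) \<and>
         (let A = cA c s + cAh c s; B = cB c s + cBh c s;
              A1 = cA1 c s + cA1h c s; B1 = cB1 c s + cB1h c s;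
              K = matrix_inv (K1 c P s)
          in PI' + PI s ** (A - B ** K ** transpose B1 ** P s ** A1)
             + (transpose A - transpose A1 ** P s ** B1 ** K ** transpose B) ** PI s
             - PI s ** B ** K ** transpose B ** PI s
             + transpose A1 ** (P s - P s ** B1 ** K ** transpose B1 ** P s) ** A1
             + cQ c s + cQh c s = 0))) \<and>
     PI T = cG c + cGh c"

definition gain0 ::
  "('n::finite, 'm::finite) mf_coeffs \<Rightarrow> (real \<Rightarrow> real^'n^'n) \<Rightarrow> real \<Rightarrow> real^'n^'m" where
  "gain0 c P s = matrix_inv (K0 c P s)
     ** (transpose (cB c s) ** P s + transpose (cB1 c s) ** P s ** cA1 c s)"

definition gain1 ::
  "('n::finite, 'm::finite) mf_coeffs \<Rightarrow> (real \<Rightarrow> real^'n^'n) \<Rightarrow> (real \<Rightarrow> real^'n^'n) \<Rightarrow> real \<Rightarrow> real^'n^'m" where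
  "gain1 c P PI s = matrix_inv (K1 c P s)
     ** (transpose (cB c s + cBh c s) ** PI s
         + transpose (cB1 c s + cB1h c s) ** P s ** (cA1 c s + cA1h c s))"

definition closed_loop_solution ::
  "'w measure \<Rightarrow> (real \<Rightarrow> 'w \<Rightarrow> real) \<Rightarrow> real \<Rightarrow> ('n::finite, 'm::finite) mf_coeffs \<Rightarrow> real^'n \<Rightarrow>
   (real \<Rightarrow> real^'n^'n) \<Rightarrow> (real \<Rightarrow> real^'n^'n) \<Rightarrow> (real \<Rightarrow> 'w \<Rightarrow> real^'n) \<Rightarrow> bool" where
  "closed_loop_solution M W T c x P PI X \<longleftrightarrow>
     state_space M W T X \<and>
     ito_differential M W T X
       (\<lambda>s \<omega>. (cA c s - cB c s ** gain0 c P s) *v (X s \<omega> - mean M X s)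
            + (cA c s + cAh c s - (cB c s + cBh c s) ** gain1 c P PI s) *v mean M X s)
       (\<lambda>s \<omega>. (cA1 c s - cB1 c s ** gain0 c P s) *v (X s \<omega> - mean M X s)
            + (cA1 c s + cA1h c s - (cB1 c s + cB1h c s) ** gain1 c P PI s) *v mean M X s) \<and>
     (AE \<omega> in M. X 0 \<omega> = x)"

end

theory Submission
  imports Defs
begin

text \<open>Why the representation holds.  Write a bar for expectations and a tilde for the deviation of a
  process from its expectation, and let \<open>\<sigma>\<close> be the diffusion coefficient of \<open>X\<close>.  Taking expectations in
  the system and subtracting splits it into a system for the deviations, in which only the coefficients
  without a hat occur, and a deterministic one for the means, with the summed coefficients.  Put
  \<open>\<eta> = Y - P X\<close> and \<open>\<zeta> = Z - P \<sigma>\<close>.  The Riccati equation for \<open>P\<close> and the optimality relation are exactly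
  what makes \<open>X\<close> and \<open>u\<close> drop out of the drift of \<open>\<eta>~\<close>: it is linear in \<open>\<eta>~\<close> and \<open>\<zeta>~\<close> with bounded
  coefficients (\<open>feedback_decoupling\<close>).  Since \<open>\<eta>~\<close> vanishes at time \<open>T\<close>, uniqueness for linear
  backward equations (\<open>backward_equation_unique\<close>) gives \<open>\<eta>~ = 0\<close> and \<open>\<zeta> = 0\<close>; that is,
  \<open>Y~ = P X~\<close> and \<open>Z = P \<sigma>\<close>, and the optimality relation becomes \<open>u~ = - gain0 X~\<close>.  As now also the mean
  of \<open>Z\<close> is \<open>P\<close> times the mean of \<open>\<sigma>\<close>, the same algebra with the summed coefficients shows that the mean
  of \<open>Y\<close> minus \<open>PI\<close> times the mean of \<open>X\<close> solves a linear homogeneous differential equation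
  with terminal value zero.  Hence it is zero as well, and adding up means and deviations
  (\<open>fluctuations_vanish\<close>, \<open>means_decouple\<close>) yields all the formulas.

  Stochastic part.  The uniqueness argument is an energy estimate which avoids the Ito formula.
  On an interval \<open>[t,r]\<close> with \<open>\<eta>~(r) = 0\<close> one has \<open>\<eta>~(t) + N = - \<integral> f\<close>, where \<open>N\<close> is the increment of the
  martingale part; \<open>N\<close> is orthogonal to \<open>\<eta>~(t)\<close> and \<open>E N\<^sup>2 = E \<integral> \<zeta>\<^sup>2\<close>, so the left side is controlled
  by \<open>(r - t)\<close> times the energy on \<open>[t,r]\<close>, and short intervals are contractions.  To know these two
  facts about \<open>N\<close> one only has to multiply the Ito process \<open>X\<close> by the deterministic function \<open>P\<close>.  This is
  done by integrating by parts in time, path by path; the second moments follow from the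
  covariances of Ito integrals (\<open>ito_covariance\<close>, \<open>ito_weighted_sum\<close>).

  Deterministic part.  Both Riccati equations are instances of one equation with a cross term.  It is
  solved by policy improvement: the cost of a feedback solves a linear (Lyapunov) equation, the
  optimal gain for that cost gives a cheaper feedback, and the decreasing costs converge to a solution
  (\<open>riccati_exists\<close>).  The estimates above need bounded gains for an arbitrary solution
  \<open>P\<close>; this is because every solution is nonnegative (\<open>riccati_P_nonneg\<close>), so that \<open>K0\<close> and \<open>K1\<close> are at
  least \<open>\<delta>\<close>.  Coefficients are merely measurable and solutions absolutely continuous, so the differential
  equations are read as integral equations by means of \<open>primitive_on\<close>; the two readings agree by the
  fundamental theorem of calculus for absolutely continuous functions
  (\<open>has_integral_abs_continuous\<close>).\<close>

section \<open>Absolutely continuous functions and their derivatives\<close>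

lemma absolutely_integrable_bounded_measurable:
  fixes f :: "real \<Rightarrow> 'a::euclidean_space"
  assumes "f \<in> borel_measurable lebesgue" "\<And>x. x \<in> {a..b} \<Longrightarrow> norm (f x) \<le> C"
  shows "f absolutely_integrable_on {a..b}"
proof (rule measurable_bounded_by_integrable_imp_absolutely_integrable)
  show "f \<in> borel_measurable (lebesgue_on {a..b})"
    using assms(1) by (simp add: measurable_restrict_space1)
  show "(\<lambda>_. C) integrable_on {a..b}" by (simp add: integrable_on_const)
qed (use assms in auto)

lemma borel_measurable_lebesgue_continuous:
  fixes f :: "real \<Rightarrow> 'a::euclidean_space"
  assumes "continuous_on UNIV f"
  shows "f \<in> borel_measurable lebesgue"
  using borel_measurable_continuous_onI[OF assms] by (simp add: measurable_completion)

text \<open>A differential equation \<open>F' = f\<close> almost everywhere, read as an integral equation on all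
  subintervals.\<close>

definition primitive_on :: "real \<Rightarrow> real \<Rightarrow> (real \<Rightarrow> 'a::euclidean_space) \<Rightarrow> (real \<Rightarrow> 'a) \<Rightarrow> bool" where
  "primitive_on a b F f \<longleftrightarrow> f absolutely_integrable_on {a..b} \<and>
     (\<forall>s t. a \<le> s \<longrightarrow> s \<le> t \<longrightarrow> t \<le> b \<longrightarrow> (f has_integral F t - F s) {s..t})"

lemma primitive_onI:
  fixes F :: "real \<Rightarrow> 'a::euclidean_space"
  assumes "f absolutely_integrable_on {a..b}" "\<And>t. a \<le> t \<Longrightarrow> t \<le> b \<Longrightarrow> F t = y + integral {a..t} f"
  shows "primitive_on a b F f"
  unfolding primitive_on_def
proof (intro conjI allI impI assms)
  fix s t assume *: "a \<le> s" "s \<le> t" "t \<le> b"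
  have i: "f integrable_on {a..b}" using assms(1) set_lebesgue_integral_eq_integral(1) by blast
  have "f integrable_on {a..t}" "f integrable_on {s..t}"
    using i * by (auto intro: integrable_subinterval_real)
  moreover from this have "integral {a..s} f + integral {s..t} f = integral {a..t} f"
    using * by (intro Henstock_Kurzweil_Integration.integral_combine) auto
  ultimately have "F t - F s = integral {s..t} f" "f integrable_on {s..t}"
    using assms(2)[of s] assms(2)[of t] * by (auto simp: algebra_simps)
  then show "(f has_integral F t - F s) {s..t}" by (simp add: has_integral_integral)
qed

lemma primitive_on_diff:
  assumes "primitive_on a b F f" "a \<le> s" "s \<le> t" "t \<le> b"
  shows "F t - F s = integral {s..t} f"
  using assms unfolding primitive_on_def by (metis integral_unique)

lemma primitive_on_integrable:
  assumes "primitive_on a b F f" "a \<le> s" "t \<le> b"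
  shows "f absolutely_integrable_on {s..t}" "f integrable_on {s..t}"
proof -
  show "f absolutely_integrable_on {s..t}"
    using assms unfolding primitive_on_def by (auto intro: absolutely_integrable_on_subinterval)
  then show "f integrable_on {s..t}" using set_lebesgue_integral_eq_integral(1) by blast
qed

lemma primitive_on_subset:
  assumes "primitive_on a b F f" "a \<le> s" "t \<le> b"
  shows "primitive_on s t F f"
  using assms primitive_on_integrable[OF assms] by (auto simp: primitive_on_def)

lemma primitive_on_continuous:
  assumes "primitive_on a b F f"
  shows "continuous_on {a..b} F"
proof (cases "a \<le> b")
  case True
  have c: "continuous_on {a..b} (\<lambda>t. F a + integral {a..t} f)"
    using primitive_on_integrable[OF assms, of a b] by (intro continuous_intros indefinite_integral_continuous_1) auto
  have "F a + integral {a..t} f = F t" if "t \<in> {a..b}" for t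
    using primitive_on_diff[OF assms, of a t] that by (simp add: algebra_simps)
  then show ?thesis by (rule continuous_on_eq[OF c])
qed auto

lemma primitive_on_reflect:
  assumes "primitive_on a b F f"
  shows "primitive_on (-b) (-a) (\<lambda>t. F (-t)) (\<lambda>t. - f (-t))"
  unfolding primitive_on_def
proof (intro conjI allI impI)
  show "(\<lambda>t. - f (-t)) absolutely_integrable_on {-b..-a}"
    using assms absolutely_integrable_reflect_real[where f=f and a=a and b=b] set_integrable_scaleR_right[where a="-1" and A="{-b..-a}" and f="\<lambda>t. f (-t)" and M=lebesgue]
    by (simp add: primitive_on_def)
  fix s t assume "-b \<le> s" "s \<le> t" "t \<le> -a"
  then have "(f has_integral F (-s) - F (-t)) {-t..-s}"
    using assms by (auto simp: primitive_on_def)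
  then have "((\<lambda>x. f (-x)) has_integral F (-s) - F (-t)) {s..t}"
    using has_integral_reflect_real[where f=f and i="F (-s) - F (-t)" and a="-t" and b="-s"] by simp
  from has_integral_neg[OF this]
  show "((\<lambda>t. - f (-t)) has_integral F (-t) - F (-s)) {s..t}" by simp
qed

lemma primitive_on_AE_cong:
  assumes "primitive_on a b F f" "negligible N" "\<And>s. s \<in> {a..b} - N \<Longrightarrow> f s = g s"
  shows "primitive_on a b F g"
  unfolding primitive_on_def
proof (intro conjI allI impI)
  show "g absolutely_integrable_on {a..b}"
    using assms absolutely_integrable_spike[where f=f and T="{a..b}" and S=N and g=g] by (auto simp: primitive_on_def)
  show "(g has_integral F t - F s) {s..t}" if "a \<le> s" "s \<le> t" "t \<le> b" for s t
    using assms that has_integral_spike[where S=N and T="{s..t}" and f=f and g=g] by (auto simp: primitive_on_def)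
qed

lemma primitive_on_add:
  assumes "primitive_on a b F f" "primitive_on a b G g"
  shows "primitive_on a b (\<lambda>t. F t + G t) (\<lambda>t. f t + g t)"
  unfolding primitive_on_def
proof (intro conjI allI impI)
  show "(\<lambda>t. f t + g t) absolutely_integrable_on {a..b}"
    using assms by (auto simp: primitive_on_def intro: set_integral_add)
  fix s t assume "a \<le> s" "s \<le> t" "t \<le> b"
  then have "(f has_integral F t - F s) {s..t}" "(g has_integral G t - G s) {s..t}"
    using assms by (auto simp: primitive_on_def)
  from has_integral_add[OF this] show "((\<lambda>t. f t + g t) has_integral F t + G t - (F s + G s)) {s..t}"
    by (simp add: algebra_simps)
qed

lemma primitive_on_minus:
  assumes "primitive_on a b F f"
  shows "primitive_on a b (\<lambda>t. - F t) (\<lambda>t. - f t)"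
  unfolding primitive_on_def
proof (intro conjI allI impI)
  show "(\<lambda>t. - f t) absolutely_integrable_on {a..b}"
    using assms set_integrable_scaleR_right[where a="-1" and A="{a..b}" and f=f and M=lebesgue] by (simp add: primitive_on_def)
  fix s t assume "a \<le> s" "s \<le> t" "t \<le> b"
  then have "(f has_integral F t - F s) {s..t}" using assms by (auto simp: primitive_on_def)
  from has_integral_neg[OF this] show "((\<lambda>t. - f t) has_integral - F t - - F s) {s..t}"
    by (simp add: algebra_simps)
qed

lemma primitive_on_sub:
  assumes "primitive_on a b F f" "primitive_on a b G g"
  shows "primitive_on a b (\<lambda>t. F t - G t) (\<lambda>t. f t - g t)"
  using primitive_on_add[OF assms(1) primitive_on_minus[OF assms(2)]] by simp

text \<open>Tagged divisions come as finite sets, not as sequences.\<close>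

lemma abs_continuous_on_Icc_finite:
  fixes f :: "real \<Rightarrow> 'b::real_normed_vector"
  assumes "abs_continuous_on_Icc l r f" "e > 0"
  shows "\<exists>d>0. \<forall>(p::'i set) u v. finite p \<longrightarrow> (\<forall>i\<in>p. l \<le> u i \<and> u i \<le> v i \<and> v i \<le> r) \<longrightarrow>
      disjoint_family_on (\<lambda>i. {u i<..<v i}) p \<longrightarrow> (\<Sum>i\<in>p. v i - u i) < d \<longrightarrow>
      (\<Sum>i\<in>p. norm (f (v i) - f (u i))) < e"
proof -
  obtain d where d: "d > 0" and *: "\<And>(N::nat) a b. (\<forall>i<N. l \<le> a i \<and> a i \<le> b i \<and> b i \<le> r) \<Longrightarrow>
        disjoint_family_on (\<lambda>i. {a i<..<b i}) {..<N} \<Longrightarrow>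
        (\<Sum>i<N. b i - a i) < d \<Longrightarrow> (\<Sum>i<N. norm (f (b i) - f (a i))) < e"
    using assms unfolding abs_continuous_on_Icc_def by meson
  show ?thesis
  proof (intro exI conjI allI impI)
    fix p :: "'i set" and u v
    assume p: "finite p" "\<forall>i\<in>p. l \<le> u i \<and> u i \<le> v i \<and> v i \<le> r"
      "disjoint_family_on (\<lambda>i. {u i<..<v i}) p" "(\<Sum>i\<in>p. v i - u i) < d"
    obtain h where h: "bij_betw h {..<card p} p"
      using ex_bij_betw_nat_finite[OF p(1)] by (auto simp: lessThan_atLeast0)
    have hp: "h i \<in> p" if "i < card p" for i using h that by (auto simp: bij_betw_def)
    have "(\<Sum>i<card p. norm (f (v (h i)) - f (u (h i)))) < e"
    proof (rule *)
      show "\<forall>i<card p. l \<le> u (h i) \<and> u (h i) \<le> v (h i) \<and> v (h i) \<le> r" using p(2) hp by auto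
      show "disjoint_family_on (\<lambda>i. {u (h i)<..<v (h i)}) {..<card p}"
        unfolding disjoint_family_on_def
      proof (intro ballI impI)
        fix m n assume mn: "m \<in> {..<card p}" "n \<in> {..<card p}" "m \<noteq> n"
        then have "h m \<noteq> h n" using h by (auto simp: bij_betw_def inj_on_def)
        then show "{u (h m)<..<v (h m)} \<inter> {u (h n)<..<v (h n)} = {}"
          using p(3) hp mn by (auto simp: disjoint_family_on_def)
      qed
      show "(\<Sum>i<card p. v (h i) - u (h i)) < d"
        using p(4) sum.reindex_bij_betw[OF h, of "\<lambda>i. v i - u i"] by simp
    qed
    then show "(\<Sum>i\<in>p. norm (f (v i) - f (u i))) < e"
      using sum.reindex_bij_betw[OF h, of "\<lambda>i. norm (f (v i) - f (u i))"] by simp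
  qed (rule d)
qed

text \<open>A gauge argument: at points where \<open>F\<close> is differentiable the usual estimate applies; the intervals
  tagged in the exceptional null set lie in an open set of small measure, where absolute continuity
  makes the increments of \<open>F\<close> small.\<close>

lemma has_integral_abs_continuous:
  fixes F :: "real \<Rightarrow> 'a::euclidean_space"
  assumes ab: "a \<le> b" and ac: "abs_continuous_on_Icc a b F" and neg: "negligible N"
    and der: "\<And>x. x \<in> {a..b} - N \<Longrightarrow> (F has_vector_derivative f x) (at x within {a..b})"
  shows "(f has_integral F b - F a) {a..b}"
proof (cases "a = b")
  case False
  with ab have ab: "a < b" by simp
  define g where "g = (\<lambda>x. if x \<in> N then 0 else f x)"
  have "(g has_integral F b - F a) {a..b}"
    unfolding has_integral_factor_content_real
  proof (intro allI impI)
    fix e :: real assume "e > 0"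
    obtain \<delta> where \<delta>: "\<delta> > 0" and ac\<delta>: "\<And>(p::(real \<times> real set) set) u v. finite p \<Longrightarrow>
       (\<forall>i\<in>p. a \<le> u i \<and> u i \<le> v i \<and> v i \<le> b) \<Longrightarrow>
      disjoint_family_on (\<lambda>i. {u i<..<v i}) p \<Longrightarrow> (\<Sum>i\<in>p. v i - u i) < \<delta> \<Longrightarrow>
      (\<Sum>i\<in>p. norm (F (v i) - F (u i))) < e * (b - a) / 2"
      using abs_continuous_on_Icc_finite[OF ac, where 'i="real \<times> real set", of "e * (b - a) / 2"]
        ab \<open>e > 0\<close> by (auto simp: zero_less_mult_iff)
    obtain U where U: "open U" "N \<subseteq> U" "U - N \<in> lmeasurable" "emeasure lebesgue (U - N) < ennreal \<delta>"
      using sets_lebesgue_outer_open[OF _ \<delta>, of N] neg negligible_imp_sets by blast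
    have N0: "N \<in> null_sets lebesgue" using neg by (simp add: negligible_iff_null_sets)
    have Um: "emeasure lebesgue U < ennreal \<delta>"
    proof -
      have "U = (U - N) \<union> N" using U(2) by auto
      then have "emeasure lebesgue U = emeasure lebesgue (U - N)"
        using emeasure_Un_null_set[of "U - N" lebesgue N] U(3) N0 by (auto simp: fmeasurableD)
      with U(4) show ?thesis by simp
    qed
    have Ul: "U \<in> lmeasurable"
      using Um U(1) by (intro fmeasurableI) (use order.strict_trans[OF Um ennreal_less_top] in auto)
    have "\<forall>x. \<exists>d>0. x \<in> {a..b} - N \<longrightarrow>
         (\<forall>y\<in>{a..b}. norm (y-x) < d \<longrightarrow> norm (F y - F x - (y-x) *\<^sub>R f x) \<le> e/2 * norm (y-x))"
      using der[unfolded has_vector_derivative_def has_derivative_within_alt] \<open>e > 0\<close>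
      by (metis (no_types, lifting) half_gt_zero zero_less_one)
    then obtain d where d: "\<And>x. 0 < d x"
                 "\<And>x y. \<lbrakk>x \<in> {a..b} - N; y \<in> {a..b}; norm (y-x) < d x\<rbrakk>
                        \<Longrightarrow> norm (F y - F x - (y-x) *\<^sub>R f x) \<le> e/2 * norm (y-x)"
      by metis
    \<comment> \<open>tags in \<open>N\<close> are confined to \<open>U\<close>, all others to the ball of good approximation\<close>
    define \<gamma> where "\<gamma> x = (if x \<in> N then U else ball x (d x))" for x
    show "\<exists>\<gamma>. gauge \<gamma> \<and> (\<forall>p. p tagged_division_of {a..b} \<and> \<gamma> fine p \<longrightarrow>
      norm (sum (\<lambda>(x,k). measure lborel k *\<^sub>R g x) p - (F b - F a)) \<le> e * measure lborel {a..b} )"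
    proof (intro exI[of _ \<gamma>] conjI allI impI, goal_cases)
      case 1
      show "gauge \<gamma>" using U d by (auto simp: gauge_def \<gamma>_def)
    next
      case (2 p)
      then have p: "p tagged_division_of {a..b}" and fine: "\<gamma> fine p" by auto
      note td = tagged_division_ofD[OF p]
      have K: "\<exists>u v. K = {u..v} \<and> u \<le> v \<and> a \<le> u \<and> v \<le> b \<and> x \<in> {u..v} \<and> K \<subseteq> \<gamma> x" if xK: "(x,K) \<in> p" for x K
      proof -
        obtain u v where uv: "K = cbox u v" using td(4)[OF xK] by auto
        have "x \<in> K" "K \<subseteq> {a..b}" using td(2,3)[OF xK] by auto
        moreover have "K \<subseteq> \<gamma> x" using fine xK by (auto simp: fine_def)
        ultimately show ?thesis using uv by (intro exI[of _ u] exI[of _ v]) auto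
      qed
      define pN where "pN = {z\<in>p. fst z \<in> N}"
      have fin: "finite p" "finite pN" "pN \<subseteq> p" using td(1) by (auto simp: pN_def)
      define err where "err z = measure lborel (snd z) *\<^sub>R g (fst z) - (F (Sup (snd z)) - F (Inf (snd z)))" for z :: "real \<times> real set"
      define len where "len z = Sup (snd z) - Inf (snd z)" for z :: "real \<times> real set"
      have FF: "F b - F a = (\<Sum>z\<in>p. F (Sup (snd z)) - F (Inf (snd z)))" and bb: "b - a = sum len p"
        using additive_tagged_division_1[of a b p F] additive_tagged_division_1[of a b p "\<lambda>x. x"] p ab
        by (auto simp: case_prod_unfold len_def)
      have disj: "disjoint_family_on (\<lambda>z. {Inf (snd z)<..<Sup (snd z)}) p"
        unfolding disjoint_family_on_def
      proof (intro ballI impI)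
        fix z z' assume zz: "z \<in> p" "z' \<in> p" "z \<noteq> z'"
        obtain u v u' v' where "snd z = {u..v}" "u \<le> v" "snd z' = {u'..v'}" "u' \<le> v'"
          using K[of "fst z" "snd z"] K[of "fst z'" "snd z'"] zz by auto
        moreover have "interior (snd z) \<inter> interior (snd z') = {}"
          using td(5)[of "fst z" "snd z" "fst z'" "snd z'"] zz by (auto simp: prod_eq_iff)
        ultimately show "{Inf (snd z)<..<Sup (snd z)} \<inter> {Inf (snd z')<..<Sup (snd z')} = {}" by auto
      qed
      have "(\<Sum>z\<in>pN. norm (F (Sup (snd z)) - F (Inf (snd z)))) < e * (b - a) / 2"
      proof (rule ac\<delta>)
        show dj: "disjoint_family_on (\<lambda>z. {Inf (snd z)<..<Sup (snd z)}) pN"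
          using disj fin(3) by (rule disjoint_family_on_mono[rotated])
        show "\<forall>i\<in>pN. a \<le> Inf (snd i) \<and> Inf (snd i) \<le> Sup (snd i) \<and> Sup (snd i) \<le> b"
          using K fin(3) by fastforce
        have "sum len pN = (\<Sum>z\<in>pN. measure lebesgue {Inf (snd z)<..<Sup (snd z)})"
        proof (rule sum.cong, rule refl)
          fix z assume "z \<in> pN"
          then obtain u v where "snd z = {u..v}" "u \<le> v" using K[of "fst z" "snd z"] fin(3) by auto
          then show "len z = measure lebesgue {Inf (snd z)<..<Sup (snd z)}" by (simp add: len_def)
        qed
        also have "\<dots> = measure lebesgue (\<Union>z\<in>pN. {Inf (snd z)<..<Sup (snd z)})"
        proof (rule measure_finite_Union[symmetric, OF fin(2)])
          show "emeasure lebesgue {Inf (snd z)<..<Sup (snd z)} \<noteq> \<infinity>" for z :: "real \<times> real set"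
            by (cases "Inf (snd z) \<le> Sup (snd z)") auto
        qed (use dj in auto)
        also have "\<dots> \<le> measure lebesgue U"
        proof (rule measure_mono_fmeasurable[OF _ _ Ul])
          show "(\<Union>z\<in>pN. {Inf (snd z)<..<Sup (snd z)}) \<subseteq> U"
          proof safe
            fix x K w assume "(x,K) \<in> pN" "w \<in> {Inf (snd (x,K))<..<Sup (snd (x,K))}"
            then show "w \<in> U" using K[of x K] fin(3) by (auto simp: pN_def \<gamma>_def)
          qed
        qed (use fin(2) in auto)
        also have "\<dots> < \<delta>" using Um Ul \<delta> by (simp add: emeasure_eq_measure2 ennreal_less_iff)
        finally show "(\<Sum>z\<in>pN. Sup (snd z) - Inf (snd z)) < \<delta>" by (simp add: len_def)
      qed (rule fin)
      moreover have "(\<Sum>z\<in>pN. norm (err z)) = (\<Sum>z\<in>pN. norm (F (Sup (snd z)) - F (Inf (snd z))))"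
        by (intro sum.cong) (auto simp: err_def pN_def g_def norm_minus_commute)
      ultimately have 1: "(\<Sum>z\<in>pN. norm (err z)) \<le> e * (b - a) / 2" by simp
      have "(\<Sum>z\<in>p - pN. norm (err z)) \<le> (\<Sum>z\<in>p - pN. e/2 * len z)"
      proof (rule sum_mono)
        fix z assume z: "z \<in> p - pN"
        obtain x K' where zz: "z = (x,K')" by fastforce
        with z have xN: "x \<notin> N" by (auto simp: pN_def)
        obtain u v where uv: "K' = {u..v}" "u \<le> v" "a \<le> u" "v \<le> b" "x \<in> {u..v}" "K' \<subseteq> ball x (d x)"
          using K[of x K'] z zz xN by (auto simp: \<gamma>_def)
        have x: "x \<in> {a..b} - N" using uv xN by auto
        have "norm ((v - u) *\<^sub>R f x - (F v - F u)) = norm (F u - F x - (u - x) *\<^sub>R f x - (F v - F x - (v - x) *\<^sub>R f x))"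
          by (auto simp: algebra_simps)
        also have "\<dots> \<le> norm (F u - F x - (u - x) *\<^sub>R f x) + norm (F v - F x - (v - x) *\<^sub>R f x)"
          by (rule norm_triangle_ineq4)
        also have "\<dots> \<le> e/2 * norm (u - x) + e/2 * norm (v - x)"
        proof (intro add_mono d(2)[OF x])
          have "u \<in> K'" "v \<in> K'" using uv by auto
          then have "u \<in> ball x (d x)" "v \<in> ball x (d x)" using uv(6) by blast+
          then show "norm (u - x) < d x" "norm (v - x) < d x"
            by (auto simp: dist_norm norm_minus_commute)
        qed (use uv in auto)
        also have "\<dots> = e/2 * (v - u)"
        proof -
          have "norm (u - x) + norm (v - x) = v - u" using uv(5) by auto
          then show ?thesis by (metis distrib_left)
        qed
        finally show "norm (err z) \<le> e/2 * len z"
          using uv xN by (simp add: zz err_def len_def g_def)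
      qed
      also have "\<dots> \<le> (\<Sum>z\<in>p. e/2 * len z)"
      proof (rule sum_mono2)
        fix z assume "z \<in> p - (p - pN)"
        then obtain u v where "snd z = {u..v}" "u \<le> v" using K[of "fst z" "snd z"] by auto
        then show "0 \<le> e/2 * len z" using \<open>e > 0\<close> by (simp add: len_def)
      qed (use fin in auto)
      also have "\<dots> = e/2 * (b - a)" by (simp add: bb sum_distrib_left)
      finally have 2: "(\<Sum>z\<in>p - pN. norm (err z)) \<le> e/2 * (b - a)" .
      have "norm (sum (\<lambda>(x,k). measure lborel k *\<^sub>R g x) p - (F b - F a)) = norm (\<Sum>z\<in>p. err z)"
        by (simp add: FF err_def case_prod_unfold sum_subtractf)
      also have "\<dots> \<le> (\<Sum>z\<in>p. norm (err z))" by (rule norm_sum)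
      also have "\<dots> = (\<Sum>z\<in>p - pN. norm (err z)) + (\<Sum>z\<in>pN. norm (err z))"
        using sum.subset_diff[OF fin(3) fin(1), of "\<lambda>z. norm (err z)"] by simp
      also have "\<dots> \<le> e * measure lborel {a..b}" using 1 2 ab by simp
      finally show ?case .
    qed
  qed
  then show ?thesis by (rule has_integral_spike[OF neg, rotated]) (auto simp: g_def)
qed auto

text \<open>Lebesgue's theorem provides the derivative from the right; applied to the reflected function it
  provides the one from the left.\<close>

lemma has_vector_derivative_integral_AE:
  fixes f :: "real \<Rightarrow> 'a::euclidean_space"
  assumes "f integrable_on {a..b}"
  obtains N where "negligible N"
    "\<And>x. x \<in> {a..b} - N \<Longrightarrow> ((\<lambda>t. integral {a..t} f) has_vector_derivative f x) (at x within {a..b})"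
proof -
  define g where "g x = (if x \<in> {a..b} then f x else 0)" for x
  have gU: "g integrable_on UNIV" unfolding g_def using Henstock_Kurzweil_Integration.integrable_restrict_UNIV[of "{a..b}" f] assms by metis
  have gi: "g integrable_on {c..d}" for c d
    using integrable_on_subcbox[OF gU subset_UNIV, of c d] by (metis cbox_interval)
  have "\<And>c d. g integrable_on cbox c d" using gi by simp
  from integrable_ccontinuous_explicit[OF this]
  obtain N1 where N1: "negligible N1" "\<And>x e. x \<notin> N1 \<Longrightarrow> 0 < e \<Longrightarrow> \<exists>d>0. \<forall>h. 0 < h \<and> h < d \<longrightarrow>
                         norm(integral {x..x+h} g /\<^sub>R h - g x) < e"
    by auto
  have "\<And>c d. (\<lambda>x. g (-x)) integrable_on cbox c d"
    using gi[of "-d" "-c" for c d] Henstock_Kurzweil_Integration.integrable_reflect_real[where f=g and a="-d" and b="-c" for c d] by simp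
  from integrable_ccontinuous_explicit[OF this]
  obtain N2 where N2: "negligible N2" "\<And>x e. x \<notin> N2 \<Longrightarrow> 0 < e \<Longrightarrow> \<exists>d>0. \<forall>h. 0 < h \<and> h < d \<longrightarrow>
                         norm(integral {x..x+h} (\<lambda>x. g (-x)) /\<^sub>R h - g (-x)) < e"
    by auto
  show ?thesis
  proof
    show "negligible (N1 \<union> uminus ` N2)"
      using N1(1) N2(1) negligible_differentiable_image_negligible[of N2 uminus]
      by (auto simp: differentiable_on_def)
    fix x assume x: "x \<in> {a..b} - (N1 \<union> uminus ` N2)"
    then have x1: "x \<notin> N1" and x2: "-x \<notin> N2" and xab: "x \<in> {a..b}" and gx: "g x = f x"
      by (auto simp: g_def image_iff)
    show "((\<lambda>t. integral {a..t} f) has_vector_derivative f x) (at x within {a..b})"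
      unfolding has_vector_derivative_def has_derivative_within_alt
    proof (intro conjI allI impI)
      show "bounded_linear (\<lambda>xa. xa *\<^sub>R f x)" by (rule bounded_linear_scaleR_left)
      fix e :: real assume e: "0 < e"
      obtain d1 where d1: "d1 > 0" "\<And>h. 0 < h \<Longrightarrow> h < d1 \<Longrightarrow> norm (integral {x..x+h} g /\<^sub>R h - g x) < e"
        using N1(2)[OF x1 e] by auto
      obtain d2 where d2: "d2 > 0" "\<And>h. 0 < h \<Longrightarrow> h < d2 \<Longrightarrow> norm (integral {-x..-x+h} (\<lambda>x. g (-x)) /\<^sub>R h - g x) < e"
        using N2(2)[OF x2 e] by auto
      have comb: "integral {a..v} f - integral {a..u} f = integral {u..v} g" if "a \<le> u" "u \<le> v" "v \<le> b" for u v
      proof -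
        have "f integrable_on {a..v}" using assms that by (auto intro: integrable_subinterval_real)
        then have "integral {a..u} f + integral {u..v} f = integral {a..v} f"
          using that by (intro Henstock_Kurzweil_Integration.integral_combine) auto
        moreover have "integral {u..v} f = integral {u..v} g"
          using that by (intro integral_cong) (auto simp: g_def)
        ultimately show ?thesis by (simp add: algebra_simps)
      qed
      have scale: "norm (w - h *\<^sub>R v) \<le> e * h" if "0 < h" "norm (w /\<^sub>R h - v) < e" for w v :: 'a and h
      proof -
        have "w - h *\<^sub>R v = h *\<^sub>R (w /\<^sub>R h - v)" using that(1) by (simp add: scaleR_diff_right)
        then have "norm (w - h *\<^sub>R v) = h * norm (w /\<^sub>R h - v)" using that(1) by simp
        then show ?thesis using that by (simp add: mult.commute mult_left_mono)
      qed
      show "\<exists>d>0. \<forall>y\<in>{a..b}. norm (y - x) < d \<longrightarrow>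
          norm (integral {a..y} f - integral {a..x} f - (y - x) *\<^sub>R f x) \<le> e * norm (y - x)"
      proof (intro exI[of _ "min d1 d2"] conjI ballI impI)
        fix y assume y: "y \<in> {a..b}" "norm (y - x) < min d1 d2"
        consider "y = x" | "x < y" | "y < x" by linarith
        then show "norm (integral {a..y} f - integral {a..x} f - (y - x) *\<^sub>R f x) \<le> e * norm (y - x)"
        proof cases
          case 2
          then have "norm (integral {x..y} g - (y - x) *\<^sub>R f x) \<le> e * (y - x)"
            using d1(2)[of "y - x"] y gx by (intro scale) auto
          with 2 comb[of x y] xab y show ?thesis by simp
        next
          case 3
          have "integral {-x..-x+(x-y)} (\<lambda>x. g (-x)) = integral {y..x} g"
            using integral_reflect_real[of x y g] by simp
          then have "norm (integral {y..x} g - (x - y) *\<^sub>R f x) \<le> e * (x - y)"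
            using d2(2)[of "x - y"] y gx 3 by (intro scale) auto
          moreover have "integral {a..y} f - integral {a..x} f - (y - x) *\<^sub>R f x = - (integral {y..x} g - (x - y) *\<^sub>R f x)"
            using comb[of y x] 3 xab y by (simp add: algebra_simps)
          ultimately show ?thesis using 3 by (simp add: norm_minus_commute)
        qed auto
      qed (use d1 d2 in auto)
    qed
  qed
qed

lemma primitive_on_has_vector_derivative:
  assumes "primitive_on a b F f"
  obtains N where "negligible N" "\<And>x. x \<in> {a..b} - N \<Longrightarrow> (F has_vector_derivative f x) (at x within {a..b})"
proof -
  obtain N where N: "negligible N"
    "\<And>x. x \<in> {a..b} - N \<Longrightarrow> ((\<lambda>t. integral {a..t} f) has_vector_derivative f x) (at x within {a..b})"
    using has_vector_derivative_integral_AE[of f a b] primitive_on_integrable[OF assms] by blast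
  have "(F has_vector_derivative f x) (at x within {a..b})" if x: "x \<in> {a..b} - N" for x
  proof -
    have 1: "((\<lambda>t. F a + integral {a..t} f) has_vector_derivative f x) (at x within {a..b})"
      using has_vector_derivative_add[OF has_vector_derivative_const[of "F a"] N(2)[OF x]] by simp
    have 2: "F t = F a + integral {a..t} f" if "t \<in> {a..b}" for t
      using primitive_on_diff[OF assms, of a t] that by (simp add: algebra_simps)
    have 3: "x \<in> {a..b}" using x by blast
    show ?thesis by (rule has_vector_derivative_transform[OF 3 2 1])
  qed
  with N(1) that show ?thesis by blast
qed

text \<open>Truncating \<open>norm f\<close> at a height \<open>k\<close> leaves a small integral, and a truncated function contributes
  at most \<open>k\<close> times the total length.\<close>

lemma primitive_on_abs_continuous:
  fixes F :: "real \<Rightarrow> 'a::euclidean_space"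
  assumes "primitive_on a b F f"
  shows "abs_continuous_on_Icc a b F"
  unfolding abs_continuous_on_Icc_def
proof (intro allI impI)
  fix e :: real assume e: "0 < e"
  define g where "g x = norm (f x)" for x
  define gk where "gk k x = min (g x) (real k)" for k x
  have fa: "f absolutely_integrable_on {a..b}" using assms by (simp add: primitive_on_def)
  have ga: "g absolutely_integrable_on {a..b}" using absolutely_integrable_norm[OF fa] by (simp add: g_def[abs_def] comp_def)
  have gi: "g integrable_on {a..b}" using ga set_lebesgue_integral_eq_integral(1) by blast
  have gka: "gk k absolutely_integrable_on {a..b}" for k
    unfolding gk_def by (intro absolutely_integrable_min_1 ga) (auto simp: absolutely_integrable_on_const)
  have gki: "gk k integrable_on {a..b}" for k using gka set_lebesgue_integral_eq_integral(1) by blast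
  have gk: "0 \<le> gk k x" "gk k x \<le> g x" "gk k x \<le> k" for k x by (auto simp: gk_def g_def)
  have "(\<lambda>k. integral {a..b} (gk k)) \<longlonglongrightarrow> integral {a..b} g"
  proof (rule dominated_convergence(2)[OF gki gi])
    fix x show "(\<lambda>k. gk k x) \<longlonglongrightarrow> g x"
    proof (rule tendsto_eventually)
      obtain K :: nat where "g x \<le> K" using real_arch_simple by blast
      then show "\<forall>\<^sub>F k in sequentially. gk k x = g x"
        by (auto simp: gk_def min_def intro!: eventually_sequentiallyI[of K])
    qed
  qed (use gk in auto)
  then have "\<forall>\<^sub>F k in sequentially. dist (integral {a..b} (gk k)) (integral {a..b} g) < e/2"
    using e by (intro tendstoD) auto
  then obtain k where k: "dist (integral {a..b} (gk k)) (integral {a..b} g) < e/2"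
    by (auto simp: eventually_sequentially)
  define h where "h x = g x - gk k x" for x
  have h0: "0 \<le> h x" for x using gk by (simp add: h_def)
  have hi: "h integrable_on {a..b}" unfolding h_def using gi gki by (intro integrable_diff)
  have hk: "integral {a..b} h < e/2"
    using k integral_diff[OF gi gki, of k] abs_ge_minus_self[of "integral {a..b} (gk k) - integral {a..b} g"]
    by (simp add: h_def[abs_def] dist_real_def del: abs_ge_minus_self)
  define \<delta> where "\<delta> = e / (2 * (real k + 1))"
  have \<delta>: "\<delta> > 0" "k * \<delta> \<le> e/2" using e by (auto simp: \<delta>_def field_simps)
  show "\<exists>\<delta>>0. \<forall>(N::nat) u v. (\<forall>i<N. a \<le> u i \<and> u i \<le> v i \<and> v i \<le> b) \<longrightarrow>
        disjoint_family_on (\<lambda>i. {u i<..<v i}) {..<N} \<longrightarrow> (\<Sum>i<N. v i - u i) < \<delta> \<longrightarrow>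
        (\<Sum>i<N. norm (F (v i) - F (u i))) < e"
  proof (intro exI[of _ \<delta>] conjI allI impI)
    fix N :: nat and u v
    assume uv: "\<forall>i<N. a \<le> u i \<and> u i \<le> v i \<and> v i \<le> b"
      and dj: "disjoint_family_on (\<lambda>i. {u i<..<v i}) {..<N}" and small: "(\<Sum>i<N. v i - u i) < \<delta>"
    have le: "norm (F (v i) - F (u i)) \<le> k * (v i - u i) + integral {u i<..<v i} h" if "i < N" for i
    proof -
      have i: "a \<le> u i" "u i \<le> v i" "v i \<le> b" using uv that by auto
      have sub: "g integrable_on {u i..v i}" "h integrable_on {u i..v i}" "gk k integrable_on {u i..v i}"
        using integrable_subinterval_real[OF gi] integrable_subinterval_real[OF hi]
          integrable_subinterval_real[OF gki] i by simp_all
      have "norm (F (v i) - F (u i)) = norm (integral {u i..v i} f)"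
        using primitive_on_diff[OF assms i] by simp
      also have "\<dots> \<le> integral {u i..v i} g"
        using primitive_on_integrable(2)[OF assms i(1,3)] sub(1) by (intro integral_norm_bound_integral) (auto simp: g_def)
      also have "\<dots> = integral {u i..v i} (gk k) + integral {u i..v i} h"
        using sub by (subst integral_add[symmetric]) (auto simp: h_def)
      also have "integral {u i..v i} (gk k) \<le> integral {u i..v i} (\<lambda>_. real k)"
        using sub gk by (intro integral_le) auto
      finally show ?thesis using i(2) by (simp add: mult.commute integral_open_interval_real)
    qed
    have iv: "(h has_integral integral {u i<..<v i} h) {u i<..<v i}" if "i < N" for i
      using uv that integrable_subinterval_real[OF hi, of "u i" "v i"]
      by (simp add: has_integral_integral[symmetric] integrable_on_open_interval_real)
    have "(h has_integral (\<Sum>i<N. integral {u i<..<v i} h)) (\<Union>i\<in>{..<N}. {u i<..<v i})"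
      using dj iv by (intro has_integral_UN) (auto simp: pairwise_def disjoint_family_on_def)
    then have "(\<Sum>i<N. integral {u i<..<v i} h) \<le> integral {a..b} h"
      by (rule has_integral_subset_le[rotated 1, OF _ integrable_integral[OF hi]]) (use uv h0 in \<open>force+\<close>)
    moreover have "real k * (\<Sum>i<N. v i - u i) \<le> e/2"
      using mult_left_mono[of "\<Sum>i<N. v i - u i" \<delta> k] small \<delta>(2) by simp
    moreover have "(\<Sum>i<N. norm (F (v i) - F (u i))) \<le> (\<Sum>i<N. k * (v i - u i) + integral {u i<..<v i} h)"
      by (intro sum_mono le) simp
    ultimately show "(\<Sum>i<N. norm (F (v i) - F (u i))) < e"
      using hk by (simp add: sum.distrib sum_distrib_left)
  qed (rule \<delta>)
qed

section \<open>The product rule and a backward Gronwall inequality\<close>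

lemma abs_continuous_on_Icc_subset:
  assumes "abs_continuous_on_Icc a b f" "a \<le> s" "t \<le> b"
  shows "abs_continuous_on_Icc s t f"
  unfolding abs_continuous_on_Icc_def
proof (intro allI impI)
  fix e :: real assume "0 < e"
  then obtain d where "d > 0" and *: "\<And>(N::nat) u v. (\<forall>i<N. a \<le> u i \<and> u i \<le> v i \<and> v i \<le> b) \<Longrightarrow>
    disjoint_family_on (\<lambda>i. {u i<..<v i}) {..<N} \<Longrightarrow> (\<Sum>i<N. v i - u i) < d \<Longrightarrow>
    (\<Sum>i<N. norm (f (v i) - f (u i))) < e"
    using assms(1) unfolding abs_continuous_on_Icc_def by meson
  then show "\<exists>d>0. \<forall>(N::nat) u v. (\<forall>i<N. s \<le> u i \<and> u i \<le> v i \<and> v i \<le> t) \<longrightarrow>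
    disjoint_family_on (\<lambda>i. {u i<..<v i}) {..<N} \<longrightarrow> (\<Sum>i<N. v i - u i) < d \<longrightarrow>
    (\<Sum>i<N. norm (f (v i) - f (u i))) < e"
  proof (intro exI[of _ d] conjI allI impI \<open>d > 0\<close>)
    fix N :: nat and u v
    assume uv: "\<forall>i<N. s \<le> u i \<and> u i \<le> v i \<and> v i \<le> t"
    assume "disjoint_family_on (\<lambda>i. {u i<..<v i}) {..<N}" "(\<Sum>i<N. v i - u i) < d"
    moreover have "\<forall>i<N. a \<le> u i \<and> u i \<le> v i \<and> v i \<le> b" using uv assms(2,3) by fastforce
    ultimately show "(\<Sum>i<N. norm (f (v i) - f (u i))) < e" by (intro *)
  qed
qed

lemma primitive_on_abs_continuousI:
  fixes F :: "real \<Rightarrow> 'a::euclidean_space"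
  assumes ac: "abs_continuous_on_Icc a b F" and neg: "negligible N" and f: "f absolutely_integrable_on {a..b}"
    and der: "\<And>x. x \<in> {a..b} - N \<Longrightarrow> (F has_vector_derivative f x) (at x within {a..b})"
  shows "primitive_on a b F f"
  unfolding primitive_on_def
proof (intro conjI allI impI f)
  fix s t assume st: "a \<le> s" "s \<le> t" "t \<le> b"
  show "(f has_integral F t - F s) {s..t}"
  proof (rule has_integral_abs_continuous[OF st(2) abs_continuous_on_Icc_subset[OF ac st(1,3)] neg])
    fix x assume "x \<in> {s..t} - N"
    then have "x \<in> {a..b} - N" using st by auto
    from der[OF this] show "(F has_vector_derivative f x) (at x within {s..t})"
      by (rule has_vector_derivative_within_subset) (use st in auto)
  qed
qed

text \<open>The product of absolutely continuous functions is absolutely continuous, and differentiable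
  wherever both factors are.\<close>

lemma primitive_on_bilinear:
  fixes F :: "real \<Rightarrow> 'a::euclidean_space" and G :: "real \<Rightarrow> 'b::euclidean_space"
    and prod :: "'a \<Rightarrow> 'b \<Rightarrow> 'c::euclidean_space"
  assumes bil: "bounded_bilinear prod" and F: "primitive_on a b F f" and G: "primitive_on a b G g"
  shows "primitive_on a b (\<lambda>t. prod (F t) (G t)) (\<lambda>t. prod (F t) (g t) + prod (f t) (G t))"
proof (cases "a \<le> b")
  case True
  interpret bounded_bilinear prod by (rule bil)
  obtain K where K: "K > 0" "\<And>x y. norm (prod x y) \<le> norm x * norm y * K" using pos_bounded by blast
  have cF: "continuous_on {a..b} F" and cG: "continuous_on {a..b} G"
    using F G by (auto intro: primitive_on_continuous)
  obtain CF where CF: "CF > 0" "\<And>s. s \<in> {a..b} \<Longrightarrow> norm (F s) \<le> CF"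
    using compact_imp_bounded[OF compact_continuous_image[OF cF compact_Icc]] unfolding bounded_pos by auto
  obtain CG where CG: "CG > 0" "\<And>s. s \<in> {a..b} \<Longrightarrow> norm (G s) \<le> CG"
    using compact_imp_bounded[OF compact_continuous_image[OF cG compact_Icc]] unfolding bounded_pos by auto
  have fa: "f absolutely_integrable_on {a..b}" and ga: "g absolutely_integrable_on {a..b}"
    using F G by (auto simp: primitive_on_def)
  have mF: "F \<in> borel_measurable (lebesgue_on {a..b})" and mG: "G \<in> borel_measurable (lebesgue_on {a..b})"
    using cF cG by (auto intro: continuous_imp_measurable_on_sets_lebesgue)
  have mf: "f \<in> borel_measurable (lebesgue_on {a..b})" and mg: "g \<in> borel_measurable (lebesgue_on {a..b})"
    using fa ga by (auto intro!: absolutely_integrable_measurable[THEN iffD1, THEN conjunct1])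
  have BF: "norm (prod (F t) w) \<le> CF * K * norm w" if "t \<in> {a..b}" for t w
  proof -
    have "norm (F t) * (norm w * K) \<le> CF * (norm w * K)"
      using CF(2)[OF that] K(1) by (intro mult_right_mono) auto
    with K(2)[of "F t" w] show ?thesis by (simp add: mult_ac)
  qed
  have BG: "norm (prod w (G t)) \<le> CG * K * norm w" if "t \<in> {a..b}" for t w
  proof -
    have "norm (G t) * (norm w * K) \<le> CG * (norm w * K)"
      using CG(2)[OF that] K(1) by (intro mult_right_mono) auto
    with K(2)[of w "G t"] show ?thesis by (simp add: mult_ac)
  qed
  have i1: "(\<lambda>t. prod (F t) (g t)) absolutely_integrable_on {a..b}"
  proof (rule measurable_bounded_by_integrable_imp_absolutely_integrable)
    show "(\<lambda>t. prod (F t) (g t)) \<in> borel_measurable (lebesgue_on {a..b})"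
      by (rule borel_measurable_continuous_Pair[OF mF mg]) (intro continuous_on continuous_intros)
    show "(\<lambda>t. CF * K * norm (g t)) integrable_on {a..b}"
      using absolutely_integrable_norm[OF ga] by (intro integrable_on_mult_right)
        (auto simp: comp_def dest: set_lebesgue_integral_eq_integral(1))
    show "norm (prod (F t) (g t)) \<le> CF * K * norm (g t)" if "t \<in> {a..b}" for t
      by (rule BF[OF that])
  qed auto
  have i2: "(\<lambda>t. prod (f t) (G t)) absolutely_integrable_on {a..b}"
  proof (rule measurable_bounded_by_integrable_imp_absolutely_integrable)
    show "(\<lambda>t. prod (f t) (G t)) \<in> borel_measurable (lebesgue_on {a..b})"
      by (rule borel_measurable_continuous_Pair[OF mf mG]) (intro continuous_on continuous_intros)
    show "(\<lambda>t. CG * K * norm (f t)) integrable_on {a..b}"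
      using absolutely_integrable_norm[OF fa] by (intro integrable_on_mult_right)
        (auto simp: comp_def dest: set_lebesgue_integral_eq_integral(1))
    show "norm (prod (f t) (G t)) \<le> CG * K * norm (f t)" if "t \<in> {a..b}" for t
      by (rule BG[OF that])
  qed auto
  have ac: "abs_continuous_on_Icc a b (\<lambda>t. prod (F t) (G t))"
    unfolding abs_continuous_on_Icc_def
  proof (intro allI impI)
    fix e :: real assume e: "0 < e"
    define S where "S = CF + CG"
    have S: "S > 0" using CF CG by (simp add: S_def)
    define e1 where "e1 = e / (2 * K * S)"
    have e1: "e1 > 0" using e K S by (simp add: e1_def)
    obtain d1 where d1: "d1 > 0" "\<And>(N::nat) u v. (\<forall>i<N. a \<le> u i \<and> u i \<le> v i \<and> v i \<le> b) \<Longrightarrow>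
        disjoint_family_on (\<lambda>i. {u i<..<v i}) {..<N} \<Longrightarrow> (\<Sum>i<N. v i - u i) < d1 \<Longrightarrow>
        (\<Sum>i<N. norm (F (v i) - F (u i))) < e1"
      using primitive_on_abs_continuous[OF F] e1 unfolding abs_continuous_on_Icc_def by meson
    obtain d2 where d2: "d2 > 0" "\<And>(N::nat) u v. (\<forall>i<N. a \<le> u i \<and> u i \<le> v i \<and> v i \<le> b) \<Longrightarrow>
        disjoint_family_on (\<lambda>i. {u i<..<v i}) {..<N} \<Longrightarrow> (\<Sum>i<N. v i - u i) < d2 \<Longrightarrow>
        (\<Sum>i<N. norm (G (v i) - G (u i))) < e1"
      using primitive_on_abs_continuous[OF G] e1 unfolding abs_continuous_on_Icc_def by meson
    show "\<exists>\<delta>>0. \<forall>(N::nat) u v. (\<forall>i<N. a \<le> u i \<and> u i \<le> v i \<and> v i \<le> b) \<longrightarrow>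
        disjoint_family_on (\<lambda>i. {u i<..<v i}) {..<N} \<longrightarrow> (\<Sum>i<N. v i - u i) < \<delta> \<longrightarrow>
        (\<Sum>i<N. norm (prod (F (v i)) (G (v i)) - prod (F (u i)) (G (u i)))) < e"
    proof (intro exI[of _ "min d1 d2"] conjI allI impI)
      fix N :: nat and u v
      assume uv: "\<forall>i<N. a \<le> u i \<and> u i \<le> v i \<and> v i \<le> b"
        and dj: "disjoint_family_on (\<lambda>i. {u i<..<v i}) {..<N}" and small: "(\<Sum>i<N. v i - u i) < min d1 d2"
      have "norm (prod (F (v i)) (G (v i)) - prod (F (u i)) (G (u i)))
          \<le> K * CF * norm (G (v i) - G (u i)) + K * CG * norm (F (v i) - F (u i))" if "i < N" for i
      proof -
        have i: "u i \<in> {a..b}" "v i \<in> {a..b}" using uv that by force+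
        have "prod (F (v i)) (G (v i)) - prod (F (u i)) (G (u i))
            = prod (F (v i)) (G (v i) - G (u i)) + prod (F (v i) - F (u i)) (G (u i))"
          by (simp add: diff_left diff_right)
        moreover have "norm (prod (F (v i)) (G (v i) - G (u i))) \<le> K * CF * norm (G (v i) - G (u i))"
          using BF[OF i(2)] by (simp add: mult_ac)
        moreover have "norm (prod (F (v i) - F (u i)) (G (u i))) \<le> K * CG * norm (F (v i) - F (u i))"
          using BG[OF i(1)] by (simp add: mult_ac)
        ultimately show ?thesis by (metis (no_types, lifting) add_mono norm_triangle_le)
      qed
      then have "(\<Sum>i<N. norm (prod (F (v i)) (G (v i)) - prod (F (u i)) (G (u i))))
          \<le> (\<Sum>i<N. K * CF * norm (G (v i) - G (u i)) + K * CG * norm (F (v i) - F (u i)))"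
        by (intro sum_mono) simp
      also have "\<dots> = K * CF * (\<Sum>i<N. norm (G (v i) - G (u i))) + K * CG * (\<Sum>i<N. norm (F (v i) - F (u i)))"
        by (simp add: sum.distrib sum_distrib_left)
      also have "\<dots> \<le> K * CF * e1 + K * CG * e1"
        using d1(2)[OF uv dj] d2(2)[OF uv dj] small K CF CG by (intro add_mono mult_left_mono) auto
      also have "\<dots> = K * S * e1" by (simp add: S_def algebra_simps)
      also have "\<dots> = e / 2" using K S by (simp add: e1_def)
      also have "\<dots> < e" using e by simp
      finally show "(\<Sum>i<N. norm (prod (F (v i)) (G (v i)) - prod (F (u i)) (G (u i)))) < e" .
    qed (use d1 d2 in auto)
  qed
  obtain N1 where N1: "negligible N1" "\<And>x. x \<in> {a..b} - N1 \<Longrightarrow> (F has_vector_derivative f x) (at x within {a..b})"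
    using primitive_on_has_vector_derivative[OF F] by blast
  obtain N2 where N2: "negligible N2" "\<And>x. x \<in> {a..b} - N2 \<Longrightarrow> (G has_vector_derivative g x) (at x within {a..b})"
    using primitive_on_has_vector_derivative[OF G] by blast
  have der: "((\<lambda>t. prod (F t) (G t)) has_vector_derivative prod (F x) (g x) + prod (f x) (G x)) (at x within {a..b})"
    if "x \<in> {a..b} - (N1 \<union> N2)" for x
    using N1(2)[of x] N2(2)[of x] that by (intro has_vector_derivative) auto
  have neg: "negligible (N1 \<union> N2)" using N1 N2 by simp
  show ?thesis
    by (rule primitive_on_abs_continuousI[OF ac neg set_integral_add(1)[OF i1 i2] der])
next
  case False
  then have "{a..b} = {}" by auto
  with False show ?thesis by (auto simp: primitive_on_def)
qed

lemma integral_exp_le: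
  fixes l :: real assumes "l > 0" "t \<le> T"
  shows "((\<lambda>s. exp (- l * s)) has_integral (exp (- l * t) - exp (- l * T)) / l) {t..T}"
proof -
  have "((\<lambda>s. exp (- l * s)) has_integral (- exp (- l * T) / l) - (- exp (- l * t) / l)) {t..T}"
  proof (intro fundamental_theorem_of_calculus assms(2))
    fix x assume "x \<in> {t..T}"
    have "((\<lambda>s. - exp (- l * s) / l) has_real_derivative exp (- l * x)) (at x within {t..T})"
      using assms(1) by (auto intro!: derivative_eq_intros)
    then show "((\<lambda>s. - exp (- l * s) / l) has_vector_derivative exp (- l * x)) (at x within {t..T})"
      by (simp add: has_real_derivative_iff_has_vector_derivative)
  qed
  then show ?thesis by (simp add: diff_divide_distrib)
qed

text \<open>Weighting with \<open>exp (l t)\<close> makes the integral operator a strict contraction on the whole interval,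
  so the maximum of the weighted function is at most a fraction of itself.\<close>

lemma gronwall_backward_zero:
  fixes f :: "real \<Rightarrow> real"
  assumes cont: "continuous_on {a..T} f" and nonneg: "\<And>t. t \<in> {a..T} \<Longrightarrow> 0 \<le> f t"
    and le: "\<And>t. t \<in> {a..T} \<Longrightarrow> f t \<le> C * integral {t..T} f" and C: "C \<ge> 0" and t: "t \<in> {a..T}"
  shows "f t = 0"
proof -
  define l where "l = C + 1"
  define h where "h s = exp (l * s) * f s" for s
  have l: "l > 0" using C by (simp add: l_def)
  have ne: "{a..T} \<noteq> {}" using t by auto
  have "continuous_on {a..T} h" unfolding h_def using cont by (intro continuous_intros)
  then obtain m where m: "m \<in> {a..T}" "\<And>s. s \<in> {a..T} \<Longrightarrow> h s \<le> h m"
    using continuous_attains_sup[OF compact_Icc ne] by blast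
  have hm: "0 \<le> h m" using nonneg[OF m(1)] by (simp add: h_def)
  have fs: "f s = exp (- l * s) * h s" for s by (simp add: h_def exp_minus_inverse mult.assoc[symmetric] exp_add[symmetric])
  have "h m \<le> exp (l * m) * (C * integral {m..T} f)"
    using le[OF m(1)] by (simp add: h_def)
  also have "integral {m..T} f \<le> integral {m..T} (\<lambda>s. exp (- l * s) * h m)"
    using m cont integral_exp_le[OF l, of m T]
    by (intro integral_le) (auto simp: fs[abs_def] intro!: integrable_continuous_real continuous_intros mult_left_mono
         continuous_on_subset[of "{a..T}" h] \<open>continuous_on {a..T} h\<close>)
  also have "\<dots> = (exp (- l * m) - exp (- l * T)) / l * h m"
    using integral_exp_le[OF l, of m T] m(1) by (simp add: integral_unique)
  also have "\<dots> \<le> exp (- l * m) / l * h m"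
    using l hm by (intro mult_right_mono divide_right_mono) auto
  finally have "h m \<le> exp (l * m) * (C * (exp (- l * m) / l * h m))"
    using C by (simp add: mult_left_mono)
  also have "\<dots> = C / l * h m" using l by (simp add: exp_minus field_simps)
  finally have "h m * (1 - C / l) \<le> 0" by (simp add: algebra_simps)
  moreover have "1 - C / l > 0" using C by (simp add: l_def)
  ultimately have "h m \<le> 0" by (simp add: mult_le_0_iff)
  then have "h t \<le> 0" using m(2)[OF t] by simp
  then show "f t = 0" using nonneg[OF t] by (simp add: h_def mult_le_0_iff)
qed

text \<open>Finitely many steps of a fixed length reach \<open>0\<close>; the \<open>max\<close> cuts off the last one.\<close>

lemma backward_steps:
  fixes T h :: real
  assumes h: "h > 0" and base: "P T" and step: "\<And>r. 0 \<le> r \<Longrightarrow> r \<le> T \<Longrightarrow> P r \<Longrightarrow> P (max 0 (r - h))" and T: "0 \<le> T"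
  shows "P 0"
proof -
  have "P (max 0 (T - real k * h))" for k
  proof (induction k)
    case 0 show ?case using base T by simp
  next
    case (Suc k)
    have "P (max 0 (max 0 (T - real k * h) - h))"
      using h T by (intro step Suc) (auto simp: max_def)
    moreover have "max 0 (max 0 (T - real k * h) - h) = max 0 (T - real (Suc k) * h)"
      using h by (auto simp: max_def algebra_simps)
    ultimately show ?case by simp
  qed
  moreover obtain k :: nat where "T \<le> k * h"
    using h by (metis pos_divide_le_eq real_arch_simple)
  ultimately show ?thesis by (metis diff_le_0_iff_le max.absorb1)
qed

section \<open>Linear differential equations with measurable coefficients\<close>

text \<open>By linearity \<open>L s (y s)\<close> is a finite combination of the functions \<open>L s e\<close> for basis vectors \<open>e\<close>.\<close>

lemma borel_measurable_linear_family:
  fixes L :: "'s \<Rightarrow> 'a::euclidean_space \<Rightarrow> 'b::euclidean_space"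
  assumes lin: "\<And>s. linear (L s)" and meas: "\<And>v. (\<lambda>s. L s v) \<in> borel_measurable M"
    and y: "y \<in> borel_measurable M"
  shows "(\<lambda>s. L s (y s)) \<in> borel_measurable M"
proof -
  have "L s (y s) = (\<Sum>i\<in>Basis. (y s \<bullet> i) *\<^sub>R L s i)" for s
  proof -
    have "L s (\<Sum>i\<in>Basis. (y s \<bullet> i) *\<^sub>R i) = (\<Sum>i\<in>Basis. (y s \<bullet> i) *\<^sub>R L s i)"
      using lin[of s] by (simp add: linear_sum linear_scale)
    then show ?thesis by (simp add: euclidean_representation)
  qed
  moreover have "(\<lambda>s. \<Sum>i\<in>Basis. (y s \<bullet> i) *\<^sub>R L s i) \<in> borel_measurable M"
    using y meas by measurable
  ultimately show ?thesis by simp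
qed

text \<open>Picard iteration in the space of bounded continuous functions.  In the variable
  \<open>z s = exp (- l s) y s\<close> with \<open>l > C\<close> the integral operator is a contraction with factor \<open>C / l\<close> on the
  whole interval, so no subdivision is needed; clamping the time to \<open>[a,b]\<close> turns functions on the
  interval into functions on the line.\<close>

lemma linear_ode_exists_forward:
  fixes L :: "real \<Rightarrow> 'a::euclidean_space \<Rightarrow> 'a"
  assumes ab: "a \<le> b" and C: "C \<ge> 0"
    and lin: "\<And>s. linear (L s)" and bd: "\<And>s v. norm (L s v) \<le> C * norm v"
    and meas: "\<And>v. (\<lambda>s. L s v) \<in> borel_measurable lebesgue"
    and gm: "g \<in> borel_measurable lebesgue" and gb: "\<And>s. norm (g s) \<le> D"
  obtains y where "y a = y0" "primitive_on a b y (\<lambda>s. L s (y s) + g s)"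
proof -
  define l where "l = C + 1"
  have l: "l > 0" using C by (simp add: l_def)
  define cl where "cl t = max a (min t b)" for t
  have cl: "cl t \<in> {a..b}" for t using ab by (auto simp: cl_def)
  have clc: "continuous_on UNIV cl" unfolding cl_def by (intro continuous_intros)
  define \<phi> where "\<phi> z s = L s (exp (l * s) *\<^sub>R z s) + g s" for z s
  define \<psi> where "\<psi> z t = exp (- l * t) *\<^sub>R (y0 + integral {a..t} (\<phi> z))" for z t
  have \<phi>m: "\<phi> (apply_bcontfun z) \<in> borel_measurable lebesgue" for z :: "real \<Rightarrow>\<^sub>C 'a"
  proof -
    have "(\<lambda>s. exp (l * s) *\<^sub>R apply_bcontfun z s) \<in> borel_measurable lebesgue"
      by (intro borel_measurable_lebesgue_continuous continuous_intros continuous_on_apply_bcontfun)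
    from borel_measurable_linear_family[OF lin meas this] show ?thesis
      unfolding \<phi>_def using gm by simp
  qed
  have \<phi>a: "\<phi> (apply_bcontfun z) absolutely_integrable_on {a..t}" if "t \<le> b" for z :: "real \<Rightarrow>\<^sub>C 'a" and t
  proof (rule absolutely_integrable_bounded_measurable[OF \<phi>m])
    fix s assume s: "s \<in> {a..t}"
    have "norm (\<phi> (apply_bcontfun z) s) \<le> C * norm (exp (l * s) *\<^sub>R apply_bcontfun z s) + D"
      unfolding \<phi>_def using bd gb by (intro norm_triangle_mono)
    also have "\<dots> \<le> C * (exp (l * b) * norm z) + D"
    proof -
      have "exp (l * s) * norm (apply_bcontfun z s) \<le> exp (l * b) * norm z"
        using s that l norm_bounded[of z s] by (intro mult_mono) auto
      then show ?thesis using C by (simp add: mult_left_mono)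
    qed
    finally show "norm (\<phi> (apply_bcontfun z) s) \<le> C * (exp (l * b) * norm z) + D" .
  qed
  then have \<phi>i: "\<phi> (apply_bcontfun z) integrable_on {a..t}" if "t \<le> b" for z :: "real \<Rightarrow>\<^sub>C 'a" and t
    using that set_lebesgue_integral_eq_integral(1) by blast
  have \<psi>c: "continuous_on {a..b} (\<psi> (apply_bcontfun z))" for z :: "real \<Rightarrow>\<^sub>C 'a"
    unfolding \<psi>_def using \<phi>i[of b z]
    by (intro continuous_intros indefinite_integral_continuous_1) auto
  have "\<exists>K. \<forall>s\<in>{a..b}. norm (\<psi> (apply_bcontfun z) s) \<le> K" for z :: "real \<Rightarrow>\<^sub>C 'a"
    using compact_imp_bounded[OF compact_continuous_image[OF \<psi>c[of z] compact_Icc]] unfolding bounded_iff by blast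
  then obtain K where K: "\<And>z s. s \<in> {a..b} \<Longrightarrow> norm (\<psi> (apply_bcontfun z) s) \<le> K z" by metis
  have \<psi>b: "(\<lambda>t. \<psi> (apply_bcontfun z) (cl t)) \<in> bcontfun" for z :: "real \<Rightarrow>\<^sub>C 'a"
  proof (rule bcontfun_normI)
    show "continuous_on UNIV (\<lambda>t. \<psi> (apply_bcontfun z) (cl t))"
      using cl by (intro continuous_on_compose2[OF \<psi>c clc]) auto
    show "norm (\<psi> (apply_bcontfun z) (cl t)) \<le> K z" for t using K cl by blast
  qed
  define S where "S z = Bcontfun (\<lambda>t. \<psi> (apply_bcontfun z) (cl t))" for z
  have S: "apply_bcontfun (S z) t = \<psi> (apply_bcontfun z) (cl t)" for z t
    unfolding S_def by (simp add: Bcontfun_inverse[OF \<psi>b])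
  have "dist (S z) (S w) \<le> C / l * dist z w" for z w
  proof (rule dist_bound)
    fix t
    define \<tau> where "\<tau> = cl t"
    have \<tau>: "a \<le> \<tau>" "\<tau> \<le> b" using cl[of t] by (auto simp: \<tau>_def)
    have e: "((\<lambda>s. exp (l * s)) has_integral (exp (l * \<tau>) - exp (l * a)) / l) {a..\<tau>}"
    proof -
      have "((\<lambda>s. exp (l * s)) has_integral exp (l * \<tau>) / l - exp (l * a) / l) {a..\<tau>}"
      proof (intro fundamental_theorem_of_calculus \<tau>)
        fix x assume "x \<in> {a..\<tau>}"
        have "((\<lambda>s. exp (l * s) / l) has_real_derivative exp (l * x)) (at x within {a..\<tau>})"
          using l by (auto intro!: derivative_eq_intros)
        then show "((\<lambda>s. exp (l * s) / l) has_vector_derivative exp (l * x)) (at x within {a..\<tau>})"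
          by (simp add: has_real_derivative_iff_has_vector_derivative)
      qed
      then show ?thesis by (simp add: diff_divide_distrib)
    qed
    have "norm (integral {a..\<tau>} (\<phi> (apply_bcontfun z)) - integral {a..\<tau>} (\<phi> (apply_bcontfun w)))
        = norm (integral {a..\<tau>} (\<lambda>s. \<phi> (apply_bcontfun z) s - \<phi> (apply_bcontfun w) s))"
      using \<phi>i[OF \<tau>(2)] by (simp add: integral_diff)
    also have "\<dots> \<le> integral {a..\<tau>} (\<lambda>s. C * dist z w * exp (l * s))"
    proof (rule integral_norm_bound_integral)
      show "(\<lambda>s. \<phi> (apply_bcontfun z) s - \<phi> (apply_bcontfun w) s) integrable_on {a..\<tau>}"
        using \<phi>i[OF \<tau>(2)] by (intro integrable_diff)
      show "(\<lambda>s. C * dist z w * exp (l * s)) integrable_on {a..\<tau>}"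
        using e by (intro integrable_on_mult_right) (auto simp: integrable_on_def)
      fix s assume "s \<in> {a..\<tau>}"
      have "\<phi> (apply_bcontfun z) s - \<phi> (apply_bcontfun w) s = L s (exp (l * s) *\<^sub>R (apply_bcontfun z s - apply_bcontfun w s))"
        unfolding \<phi>_def scaleR_diff_right linear_diff[OF lin] by simp
      also have "norm \<dots> \<le> C * norm (exp (l * s) *\<^sub>R (apply_bcontfun z s - apply_bcontfun w s))" by (rule bd)
      also have "\<dots> \<le> C * (exp (l * s) * dist z w)"
        using dist_bounded[of z s w] C by (auto simp: dist_norm intro!: mult_left_mono)
      finally show "norm (\<phi> (apply_bcontfun z) s - \<phi> (apply_bcontfun w) s) \<le> C * dist z w * exp (l * s)"
        by (simp add: mult_ac)
    qed
    also have "\<dots> = C * dist z w * ((exp (l * \<tau>) - exp (l * a)) / l)"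
      by (simp add: integral_unique[OF e])
    also have "\<dots> \<le> C * dist z w * (exp (l * \<tau>) / l)"
      using C l by (intro mult_left_mono divide_right_mono) auto
    finally have *: "norm (integral {a..\<tau>} (\<phi> (apply_bcontfun z)) - integral {a..\<tau>} (\<phi> (apply_bcontfun w)))
       \<le> C * dist z w * (exp (l * \<tau>) / l)" .
    have "dist (apply_bcontfun (S z) t) (apply_bcontfun (S w) t)
       = exp (- l * \<tau>) * norm (integral {a..\<tau>} (\<phi> (apply_bcontfun z)) - integral {a..\<tau>} (\<phi> (apply_bcontfun w)))"
      unfolding S \<tau>_def[symmetric] \<psi>_def dist_norm scaleR_diff_right[symmetric] by simp
    also have "\<dots> \<le> exp (- l * \<tau>) * (C * dist z w * (exp (l * \<tau>) / l))"
      using * by (intro mult_left_mono) auto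
    also have "\<dots> = C / l * dist z w" by (simp add: exp_minus field_simps)
    finally show "dist (apply_bcontfun (S z) t) (apply_bcontfun (S w) t) \<le> C / l * dist z w" .
  qed
  moreover have "0 \<le> C / l" "C / l < 1" using C by (auto simp: l_def)
  ultimately obtain z where z: "S z = z" using banach_fix_type[of "C / l" S] by blast
  define y where "y t = y0 + integral {a..t} (\<phi> (apply_bcontfun z))" for t
  have y: "exp (l * t) *\<^sub>R apply_bcontfun z t = y t" if "t \<in> {a..b}" for t
  proof -
    have "apply_bcontfun z t = \<psi> (apply_bcontfun z) (cl t)" using S[of z t] z by simp
    moreover have "cl t = t" using that by (auto simp: cl_def)
    ultimately show ?thesis by (simp add: \<psi>_def y_def exp_minus_inverse)
  qed
  have "primitive_on a b y (\<phi> (apply_bcontfun z))"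
    by (rule primitive_onI[where y=y0]) (auto simp: \<phi>a y_def)
  then have "primitive_on a b y (\<lambda>s. L s (y s) + g s)"
    by (rule primitive_on_AE_cong[where N="{}"]) (auto simp: \<phi>_def y)
  moreover have "y a = y0" by (simp add: y_def)
  ultimately show ?thesis using that by blast
qed

lemma linear_ode_exists_backward:
  fixes L :: "real \<Rightarrow> 'a::euclidean_space \<Rightarrow> 'a"
  assumes ab: "a \<le> b" and C: "C \<ge> 0"
    and lin: "\<And>s. linear (L s)" and bd: "\<And>s v. norm (L s v) \<le> C * norm v"
    and meas: "\<And>v. (\<lambda>s. L s v) \<in> borel_measurable lebesgue"
    and gm: "g \<in> borel_measurable lebesgue" and gb: "\<And>s. norm (g s) \<le> D"
  obtains y where "y b = y0" "primitive_on a b y (\<lambda>s. - (L s (y s) + g s))"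
proof -
  have refl: "(\<lambda>s. f (-s)) \<in> borel_measurable lebesgue" if "f \<in> borel_measurable lebesgue" for f :: "real \<Rightarrow> 'a"
    using measurable_compose[OF lebesgue_measurable_scaling[of "-1"] that] by simp
  obtain z where z: "z (-b) = y0" "primitive_on (-b) (-a) z (\<lambda>s. L (-s) (z s) + g (-s))"
    using linear_ode_exists_forward[of "-b" "-a" C "\<lambda>s. L (-s)" "\<lambda>s. g (-s)" D y0]
      ab C lin bd refl[OF meas] refl[OF gm] gb by auto
  from primitive_on_reflect[OF z(2)]
  have "primitive_on a b (\<lambda>t. z (-t)) (\<lambda>s. - (L s (z (-s)) + g s))" by simp
  with z(1) that[of "\<lambda>t. z (-t)"] show ?thesis by simp
qed

section \<open>Bounded measurable matrix functions\<close>

lemma norm_matrix_vector_mult_le: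
  fixes A :: "real^'n^'m"
  shows "norm (A *v x) \<le> norm A * norm x"
proof -
  have "norm (A *v x) = L2_set (\<lambda>i. norm (A $ i \<bullet> x)) UNIV"
    by (simp add: norm_vec_def matrix_vector_mul_component)
  also have "\<dots> \<le> L2_set (\<lambda>i. norm (A $ i) * norm x) UNIV"
    by (intro L2_set_mono) (auto simp: Cauchy_Schwarz_ineq2)
  also have "\<dots> = norm A * norm x"
    by (simp add: norm_vec_def L2_set_left_distrib)
  finally show ?thesis .
qed

lemma norm_matrix_le_columns:
  fixes A :: "real^'n^'m"
  assumes "\<And>v. norm (A *v v) \<le> c * norm v"
  shows "norm A \<le> real CARD('n) * c"
proof -
  have "norm A = norm (transpose A)"
    by (simp add: norm_eq_sqrt_inner inner_vec_def transpose_def) (subst sum.swap, simp)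
  also have "\<dots> \<le> (\<Sum>j\<in>UNIV. norm (transpose A $ j))"
    unfolding norm_vec_def[of "transpose A"] by (rule L2_set_le_sum) simp
  also have "\<dots> \<le> (\<Sum>j\<in>(UNIV::'n set). c)"
  proof (rule sum_mono)
    fix j :: 'n
    have "transpose A $ j = A *v axis j 1"
      by (simp add: matrix_vector_mult_basis column_def transpose_def)
    then show "norm (transpose A $ j) \<le> c" using assms[of "axis j 1"] by simp
  qed
  finally show ?thesis by simp
qed

lemma transpose_add: "transpose (A + B) = transpose A + transpose (B :: real^'n^'m)"
  and transpose_diff: "transpose (A - B) = transpose A - transpose (B :: real^'n^'m)"
  and transpose_minus: "transpose (- B) = - transpose (B :: real^'n^'m)"
  and transpose_zero: "transpose (0 :: real^'n^'m) = 0"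
  and transpose_scaleR: "transpose (r *\<^sub>R B) = r *\<^sub>R transpose (B :: real^'n^'m)"
  by (simp_all add: transpose_def vec_eq_iff)

lemma bounded_bilinear_matrix_vector_mult:
  "bounded_bilinear ((*v) :: real^'n^'m \<Rightarrow> real^'n \<Rightarrow> real^'m)"
  unfolding bilinear_conv_bounded_bilinear[symmetric] bilinear_def
  by (auto intro!: linearI simp: matrix_vector_mult_add_rdistrib matrix_vector_right_distrib
      scaleR_matrix_vector_assoc matrix_vector_mult_scaleR)

lemma bounded_bilinear_matrix_mult:
  "bounded_bilinear ((**) :: real^'n^'m \<Rightarrow> real^'p^'n \<Rightarrow> real^'p^'m)"
  unfolding bilinear_conv_bounded_bilinear[symmetric] bilinear_def
  by (auto intro!: linearI simp: matrix_add_ldistrib matrix_matrix_mult_def vec_eq_iff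
     sum.distrib sum_distrib_left algebra_simps)

lemma bounded_linear_transpose: "bounded_linear (transpose :: real^'n^'m \<Rightarrow> real^'m^'n)"
  unfolding linear_conv_bounded_linear[symmetric]
  by (auto intro!: linearI simp: transpose_add transpose_scaleR)

lemmas matrix_mult_diff_left = bounded_bilinear.diff_left[OF bounded_bilinear_matrix_mult]
lemmas matrix_mult_diff_right = bounded_bilinear.diff_right[OF bounded_bilinear_matrix_mult]
lemmas matrix_mult_zero_left = bounded_bilinear.zero_left[OF bounded_bilinear_matrix_mult]

lemma matrix_vector_mult_minus_left: "(- A) *v x = - ((A :: real^'n^'m) *v x)"
  by (rule bounded_bilinear.minus_left[OF bounded_bilinear_matrix_vector_mult])

lemma matrix_vector_mult_minus_right: "A *v (- x) = - ((A :: real^'n^'m) *v x)"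
  by (rule bounded_bilinear.minus_right[OF bounded_bilinear_matrix_vector_mult])

lemma measurable_matrix_vector_mult[measurable (raw)]:
  fixes A :: "'s \<Rightarrow> real^'n^'m"
  assumes "A \<in> borel_measurable M" "x \<in> borel_measurable M"
  shows "(\<lambda>s. A s *v x s) \<in> borel_measurable M"
  using assms by (rule borel_measurable_continuous_Pair)
    (intro bounded_bilinear.continuous_on[OF bounded_bilinear_matrix_vector_mult] continuous_intros)

lemma measurable_matrix_mult[measurable (raw)]:
  fixes A :: "'s \<Rightarrow> real^'n^'m" and B :: "'s \<Rightarrow> real^'p^'n"
  assumes "A \<in> borel_measurable M" "B \<in> borel_measurable M"
  shows "(\<lambda>s. A s ** B s) \<in> borel_measurable M"
  using assms by (rule borel_measurable_continuous_Pair)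
    (intro bounded_bilinear.continuous_on[OF bounded_bilinear_matrix_mult] continuous_intros)

lemma measurable_transpose[measurable (raw)]:
  fixes A :: "'s \<Rightarrow> real^'n^'m"
  assumes "A \<in> borel_measurable M"
  shows "(\<lambda>s. transpose (A s)) \<in> borel_measurable M"
  using measurable_compose[OF assms borel_measurable_continuous_onI[OF
      linear_continuous_on[OF bounded_linear_transpose]]] .

lemma matrix_inv_right: "A ** matrix_inv A = mat 1"
  and matrix_inv_left: "matrix_inv A ** A = mat 1" if "invertible A" for A :: "real^'n^'n"
  using someI_ex[of "\<lambda>A'. A ** A' = mat 1 \<and> A' ** A = mat 1"] that
  by (auto simp: invertible_def matrix_inv_def)

lemma continuous_on_det: "continuous_on S (det :: real^'n^'n \<Rightarrow> real)"
  unfolding det_def by (intro continuous_intros)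

text \<open>Cramer's rule exhibits the inverse as a quotient of polynomials in the entries.\<close>

lemma continuous_on_matrix_inv: "continuous_on {A. det A \<noteq> 0} (matrix_inv :: real^'n^'n \<Rightarrow> real^'n^'n)"
proof -
  define U :: "(real^'n^'n) set" where "U = {A. det A \<noteq> 0}"
  define cof where "cof A i j = det (\<chi> r c. if c = i then axis j 1 $ r else A $ r $ c)" for A :: "real^'n^'n" and i j
  define f where "f A = (\<chi> i j. cof A i j / det A)" for A
  have eq: "f A = matrix_inv A" if "A \<in> U" for A
  proof -
    have inv: "invertible A" using that by (simp add: U_def invertible_det_nz)
    have "matrix_inv A $ i $ j = f A $ i $ j" for i j
    proof -
      have "A *v (matrix_inv A *v axis j 1) = axis j 1"
        using inv by (simp add: matrix_vector_mul_assoc matrix_inv_right)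
      then have "matrix_inv A *v axis j 1 = (\<chi> k. det (\<chi> r c. if c = k then axis j 1 $ r else A $ r $ c) / det A)"
        using that cramer[of A "matrix_inv A *v axis j 1" "axis j 1"] by (simp add: U_def)
      then have "(matrix_inv A *v axis j 1) $ i = cof A i j / det A" by (simp add: cof_def)
      then show ?thesis by (simp add: f_def matrix_vector_mult_basis column_def)
    qed
    then show ?thesis by (simp add: vec_eq_iff)
  qed
  have "continuous_on U f"
    unfolding f_def cof_def
  proof (intro continuous_on_vec_lambda continuous_on_divide continuous_on_det)
    fix i j :: 'n
    have "continuous_on U (\<lambda>A. (\<chi> r c. if c = i then axis j 1 $ r else A $ r $ c) :: real^'n^'n)"
    proof (intro continuous_on_vec_lambda)
      fix r c show "continuous_on U (\<lambda>A. if c = i then axis j 1 $ r else A $ r $ c :: real)"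
        by (cases "c = i") (auto intro!: continuous_intros)
    qed
    then show "continuous_on U (\<lambda>A. det (\<chi> r c. if c = i then axis j 1 $ r else A $ r $ c))"
      by (rule continuous_on_compose2[OF continuous_on_det]) auto
  qed (auto simp: U_def)
  then have "continuous_on U (matrix_inv :: real^'n^'n \<Rightarrow> real^'n^'n)"
    by (rule continuous_on_eq) (rule eq)
  then show ?thesis by (simp add: U_def)
qed

lemma open_det_nonzero: "open {A :: real^'n^'n. det A \<noteq> 0}"
  using continuous_open_preimage[OF continuous_on_det[of UNIV] open_UNIV, of "-{0}"]
  by (auto simp: vimage_def Collect_neg_eq)

lemma tendsto_matrix_inv:
  fixes K :: "real^'n^'n"
  assumes "(k \<longlongrightarrow> K) F" "invertible K"
  shows "((\<lambda>x. matrix_inv (k x)) \<longlongrightarrow> matrix_inv K) F"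
proof -
  have "isCont matrix_inv K"
    using continuous_on_eq_continuous_at[THEN iffD1, OF open_det_nonzero continuous_on_matrix_inv] assms(2)
    by (auto simp: invertible_det_nz)
  then show ?thesis using assms(1) by (rule isCont_tendsto_compose)
qed

text \<open>At a singular matrix \<open>matrix_inv\<close> is a choice from the empty set, hence constant there.\<close>

lemma borel_measurable_matrix_inv: "(matrix_inv :: real^'n^'n \<Rightarrow> real^'n^'n) \<in> borel_measurable borel"
proof -
  define U :: "(real^'n^'n) set" where "U = {A. det A \<noteq> 0}"
  define g :: "real^'n^'n" where "g = (SOME A'. False)"
  have U: "U \<in> sets borel" unfolding U_def by (rule borel_open[OF open_det_nonzero])
  have "matrix_inv A = g" if "A \<notin> U" for A
  proof -
    have "\<not> invertible A" using that by (simp add: U_def invertible_det_nz)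
    then have "(\<lambda>A'. A ** A' = mat 1 \<and> A' ** A = mat 1) = (\<lambda>_. False)"
      by (auto simp: invertible_def)
    then show ?thesis by (simp add: matrix_inv_def g_def)
  qed
  then have eq: "matrix_inv = (\<lambda>A. if A \<in> U then matrix_inv A else g)" by auto
  have "continuous_on U (matrix_inv :: real^'n^'n \<Rightarrow> real^'n^'n)"
    using continuous_on_matrix_inv by (simp add: U_def)
  from borel_measurable_continuous_on_if[OF U this continuous_on_const[of _ g]]
  show ?thesis by (subst eq)
qed

lemma measurable_matrix_inv[measurable (raw)]:
  fixes A :: "'s \<Rightarrow> real^'n^'n"
  shows "A \<in> borel_measurable M \<Longrightarrow> (\<lambda>s. matrix_inv (A s)) \<in> borel_measurable M"
  by (rule measurable_compose[OF _ borel_measurable_matrix_inv])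

named_theorems bounded_range_intros

lemma bounded_range_const[bounded_range_intros]: "bounded (range (\<lambda>_. c))"
  by (simp add: image_constant_conv)

lemma bounded_range_add[bounded_range_intros]:
  fixes f g :: "'i \<Rightarrow> 'a::real_normed_vector"
  assumes "bounded (range f)" "bounded (range g)"
  shows "bounded (range (\<lambda>x. f x + g x))"
proof -
  obtain a b where "\<And>x. norm (f x) \<le> a" "\<And>x. norm (g x) \<le> b"
    using assms unfolding bounded_iff by auto
  then show ?thesis unfolding bounded_iff by (auto intro!: exI[of _ "a + b"] norm_triangle_mono)
qed

lemma bounded_range_minus[bounded_range_intros]:
  fixes f :: "'i \<Rightarrow> 'a::real_normed_vector"
  shows "bounded (range f) \<Longrightarrow> bounded (range (\<lambda>x. - f x))"
  by (auto simp: bounded_iff)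

lemma bounded_range_diff[bounded_range_intros]:
  fixes f g :: "'i \<Rightarrow> 'a::real_normed_vector"
  assumes "bounded (range f)" "bounded (range g)"
  shows "bounded (range (\<lambda>x. f x - g x))"
  using bounded_range_add[OF assms(1) bounded_range_minus[OF assms(2)]] by simp

lemma bounded_range_bilinear:
  fixes f :: "'i \<Rightarrow> 'a::real_normed_vector" and g :: "'i \<Rightarrow> 'b::real_normed_vector"
  assumes "bounded_bilinear p" "bounded (range f)" "bounded (range g)"
  shows "bounded (range (\<lambda>x. p (f x) (g x)))"
proof -
  obtain a b where "\<And>x. norm (f x) \<le> a" "\<And>x. norm (g x) \<le> b"
    using assms unfolding bounded_iff by auto
  moreover obtain K where "\<And>x y. norm (p x y) \<le> norm x * norm y * K" "0 \<le> K"
    using bounded_bilinear.nonneg_bounded[OF assms(1)] by blast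
  ultimately have "norm (p (f x) (g x)) \<le> a * b * K" for x
    by (meson mult_mono mult_right_mono norm_ge_zero order_trans)
  then show ?thesis unfolding bounded_iff by auto
qed

lemmas bounded_range_matrix_mult[bounded_range_intros] = bounded_range_bilinear[OF bounded_bilinear_matrix_mult]

lemma bounded_range_transpose[bounded_range_intros]:
  "bounded (range f) \<Longrightarrow> bounded (range (\<lambda>x. transpose (f x :: real^'n^'m)))"
  using bounded_linear_image[OF _ bounded_linear_transpose, of "range f"] by (simp add: image_image)

lemma bounded_range_compose:
  "bounded (range f) \<Longrightarrow> bounded (range (\<lambda>x. f (g x)))"
  by (rule bounded_subset) auto

text \<open>Coefficients are kept bounded and measurable on the whole line, so that
  sums and products of coefficients stay in the class.\<close>

definition bounded_measurable :: "(real \<Rightarrow> 'a::euclidean_space) \<Rightarrow> bool" where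
  "bounded_measurable f \<longleftrightarrow> f \<in> borel_measurable lebesgue \<and> bounded (range f)"

named_theorems bounded_measurable_intros

lemma bounded_measurable_const[bounded_measurable_intros]: "bounded_measurable (\<lambda>_. c)"
  by (simp add: bounded_measurable_def bounded_range_const)

lemma bounded_measurable_add[bounded_measurable_intros]:
  "bounded_measurable f \<Longrightarrow> bounded_measurable g \<Longrightarrow> bounded_measurable (\<lambda>x. f x + g x)"
  by (simp add: bounded_measurable_def bounded_range_add borel_measurable_add)

lemma bounded_measurable_diff[bounded_measurable_intros]:
  "bounded_measurable f \<Longrightarrow> bounded_measurable g \<Longrightarrow> bounded_measurable (\<lambda>x. f x - g x)"
  by (simp add: bounded_measurable_def bounded_range_diff borel_measurable_diff)

lemma bounded_measurable_minus[bounded_measurable_intros]: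
  "bounded_measurable f \<Longrightarrow> bounded_measurable (\<lambda>x. - f x)"
  by (simp add: bounded_measurable_def bounded_range_minus)

lemma bounded_measurable_mult[bounded_measurable_intros]:
  fixes f :: "real \<Rightarrow> real^'n^'m" and g :: "real \<Rightarrow> real^'p^'n"
  shows "bounded_measurable f \<Longrightarrow> bounded_measurable g \<Longrightarrow> bounded_measurable (\<lambda>x. f x ** g x)"
  by (simp add: bounded_measurable_def bounded_range_matrix_mult measurable_matrix_mult)

lemma bounded_measurable_transpose[bounded_measurable_intros]:
  fixes f :: "real \<Rightarrow> real^'n^'m"
  shows "bounded_measurable f \<Longrightarrow> bounded_measurable (\<lambda>x. transpose (f x))"
  by (simp add: bounded_measurable_def bounded_range_transpose measurable_transpose)

lemma bounded_measurable_absolutely_integrable: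
  assumes "bounded_measurable f"
  shows "f absolutely_integrable_on {a..b}"
  using assms absolutely_integrable_bounded_measurable[of f a b]
  by (auto simp: bounded_measurable_def bounded_iff)

lemma bounded_measurable_continuous_on:
  fixes f :: "real \<Rightarrow> 'a::euclidean_space"
  assumes "continuous_on {a..b} f" "\<And>s. s \<notin> {a..b} \<Longrightarrow> f s = 0"
  shows "bounded_measurable f"
  unfolding bounded_measurable_def
proof
  have "f = (\<lambda>s. if s \<in> {a..b} then f s else 0)" using assms(2) by auto
  moreover have "(\<lambda>s. if s \<in> {a..b} then f s else 0) \<in> borel_measurable lebesgue"
    using assms(1) by (subst borel_measurable_if) (auto intro: continuous_imp_measurable_on_sets_lebesgue)
  ultimately show "f \<in> borel_measurable lebesgue" by simp
  obtain B where "\<And>s. s \<in> {a..b} \<Longrightarrow> norm (f s) \<le> B"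
    using compact_imp_bounded[OF compact_continuous_image[OF assms(1) compact_Icc]] unfolding bounded_iff by blast
  then have "norm (f s) \<le> max B 0" for s using assms(2)[of s] by (cases "s \<in> {a..b}") fastforce+
  then show "bounded (range f)" unfolding bounded_iff by blast
qed

section \<open>Positive definite matrices\<close>

lemma inner_transpose_mult: "x \<bullet> (transpose A *v y) = (A *v x) \<bullet> (y :: real^'m)" for A :: "real^'n^'m"
  by (simp add: dot_lmul_matrix inner_commute[of _ y] inner_commute[of x] vector_transpose_matrix)

lemma inner_symmetric_mult: "transpose A = A \<Longrightarrow> x \<bullet> (A *v y) = (A *v x) \<bullet> y" for A :: "real^'n^'n"
  using inner_transpose_mult[of x A y] by simp

lemma symmetric_eqI:
  fixes M N :: "real^'n^'n"
  assumes "transpose M = M" "transpose N = N" "\<And>v. v \<bullet> (M *v v) = v \<bullet> (N *v v)"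
  shows "M = N"
proof -
  have D: "v \<bullet> ((M - N) *v v) = 0" for v
    using assms(3)[of v] by (simp add: matrix_vector_mult_diff_rdistrib inner_diff_right)
  have s: "transpose (M - N) = M - N" using assms by (simp add: transpose_diff)
  have "w \<bullet> ((M - N) *v v) = 0" for v w
    using D[of "v + w"] D[of v] D[of w] inner_symmetric_mult[OF s, of v w]
    by (simp add: matrix_vector_right_distrib inner_add_left inner_add_right inner_commute)
  then have "(M - N) *v v = 0" for v using inner_eq_zero_iff by blast
  then have "M *v v = N *v v" for v by (simp add: matrix_vector_mult_diff_rdistrib)
  then show ?thesis by (simp add: matrix_eq)
qed

lemma coercive_invertible:
  fixes K :: "real^'m^'m"
  assumes "\<And>v. d * (v \<bullet> v) \<le> v \<bullet> (K *v v)" "d > 0"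
  shows "invertible K" "norm (matrix_inv K *v w) \<le> norm w / d"
proof -
  have *: "d * norm v \<le> norm (K *v v)" for v
  proof (cases "v = 0")
    case False
    have "norm v * (d * norm v) \<le> v \<bullet> (K *v v)"
      using assms(1)[of v] by (simp add: dot_square_norm power2_eq_square mult_ac)
    also have "\<dots> \<le> norm v * norm (K *v v)" by (rule norm_cauchy_schwarz)
    finally show ?thesis using False by simp
  qed simp
  have "v = 0" if "K *v v = 0" for v using *[of v] that assms(2) by (simp add: mult_le_0_iff)
  then show inv: "invertible K" unfolding invertible_left_inverse matrix_left_invertible_ker by blast
  have "K *v (matrix_inv K *v w) = w" using inv by (simp add: matrix_vector_mul_assoc matrix_inv_right)
  then show "norm (matrix_inv K *v w) \<le> norm w / d"
    using *[of "matrix_inv K *v w"] assms(2) by (simp add: field_simps)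
qed

lemma bounded_range_matrix_inv:
  fixes K :: "'i \<Rightarrow> real^'m^'m"
  assumes "\<And>i v. d * (v \<bullet> v) \<le> v \<bullet> (K i *v v)" "d > 0"
  shows "bounded (range (\<lambda>i. matrix_inv (K i)))"
proof -
  have "norm (matrix_inv (K i)) \<le> real CARD('m) * (1 / d)" for i
    using coercive_invertible(2)[OF assms(1) assms(2), of i] by (intro norm_matrix_le_columns) simp
  then show ?thesis unfolding bounded_iff by blast
qed

lemma matrix_inv_mult_vector:
  fixes K :: "real^'m^'m"
  assumes "invertible K"
  shows "K *v (matrix_inv K *v w) = w" "matrix_inv K *v (K *v w) = w"
  using assms by (simp_all add: matrix_vector_mul_assoc matrix_inv_right matrix_inv_left)

lemma transpose_matrix_inv:
  fixes K :: "real^'m^'m"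
  assumes "invertible K" "transpose K = K"
  shows "transpose (matrix_inv K) = matrix_inv K"
proof -
  have "transpose (matrix_inv K) ** K = mat 1"
    using assms by (metis matrix_inv_right matrix_transpose_mul transpose_mat)
  then have "transpose (matrix_inv K) ** K ** matrix_inv K = matrix_inv K" by simp
  then show ?thesis using assms(1) by (simp add: matrix_mul_assoc[symmetric] matrix_inv_right)
qed

section \<open>Lyapunov equations\<close>

text \<open>The quadratic form of \<open>lyap C D X\<close> is the drift of \<open>x \<bullet> X x\<close> along \<open>dx = C x ds + D x dW\<close>; the Lyapunov equation
  \<open>P' + lyap C D P + N = 0\<close> is the equation of a quadratic cost with running weight \<open>N\<close>.\<close>

definition lyap :: "real^'n^'n \<Rightarrow> real^'n^'n \<Rightarrow> real^'n^'n \<Rightarrow> real^'n^'n" where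
  "lyap C D X = transpose C ** X + X ** C + transpose D ** X ** D"

lemma lyap_quadratic:
  assumes "transpose X = X"
  shows "v \<bullet> (lyap C D X *v v) = 2 * ((X *v v) \<bullet> (C *v v)) + (D *v v) \<bullet> (X *v (D *v v))"
proof -
  have "v \<bullet> (transpose C *v (X *v v)) = (X *v v) \<bullet> (C *v v)"
    by (subst inner_transpose_mult) (rule inner_commute)
  moreover have "v \<bullet> (X *v (C *v v)) = (X *v v) \<bullet> (C *v v)" by (rule inner_symmetric_mult[OF assms])
  moreover have "v \<bullet> (transpose D *v (X *v (D *v v))) = (D *v v) \<bullet> (X *v (D *v v))"
    by (rule inner_transpose_mult)
  ultimately show ?thesis
    unfolding lyap_def
    by (simp add: matrix_vector_mult_add_rdistrib matrix_vector_mul_assoc[symmetric] inner_add_right)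
qed

lemma transpose_lyap: "transpose (lyap C D X) = lyap C D (transpose X)"
  by (simp add: lyap_def transpose_add matrix_transpose_mul matrix_mul_assoc add_ac)

lemma linear_lyap: "linear (lyap C D)"
  unfolding lyap_def
  by (intro linear_compose_add bounded_linear.linear
      bounded_linear_compose[OF bounded_bilinear.bounded_linear_left[OF bounded_bilinear_matrix_mult]]
      bounded_bilinear.bounded_linear_right[OF bounded_bilinear_matrix_mult]
      bounded_bilinear.bounded_linear_left[OF bounded_bilinear_matrix_mult])

lemma psd_kernel:
  fixes M :: "real^'n^'n"
  assumes sym: "transpose M = M" and psd: "\<And>w. 0 \<le> w \<bullet> (M *v w)" and z: "v \<bullet> (M *v v) = 0"
  shows "M *v v = 0"
proof (rule ccontr)
  define u where "u = M *v v"
  define a where "a = u \<bullet> u"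
  define k where "k = u \<bullet> (M *v u)"
  assume "M *v v \<noteq> 0"
  then have a: "a > 0" by (simp add: a_def u_def)
  have k: "k \<ge> 0" using psd by (simp add: k_def)
  define e where "e = a / (k + 1)"
  have e: "e > 0" using a k by (simp add: e_def)
  have "v \<bullet> (M *v u) = a" using inner_symmetric_mult[OF sym, of v u] by (simp add: a_def u_def)
  then have "(v - e *\<^sub>R u) \<bullet> (M *v (v - e *\<^sub>R u)) = e * (e * k - 2 * a)"
    using z by (simp add: matrix_vector_mult_diff_distrib matrix_vector_mult_scaleR inner_diff_left inner_diff_right
       u_def[symmetric] a_def[symmetric] k_def[symmetric] algebra_simps)
  moreover have "e * k \<le> a" using a k by (simp add: e_def field_simps)
  then have "e * (e * k - 2 * a) < 0" using a e by (intro mult_pos_neg) auto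
  ultimately show False using psd[of "v - e *\<^sub>R u"] by simp
qed

lemma primitive_on_bounded_linear:
  assumes "bounded_linear h" "primitive_on a b F f"
  shows "primitive_on a b (\<lambda>t. h (F t)) (\<lambda>t. h (f t))"
  unfolding primitive_on_def
proof (intro conjI allI impI)
  have "f absolutely_integrable_on {a..b}" using assms(2) by (simp add: primitive_on_def)
  from absolutely_integrable_linear[OF this assms(1)]
  show "(\<lambda>t. h (f t)) absolutely_integrable_on {a..b}" by (simp add: comp_def)
  fix s t assume "a \<le> s" "s \<le> t" "t \<le> b"
  then have "(f has_integral F t - F s) {s..t}" using assms by (simp add: primitive_on_def)
  from has_integral_linear[OF this assms(1)]
  show "((\<lambda>t. h (f t)) has_integral h (F t) - h (F s)) {s..t}"
    by (simp add: comp_def linear_diff[OF bounded_linear.linear[OF assms(1)]])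
qed

lemma primitive_on_exp: "primitive_on a b (\<lambda>s. exp (l * s)) (\<lambda>s. l * exp (l * s :: real))"
  unfolding primitive_on_def
proof (intro conjI allI impI)
  show "(\<lambda>s. l * exp (l * s)) absolutely_integrable_on {a..b}"
    by (intro absolutely_integrable_continuous_real continuous_intros)
  fix s t :: real assume st: "a \<le> s" "s \<le> t" "t \<le> b"
  show "((\<lambda>s. l * exp (l * s)) has_integral exp (l * t) - exp (l * s)) {s..t}"
  proof (intro fundamental_theorem_of_calculus st)
    fix x assume "x \<in> {s..t}"
    have "((\<lambda>s. exp (l * s)) has_real_derivative l * exp (l * x)) (at x within {s..t})"
      by (auto intro!: derivative_eq_intros)
    then show "((\<lambda>s. exp (l * s)) has_vector_derivative l * exp (l * x)) (at x within {s..t})"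
      by (simp add: has_real_derivative_iff_has_vector_derivative)
  qed
qed

text \<open>Positivity without the stochastic interpretation: let \<open>w\<close> be a unit vector and \<open>t0\<close> a time at which
  \<open>exp (l s) (w \<bullet> P s w)\<close> is smallest.  If the value is negative then \<open>w\<close> is an eigenvector of \<open>P t0\<close>, to
  its smallest eigenvalue, and the equation forces \<open>exp (l s) (w \<bullet> P s w)\<close> to decrease strictly to the
  right of \<open>t0\<close>, a contradiction.\<close>

lemma lyapunov_nonneg:
  fixes P :: "real \<Rightarrow> real^'n^'n"
  assumes prim: "primitive_on r T P (\<lambda>s. - (lyap (C s) (D s) (P s) + N s))"
    and bC: "\<And>s. s \<in> {r..T} \<Longrightarrow> norm (C s) \<le> c" and bD: "\<And>s. s \<in> {r..T} \<Longrightarrow> norm (D s) \<le> d"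
    and sym: "\<And>s. s \<in> {r..T} \<Longrightarrow> transpose (P s) = P s"
    and N: "\<And>s v. s \<in> {r..T} \<Longrightarrow> 0 \<le> v \<bullet> (N s *v v)"
    and PT: "\<And>v. 0 \<le> v \<bullet> (P T *v v)"
    and t: "t \<in> {r..T}"
  shows "0 \<le> v \<bullet> (P t *v v)"
proof (rule ccontr)
  assume neg: "\<not> 0 \<le> v \<bullet> (P t *v v)"
  have c0: "c \<ge> 0" "d \<ge> 0" using bC[OF t] bD[OF t] norm_ge_zero order_trans by blast+
  \<comment> \<open>\<open>K\<close> bounds the effect of \<open>lyap\<close> on the smallest eigenvalue; \<open>l > K\<close> gives a strict sign\<close>
  define K where "K = 2 * c + d\<^sup>2"
  have K0: "K \<ge> 0" using c0 by (simp add: K_def)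
  define l where "l = K + 1"
  have contP: "continuous_on {r..T} P" using primitive_on_continuous[OF prim] .
  define h where "h = (\<lambda>(s, w). - (exp (l * s) * (w \<bullet> (P s *v w))))"
  have ch: "continuous_on ({r..T} \<times> sphere 0 1) h"
    unfolding h_def case_prod_unfold
    by (intro continuous_intros bounded_bilinear.continuous_on[OF bounded_bilinear_matrix_vector_mult]
        continuous_on_compose2[OF contP]) auto
  have v0: "v \<noteq> 0" using neg by auto
  define v' where "v' = v /\<^sub>R norm v"
  have v': "v' \<in> sphere 0 1" using v0 by (simp add: v'_def)
  have scale: "(w /\<^sub>R norm w) \<bullet> (M *v (w /\<^sub>R norm w)) = (w \<bullet> (M *v w)) / (w \<bullet> w)" for M :: "real^'n^'n" and w
    by (simp add: matrix_vector_mult_scaleR dot_square_norm power2_eq_square field_simps)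
  have "compact ({r..T} \<times> sphere (0::real^'n) 1)" by (intro compact_Times compact_Icc compact_sphere)
  moreover have "{r..T} \<times> sphere (0::real^'n) 1 \<noteq> {}" using t v' by blast
  ultimately obtain z where z: "z \<in> {r..T} \<times> sphere 0 1" "\<And>y. y \<in> {r..T} \<times> sphere 0 1 \<Longrightarrow> h y \<le> h z"
    using continuous_attains_sup[OF _ _ ch] by blast
  obtain t0 w where zz: "z = (t0, w)" by (cases z)
  have t0: "t0 \<in> {r..T}" and w: "norm w = 1" using z(1) zz by auto
  define lam where "lam = w \<bullet> (P t0 *v w)"
  have hs: "h (s, u /\<^sub>R norm u) = - (exp (l * s) * ((u \<bullet> (P s *v u)) / (u \<bullet> u)))" for s u
    by (simp only: h_def case_prod_conv scale)
  have "h (t, v') > 0"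
    using neg v0 unfolding v'_def hs by (simp add: divide_neg_pos mult_pos_neg)
  then have "h (t0, w) > 0" using z(2)[of "(t, v')"] t v' zz by simp
  then have lam: "lam < 0" by (simp add: h_def lam_def mult_less_0_iff)
  have min0: "0 \<le> u \<bullet> ((P t0 - lam *\<^sub>R mat 1) *v u)" for u
  proof (cases "u = 0")
    case False
    then have "h (t0, u /\<^sub>R norm u) \<le> h (t0, w)" using z(2)[of "(t0, u /\<^sub>R norm u)"] t0 zz by simp
    then have "exp (l * t0) * lam \<le> exp (l * t0) * ((u \<bullet> (P t0 *v u)) / (u \<bullet> u))"
      unfolding hs by (simp only: h_def case_prod_conv lam_def neg_le_iff_le)
    then have "lam \<le> (u \<bullet> (P t0 *v u)) / (u \<bullet> u)" by (simp only: mult_le_cancel_left_pos[OF exp_gt_zero])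
    then have "lam * (u \<bullet> u) \<le> u \<bullet> (P t0 *v u)" using False by (simp add: pos_le_divide_eq)
    then show ?thesis by (simp add: matrix_vector_mult_diff_rdistrib scaleR_matrix_vector_assoc[symmetric] inner_diff_right)
  qed simp
  have "(P t0 - lam *\<^sub>R mat 1) *v w = 0"
  proof (rule psd_kernel[OF _ min0])
    show "transpose (P t0 - lam *\<^sub>R mat 1) = P t0 - lam *\<^sub>R mat 1"
      using sym[OF t0] by (simp add: transpose_diff transpose_scaleR transpose_mat)
    show "w \<bullet> ((P t0 - lam *\<^sub>R mat 1) *v w) = 0"
      using w by (simp add: matrix_vector_mult_diff_rdistrib scaleR_matrix_vector_assoc[symmetric] inner_diff_right lam_def dot_square_norm)
  qed
  then have eig: "P t0 *v w = lam *\<^sub>R w"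
    by (simp add: matrix_vector_mult_diff_rdistrib scaleR_matrix_vector_assoc[symmetric])
  have "t0 \<noteq> T" using PT[of w] lam by (auto simp: lam_def)
  then have t0T: "t0 < T" using t0 by simp
  \<comment> \<open>how closely \<open>P s\<close> must follow \<open>P t0\<close> for the derivative to stay negative\<close>
  define \<eta> where "\<eta> = - lam / (2 * (2 * K + 1))"
  have \<eta>: "\<eta> > 0" "\<eta> * (2 * K + 1) = - lam / 2" using lam K0 by (auto simp: \<eta>_def field_simps)
  obtain \<epsilon> where \<epsilon>: "\<epsilon> > 0" "\<And>s. s \<in> {r..T} \<Longrightarrow> dist s t0 < \<epsilon> \<Longrightarrow> dist (P s) (P t0) < \<eta>"
    using contP t0 \<eta>(1) unfolding continuous_on_iff by meson
  define s1 where "s1 = min T (t0 + \<epsilon> / 2)"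
  have s1: "t0 < s1" "s1 \<le> T" using t0T \<epsilon>(1) by (auto simp: s1_def)
  have near: "norm (P s - P t0) \<le> \<eta>" if "s \<in> {t0..s1}" for s
  proof -
    have "s \<in> {r..T}" "dist s t0 < \<epsilon>" using that t0 s1 \<epsilon>(1) by (auto simp: s1_def dist_real_def)
    then show ?thesis using \<epsilon>(2)[of s] by (simp add: dist_norm)
  qed
  define \<phi> where "\<phi> s = w \<bullet> (P s *v w)" for s
  define \<phi>' where "\<phi>' s = w \<bullet> ((- (lyap (C s) (D s) (P s) + N s)) *v w)" for s
  have bl: "bounded_linear (\<lambda>X :: real^'n^'n. w \<bullet> (X *v w))"
    by (intro bounded_linear_compose[OF bounded_linear_inner_right]
        bounded_bilinear.bounded_linear_left[OF bounded_bilinear_matrix_vector_mult])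
  have "primitive_on r T (\<lambda>s. exp (l * s) * \<phi> s) (\<lambda>s. exp (l * s) * \<phi>' s + l * exp (l * s) * \<phi> s)"
    unfolding \<phi>_def \<phi>'_def
    by (rule primitive_on_bilinear[OF bounded_bilinear_mult primitive_on_exp primitive_on_bounded_linear[OF bl prim]])
  then have pr: "primitive_on t0 s1 (\<lambda>s. exp (l * s) * \<phi> s) (\<lambda>s. exp (l * s) * \<phi>' s + l * exp (l * s) * \<phi> s)"
    by (rule primitive_on_subset) (use t0 s1 in auto)
  have bound: "\<phi>' s + l * \<phi> s \<le> lam / 2" if s: "s \<in> {t0..s1}" for s
  proof -
    have sr: "s \<in> {r..T}" using s t0 s1 by auto
    define \<Delta> where "\<Delta> = P s - P t0"
    have P: "P s = P t0 + \<Delta>" by (simp add: \<Delta>_def)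
    have \<Delta>: "norm (\<Delta> *v u) \<le> \<eta> * norm u" for u
      using norm_matrix_vector_mult_le[of \<Delta> u] mult_right_mono[OF near[OF s], of "norm u"] by (simp add: \<Delta>_def)
    define cw where "cw = C s *v w"
    define dw where "dw = D s *v w"
    have cw: "norm cw \<le> c" using norm_matrix_vector_mult_le[of "C s" w] bC[OF sr] w by (simp add: cw_def)
    have dw: "norm dw \<le> d" using norm_matrix_vector_mult_le[of "D s" w] bD[OF sr] w by (simp add: dw_def)
    have "norm (\<Delta> *v w) \<le> \<eta>" using \<Delta>[of w] w by simp
    then have 1: "\<bar>(\<Delta> *v w) \<bullet> cw\<bar> \<le> \<eta> * c"
      using Cauchy_Schwarz_ineq2[of "\<Delta> *v w" cw] mult_mono[of "norm (\<Delta> *v w)" \<eta> "norm cw" c] cw \<eta>(1) by simp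
    have 2: "\<bar>w \<bullet> cw\<bar> \<le> c" using Cauchy_Schwarz_ineq2[of w cw] cw w by simp
    have 3: "lam * (dw \<bullet> dw) \<le> dw \<bullet> (P t0 *v dw)" using min0[of dw]
      by (simp add: matrix_vector_mult_diff_rdistrib scaleR_matrix_vector_assoc[symmetric] inner_diff_right)
    have 4: "\<bar>dw \<bullet> (\<Delta> *v dw)\<bar> \<le> \<eta> * (dw \<bullet> dw)"
    proof -
      have "\<bar>dw \<bullet> (\<Delta> *v dw)\<bar> \<le> norm dw * norm (\<Delta> *v dw)" by (rule Cauchy_Schwarz_ineq2)
      also have "\<dots> \<le> norm dw * (\<eta> * norm dw)" by (intro mult_left_mono \<Delta>) auto
      finally show ?thesis by (simp add: dot_square_norm power2_eq_square mult_ac)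
    qed
    have 5: "dw \<bullet> dw \<le> d\<^sup>2" using dw by (simp add: dot_square_norm power_mono)
    have 6: "\<bar>w \<bullet> (\<Delta> *v w)\<bar> \<le> \<eta>"
      using Cauchy_Schwarz_ineq2[of w "\<Delta> *v w"] \<Delta>[of w] w by simp
    have "w \<bullet> (lyap (C s) (D s) (P s) *v w) = 2 * (lam * (w \<bullet> cw) + (\<Delta> *v w) \<bullet> cw) + (dw \<bullet> (P t0 *v dw) + dw \<bullet> (\<Delta> *v dw))"
      unfolding lyap_quadratic[OF sym[OF sr]] cw_def[symmetric] dw_def[symmetric]
      by (simp add: P eig matrix_vector_mult_add_rdistrib inner_add_left inner_add_right)
    moreover have "lam * c \<le> lam * (w \<bullet> cw)"
      using 2 lam by (intro mult_left_mono_neg) auto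
    moreover have "(lam - \<eta>) * d\<^sup>2 \<le> (lam - \<eta>) * (dw \<bullet> dw)"
      using 5 lam \<eta>(1) by (intro mult_left_mono_neg) auto
    ultimately have "(lam - \<eta>) * K \<le> w \<bullet> (lyap (C s) (D s) (P s) *v w)"
      using 1 3 4 by (simp add: K_def algebra_simps abs_le_iff)
    moreover have "\<phi>' s = - (w \<bullet> (lyap (C s) (D s) (P s) *v w)) - w \<bullet> (N s *v w)"
      by (simp add: \<phi>'_def matrix_vector_mult_diff_rdistrib matrix_vector_mult_minus_left inner_diff_right
          matrix_vector_mult_add_rdistrib inner_add_right)
    ultimately have p: "\<phi>' s \<le> - ((lam - \<eta>) * K)" using N[OF sr, of w] by linarith
    have "\<phi> s = lam + w \<bullet> (\<Delta> *v w)"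
      by (simp add: \<phi>_def P matrix_vector_mult_add_rdistrib inner_add_right lam_def)
    then have "l * \<phi> s \<le> l * (lam + \<eta>)" using 6 K0 by (intro mult_left_mono) (auto simp: l_def)
    with p have "\<phi>' s + l * \<phi> s \<le> lam + \<eta> * (2 * K + 1)" by (simp add: l_def algebra_simps)
    then show ?thesis using \<eta>(2) by simp
  qed
  have "exp (l * s1) * \<phi> s1 - exp (l * t0) * \<phi> t0 = integral {t0..s1} (\<lambda>s. exp (l * s) * \<phi>' s + l * exp (l * s) * \<phi> s)"
    using primitive_on_diff[OF pr, of t0 s1] s1 by simp
  also have "\<dots> \<le> integral {t0..s1} (\<lambda>s. exp (l * t0) * (lam / 2))"
  proof (rule integral_le)
    show "(\<lambda>s. exp (l * s) * \<phi>' s + l * exp (l * s) * \<phi> s) integrable_on {t0..s1}"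
      using primitive_on_integrable(2)[OF pr, of t0 s1] by simp
    fix s assume s: "s \<in> {t0..s1}"
    have "exp (l * s) * \<phi>' s + l * exp (l * s) * \<phi> s = exp (l * s) * (\<phi>' s + l * \<phi> s)"
      by (simp add: algebra_simps)
    also have "\<dots> \<le> exp (l * s) * (lam / 2)" using bound[OF s] by (intro mult_left_mono) auto
    also have "\<dots> \<le> exp (l * t0) * (lam / 2)"
      using s lam K0 by (intro mult_right_mono_neg) (auto simp: l_def)
    finally show "exp (l * s) * \<phi>' s + l * exp (l * s) * \<phi> s \<le> exp (l * t0) * (lam / 2)" .
  qed auto
  also have "\<dots> < 0" using s1 lam by (simp add: mult_pos_neg mult_neg_pos)
  finally have "h (s1, w) > h (t0, w)" by (simp add: h_def \<phi>_def)
  moreover have "h (s1, w) \<le> h (t0, w)" using z(2)[of "(s1, w)"] zz t0 s1 w by simp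
  ultimately show False by simp
qed

text \<open>A linear differential equation in the space of matrices.\<close>

lemma lyapunov_exists:
  fixes C D N :: "real \<Rightarrow> real^'n^'n"
  assumes aT: "a \<le> T" and C: "bounded_measurable C" and D: "bounded_measurable D" and N: "bounded_measurable N"
    and symN: "\<And>s. transpose (N s) = N s" and symG: "transpose G = G"
  obtains P where "P T = G" "primitive_on a T P (\<lambda>s. - (lyap (C s) (D s) (P s) + N s))" "\<And>s. transpose (P s) = P s"
proof -
  obtain K where K: "0 \<le> K" "\<And>(A :: real^'n^'n) (B :: real^'n^'n). norm (A ** B) \<le> norm A * norm B * K"
    using bounded_bilinear.nonneg_bounded[OF bounded_bilinear_matrix_mult] by blast
  obtain c where c: "\<And>s. norm (C s) \<le> c" using C unfolding bounded_measurable_def bounded_iff by auto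
  have ct: "norm (transpose (C s)) = norm (C s)" "norm (transpose (D s)) = norm (D s)" for s
    by (simp_all add: norm_eq_sqrt_inner inner_vec_def transpose_def) (subst sum.swap, simp)+
  obtain d where d: "\<And>s. norm (D s) \<le> d" using D unfolding bounded_measurable_def bounded_iff by auto
  obtain nb where nb: "\<And>s. norm (N s) \<le> nb" using N unfolding bounded_measurable_def bounded_iff by auto
  have cd: "0 \<le> c" "0 \<le> d" using c[of 0] d[of 0] norm_ge_zero order_trans by blast+
  have bd: "norm (lyap (C s) (D s) X) \<le> (2 * c * K + d * K * d * K) * norm X" for s X
  proof -
    have "norm (transpose (C s) ** X) \<le> norm (C s) * norm X * K" "norm (X ** C s) \<le> norm X * norm (C s) * K"
      using K(2) ct by metis+
    moreover have "norm (C s) * norm X * K \<le> c * norm X * K" using c[of s] K by (intro mult_right_mono) auto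
    moreover have "norm (transpose (D s) ** X ** D s) \<le> d * norm X * K * d * K"
    proof -
      have "norm (transpose (D s) ** X ** D s) \<le> norm (transpose (D s) ** X) * norm (D s) * K" by (rule K)
      also have "\<dots> \<le> (d * norm X * K) * d * K"
      proof (intro mult_right_mono mult_mono)
        have "norm (transpose (D s) ** X) \<le> norm (D s) * norm X * K" using K(2) ct by metis
        also have "\<dots> \<le> d * norm X * K" using d[of s] K by (intro mult_right_mono) auto
        finally show "norm (transpose (D s) ** X) \<le> d * norm X * K" .
      qed (use d K cd in auto)
      finally show ?thesis .
    qed
    ultimately have "norm (transpose (C s) ** X) + norm (X ** C s) + norm (transpose (D s) ** X ** D s)
       \<le> (2 * c * K + d * K * d * K) * norm X" by (simp add: algebra_simps)
    moreover have "norm (lyap (C s) (D s) X) \<le> norm (transpose (C s) ** X) + norm (X ** C s) + norm (transpose (D s) ** X ** D s)"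
      unfolding lyap_def by (intro norm_triangle_mono order_refl)
    ultimately show ?thesis by linarith
  qed
  obtain P0 where P0: "P0 T = G" "primitive_on a T P0 (\<lambda>s. - (lyap (C s) (D s) (P0 s) + N s))"
  proof (rule linear_ode_exists_backward[of a T "2 * c * K + d * K * d * K" "\<lambda>s. lyap (C s) (D s)" N nb G])
    show "(\<lambda>s. lyap (C s) (D s) v) \<in> borel_measurable lebesgue" for v
      using C D unfolding bounded_measurable_def lyap_def
      by (intro borel_measurable_add measurable_matrix_mult measurable_transpose borel_measurable_const) auto
  qed (use aT linear_lyap bd nb N K cd in \<open>auto simp: bounded_measurable_def\<close>)
  define P where "P s = (1/2) *\<^sub>R (P0 s + transpose (P0 s))" for s
  have "primitive_on a T (\<lambda>s. P0 s + transpose (P0 s)) (\<lambda>s. - (lyap (C s) (D s) (P0 s) + N s) + transpose (- (lyap (C s) (D s) (P0 s) + N s)))"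
    by (intro primitive_on_add P0(2) primitive_on_bounded_linear[OF bounded_linear_transpose])
  from primitive_on_bounded_linear[OF bounded_linear_scaleR_right[of "1/2"] this]
  have "primitive_on a T P (\<lambda>s. (1/2) *\<^sub>R (- (lyap (C s) (D s) (P0 s) + N s) + transpose (- (lyap (C s) (D s) (P0 s) + N s))))"
    by (simp add: P_def[abs_def])
  moreover have "(1/2) *\<^sub>R (- (lyap (C s) (D s) (P0 s) + N s) + transpose (- (lyap (C s) (D s) (P0 s) + N s)))
      = - (lyap (C s) (D s) (P s) + N s)" for s
  proof -
    have half: "(1/2) *\<^sub>R (- (x + n) + - (y + n)) = - ((1/2) *\<^sub>R (x + y) + n)" for x y n :: "real^'n^'n"
      by (simp add: vec_eq_iff field_simps)
    have t: "transpose (- (lyap (C s) (D s) (P0 s) + N s)) = - (lyap (C s) (D s) (transpose (P0 s)) + N s)"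
      by (simp only: transpose_minus transpose_add transpose_lyap symN)
    show ?thesis
      by (simp only: P_def linear_scale[OF linear_lyap] linear_add[OF linear_lyap] t half)
  qed
  ultimately have "primitive_on a T P (\<lambda>s. - (lyap (C s) (D s) (P s) + N s))" by simp
  moreover have "P T = G" by (simp add: P_def P0(1) symG vec_eq_iff)
  moreover have "transpose (P s) = P s" for s by (simp add: P_def transpose_scaleR transpose_add add.commute)
  ultimately show ?thesis using that by blast
qed

section \<open>Riccati equations\<close>

declare transpose_matrix_vector [simp del]

lemma primitive_on_cong:
  assumes "primitive_on a b F f" "\<And>t. t \<in> {a..b} \<Longrightarrow> F t = G t"
  shows "primitive_on a b G f"
  unfolding primitive_on_def
proof (intro conjI allI impI)
  show "f absolutely_integrable_on {a..b}" using assms(1) by (simp add: primitive_on_def)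
  fix s t assume st: "a \<le> s" "s \<le> t" "t \<le> b"
  then have "(f has_integral F t - F s) {s..t}" using assms(1) by (simp add: primitive_on_def)
  then show "(f has_integral G t - G s) {s..t}" using assms(2)[of s] assms(2)[of t] st by simp
qed

text \<open>Notation for a Riccati equation with cross term \<open>S\<close>: \<open>ric_K\<close> is the weight of the control,
  \<open>ric_L\<close> the coefficient of the mixed term, and \<open>ric_closed\<close> the right-hand side of the Lyapunov equation
  for the cost of the feedback \<open>u = - \<Theta> x\<close>, whose running weight is \<open>run_cost\<close>.\<close>

definition ric_K :: "real^'m^'n \<Rightarrow> real^'m^'m \<Rightarrow> real^'n^'n \<Rightarrow> real^'m^'m" where
  "ric_K B1 R X = R + transpose B1 ** X ** B1"

definition ric_L :: "real^'n^'n \<Rightarrow> real^'m^'n \<Rightarrow> real^'m^'n \<Rightarrow> real^'n^'m \<Rightarrow> real^'n^'n \<Rightarrow> real^'n^'m" where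
  "ric_L A1 B B1 S X = transpose B ** X + transpose B1 ** X ** A1 + S"

definition run_cost :: "real^'n^'n \<Rightarrow> real^'m^'m \<Rightarrow> real^'n^'m \<Rightarrow> real^'n^'m \<Rightarrow> real^'n^'n" where
  "run_cost Q R S \<Theta> = Q - transpose S ** \<Theta> - transpose \<Theta> ** S + transpose \<Theta> ** R ** \<Theta>"

definition ric_closed ::
  "real^'n^'n \<Rightarrow> real^'n^'n \<Rightarrow> real^'m^'n \<Rightarrow> real^'m^'n \<Rightarrow> real^'n^'n \<Rightarrow> real^'m^'m \<Rightarrow> real^'n^'m
    \<Rightarrow> real^'n^'m \<Rightarrow> real^'n^'n \<Rightarrow> real^'n^'n" where
  "ric_closed A A1 B B1 Q R S \<Theta> X = lyap (A - B ** \<Theta>) (A1 - B1 ** \<Theta>) X + run_cost Q R S \<Theta>"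

lemma run_cost_quadratic:
  "v \<bullet> (run_cost Q R S \<Theta> *v v) = v \<bullet> (Q *v v) - 2 * ((\<Theta> *v v) \<bullet> (S *v v)) + (\<Theta> *v v) \<bullet> (R *v (\<Theta> *v v))"
proof -
  have "v \<bullet> (transpose S *v (\<Theta> *v v)) = (\<Theta> *v v) \<bullet> (S *v v)"
    by (subst inner_transpose_mult) (rule inner_commute)
  then show ?thesis
    unfolding run_cost_def
    by (simp add: matrix_vector_mult_add_rdistrib matrix_vector_mult_diff_rdistrib
        matrix_vector_mul_assoc[symmetric] inner_add_right inner_diff_right inner_transpose_mult)
qed

lemma transpose_run_cost:
  assumes "transpose Q = Q" "transpose R = R"
  shows "transpose (run_cost Q R S \<Theta>) = run_cost Q R S \<Theta>"
  using assms by (simp add: run_cost_def transpose_add transpose_diff matrix_transpose_mul matrix_mul_assoc)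

lemma ric_closed_quadratic:
  assumes "transpose X = X"
  shows "v \<bullet> (ric_closed A A1 B B1 Q R S \<Theta> X *v v) =
      2 * ((X *v v) \<bullet> (A *v v)) + (A1 *v v) \<bullet> (X *v (A1 *v v)) + v \<bullet> (Q *v v)
      - 2 * ((\<Theta> *v v) \<bullet> (ric_L A1 B B1 S X *v v)) + (\<Theta> *v v) \<bullet> (ric_K B1 R X *v (\<Theta> *v v))"
proof -
  define w where "w = \<Theta> *v v"
  have L: "w \<bullet> (ric_L A1 B B1 S X *v v) = (X *v v) \<bullet> (B *v w) + (B1 *v w) \<bullet> (X *v (A1 *v v)) + w \<bullet> (S *v v)"
    unfolding ric_L_def
    by (simp add: matrix_vector_mult_add_rdistrib matrix_vector_mul_assoc[symmetric] inner_add_right inner_transpose_mult)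
       (simp add: inner_commute)
  have K: "w \<bullet> (ric_K B1 R X *v w) = w \<bullet> (R *v w) + (B1 *v w) \<bullet> (X *v (B1 *v w))"
    unfolding ric_K_def
    by (simp add: matrix_vector_mult_add_rdistrib matrix_vector_mul_assoc[symmetric] inner_add_right inner_transpose_mult)
  have c: "(A1 *v v) \<bullet> (X *v (B1 *v w)) = (B1 *v w) \<bullet> (X *v (A1 *v v))"
    by (subst inner_symmetric_mult[OF assms]) (rule inner_commute)
  show ?thesis
    unfolding ric_closed_def
    by (simp only: matrix_vector_mult_add_rdistrib inner_add_right lyap_quadratic[OF assms] run_cost_quadratic
        matrix_vector_mult_diff_rdistrib matrix_vector_mul_assoc[symmetric] w_def[symmetric] L K
        matrix_vector_mult_diff_distrib inner_diff_left inner_diff_right c)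
       (simp add: algebra_simps)
qed

lemma transpose_ric_closed:
  assumes "transpose Q = Q" "transpose R = R" "transpose X = X"
  shows "transpose (ric_closed A A1 B B1 Q R S \<Theta> X) = ric_closed A A1 B B1 Q R S \<Theta> X"
  using assms by (simp add: ric_closed_def transpose_add transpose_lyap transpose_run_cost)

lemma transpose_ric_K: "transpose R = R \<Longrightarrow> transpose X = X \<Longrightarrow> transpose (ric_K B1 R X) = ric_K B1 R X"
  by (simp add: ric_K_def transpose_add matrix_transpose_mul matrix_mul_assoc)

text \<open>Completion of the square in the feedback.\<close>

lemma ric_closed_completion:
  fixes R :: "real^'m^'m" and X A1 :: "real^'n^'n" and B B1 :: "real^'m^'n" and S :: "real^'n^'m"
  assumes X: "transpose X = X" and R: "transpose R = R" and inv: "invertible (ric_K B1 R X)"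
  defines "\<Gamma> \<equiv> matrix_inv (ric_K B1 R X) ** ric_L A1 B B1 S X"
  shows "v \<bullet> (ric_closed A A1 B B1 Q R S \<Theta> X *v v) = v \<bullet> (ric_closed A A1 B B1 Q R S \<Gamma> X *v v)
     + ((\<Theta> - \<Gamma>) *v v) \<bullet> (ric_K B1 R X *v ((\<Theta> - \<Gamma>) *v v))"
proof -
  let ?K = "ric_K B1 R X"
  define w where "w = \<Theta> *v v"
  define g where "g = \<Gamma> *v v"
  have L: "ric_L A1 B B1 S X *v v = ?K *v g"
    unfolding g_def \<Gamma>_def using matrix_inv_mult_vector(1)[OF inv] by (simp add: matrix_vector_mul_assoc[symmetric])
  have c: "g \<bullet> (?K *v w) = w \<bullet> (?K *v g)"
    by (subst inner_symmetric_mult[OF transpose_ric_K[OF R X]]) (rule inner_commute)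
  show ?thesis
    unfolding ric_closed_quadratic[OF X] w_def[symmetric] g_def[symmetric] L matrix_vector_mult_diff_rdistrib
    by (simp add: matrix_vector_mult_diff_distrib inner_diff_left inner_diff_right c)
qed

text \<open>Both sides are symmetric, so it suffices to compare their quadratic forms: for the optimal
  feedback the completed square disappears.\<close>

lemma ric_closed_gain:
  fixes R :: "real^'m^'m" and X :: "real^'n^'n"
  assumes X: "transpose X = X" and R: "transpose R = R" and Q: "transpose Q = Q" and inv: "invertible (ric_K B1 R X)"
  shows "ric_closed A A1 B B1 Q R S (matrix_inv (ric_K B1 R X) ** ric_L A1 B B1 S X) X =
     X ** A + transpose A ** X + transpose A1 ** X ** A1 + Q
     - transpose (ric_L A1 B B1 S X) ** matrix_inv (ric_K B1 R X) ** ric_L A1 B B1 S X"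
    (is "_ = ?rhs")
proof (rule symmetric_eqI)
  let ?K = "ric_K B1 R X" and ?L = "ric_L A1 B B1 S X"
  show "transpose (ric_closed A A1 B B1 Q R S (matrix_inv ?K ** ?L) X) = ric_closed A A1 B B1 Q R S (matrix_inv ?K ** ?L) X"
    by (rule transpose_ric_closed[OF Q R X])
  show "transpose ?rhs = ?rhs"
    using Q X transpose_matrix_inv[OF inv transpose_ric_K[OF R X]]
    by (simp add: transpose_add transpose_diff matrix_transpose_mul matrix_mul_assoc add_ac)
  fix v
  define l where "l = ?L *v v"
  have 1: "v \<bullet> (X *v (A *v v)) = (X *v v) \<bullet> (A *v v)" by (rule inner_symmetric_mult[OF X])
  have 2: "v \<bullet> (transpose A *v (X *v v)) = (X *v v) \<bullet> (A *v v)"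
    by (subst inner_transpose_mult) (rule inner_commute)
  have "v \<bullet> (?rhs *v v) = 2 * ((X *v v) \<bullet> (A *v v)) + (A1 *v v) \<bullet> (X *v (A1 *v v)) + v \<bullet> (Q *v v) - l \<bullet> (matrix_inv ?K *v l)"
    by (simp add: matrix_vector_mult_add_rdistrib matrix_vector_mult_diff_rdistrib matrix_vector_mul_assoc[symmetric]
        inner_add_right inner_diff_right 1 2 inner_transpose_mult[of v A1] inner_transpose_mult[of v ?L] l_def)
  moreover have "v \<bullet> (ric_closed A A1 B B1 Q R S (matrix_inv ?K ** ?L) X *v v) = 2 * ((X *v v) \<bullet> (A *v v))
     + (A1 *v v) \<bullet> (X *v (A1 *v v)) + v \<bullet> (Q *v v) - l \<bullet> (matrix_inv ?K *v l)"
    unfolding ric_closed_quadratic[OF X]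
    by (simp add: matrix_vector_mul_assoc[symmetric] l_def[symmetric] matrix_inv_mult_vector(1)[OF inv] inner_commute)
  ultimately show "v \<bullet> (ric_closed A A1 B B1 Q R S (matrix_inv ?K ** ?L) X *v v) = v \<bullet> (?rhs *v v)" by simp
qed

lemma ric_closed_diff:
  "ric_closed A A1 B B1 Q R S \<Theta> X - ric_closed A A1 B B1 Q R S \<Theta> Y = lyap (A - B ** \<Theta>) (A1 - B1 ** \<Theta>) (X - Y)"
  by (simp add: ric_closed_def linear_diff[OF linear_lyap])

lemma ric_K_coercive:
  assumes "\<And>v. d * (v \<bullet> v) \<le> v \<bullet> (R *v v)" "\<And>v. 0 \<le> v \<bullet> (X *v v)"
  shows "d * (w \<bullet> w) \<le> w \<bullet> (ric_K B1 R X *v w)"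
  using assms(1)[of w] assms(2)[of "B1 *v w"]
  by (simp add: ric_K_def matrix_vector_mult_add_rdistrib matrix_vector_mul_assoc[symmetric] inner_add_right inner_transpose_mult)

text \<open>The cross term \<open>S\<close> is there for the second Riccati equation of the mean-field problem, which has the
  form treated here with \<open>A1 = 0\<close>, \<open>B1 = 0\<close>.\<close>

locale riccati_coefficients =
  fixes T d :: real and A A1 Q :: "real \<Rightarrow> real^'n^'n" and B B1 :: "real \<Rightarrow> real^'m^'n"
    and R :: "real \<Rightarrow> real^'m^'m" and S :: "real \<Rightarrow> real^'n^'m" and G :: "real^'n^'n"
  assumes T: "0 \<le> T" and d: "0 < d"
    and bm: "bounded_measurable A" "bounded_measurable A1" "bounded_measurable Q" "bounded_measurable B"
      "bounded_measurable B1" "bounded_measurable R" "bounded_measurable S"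
    and sym: "\<And>s. transpose (Q s) = Q s" "\<And>s. transpose (R s) = R s" "transpose G = G"
    and G: "\<And>v. 0 \<le> v \<bullet> (G *v v)"
    and R: "\<And>s v. d * (v \<bullet> v) \<le> v \<bullet> (R s *v v)"
    and cost: "\<And>s v w. 0 \<le> v \<bullet> (Q s *v v) + 2 * (w \<bullet> (S s *v v)) + w \<bullet> (R s *v w)"
begin

definition gain :: "real \<Rightarrow> real^'n^'n \<Rightarrow> real^'n^'m" where
  "gain s X = matrix_inv (ric_K (B1 s) (R s) X) ** ric_L (A1 s) (B s) (B1 s) (S s) X"

definition closed :: "real \<Rightarrow> real^'n^'m \<Rightarrow> real^'n^'n \<Rightarrow> real^'n^'n" where
  "closed s \<Theta> X = ric_closed (A s) (A1 s) (B s) (B1 s) (Q s) (R s) (S s) \<Theta> X"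

text \<open>\<open>policy \<Theta> P\<close>: the quadratic form of \<open>P s\<close> is the cost-to-go from time \<open>s\<close> under the
  feedback \<open>\<Theta>\<close>.  Outside \<open>[0,T]\<close> the function is 0, which keeps it bounded and measurable on
  the whole line.\<close>

definition policy :: "(real \<Rightarrow> real^'n^'m) \<Rightarrow> (real \<Rightarrow> real^'n^'n) \<Rightarrow> bool" where
  "policy \<Theta> P \<longleftrightarrow> (\<forall>s. transpose (P s) = P s) \<and> (\<forall>s v. 0 \<le> v \<bullet> (P s *v v)) \<and> bounded_measurable P
     \<and> (\<forall>s. s \<notin> {0..T} \<longrightarrow> P s = 0) \<and> P T = G \<and> primitive_on 0 T P (\<lambda>s. - closed s (\<Theta> s) (P s))"

lemma policy_exists:
  assumes "bounded_measurable \<Theta>"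
  shows "\<exists>P. policy \<Theta> P"
proof -
  define C where "C s = A s - B s ** \<Theta> s" for s
  define D where "D s = A1 s - B1 s ** \<Theta> s" for s
  define N where "N s = run_cost (Q s) (R s) (S s) (\<Theta> s)" for s
  have bC: "bounded_measurable C" and bD: "bounded_measurable D" and bN: "bounded_measurable N"
    unfolding C_def D_def N_def run_cost_def by (intro bounded_measurable_intros bm assms)+
  have symN: "transpose (N s) = N s" for s
    unfolding N_def by (rule transpose_run_cost[OF sym(1,2)])
  obtain P0 where P0: "P0 T = G" "primitive_on 0 T P0 (\<lambda>s. - (lyap (C s) (D s) (P0 s) + N s))" "\<And>s. transpose (P0 s) = P0 s"
    using lyapunov_exists[OF T bC bD bN symN sym(3)] by blast
  obtain c e where ce: "\<And>s. norm (C s) \<le> c" "\<And>s. norm (D s) \<le> e"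
    using bC bD unfolding bounded_measurable_def bounded_iff by auto
  have psd: "0 \<le> v \<bullet> (P0 s *v v)" if "s \<in> {0..T}" for s v
  proof (rule lyapunov_nonneg[OF P0(2) ce _ _ _ that])
    show "0 \<le> v \<bullet> (N s *v v)" for s v
      using cost[of v s "- (\<Theta> s *v v)"] unfolding N_def run_cost_quadratic
      by (simp add: matrix_vector_mult_minus_right)
    show "0 \<le> v \<bullet> (P0 T *v v)" for v using G P0(1) by simp
  qed (rule P0)
  define P where "P s = (if s \<in> {0..T} then P0 s else 0)" for s
  have "primitive_on 0 T P (\<lambda>s. - closed s (\<Theta> s) (P s))"
  proof (rule primitive_on_cong)
    show "primitive_on 0 T P0 (\<lambda>s. - closed s (\<Theta> s) (P s))"
      by (rule primitive_on_AE_cong[OF P0(2) negligible_empty])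
        (simp add: closed_def ric_closed_def C_def D_def N_def P_def)
  qed (simp add: P_def)
  moreover have "continuous_on {0..T} P"
    using primitive_on_continuous[OF calculation] .
  then have "bounded_measurable P"
    by (rule bounded_measurable_continuous_on) (simp add: P_def del: atLeastAtMost_iff)
  ultimately have "policy \<Theta> P"
    unfolding policy_def
  proof (intro conjI allI impI)
    show "transpose (P s) = P s" for s using P0(3) by (simp add: P_def transpose_zero)
    show "0 \<le> v \<bullet> (P s *v v)" for s v using psd by (simp add: P_def)
    show "P s = 0" if "s \<notin> {0..T}" for s using that by (simp only: P_def if_False)
    show "P T = G" using P0(1) T by (simp add: P_def)
  qed
  then show ?thesis by blast
qed

lemma coercive:
  assumes "\<And>v. 0 \<le> v \<bullet> (X *v v)"
  shows "d * (w \<bullet> w) \<le> w \<bullet> (ric_K (B1 s) (R s) X *v w)"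
  using R assms by (rule ric_K_coercive)

lemma gain_bounded_range:
  fixes P :: "'i \<Rightarrow> real^'n^'n" and t :: "'i \<Rightarrow> real"
  assumes "\<And>i v. 0 \<le> v \<bullet> (P i *v v)" "bounded (range P)"
  shows "bounded (range (\<lambda>i. gain (t i) (P i)))"
proof -
  have b: "bounded (range (\<lambda>i. A1 (t i)))" "bounded (range (\<lambda>i. B (t i)))" "bounded (range (\<lambda>i. B1 (t i)))" "bounded (range (\<lambda>i. S (t i)))"
    using bm unfolding bounded_measurable_def by (auto intro: bounded_range_compose)
  show ?thesis
    unfolding gain_def ric_L_def
    by (intro bounded_range_intros bounded_range_matrix_inv[OF coercive d] assms b)
qed

lemma gain_bounded_measurable:
  assumes "\<And>s v. 0 \<le> v \<bullet> (P s *v v)" "bounded_measurable P"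
  shows "bounded_measurable (\<lambda>s. gain s (P s))"
  unfolding bounded_measurable_def
proof
  show "bounded (range (\<lambda>s. gain s (P s)))"
    using assms by (intro gain_bounded_range) (auto simp: bounded_measurable_def)
  show "(\<lambda>s. gain s (P s)) \<in> borel_measurable lebesgue"
    using bm assms(2) unfolding gain_def ric_K_def ric_L_def bounded_measurable_def
    by (intro measurable_matrix_mult measurable_matrix_inv borel_measurable_add measurable_transpose) auto
qed

text \<open>The difference of the two costs solves a Lyapunov equation with terminal value zero, whose running
  weight is the square completed in \<open>ric_closed_completion\<close>.\<close>

lemma policy_improvement:
  assumes P: "policy \<Theta> P" and P': "policy (\<lambda>s. gain s (P s)) P'"
  shows "v \<bullet> (P' t *v v) \<le> v \<bullet> (P t *v v)"
proof (cases "t \<in> {0..T}")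
  case True
  define \<Gamma> where "\<Gamma> s = gain s (P s)" for s
  define C where "C s = A s - B s ** \<Gamma> s" for s
  define D where "D s = A1 s - B1 s ** \<Gamma> s" for s
  define N where "N s = closed s (\<Theta> s) (P s) - closed s (\<Gamma> s) (P s)" for s
  have psd: "\<And>s v. 0 \<le> v \<bullet> (P s *v v)" and symP: "\<And>s. transpose (P s) = P s" "\<And>s. transpose (P' s) = P' s"
    using P P' by (auto simp: policy_def)
  have "bounded_measurable \<Gamma>" unfolding \<Gamma>_def using P by (intro gain_bounded_measurable) (auto simp: policy_def)
  then have bC: "bounded_measurable C" and bD: "bounded_measurable D"
    unfolding C_def D_def by (intro bounded_measurable_intros bm; assumption)+
  obtain c e where ce: "\<And>s. norm (C s) \<le> c" "\<And>s. norm (D s) \<le> e"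
    using bC bD unfolding bounded_measurable_def bounded_iff by auto
  have "primitive_on 0 T (\<lambda>s. P s - P' s) (\<lambda>s. - closed s (\<Theta> s) (P s) - - closed s (\<Gamma> s) (P' s))"
    using P P' unfolding policy_def \<Gamma>_def by (intro primitive_on_sub) auto
  moreover have "- closed s (\<Theta> s) (P s) - - closed s (\<Gamma> s) (P' s) = - (lyap (C s) (D s) (P s - P' s) + N s)" for s
  proof -
    have "closed s (\<Gamma> s) (P s) - closed s (\<Gamma> s) (P' s) = lyap (C s) (D s) (P s - P' s)"
      unfolding closed_def C_def D_def by (rule ric_closed_diff)
    then show ?thesis by (simp add: N_def algebra_simps)
  qed
  ultimately have pr: "primitive_on 0 T (\<lambda>s. P s - P' s) (\<lambda>s. - (lyap (C s) (D s) (P s - P' s) + N s))" by simp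
  have "0 \<le> v \<bullet> ((P t - P' t) *v v)"
  proof (rule lyapunov_nonneg[OF pr ce _ _ _ True])
    show "transpose (P s - P' s) = P s - P' s" for s by (simp add: transpose_diff symP)
    show "0 \<le> v \<bullet> ((P T - P' T) *v v)" for v using P P' by (simp add: policy_def)
    fix s and v :: "real^'n"
    have inv: "invertible (ric_K (B1 s) (R s) (P s))" using coercive_invertible(1)[OF coercive[OF psd] d] .
    have "v \<bullet> (N s *v v) = ((\<Theta> s - \<Gamma> s) *v v) \<bullet> (ric_K (B1 s) (R s) (P s) *v ((\<Theta> s - \<Gamma> s) *v v))"
      using ric_closed_completion[OF symP(1) sym(2) inv, where \<Theta>="\<Theta> s" and v=v]
      unfolding N_def closed_def \<Gamma>_def gain_def by (simp add: matrix_vector_mult_diff_rdistrib[of "ric_closed _ _ _ _ _ _ _ _ _"] inner_diff_right)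
    also have "\<dots> \<ge> d * (((\<Theta> s - \<Gamma> s) *v v) \<bullet> ((\<Theta> s - \<Gamma> s) *v v))" by (rule coercive[OF psd])
    moreover have "d * (((\<Theta> s - \<Gamma> s) *v v) \<bullet> ((\<Theta> s - \<Gamma> s) *v v)) \<ge> 0" using d by simp
    ultimately show "0 \<le> v \<bullet> (N s *v v)" by linarith
  qed
  then show ?thesis by (simp add: matrix_vector_mult_diff_rdistrib inner_diff_right)
next
  case False
  then show ?thesis using P P' by (simp add: policy_def)
qed

fun iterate :: "nat \<Rightarrow> real \<Rightarrow> real^'n^'n" where
  "iterate 0 = (SOME P. policy (\<lambda>_. 0) P)"
| "iterate (Suc k) = (SOME P. policy (\<lambda>s. gain s (iterate k s)) P)"

lemma policy_iterate:
  "policy (case k of 0 \<Rightarrow> (\<lambda>_. 0) | Suc k \<Rightarrow> (\<lambda>s. gain s (iterate k s))) (iterate k)"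
proof (induction k)
  case 0
  show ?case using someI_ex[OF policy_exists[OF bounded_measurable_const[of 0]]] by simp
next
  case (Suc k)
  have "bounded_measurable (\<lambda>s. gain s (iterate k s))"
    using Suc by (intro gain_bounded_measurable) (auto simp: policy_def)
  from someI_ex[OF policy_exists[OF this]] show ?case by simp
qed

lemma iterate_Suc: "policy (\<lambda>s. gain s (iterate k s)) (iterate (Suc k))"
  using policy_iterate[of "Suc k"] by simp

lemma iterate_props:
  "transpose (iterate k s) = iterate k s" "0 \<le> v \<bullet> (iterate k s *v v)" "bounded_measurable (iterate k)"
  "iterate k T = G"
  using policy_iterate[of k] by (auto simp: policy_def)

lemma iterate_decreasing: "v \<bullet> (iterate (Suc k) s *v v) \<le> v \<bullet> (iterate k s *v v)"
  using policy_iterate[of k] iterate_Suc[of k] by (rule policy_improvement)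

lemma iterate_le: "v \<bullet> (iterate k s *v v) \<le> v \<bullet> (iterate 0 s *v v)"
  by (induction k) (auto intro: order_trans[OF iterate_decreasing] simp del: iterate.simps)

lemma iterate_entry:
  "iterate k s $ i $ j = ((axis i 1 + axis j 1) \<bullet> (iterate k s *v (axis i 1 + axis j 1))
     - (axis i 1 - axis j 1) \<bullet> (iterate k s *v (axis i 1 - axis j 1))) / 4"
proof -
  define M where "M = iterate k s"
  have e: "axis a 1 \<bullet> (M *v axis b 1) = M $ a $ b" for a b
    by (simp add: inner_axis' matrix_vector_mult_basis column_def)
  have "M $ j $ i = transpose M $ i $ j" by (simp add: transpose_def)
  then have "M $ j $ i = M $ i $ j" using iterate_props(1)[of k s] by (simp add: M_def)
  then show ?thesis
    by (simp add: M_def[symmetric] matrix_vector_right_distrib matrix_vector_mult_diff_distrib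
       inner_add_left inner_add_right inner_diff_left inner_diff_right e)
qed

lemma iterate_bounded: "bounded (range (\<lambda>(k, s). iterate k s))"
proof -
  obtain c where c: "\<And>s. norm (iterate 0 s) \<le> c"
    using iterate_props(3)[of 0] unfolding bounded_measurable_def bounded_iff by auto
  have q: "v \<bullet> (iterate k s *v v) \<le> c * (norm v)\<^sup>2" for k s v
  proof -
    have "v \<bullet> (iterate k s *v v) \<le> v \<bullet> (iterate 0 s *v v)" by (rule iterate_le)
    also have "\<dots> \<le> norm v * norm (iterate 0 s *v v)" by (rule norm_cauchy_schwarz)
    also have "\<dots> \<le> norm v * (c * norm v)"
      by (intro mult_left_mono order_trans[OF norm_matrix_vector_mult_le] mult_right_mono c) auto
    finally show ?thesis by (simp add: power2_eq_square mult_ac)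
  qed
  have c0: "c \<ge> 0" using c[of 0] norm_ge_zero order_trans by blast
  have n2: "(norm (axis i 1 + axis j 1 :: real^'n))\<^sup>2 \<le> 4" "(norm (axis i 1 - axis j 1 :: real^'n))\<^sup>2 \<le> 4" for i j :: 'n
    using norm_triangle_ineq[of "axis i 1 :: real^'n" "axis j 1"] norm_triangle_ineq4[of "axis i 1 :: real^'n" "axis j 1"]
      power_mono[of "norm (axis i 1 + axis j 1 :: real^'n)" 2 2] power_mono[of "norm (axis i 1 - axis j 1 :: real^'n)" 2 2] by simp_all
  have entry: "\<bar>iterate k s $ i $ j\<bar> \<le> c" for k s i j
  proof -
    let ?p = "(axis i 1 + axis j 1) \<bullet> (iterate k s *v (axis i 1 + axis j 1))"
    let ?m = "(axis i 1 - axis j 1) \<bullet> (iterate k s *v (axis i 1 - axis j 1))"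
    have "0 \<le> ?p" "0 \<le> ?m" by (rule iterate_props(2))+
    moreover have "?p \<le> c * 4" by (rule order_trans[OF q mult_left_mono[OF n2(1) c0]])
    moreover have "?m \<le> c * 4" by (rule order_trans[OF q mult_left_mono[OF n2(2) c0]])
    moreover have "\<bar>(p - m) / 4\<bar> \<le> c" if "0 \<le> p" "0 \<le> m" "p \<le> c * 4" "m \<le> c * 4" for p m
      using that by (simp add: abs_le_iff)
    ultimately show ?thesis unfolding iterate_entry[of k s i j] by blast
  qed
  have "norm (iterate k s) \<le> (\<Sum>i\<in>(UNIV::'n set). \<Sum>j\<in>(UNIV::'n set). c)" for k s
  proof -
    have "norm (iterate k s) \<le> (\<Sum>i\<in>UNIV. norm (iterate k s $ i))"
      unfolding norm_vec_def[of "iterate k s"] by (rule L2_set_le_sum) simp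
    also have "\<dots> \<le> (\<Sum>i\<in>(UNIV::'n set). \<Sum>j\<in>(UNIV::'n set). c)"
      by (intro sum_mono order_trans[OF norm_le_l1_cart] entry)
    finally show ?thesis .
  qed
  then show ?thesis unfolding bounded_iff by auto
qed

lemma iterate_convergent: "convergent (\<lambda>k. iterate k s)"
proof -
  have q: "convergent (\<lambda>k. v \<bullet> (iterate k s *v v))" for v
  proof (rule Bseq_monoseq_convergent)
    show "Bseq (\<lambda>k. v \<bullet> (iterate k s *v v))"
    proof (rule BseqI')
      fix k show "norm (v \<bullet> (iterate k s *v v)) \<le> v \<bullet> (iterate 0 s *v v)"
        using iterate_props(2)[of v k s] iterate_le[of v k s] unfolding real_norm_def by linarith
    qed
    show "monoseq (\<lambda>k. v \<bullet> (iterate k s *v v))"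
      by (intro decseq_imp_monoseq decseq_SucI iterate_decreasing)
  qed
  then have "convergent (\<lambda>k. iterate k s $ i $ j)" for i j
    unfolding iterate_entry divide_inverse
    by (intro convergent_mult convergent_diff convergent_const q)
  then obtain P where "\<And>i j. (\<lambda>k. iterate k s $ i $ j) \<longlonglongrightarrow> P i j" unfolding convergent_def by metis
  then have "(\<lambda>k. iterate k s) \<longlonglongrightarrow> (\<chi> i j. P i j)" by (intro vec_tendstoI) simp
  then show ?thesis by (auto simp: convergent_def)
qed

text \<open>The costs of the successively improved feedbacks decrease and are nonnegative, so they converge at
  every time; the gains depend continuously on the costs, and dominated convergence passes to
  the limit in the integrated Lyapunov equations.\<close>

theorem riccati_exists:
  "\<exists>P. (\<forall>s. transpose (P s) = P s) \<and> (\<forall>s v. 0 \<le> v \<bullet> (P s *v v)) \<and> bounded_measurable P \<and> P T = G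
      \<and> primitive_on 0 T P (\<lambda>s. - closed s (gain s (P s)) (P s))"
proof -
  define P where "P s = lim (\<lambda>k. iterate k s)" for s
  have lim: "(\<lambda>k. iterate k s) \<longlonglongrightarrow> P s" for s
    using iterate_convergent[of s] by (simp add: P_def convergent_LIMSEQ_iff)
  have limv: "(\<lambda>k. iterate k s *v v) \<longlonglongrightarrow> P s *v v" for s v
    by (intro bounded_bilinear.tendsto[OF bounded_bilinear_matrix_vector_mult] lim tendsto_const)
  have sym_P: "transpose (P s) = P s" for s
    using bounded_linear.tendsto[OF bounded_linear_transpose lim[of s]] iterate_props(1)
    by (simp add: LIMSEQ_unique[OF _ lim])
  have psd: "0 \<le> v \<bullet> (P s *v v)" for s v
    by (rule LIMSEQ_le_const[OF tendsto_inner[OF tendsto_const limv]]) (use iterate_props(2) in blast)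
  obtain c where c: "\<And>k s. norm (iterate k s) \<le> c"
    using iterate_bounded unfolding bounded_iff by auto
  have Pc: "norm (P s) \<le> c" for s
    by (rule LIMSEQ_le_const2[OF tendsto_norm[OF lim]]) (use c in blast)
  have bmP: "bounded_measurable P"
    unfolding bounded_measurable_def
  proof
    show "P \<in> borel_measurable lebesgue"
      by (rule borel_measurable_LIMSEQ_metric[OF _ lim]) (use iterate_props(3) in \<open>auto simp: bounded_measurable_def\<close>)
    show "bounded (range P)" using Pc unfolding bounded_iff by blast
  qed
  have inv: "invertible (ric_K (B1 s) (R s) (P s))" for s
    using coercive_invertible(1)[OF coercive[OF psd] d] .
  note tends = bounded_bilinear.tendsto[OF bounded_bilinear_matrix_mult]
  have limK: "(\<lambda>k. ric_K (B1 s) (R s) (iterate k s)) \<longlonglongrightarrow> ric_K (B1 s) (R s) (P s)" for s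
    unfolding ric_K_def by (intro tendsto_add tends tendsto_const lim)
  have limG: "(\<lambda>k. gain s (iterate k s)) \<longlonglongrightarrow> gain s (P s)" for s
    unfolding gain_def ric_L_def by (intro tendsto_add tends tendsto_const lim tendsto_matrix_inv[OF limK inv])
  define f where "f k s = - closed s (gain s (iterate k s)) (iterate (Suc k) s)" for k s
  define F where "F s = - closed s (gain s (P s)) (P s)" for s
  have limf: "(\<lambda>k. f k s) \<longlonglongrightarrow> F s" for s
    unfolding f_def F_def closed_def ric_closed_def run_cost_def lyap_def
    by (intro tendsto_add tendsto_diff tendsto_minus tends tendsto_const LIMSEQ_Suc[OF lim] limG
        bounded_linear.tendsto[OF bounded_linear_transpose])
  have bG: "bounded (range (\<lambda>z. gain (snd z) (iterate (fst z) (snd z))))"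
    by (rule gain_bounded_range) (use iterate_props(2) iterate_bounded in \<open>auto simp: case_prod_unfold\<close>)
  have bI: "bounded (range (\<lambda>z. iterate (Suc (fst z)) (snd z)))"
    using c unfolding bounded_iff by blast
  have bcoef: "bounded (range (\<lambda>z :: nat \<times> real. A (snd z)))" "bounded (range (\<lambda>z :: nat \<times> real. A1 (snd z)))"
    "bounded (range (\<lambda>z :: nat \<times> real. B (snd z)))" "bounded (range (\<lambda>z :: nat \<times> real. B1 (snd z)))"
    "bounded (range (\<lambda>z :: nat \<times> real. Q (snd z)))" "bounded (range (\<lambda>z :: nat \<times> real. R (snd z)))"
    "bounded (range (\<lambda>z :: nat \<times> real. S (snd z)))"
    using bm unfolding bounded_measurable_def by (auto intro: bounded_range_compose)
  have "bounded (range (\<lambda>z. f (fst z) (snd z)))"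
    unfolding f_def closed_def ric_closed_def run_cost_def lyap_def
    by (intro bounded_range_intros bG bI bcoef)
  then obtain b where b: "\<And>k s. norm (f k s) \<le> b" unfolding bounded_iff by auto
  have bmF: "bounded_measurable F"
    unfolding F_def closed_def ric_closed_def run_cost_def lyap_def
    by (intro bounded_measurable_intros bm bmP gain_bounded_measurable psd)
  have pr: "primitive_on 0 T (iterate (Suc k)) (f k)" for k
    using iterate_Suc[of k] unfolding policy_def f_def by blast
  have diff: "P t - P s = integral {s..t} F" if "0 \<le> s" "s \<le> t" "t \<le> T" for s t
  proof -
    have "(\<lambda>k. integral {s..t} (f k)) \<longlonglongrightarrow> integral {s..t} F"
      by (rule dominated_convergence(2)[where h="\<lambda>_. b"])
        (use primitive_on_integrable(2)[OF pr] that b limf in auto)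
    moreover have "integral {s..t} (f k) = iterate (Suc k) t - iterate (Suc k) s" for k
      using primitive_on_diff[OF pr that] by simp
    moreover have "(\<lambda>k. iterate (Suc k) t - iterate (Suc k) s) \<longlonglongrightarrow> P t - P s"
      by (intro tendsto_diff LIMSEQ_Suc lim)
    ultimately show ?thesis using LIMSEQ_unique by fastforce
  qed
  have "primitive_on 0 T P F"
  proof (rule primitive_onI)
    show "F absolutely_integrable_on {0..T}" using bmF by (rule bounded_measurable_absolutely_integrable)
    show "P t = P 0 + integral {0..t} F" if "0 \<le> t" "t \<le> T" for t
      using diff[of 0 t] that by (simp add: algebra_simps)
  qed
  moreover have "P T = G"
    using lim[of T] by (simp add: iterate_props(4) LIMSEQ_const_iff del: iterate.simps)
  ultimately show ?thesis using sym_P psd bmP unfolding F_def by blast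
qed

end

section \<open>The Riccati equations of the mean-field problem\<close>

lemma AE_lebesgue_onD:
  fixes a b :: real
  assumes "AE s in lebesgue_on {a..b}. P s"
  obtains N where "negligible N" "\<And>s. s \<in> {a..b} - N \<Longrightarrow> P s"
proof -
  have "AE s in lebesgue. s \<in> {a..b} \<longrightarrow> P s" using assms by (subst (asm) AE_restrict_space_iff) auto
  then obtain N where N: "N \<in> null_sets lebesgue" "{s \<in> space lebesgue. \<not> (s \<in> {a..b} \<longrightarrow> P s)} \<subseteq> N"
    unfolding eventually_ae_filter by blast
  show thesis by (rule that[of N]) (use N in \<open>auto simp: negligible_iff_null_sets\<close>)
qed

lemma AE_lebesgue_onI:
  fixes a b :: real
  assumes "negligible N" "\<And>s. s \<in> {a..b} - N \<Longrightarrow> P s"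
  shows "AE s in lebesgue_on {a..b}. P s"
  by (subst AE_restrict_space_iff)
     (use assms in \<open>auto simp: negligible_iff_null_sets intro!: AE_I'[of N]\<close>)

lemma abs_continuous_on_Icc_continuous:
  fixes f :: "real \<Rightarrow> 'b::real_normed_vector"
  assumes "abs_continuous_on_Icc a b f"
  shows "continuous_on {a..b} f"
  unfolding continuous_on_iff
proof (intro ballI allI impI)
  fix x e :: real assume x: "x \<in> {a..b}" and e: "0 < e"
  obtain d where d: "d > 0" and *: "\<And>(N::nat) u v. (\<forall>i<N. a \<le> u i \<and> u i \<le> v i \<and> v i \<le> b) \<Longrightarrow>
        disjoint_family_on (\<lambda>i. {u i<..<v i}) {..<N} \<Longrightarrow> (\<Sum>i<N. v i - u i) < d \<Longrightarrow>
        (\<Sum>i<N. norm (f (v i) - f (u i))) < e"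
    using assms e unfolding abs_continuous_on_Icc_def by meson
  show "\<exists>d>0. \<forall>x'\<in>{a..b}. dist x' x < d \<longrightarrow> dist (f x') (f x) < e"
  proof (intro exI[of _ d] conjI ballI impI d)
    fix y assume y: "y \<in> {a..b}" "dist y x < d"
    have "norm (f (max x y) - f (min x y)) < e"
      using *[of 1 "\<lambda>_. min x y" "\<lambda>_. max x y"] x y
      by (auto simp: disjoint_family_on_def dist_real_def)
    then show "dist (f y) (f x) < e"
      by (cases "x \<le> y") (auto simp: dist_norm norm_minus_commute max_def min_def split: if_splits)
  qed
qed

lemma bounded_measurable_truncate:
  fixes f :: "real \<Rightarrow> 'a::euclidean_space"
  assumes "continuous_on {a..b} f"
  shows "bounded_measurable (\<lambda>s. if s \<in> {a..b} then f s else 0)"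
  by (rule bounded_measurable_continuous_on[OF continuous_on_eq[OF assms]]) (simp_all del: atLeastAtMost_iff)

lemma bounded_measurable_restrict:
  fixes f :: "real \<Rightarrow> 'a::euclidean_space"
  assumes f: "f \<in> borel_measurable (lebesgue_on {0..T})" and N: "negligible N"
    and C: "\<And>s. s \<in> {0..T} - N \<Longrightarrow> norm (f s) \<le> C"
  shows "bounded_measurable (\<lambda>s. if s \<in> {0..T} - N then f s else c)"
  unfolding bounded_measurable_def
proof
  have U: "{0..T} - N \<in> sets lebesgue" using negligible_imp_sets[OF N] by (intro sets.Diff) auto
  have "f \<in> borel_measurable (lebesgue_on ({0..T} - N))"
    using f by (rule measurable_restrict_mono) auto
  then have "(\<lambda>s. f s - c) \<in> borel_measurable (lebesgue_on ({0..T} - N))" by measurable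
  then have "(\<lambda>s. if s \<in> {0..T} - N then f s - c else 0) \<in> borel_measurable lebesgue"
    by (simp only: borel_measurable_if[OF U])
  then have "(\<lambda>s. (if s \<in> {0..T} - N then f s - c else 0) + c) \<in> borel_measurable lebesgue" by measurable
  moreover have "(\<lambda>s. (if s \<in> {0..T} - N then f s - c else 0) + c) = (\<lambda>s. if s \<in> {0..T} - N then f s else c)"
    by (intro ext) simp
  ultimately show "(\<lambda>s. if s \<in> {0..T} - N then f s else c) \<in> borel_measurable lebesgue" by simp
  have "norm (if s \<in> {0..T} - N then f s else c) \<le> max C (norm c)" for s
    using C[of s] by (simp del: Diff_iff add: le_max_iff_disj)
  then show "bounded (range (\<lambda>s. if s \<in> {0..T} - N then f s else c))" unfolding bounded_iff by blast
qed

locale mf_problem =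
  fixes T \<delta> :: real and c :: "('n::finite, 'm::finite) mf_coeffs"
  assumes T: "0 < T" and \<delta>: "0 < \<delta>"
    and Linf: "Linfty T (cA c)" "Linfty T (cAh c)" "Linfty T (cA1 c)" "Linfty T (cA1h c)"
      "Linfty T (cB c)" "Linfty T (cBh c)" "Linfty T (cB1 c)" "Linfty T (cB1h c)"
      "Linfty_sym T (cQ c)" "Linfty_sym T (cQh c)" "Linfty_sym T (cR c)" "Linfty_sym T (cRh c)"
    and Gsym: "transpose (cG c) = cG c" "transpose (cGh c) = cGh c"
    and Q: "AE s in lebesgue_on {0..T}. loewner_le 0 (cQ c s)"
      "AE s in lebesgue_on {0..T}. loewner_le 0 (cQ c s + cQh c s)"
    and R: "AE s in lebesgue_on {0..T}. loewner_le (\<delta> *\<^sub>R mat 1) (cR c s)"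
      "AE s in lebesgue_on {0..T}. loewner_le (\<delta> *\<^sub>R mat 1) (cR c s + cRh c s)"
    and G: "loewner_le 0 (cG c)" "loewner_le 0 (cG c + cGh c)"
begin

definition regular_at :: "real \<Rightarrow> real \<Rightarrow> bool" where
  "regular_at C s \<longleftrightarrow> norm (cA c s) \<le> C \<and> norm (cAh c s) \<le> C \<and> norm (cA1 c s) \<le> C \<and> norm (cA1h c s) \<le> C
    \<and> norm (cB c s) \<le> C \<and> norm (cBh c s) \<le> C \<and> norm (cB1 c s) \<le> C \<and> norm (cB1h c s) \<le> C
    \<and> norm (cQ c s) \<le> C \<and> norm (cQh c s) \<le> C \<and> norm (cR c s) \<le> C \<and> norm (cRh c s) \<le> C
    \<and> loewner_le 0 (cQ c s) \<and> loewner_le 0 (cQ c s + cQh c s)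
    \<and> loewner_le (\<delta> *\<^sub>R mat 1) (cR c s) \<and> loewner_le (\<delta> *\<^sub>R mat 1) (cR c s + cRh c s)"

lemma regular_exists: "\<exists>N C. negligible N \<and> (\<forall>s\<in>{0..T} - N. regular_at C s)"
proof -
  have bd: "\<exists>C. AE s in lebesgue_on {0..T}. norm (f s) \<le> C" if "Linfty T f" for f :: "real \<Rightarrow> 'x::euclidean_space"
    using that by (auto simp: Linfty_def)
  have L: "Linfty T (cQ c)" "Linfty T (cQh c)" "Linfty T (cR c)" "Linfty T (cRh c)"
    using Linf by (auto simp: Linfty_sym_def)
  obtain C1 C2 C3 C4 C5 C6 C7 C8 where C: "AE s in lebesgue_on {0..T}. norm (cA c s) \<le> C1"
    "AE s in lebesgue_on {0..T}. norm (cAh c s) \<le> C2" "AE s in lebesgue_on {0..T}. norm (cA1 c s) \<le> C3"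
    "AE s in lebesgue_on {0..T}. norm (cA1h c s) \<le> C4" "AE s in lebesgue_on {0..T}. norm (cB c s) \<le> C5"
    "AE s in lebesgue_on {0..T}. norm (cBh c s) \<le> C6" "AE s in lebesgue_on {0..T}. norm (cB1 c s) \<le> C7"
    "AE s in lebesgue_on {0..T}. norm (cB1h c s) \<le> C8"
    using Linf(1-8)[THEN bd] by metis
  obtain D1 D2 D3 D4 where D: "AE s in lebesgue_on {0..T}. norm (cQ c s) \<le> D1"
    "AE s in lebesgue_on {0..T}. norm (cQh c s) \<le> D2" "AE s in lebesgue_on {0..T}. norm (cR c s) \<le> D3"
    "AE s in lebesgue_on {0..T}. norm (cRh c s) \<le> D4"
    using L[THEN bd] by metis
  define C where "C = Max {C1, C2, C3, C4, C5, C6, C7, C8, D1, D2, D3, D4}"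
  have le: "x \<le> C" if "x \<in> {C1, C2, C3, C4, C5, C6, C7, C8, D1, D2, D3, D4}" for x
    unfolding C_def using that by (intro Max_ge) auto
  have "AE s in lebesgue_on {0..T}. regular_at C s"
    unfolding regular_at_def
    using C D Q R by eventually_elim (auto intro: order_trans[OF _ le])
  then show ?thesis using AE_lebesgue_onD by metis
qed

text \<open>All exceptional null sets are collected in one.  Modified there, the coefficients are bounded
  everywhere and keep their symmetry and positivity, while the equations are unaffected.\<close>

definition bad :: "real set" where
  "bad = (SOME N. negligible N \<and> (\<exists>C. \<forall>s\<in>{0..T} - N. regular_at C s))"

lemma negligible_bad: "negligible bad" and bad_regular: "\<exists>C. \<forall>s\<in>{0..T} - bad. regular_at C s"
  using someI_ex[of "\<lambda>N. negligible N \<and> (\<exists>C. \<forall>s\<in>{0..T} - N. regular_at C s)"] regular_exists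
  unfolding bad_def by blast+

definition good :: "real set" where "good = {0..T} - bad"

definition "kA s = (if s \<in> good then cA c s else 0)"
definition "kA1 s = (if s \<in> good then cA1 c s else 0)"
definition "kB s = (if s \<in> good then cB c s else 0)"
definition "kB1 s = (if s \<in> good then cB1 c s else 0)"
definition "kQ s = (if s \<in> good then cQ c s else 0)"
definition "kR s = (if s \<in> good then cR c s else \<delta> *\<^sub>R mat 1)"
definition "bA s = (if s \<in> good then cA c s + cAh c s else 0)"
definition "bA1 s = (if s \<in> good then cA1 c s + cA1h c s else 0)"
definition "bB s = (if s \<in> good then cB c s + cBh c s else 0)"
definition "bB1 s = (if s \<in> good then cB1 c s + cB1h c s else 0)"
definition "bQ s = (if s \<in> good then cQ c s + cQh c s else 0)"
definition "bR s = (if s \<in> good then cR c s + cRh c s else \<delta> *\<^sub>R mat 1)"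

lemmas k_defs = kA_def kA1_def kB_def kB1_def kQ_def kR_def bA_def bA1_def bB_def bB1_def bQ_def bR_def

lemma AE_good: "AE s in lebesgue_on {0..T}. s \<in> good"
  by (rule AE_lebesgue_onI[OF negligible_bad]) (simp add: good_def)

lemma bounded_measurable_coefficients:
  "bounded_measurable kA" "bounded_measurable kA1" "bounded_measurable kB" "bounded_measurable kB1"
  "bounded_measurable kQ" "bounded_measurable kR" "bounded_measurable bA" "bounded_measurable bA1"
  "bounded_measurable bB" "bounded_measurable bB1" "bounded_measurable bQ" "bounded_measurable bR"
proof -
  obtain C where C: "\<And>s. s \<in> {0..T} - bad \<Longrightarrow> regular_at C s" using bad_regular by blast
  have m: "f \<in> borel_measurable (lebesgue_on {0..T})" if "Linfty T f" for f :: "real \<Rightarrow> 'x::euclidean_space"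
    using that by (simp add: Linfty_def)
  note m1 = Linf(1-8)[THEN m]
  have m2: "cQ c \<in> borel_measurable (lebesgue_on {0..T})" "cQh c \<in> borel_measurable (lebesgue_on {0..T})"
    "cR c \<in> borel_measurable (lebesgue_on {0..T})" "cRh c \<in> borel_measurable (lebesgue_on {0..T})"
    using Linf(9-12) by (auto simp: Linfty_sym_def Linfty_def)
  note bm = bounded_measurable_restrict[where T=T and C="2 * C", OF _ negligible_bad, folded good_def]
  have n: "norm (x + y) \<le> 2 * C" if "norm x \<le> C" "norm y \<le> C" for x y :: "'x::euclidean_space"
    using norm_triangle_mono[OF that] by simp
  have n': "norm x \<le> 2 * C" if "norm x \<le> C" for x :: "'x::euclidean_space"
    using that norm_ge_zero[of x] by linarith
  have reg: "regular_at C s" if "s \<in> good" for s using C that by (simp add: good_def)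
  note * = bm borel_measurable_add m1 m2
  show "bounded_measurable kA" unfolding k_defs[abs_def] by (intro *; simp add: n n' reg[unfolded regular_at_def])
  show "bounded_measurable kA1" unfolding k_defs[abs_def] by (intro *; simp add: n n' reg[unfolded regular_at_def])
  show "bounded_measurable kB" unfolding k_defs[abs_def] by (intro *; simp add: n n' reg[unfolded regular_at_def])
  show "bounded_measurable kB1" unfolding k_defs[abs_def] by (intro *; simp add: n n' reg[unfolded regular_at_def])
  show "bounded_measurable kQ" unfolding k_defs[abs_def] by (intro *; simp add: n n' reg[unfolded regular_at_def])
  show "bounded_measurable kR" unfolding k_defs[abs_def] by (intro *; simp add: n n' reg[unfolded regular_at_def])
  show "bounded_measurable bA" unfolding k_defs[abs_def] by (intro *; simp add: n n' reg[unfolded regular_at_def])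
  show "bounded_measurable bA1" unfolding k_defs[abs_def] by (intro *; simp add: n n' reg[unfolded regular_at_def])
  show "bounded_measurable bB" unfolding k_defs[abs_def] by (intro *; simp add: n n' reg[unfolded regular_at_def])
  show "bounded_measurable bB1" unfolding k_defs[abs_def] by (intro *; simp add: n n' reg[unfolded regular_at_def])
  show "bounded_measurable bQ" unfolding k_defs[abs_def] by (intro *; simp add: n n' reg[unfolded regular_at_def])
  show "bounded_measurable bR" unfolding k_defs[abs_def] by (intro *; simp add: n n' reg[unfolded regular_at_def])
qed

lemma coefficients_symmetric:
  "transpose (kQ s) = kQ s" "transpose (kR s) = kR s" "transpose (bQ s) = bQ s" "transpose (bR s) = bR s"
  using bad_regular
  by (auto simp: k_defs good_def regular_at_def loewner_le_def transpose_scaleR transpose_mat transpose_zero)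

lemma coefficients_psd:
  "0 \<le> v \<bullet> (kQ s *v v)" "0 \<le> v \<bullet> (bQ s *v v)"
  "\<delta> * (w \<bullet> w) \<le> w \<bullet> (kR s *v w)" "\<delta> * (w \<bullet> w) \<le> w \<bullet> (bR s *v w)"
  using bad_regular
  by (auto simp: k_defs good_def regular_at_def loewner_le_def scaleR_matrix_vector_assoc[symmetric])

lemma terminal_psd: "0 \<le> v \<bullet> (cG c *v v)" "0 \<le> v \<bullet> ((cG c + cGh c) *v v)"
  using G by (auto simp: loewner_le_def)

lemma K0_eq: "s \<in> good \<Longrightarrow> K0 c P s = ric_K (kB1 s) (kR s) (P s)"
  by (simp add: K0_def ric_K_def k_defs)

lemma K1_eq: "s \<in> good \<Longrightarrow> K1 c P s = ric_K (bB1 s) (bR s) (P s)"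
  by (simp add: K1_def ric_K_def k_defs)

lemma gain0_eq: "s \<in> good \<Longrightarrow> gain0 c P s = matrix_inv (ric_K (kB1 s) (kR s) (P s)) ** ric_L (kA1 s) (kB s) (kB1 s) 0 (P s)"
  by (simp add: gain0_def K0_eq ric_L_def) (simp add: k_defs)

sublocale P: riccati_coefficients T \<delta> kA kA1 kQ kB kB1 kR "\<lambda>_. 0" "cG c"
proof
  show "0 \<le> v \<bullet> (kQ s *v v) + 2 * (w \<bullet> (0 *v v)) + w \<bullet> (kR s *v w)" for s v w
  proof -
    have "0 \<le> \<delta> * (w \<bullet> w)" using \<delta> by simp
    then show ?thesis using coefficients_psd(1)[of v s] coefficients_psd(3)[of w s] by simp
  qed
qed (use T \<delta> Gsym in \<open>auto intro: bounded_measurable_coefficients bounded_measurable_const coefficients_symmetric coefficients_psd terminal_psd\<close>)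

lemma P_closed_eq:
  assumes g: "s \<in> good" and symP: "transpose (P s) = P s" and inv: "invertible (ric_K (kB1 s) (kR s) (P s))"
  shows "P.closed s (P.gain s (P s)) (P s) = P s ** cA c s + transpose (cA c s) ** P s
     + transpose (cA1 c s) ** P s ** cA1 c s + cQ c s
     - (P s ** cB c s + transpose (cA1 c s) ** P s ** cB1 c s) ** matrix_inv (K0 c P s)
         ** (transpose (cB c s) ** P s + transpose (cB1 c s) ** P s ** cA1 c s)"
proof -
  have "P.closed s (P.gain s (P s)) (P s) = P s ** kA s + transpose (kA s) ** P s + transpose (kA1 s) ** P s ** kA1 s + kQ s
    - transpose (ric_L (kA1 s) (kB s) (kB1 s) 0 (P s)) ** matrix_inv (K0 c P s) ** ric_L (kA1 s) (kB s) (kB1 s) 0 (P s)"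
    unfolding P.closed_def P.gain_def K0_eq[OF g]
    by (rule ric_closed_gain[OF symP coefficients_symmetric(2,1) inv])
  moreover have "transpose (ric_L (kA1 s) (kB s) (kB1 s) 0 (P s)) = P s ** kB s + transpose (kA1 s) ** P s ** kB1 s"
    by (simp add: ric_L_def transpose_add matrix_transpose_mul matrix_mul_assoc symP)
  ultimately show ?thesis using g by (simp add: ric_L_def) (simp add: k_defs)
qed

lemma riccati_P_exists:
  "\<exists>P. riccati_P_solution T c P \<and> (\<forall>s v. 0 \<le> v \<bullet> (P s *v v)) \<and> (\<forall>s. transpose (P s) = P s) \<and> bounded_measurable P"
proof -
  obtain P where P: "\<And>s. transpose (P s) = P s" "\<And>s v. 0 \<le> v \<bullet> (P s *v v)" "bounded_measurable P" "P T = cG c"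
    "primitive_on 0 T P (\<lambda>s. - P.closed s (P.gain s (P s)) (P s))"
    using P.riccati_exists by blast
  obtain N where N: "negligible N" "\<And>s. s \<in> {0..T} - N \<Longrightarrow>
      (P has_vector_derivative - P.closed s (P.gain s (P s)) (P s)) (at s within {0..T})"
    using primitive_on_has_vector_derivative[OF P(5)] by blast
  have "AE s in lebesgue_on {0..T}. invertible (K0 c P s) \<and>
       (\<exists>P'. (P has_vector_derivative P') (at s within {0..T}) \<and>
         P' + P s ** cA c s + transpose (cA c s) ** P s + transpose (cA1 c s) ** P s ** cA1 c s + cQ c s
         - (P s ** cB c s + transpose (cA1 c s) ** P s ** cB1 c s) ** matrix_inv (K0 c P s)
           ** (transpose (cB c s) ** P s + transpose (cB1 c s) ** P s ** cA1 c s) = 0)" (is "AE s in _. ?R s")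
  proof (rule AE_lebesgue_onI)
    show "negligible (N \<union> bad)" using N(1) negligible_bad by simp
    fix s assume s: "s \<in> {0..T} - (N \<union> bad)"
    then have g: "s \<in> good" by (simp add: good_def)
    have inv: "invertible (ric_K (kB1 s) (kR s) (P s))"
      using coercive_invertible(1)[OF P.coercive[OF P(2)] \<delta>] .
    show "?R s"
    proof (intro conjI exI[of _ "- P.closed s (P.gain s (P s)) (P s)"])
      show "invertible (K0 c P s)" using inv by (simp add: K0_eq[OF g])
      show "(P has_vector_derivative - P.closed s (P.gain s (P s)) (P s)) (at s within {0..T})"
        using N(2) s by blast
      show "- P.closed s (P.gain s (P s)) (P s) + P s ** cA c s + transpose (cA c s) ** P s + transpose (cA1 c s) ** P s ** cA1 c s + cQ c s
         - (P s ** cB c s + transpose (cA1 c s) ** P s ** cB1 c s) ** matrix_inv (K0 c P s)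
           ** (transpose (cB c s) ** P s + transpose (cB1 c s) ** P s ** cA1 c s) = 0"
        unfolding P_closed_eq[of s P, OF g P(1) inv] by simp
    qed
  qed
  then have "riccati_P_solution T c P"
    unfolding riccati_P_solution_def using P primitive_on_abs_continuous[OF P(5)] by blast
  with P show ?thesis by blast
qed

text \<open>The cost is nonnegative: its terms with \<open>P\<close> add up to the quadratic form of \<open>P\<close> at \<open>A1 v + B1 w\<close>.\<close>

lemma riccati_Pi_coefficients:
  assumes P: "\<And>s v. 0 \<le> v \<bullet> (P s *v v)" "\<And>s. transpose (P s) = P s" "bounded_measurable P"
  shows "riccati_coefficients T \<delta> bA (\<lambda>_. 0) (\<lambda>s. transpose (bA1 s) ** P s ** bA1 s + bQ s) bB (\<lambda>_. 0)
     (\<lambda>s. ric_K (bB1 s) (bR s) (P s)) (\<lambda>s. transpose (bB1 s) ** P s ** bA1 s) (cG c + cGh c)"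
proof
  fix s and v :: "real^'n" and w :: "real^'m"
  define x where "x = bA1 s *v v"
  define y where "y = bB1 s *v w"
  have sym: "x \<bullet> (P s *v y) = y \<bullet> (P s *v x)"
    by (subst inner_symmetric_mult[OF P(2)]) (rule inner_commute)
  have "v \<bullet> ((transpose (bA1 s) ** P s ** bA1 s + bQ s) *v v) + 2 * (w \<bullet> ((transpose (bB1 s) ** P s ** bA1 s) *v v))
      + w \<bullet> (ric_K (bB1 s) (bR s) (P s) *v w) = (x + y) \<bullet> (P s *v (x + y)) + v \<bullet> (bQ s *v v) + w \<bullet> (bR s *v w)"
    unfolding ric_K_def
    by (simp add: matrix_vector_mult_add_rdistrib matrix_vector_mul_assoc[symmetric] inner_add_right inner_add_left
       inner_transpose_mult matrix_vector_right_distrib x_def[symmetric] y_def[symmetric] sym)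
  moreover have "0 \<le> \<delta> * (w \<bullet> w)" using \<delta> by simp
  ultimately show "0 \<le> v \<bullet> ((transpose (bA1 s) ** P s ** bA1 s + bQ s) *v v) + 2 * (w \<bullet> ((transpose (bB1 s) ** P s ** bA1 s) *v v))
      + w \<bullet> (ric_K (bB1 s) (bR s) (P s) *v w)"
    using P(1)[of "x + y" s] coefficients_psd(2)[of v s] coefficients_psd(4)[of w s] by simp
next
  show "transpose (transpose (bA1 s) ** P s ** bA1 s + bQ s) = transpose (bA1 s) ** P s ** bA1 s + bQ s" for s
    by (simp add: transpose_add matrix_transpose_mul matrix_mul_assoc P(2) coefficients_symmetric)
  show "transpose (ric_K (bB1 s) (bR s) (P s)) = ric_K (bB1 s) (bR s) (P s)" for s
    by (rule transpose_ric_K[OF coefficients_symmetric(4) P(2)])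
  show "\<delta> * (v \<bullet> v) \<le> v \<bullet> (ric_K (bB1 s) (bR s) (P s) *v v)" for s v
    by (rule ric_K_coercive[OF coefficients_psd(4) P(1)])
  show "transpose (cG c + cGh c) = cG c + cGh c" by (simp add: transpose_add Gsym)
qed (use T \<delta> in \<open>auto simp: ric_K_def intro!: bounded_measurable_intros bounded_measurable_coefficients P terminal_psd\<close>)

text \<open>Multiplied out, the second Riccati equation is the one with cross term \<open>transpose B1 ** P ** A1\<close>, state
  weight \<open>transpose A1 ** P ** A1 + Q\<close> and control weight \<open>K1\<close>, in which \<open>A1\<close> and \<open>B1\<close> no longer act.\<close>

lemma riccati_Pi_form:
  assumes "transpose X = X" "transpose p = p" "transpose K = K"
  shows "X ** A + transpose A ** X + (transpose A1 ** p ** A1 + Q)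
     - transpose (ric_L 0 B 0 (transpose B1 ** p ** A1) X) ** K ** ric_L 0 B 0 (transpose B1 ** p ** A1) X
   = X ** (A - B ** K ** transpose B1 ** p ** A1) + (transpose A - transpose A1 ** p ** B1 ** K ** transpose B) ** X
     - X ** B ** K ** transpose B ** X + transpose A1 ** (p - p ** B1 ** K ** transpose B1 ** p) ** A1 + Q"
  using assms
  by (simp add: ric_L_def transpose_zero matrix_mult_zero_left transpose_add matrix_transpose_mul matrix_mul_assoc
      matrix_add_ldistrib bounded_bilinear.add_left[OF bounded_bilinear_matrix_mult] matrix_mult_diff_left matrix_mult_diff_right algebra_simps)

lemma riccati_Pi_exists:
  assumes P: "\<And>s v. 0 \<le> v \<bullet> (P s *v v)" "\<And>s. transpose (P s) = P s" "bounded_measurable P"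
  shows "\<exists>PI. riccati_Pi_solution T c P PI"
proof -
  interpret PI: riccati_coefficients T \<delta> bA "\<lambda>_. 0" "\<lambda>s. transpose (bA1 s) ** P s ** bA1 s + bQ s" bB "\<lambda>_. 0"
     "\<lambda>s. ric_K (bB1 s) (bR s) (P s)" "\<lambda>s. transpose (bB1 s) ** P s ** bA1 s" "cG c + cGh c"
    by (rule riccati_Pi_coefficients[OF P])
  obtain X where X: "\<And>s. transpose (X s) = X s" "X T = cG c + cGh c"
    "primitive_on 0 T X (\<lambda>s. - PI.closed s (PI.gain s (X s)) (X s))"
    using PI.riccati_exists by blast
  obtain N where N: "negligible N" "\<And>s. s \<in> {0..T} - N \<Longrightarrow>
      (X has_vector_derivative - PI.closed s (PI.gain s (X s)) (X s)) (at s within {0..T})"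
    using primitive_on_has_vector_derivative[OF X(3)] by blast
  have K0: "ric_K 0 K Y = K" for K :: "real^'m^'m" and Y :: "real^'n^'n"
    by (simp add: ric_K_def transpose_zero matrix_mult_zero_left)
  have "AE s in lebesgue_on {0..T}. invertible (K1 c P s) \<and>
       (\<exists>PI'. (X has_vector_derivative PI') (at s within {0..T}) \<and>
         (let A = cA c s + cAh c s; B = cB c s + cBh c s;
              A1 = cA1 c s + cA1h c s; B1 = cB1 c s + cB1h c s;
              K = matrix_inv (K1 c P s)
          in PI' + X s ** (A - B ** K ** transpose B1 ** P s ** A1)
             + (transpose A - transpose A1 ** P s ** B1 ** K ** transpose B) ** X s
             - X s ** B ** K ** transpose B ** X s
             + transpose A1 ** (P s - P s ** B1 ** K ** transpose B1 ** P s) ** A1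
             + cQ c s + cQh c s = 0))" (is "AE s in _. ?R s")
  proof (rule AE_lebesgue_onI)
    show "negligible (N \<union> bad)" using N(1) negligible_bad by simp
    fix s assume s: "s \<in> {0..T} - (N \<union> bad)"
    then have g: "s \<in> good" by (simp add: good_def)
    define K where "K = ric_K (bB1 s) (bR s) (P s)"
    have inv: "invertible K"
      unfolding K_def using coercive_invertible(1)[OF PI.R \<delta>] .
    have symK: "transpose K = K" unfolding K_def by (rule PI.sym)
    have "PI.closed s (PI.gain s (X s)) (X s) = X s ** bA s + transpose (bA s) ** X s + (transpose (bA1 s) ** P s ** bA1 s + bQ s)
      - transpose (ric_L 0 (bB s) 0 (transpose (bB1 s) ** P s ** bA1 s) (X s)) ** matrix_inv K ** ric_L 0 (bB s) 0 (transpose (bB1 s) ** P s ** bA1 s) (X s)"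
      using ric_closed_gain[OF X(1)[of s] symK PI.sym(1)[of s], of 0 "bA s" 0 "bB s" "transpose (bB1 s) ** P s ** bA1 s"] inv
      unfolding PI.closed_def PI.gain_def K0 K_def[symmetric] by (simp add: transpose_zero matrix_mult_zero_left)
    then have eq: "PI.closed s (PI.gain s (X s)) (X s) =
       X s ** (bA s - bB s ** matrix_inv K ** transpose (bB1 s) ** P s ** bA1 s)
       + (transpose (bA s) - transpose (bA1 s) ** P s ** bB1 s ** matrix_inv K ** transpose (bB s)) ** X s
       - X s ** bB s ** matrix_inv K ** transpose (bB s) ** X s
       + transpose (bA1 s) ** (P s - P s ** bB1 s ** matrix_inv K ** transpose (bB1 s) ** P s) ** bA1 s + bQ s"
      unfolding riccati_Pi_form[OF X(1) P(2) transpose_matrix_inv[OF inv symK]] .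
    have b: "cA c s + cAh c s = bA s" "cB c s + cBh c s = bB s" "cA1 c s + cA1h c s = bA1 s"
      "cB1 c s + cB1h c s = bB1 s" "cQ c s + cQh c s = bQ s" using g by (simp_all add: k_defs)
    show "?R s"
    proof (intro conjI exI[of _ "- PI.closed s (PI.gain s (X s)) (X s)"])
      show "invertible (K1 c P s)" using inv by (simp add: K1_eq[OF g] K_def)
      show "(X has_vector_derivative - PI.closed s (PI.gain s (X s)) (X s)) (at s within {0..T})"
        using N(2) s by blast
    qed (simp only: Let_def b K1_eq[OF g] K_def[symmetric] eq, simp add: b(5)[symmetric])
  qed
  then have "riccati_Pi_solution T c P X"
    unfolding riccati_Pi_solution_def using X primitive_on_abs_continuous[OF X(3)] by blast
  then show ?thesis by blast
qed

text \<open>A lower bound \<open>- \<kappa>\<close> for \<open>P\<close> with small \<open>\<kappa>\<close> keeps \<open>K0\<close> coercive.  This bounds the gain, so the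
  derivative of \<open>P\<close> is integrable and the Riccati equation may be integrated.\<close>

lemma riccati_P_primitive:
  assumes sol: "riccati_P_solution T c P" and r: "0 \<le> r" "r \<le> T" and \<kappa>0: "0 \<le> \<kappa>"
    and low: "\<And>s v. s \<in> {r..T} \<Longrightarrow> - \<kappa> * (v \<bullet> v) \<le> v \<bullet> (P s *v v)"
    and \<kappa>: "\<And>s. \<kappa> * (norm (kB1 s))\<^sup>2 \<le> \<delta> / 2"
  obtains \<Theta> where "bounded_measurable \<Theta>" "\<And>s. s \<in> {r..T} \<Longrightarrow> \<Theta> s = P.gain s (P s)"
    "\<And>s. s \<in> {r..T} \<Longrightarrow> invertible (ric_K (kB1 s) (kR s) (P s))"
    "primitive_on r T P (\<lambda>s. - P.closed s (\<Theta> s) (P s))"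
proof -
  have ac: "abs_continuous_on_Icc 0 T P" and symP: "\<And>s. s \<in> {0..T} \<Longrightarrow> transpose (P s) = P s"
    using sol by (auto simp: riccati_P_solution_def)
  have acr: "abs_continuous_on_Icc r T P" by (rule abs_continuous_on_Icc_subset[OF ac r(1) order_refl])
  define Pt where "Pt s = (if s \<in> {r..T} then P s else 0)" for s
  have bPt: "bounded_measurable Pt"
    unfolding Pt_def[abs_def] by (rule bounded_measurable_truncate[OF abs_continuous_on_Icc_continuous[OF acr]])
  have lowt: "- \<kappa> * (v \<bullet> v) \<le> v \<bullet> (Pt s *v v)" for s v
    using low[of s v] \<kappa>0 by (simp add: Pt_def)
  have co: "\<delta> / 2 * (w \<bullet> w) \<le> w \<bullet> (ric_K (kB1 s) (kR s) (Pt s) *v w)" for s w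
  proof -
    have "(norm (kB1 s *v w))\<^sup>2 \<le> (norm (kB1 s))\<^sup>2 * (w \<bullet> w)"
      using power_mono[OF norm_matrix_vector_mult_le[of "kB1 s" w] norm_ge_zero, of 2]
      by (simp add: power_mult_distrib dot_square_norm)
    then have "\<kappa> * (norm (kB1 s *v w))\<^sup>2 \<le> \<kappa> * ((norm (kB1 s))\<^sup>2 * (w \<bullet> w))"
      using \<kappa>0 by (rule mult_left_mono)
    also have "\<dots> \<le> \<delta> / 2 * (w \<bullet> w)"
      using mult_right_mono[OF \<kappa>, of "w \<bullet> w" s] by (simp add: mult_ac)
    finally have "- (\<delta> / 2 * (w \<bullet> w)) \<le> (kB1 s *v w) \<bullet> (Pt s *v (kB1 s *v w))"
      using lowt[of "kB1 s *v w" s] by (simp add: dot_square_norm)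
    moreover have "w \<bullet> (ric_K (kB1 s) (kR s) (Pt s) *v w) = w \<bullet> (kR s *v w) + (kB1 s *v w) \<bullet> (Pt s *v (kB1 s *v w))"
      by (simp add: ric_K_def matrix_vector_mult_add_rdistrib matrix_vector_mul_assoc[symmetric] inner_add_right inner_transpose_mult)
    ultimately show ?thesis using coefficients_psd(3)[of w s] by simp
  qed
  have d2: "\<delta> / 2 > 0" using \<delta> by simp
  define \<Theta> where "\<Theta> s = P.gain s (Pt s)" for s
  have b\<Theta>: "bounded_measurable \<Theta>"
    unfolding bounded_measurable_def
  proof
    have b: "bounded (range kA1)" "bounded (range kB)" "bounded (range kB1)" "bounded (range Pt)"
      using bounded_measurable_coefficients bPt unfolding bounded_measurable_def by auto
    show "bounded (range \<Theta>)"
      unfolding \<Theta>_def P.gain_def ric_L_def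
      by (intro bounded_range_intros bounded_range_matrix_inv[OF co d2] b)
    show "\<Theta> \<in> borel_measurable lebesgue"
      using bounded_measurable_coefficients bPt unfolding \<Theta>_def P.gain_def ric_K_def ric_L_def bounded_measurable_def
      by (intro measurable_matrix_mult measurable_matrix_inv borel_measurable_add measurable_transpose) auto
  qed
  define f where "f s = - P.closed s (\<Theta> s) (Pt s)" for s
  have bf: "bounded_measurable f"
    unfolding f_def P.closed_def ric_closed_def run_cost_def lyap_def
    by (intro bounded_measurable_intros bounded_measurable_coefficients bPt b\<Theta>)
  have inv: "invertible (ric_K (kB1 s) (kR s) (P s))" if "s \<in> {r..T}" for s
    using coercive_invertible(1)[OF co d2, of s] that by (simp add: Pt_def)
  have "AE s in lebesgue_on {0..T}.
       (\<exists>P'. (P has_vector_derivative P') (at s within {0..T}) \<and>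
         P' + P s ** cA c s + transpose (cA c s) ** P s + transpose (cA1 c s) ** P s ** cA1 c s + cQ c s
         - (P s ** cB c s + transpose (cA1 c s) ** P s ** cB1 c s) ** matrix_inv (K0 c P s)
           ** (transpose (cB c s) ** P s + transpose (cB1 c s) ** P s ** cA1 c s) = 0)"
    using sol unfolding riccati_P_solution_def by (auto elim: eventually_mono)
  then obtain N where N: "negligible N" "\<And>s. s \<in> {0..T} - N \<Longrightarrow> (\<exists>P'. (P has_vector_derivative P') (at s within {0..T}) \<and>
         P' + P s ** cA c s + transpose (cA c s) ** P s + transpose (cA1 c s) ** P s ** cA1 c s + cQ c s
         - (P s ** cB c s + transpose (cA1 c s) ** P s ** cB1 c s) ** matrix_inv (K0 c P s)
           ** (transpose (cB c s) ** P s + transpose (cB1 c s) ** P s ** cA1 c s) = 0)"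
    by (rule AE_lebesgue_onD) blast
  have "primitive_on r T P f"
  proof (rule primitive_on_abs_continuousI[OF acr])
    show "negligible (N \<union> bad)" using N(1) negligible_bad by simp
    show "f absolutely_integrable_on {r..T}" using bf by (rule bounded_measurable_absolutely_integrable)
    fix s assume s: "s \<in> {r..T} - (N \<union> bad)"
    then have s0: "s \<in> {0..T} - N" and g: "s \<in> good" and sr: "s \<in> {r..T}" and s1: "s \<in> {0..T}"
      using r by (auto simp: good_def)
    obtain P' where P': "(P has_vector_derivative P') (at s within {0..T})"
       "P' + P s ** cA c s + transpose (cA c s) ** P s + transpose (cA1 c s) ** P s ** cA1 c s + cQ c s
         - (P s ** cB c s + transpose (cA1 c s) ** P s ** cB1 c s) ** matrix_inv (K0 c P s)
           ** (transpose (cB c s) ** P s + transpose (cB1 c s) ** P s ** cA1 c s) = 0"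
      using N(2)[OF s0] by blast
    have z: "p = - (a + b + d + e - g)" if "p + a + b + d + e - g = 0" for p a b d e g :: "real^'n^'n"
      using that by (simp add: algebra_simps add_eq_0_iff)
    have "P' = - P.closed s (P.gain s (P s)) (P s)"
      unfolding P_closed_eq[of s P, OF g symP[OF s1] inv[OF sr]] using z[OF P'(2)] by simp
    then have "P' = f s" using sr by (simp add: f_def \<Theta>_def Pt_def)
    with P'(1) show "(P has_vector_derivative f s) (at s within {r..T})"
      using r by (auto intro: has_vector_derivative_within_subset)
  qed
  then have "primitive_on r T P (\<lambda>s. - P.closed s (\<Theta> s) (P s))"
    by (rule primitive_on_AE_cong[OF _ negligible_empty]) (simp add: f_def Pt_def)
  moreover have "\<Theta> s = P.gain s (P s)" if "s \<in> {r..T}" for s using that by (simp add: \<Theta>_def Pt_def)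
  ultimately show thesis using that[of \<Theta>] b\<Theta> inv by blast
qed

text \<open>Every solution of the first Riccati equation is nonnegative: as long as \<open>P \<ge> - \<kappa>\<close> the matrix
  \<open>K0\<close> stays coercive, the feedback is bounded and the closed-loop Lyapunov equation forces
  \<open>P \<ge> 0\<close>; uniform continuity then propagates this backwards in steps of fixed length.\<close>

lemma riccati_P_nonneg:
  assumes sol: "riccati_P_solution T c P" and s: "s \<in> {0..T}"
  shows "0 \<le> v \<bullet> (P s *v v)"
proof -
  obtain C where C: "\<And>s. norm (kB1 s) \<le> C"
    using bounded_measurable_coefficients(4) unfolding bounded_measurable_def bounded_iff by auto
  define S where "S = C\<^sup>2 + 1"
  define \<kappa> where "\<kappa> = \<delta> / (2 * S)"
  have C1: "S > 0" by (simp add: S_def add_nonneg_pos)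
  have \<kappa>0: "\<kappa> > 0" using \<delta> C1 by (simp add: \<kappa>_def)
  have \<kappa>: "\<kappa> * (norm (kB1 s))\<^sup>2 \<le> \<delta> / 2" for s
  proof -
    have "(norm (kB1 s))\<^sup>2 \<le> S" using power_mono[OF C[of s] norm_ge_zero, of 2] by (simp add: S_def)
    then have "\<kappa> * (norm (kB1 s))\<^sup>2 \<le> \<kappa> * S" using \<kappa>0 by (intro mult_left_mono) auto
    also have "\<dots> = \<delta> / 2" using C1 by (simp add: \<kappa>_def)
    finally show ?thesis .
  qed
  have ac: "abs_continuous_on_Icc 0 T P" and PT: "P T = cG c" and symP: "\<And>s. s \<in> {0..T} \<Longrightarrow> transpose (P s) = P s"
    using sol by (auto simp: riccati_P_solution_def)
  have "uniformly_continuous_on {0..T} P"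
    using abs_continuous_on_Icc_continuous[OF ac] by (intro compact_uniformly_continuous) auto
  then obtain h where h: "h > 0" "\<And>s s'. s \<in> {0..T} \<Longrightarrow> s' \<in> {0..T} \<Longrightarrow> dist s' s < h \<Longrightarrow> dist (P s') (P s) < \<kappa>"
    using \<kappa>0 unfolding uniformly_continuous_on_def by meson
  have "\<forall>s\<in>{0..T}. \<forall>v. 0 \<le> v \<bullet> (P s *v v)"
  proof (rule backward_steps[where T=T and h="h/2" and P="\<lambda>r. \<forall>s\<in>{r..T}. \<forall>v. 0 \<le> v \<bullet> (P s *v v)"])
    show "\<forall>s\<in>{T..T}. \<forall>v. 0 \<le> v \<bullet> (P s *v v)" using PT terminal_psd(1) by simp
    fix r assume r: "0 \<le> r" "r \<le> T" and IH: "\<forall>s\<in>{r..T}. \<forall>v. 0 \<le> v \<bullet> (P s *v v)"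
    define q where "q = max 0 (r - h/2)"
    have q: "0 \<le> q" "q \<le> T" "q \<le> r" using r h(1) by (auto simp: q_def)
    have low: "- \<kappa> * (v \<bullet> v) \<le> v \<bullet> (P s *v v)" if s: "s \<in> {q..T}" for s v
    proof (cases "r \<le> s")
      case True
      then have "0 \<le> v \<bullet> (P s *v v)" using IH s by simp
      moreover have "- \<kappa> * (v \<bullet> v) \<le> 0" using \<kappa>0 by simp
      ultimately show ?thesis by linarith
    next
      case False
      have "dist s r < h" using s False h(1) by (auto simp: q_def dist_real_def)
      then have n: "norm (P s - P r) \<le> \<kappa>" using h(2)[of r s] s r q by (auto simp: dist_norm)
      have "\<bar>v \<bullet> ((P s - P r) *v v)\<bar> \<le> norm v * norm ((P s - P r) *v v)" by (rule Cauchy_Schwarz_ineq2)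
      also have "\<dots> \<le> norm v * (\<kappa> * norm v)"
        by (intro mult_left_mono order_trans[OF norm_matrix_vector_mult_le] mult_right_mono n) auto
      finally have "- \<kappa> * (v \<bullet> v) \<le> v \<bullet> ((P s - P r) *v v)"
        by (simp add: dot_square_norm power2_eq_square mult_ac abs_le_iff)
      moreover have "0 \<le> v \<bullet> (P r *v v)" using IH r by simp
      ultimately show ?thesis by (simp add: matrix_vector_mult_diff_rdistrib inner_diff_right)
    qed
    obtain \<Theta> where \<Theta>: "bounded_measurable \<Theta>" "primitive_on q T P (\<lambda>s. - P.closed s (\<Theta> s) (P s))"
      by (rule riccati_P_primitive[OF sol q(1,2) less_imp_le[OF \<kappa>0] low \<kappa>]) blast
    have bC: "bounded_measurable (\<lambda>s. kA s - kB s ** \<Theta> s)" and bD: "bounded_measurable (\<lambda>s. kA1 s - kB1 s ** \<Theta> s)"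
      by (intro bounded_measurable_intros bounded_measurable_coefficients \<Theta>(1))+
    obtain c1 c2 where cc: "\<And>s. norm (kA s - kB s ** \<Theta> s) \<le> c1" "\<And>s. norm (kA1 s - kB1 s ** \<Theta> s) \<le> c2"
      using bC bD unfolding bounded_measurable_def bounded_iff by auto
    show "\<forall>s\<in>{max 0 (r - h/2)..T}. \<forall>v. 0 \<le> v \<bullet> (P s *v v)"
    proof (intro ballI allI)
      fix s v assume s: "s \<in> {max 0 (r - h/2)..T}"
      show "0 \<le> v \<bullet> (P s *v v)"
      proof (rule lyapunov_nonneg[OF \<Theta>(2)[unfolded P.closed_def ric_closed_def] cc])
        show "0 \<le> v \<bullet> (run_cost (kQ s) (kR s) 0 (\<Theta> s) *v v)" for s v
          using P.cost[of v s "- (\<Theta> s *v v)"] unfolding run_cost_quadratic by (simp add: matrix_vector_mult_minus_right)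
      qed (use s q symP PT terminal_psd(1) in \<open>auto simp: q_def\<close>)
    qed
  qed (use h T in auto)
  then show ?thesis using s by blast
qed

text \<open>A solution is unconstrained off \<open>[0,T]\<close> and satisfies its equation almost everywhere only.
  Here the gain and the derivative are replaced by functions which are bounded and measurable everywhere
  and which satisfy the defining relations at every good time.\<close>

lemma riccati_P_feedback:
  assumes sol: "riccati_P_solution T c P"
  obtains \<Theta> P' where "bounded_measurable \<Theta>" "bounded_measurable P'" "primitive_on 0 T P P'"
    "\<And>s. s \<in> good \<Longrightarrow> gain0 c P s = \<Theta> s" "\<And>s. s \<in> good \<Longrightarrow> invertible (K0 c P s)"
    "\<And>s. s \<in> good \<Longrightarrow> K0 c P s ** \<Theta> s = transpose (cB c s) ** P s + transpose (cB1 c s) ** P s ** cA1 c s"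
    "\<And>s. s \<in> good \<Longrightarrow> P' s = - (P s ** cA c s + transpose (cA c s) ** P s + transpose (cA1 c s) ** P s ** cA1 c s + cQ c s
         - (P s ** cB c s + transpose (cA1 c s) ** P s ** cB1 c s) ** \<Theta> s)"
proof -
  obtain \<Theta> where \<Theta>: "bounded_measurable \<Theta>" "\<And>s. s \<in> {0..T} \<Longrightarrow> \<Theta> s = P.gain s (P s)"
    "\<And>s. s \<in> {0..T} \<Longrightarrow> invertible (ric_K (kB1 s) (kR s) (P s))"
    "primitive_on 0 T P (\<lambda>s. - P.closed s (\<Theta> s) (P s))"
    by (rule riccati_P_primitive[OF sol, of 0 0]) (use T \<delta> riccati_P_nonneg[OF sol] in auto)
  define Pt where "Pt s = (if s \<in> {0..T} then P s else 0)" for s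
  have bPt: "bounded_measurable Pt"
    unfolding Pt_def[abs_def] by (rule bounded_measurable_truncate[OF primitive_on_continuous[OF \<Theta>(4)]])
  have b': "bounded_measurable (\<lambda>s. - P.closed s (\<Theta> s) (Pt s))"
    unfolding P.closed_def ric_closed_def run_cost_def lyap_def
    by (intro bounded_measurable_intros bounded_measurable_coefficients bPt \<Theta>(1))
  have pr: "primitive_on 0 T P (\<lambda>s. - P.closed s (\<Theta> s) (Pt s))"
    by (rule primitive_on_AE_cong[OF \<Theta>(4) negligible_empty]) (simp add: Pt_def)
  have symP: "transpose (P s) = P s" if "s \<in> {0..T}" for s using sol that by (simp add: riccati_P_solution_def)
  have g0: "s \<in> {0..T}" if "s \<in> good" for s using that by (simp add: good_def)
  have g1: "gain0 c P s = \<Theta> s" if "s \<in> good" for s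
    using \<Theta>(2)[OF g0[OF that]] gain0_eq[OF that, of P] by (simp add: P.gain_def)
  have inv: "invertible (K0 c P s)" if "s \<in> good" for s
    using \<Theta>(3)[OF g0[OF that]] by (simp add: K0_eq[OF that])
  have 1: "K0 c P s ** \<Theta> s = transpose (cB c s) ** P s + transpose (cB1 c s) ** P s ** cA1 c s" if "s \<in> good" for s
    unfolding g1[OF that, symmetric] gain0_def using matrix_inv_right[OF inv[OF that]] by (simp add: matrix_mul_assoc)
  have 2: "- P.closed s (\<Theta> s) (Pt s) = - (P s ** cA c s + transpose (cA c s) ** P s + transpose (cA1 c s) ** P s ** cA1 c s + cQ c s
         - (P s ** cB c s + transpose (cA1 c s) ** P s ** cB1 c s) ** \<Theta> s)" if g: "s \<in> good" for s
  proof -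
    have "Pt s = P s" using g0[OF g] by (simp add: Pt_def)
    moreover have "\<Theta> s = P.gain s (P s)" using \<Theta>(2)[OF g0[OF g]] .
    ultimately have "P.closed s (\<Theta> s) (Pt s) = P s ** cA c s + transpose (cA c s) ** P s
     + transpose (cA1 c s) ** P s ** cA1 c s + cQ c s
     - (P s ** cB c s + transpose (cA1 c s) ** P s ** cB1 c s) ** matrix_inv (K0 c P s)
         ** (transpose (cB c s) ** P s + transpose (cB1 c s) ** P s ** cA1 c s)"
      using P_closed_eq[of s P, OF g symP[OF g0[OF g]] \<Theta>(3)[OF g0[OF g]]] by simp
    also have "\<dots> = P s ** cA c s + transpose (cA c s) ** P s + transpose (cA1 c s) ** P s ** cA1 c s + cQ c s
         - (P s ** cB c s + transpose (cA1 c s) ** P s ** cB1 c s) ** gain0 c P s"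
      by (simp add: gain0_def matrix_mul_assoc)
    finally show ?thesis by (simp only: g1[OF g])
  qed
  show thesis by (rule that[OF \<Theta>(1) b' pr g1 inv 1 2])
qed

lemma riccati_Pi_feedback:
  assumes solP: "riccati_P_solution T c P" and sol: "riccati_Pi_solution T c P PI"
  obtains \<Theta> PI' where "bounded_measurable \<Theta>" "bounded_measurable PI'" "primitive_on 0 T PI PI'"
    "\<And>s. s \<in> good \<Longrightarrow> gain1 c P PI s = \<Theta> s" "\<And>s. s \<in> good \<Longrightarrow> invertible (K1 c P s)"
    "\<And>s. s \<in> good \<Longrightarrow> K1 c P s ** \<Theta> s = transpose (bB s) ** PI s + transpose (bB1 s) ** P s ** bA1 s"
    "\<And>s. s \<in> good \<Longrightarrow> PI' s = - (PI s ** bA s + transpose (bA s) ** PI s + transpose (bA1 s) ** P s ** bA1 s + bQ s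
         - (PI s ** bB s + transpose (bA1 s) ** P s ** bB1 s) ** \<Theta> s)"
proof -
  have ac: "abs_continuous_on_Icc 0 T PI" and symPI: "\<And>s. s \<in> {0..T} \<Longrightarrow> transpose (PI s) = PI s"
    using sol by (auto simp: riccati_Pi_solution_def)
  have acP: "abs_continuous_on_Icc 0 T P" and symP: "\<And>s. s \<in> {0..T} \<Longrightarrow> transpose (P s) = P s"
    using solP by (auto simp: riccati_P_solution_def)
  define Pt where "Pt s = (if s \<in> {0..T} then P s else 0)" for s
  define X where "X s = (if s \<in> {0..T} then PI s else 0)" for s
  have bPt: "bounded_measurable Pt"
    unfolding Pt_def[abs_def] by (rule bounded_measurable_truncate[OF abs_continuous_on_Icc_continuous[OF acP]])
  have bX: "bounded_measurable X"
    unfolding X_def[abs_def] by (rule bounded_measurable_truncate[OF abs_continuous_on_Icc_continuous[OF ac]])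
  have psd: "0 \<le> v \<bullet> (Pt s *v v)" for s v using riccati_P_nonneg[OF solP, of s v] by (simp add: Pt_def)
  have co: "\<delta> * (w \<bullet> w) \<le> w \<bullet> (ric_K (bB1 s) (bR s) (Pt s) *v w)" for s w
    by (rule ric_K_coercive[OF coefficients_psd(4) psd])
  define L where "L s = transpose (bB s) ** X s + transpose (bB1 s) ** Pt s ** bA1 s" for s
  define \<Theta> where "\<Theta> s = matrix_inv (ric_K (bB1 s) (bR s) (Pt s)) ** L s" for s
  define PI' where "PI' s = - (X s ** bA s + transpose (bA s) ** X s + transpose (bA1 s) ** Pt s ** bA1 s + bQ s
         - (X s ** bB s + transpose (bA1 s) ** Pt s ** bB1 s) ** \<Theta> s)" for s
  have b\<Theta>: "bounded_measurable \<Theta>"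
    unfolding bounded_measurable_def
  proof
    have b: "bounded (range bA1)" "bounded (range bB)" "bounded (range bB1)" "bounded (range Pt)" "bounded (range X)"
      using bounded_measurable_coefficients bPt bX unfolding bounded_measurable_def by auto
    show "bounded (range \<Theta>)"
      unfolding \<Theta>_def L_def by (intro bounded_range_intros bounded_range_matrix_inv[OF co \<delta>] b)
    show "\<Theta> \<in> borel_measurable lebesgue"
      using bounded_measurable_coefficients bPt bX unfolding \<Theta>_def L_def ric_K_def bounded_measurable_def
      by (intro measurable_matrix_mult measurable_matrix_inv borel_measurable_add measurable_transpose) auto
  qed
  have bPI': "bounded_measurable PI'"
    unfolding PI'_def by (intro bounded_measurable_intros bounded_measurable_coefficients bPt bX b\<Theta>)
  have g0: "s \<in> {0..T}" "Pt s = P s" "X s = PI s" if "s \<in> good" for s using that by (auto simp: good_def Pt_def X_def)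
  have K1e: "K1 c P s = ric_K (bB1 s) (bR s) (Pt s)" if "s \<in> good" for s
    using K1_eq[OF that, of P] g0[OF that] by simp
  have inv: "invertible (K1 c P s)" if "s \<in> good" for s
    using coercive_invertible(1)[OF co \<delta>, of s] by (simp add: K1e[OF that])
  have g1: "gain1 c P PI s = \<Theta> s" if g: "s \<in> good" for s
    unfolding gain1_def \<Theta>_def L_def K1e[OF g] g0[OF g] using g by (simp add: k_defs)
  have 1: "K1 c P s ** \<Theta> s = transpose (bB s) ** PI s + transpose (bB1 s) ** P s ** bA1 s" if g: "s \<in> good" for s
    using matrix_inv_right[OF inv[OF g]] unfolding \<Theta>_def K1e[OF g]
    by (simp add: matrix_mul_assoc L_def g0[OF g])
  from sol[unfolded riccati_Pi_solution_def, THEN conjunct2, THEN conjunct2, THEN conjunct1] AE_good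
  have "AE s in lebesgue_on {0..T}. (PI has_vector_derivative PI' s) (at s within {0..T})"
  proof eventually_elim
    case (elim s)
    note g = elim(2)
    define K where "K = matrix_inv (K1 c P s)"
    have symK: "transpose K = K"
      unfolding K_def
      by (rule transpose_matrix_inv[OF inv[OF g]])
        (use transpose_ric_K[OF coefficients_symmetric(4) symP, of s] g0[OF g] in \<open>simp add: K1_eq[OF g]\<close>)
    have b: "cA c s + cAh c s = bA s" "cB c s + cBh c s = bB s" "cA1 c s + cA1h c s = bA1 s"
      "cB1 c s + cB1h c s = bB1 s" "cQ c s + cQh c s = bQ s" using g by (simp_all add: k_defs)
    obtain D where D: "(PI has_vector_derivative D) (at s within {0..T})"
      "D + PI s ** (bA s - bB s ** K ** transpose (bB1 s) ** P s ** bA1 s)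
             + (transpose (bA s) - transpose (bA1 s) ** P s ** bB1 s ** K ** transpose (bB s)) ** PI s
             - PI s ** bB s ** K ** transpose (bB s) ** PI s
             + transpose (bA1 s) ** (P s - P s ** bB1 s ** K ** transpose (bB1 s) ** P s) ** bA1 s
             + cQ c s + cQh c s = 0"
      using elim(1) unfolding Let_def b K_def[symmetric] by blast
    have z: "D = - (a + b - e + f + (p + q))" if "D + a + b - e + f + p + q = 0" for D a b e f p q :: "real^'n^'n"
      using that by (simp add: algebra_simps add_eq_0_iff)
    have tL: "transpose (ric_L 0 (bB s) 0 (transpose (bB1 s) ** P s ** bA1 s) (PI s)) = PI s ** bB s + transpose (bA1 s) ** P s ** bB1 s"
      by (simp add: ric_L_def transpose_zero matrix_mult_zero_left transpose_add matrix_transpose_mul matrix_mul_assoc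
          symP[OF g0(1)[OF g]] symPI[OF g0(1)[OF g]])
    have KL: "K ** ric_L 0 (bB s) 0 (transpose (bB1 s) ** P s ** bA1 s) (PI s) = \<Theta> s"
      by (simp add: ric_L_def transpose_zero matrix_mult_zero_left \<Theta>_def K_def K1e[OF g] L_def g0[OF g])
    have "D = - (PI s ** bA s + transpose (bA s) ** PI s + (transpose (bA1 s) ** P s ** bA1 s + bQ s)
     - transpose (ric_L 0 (bB s) 0 (transpose (bB1 s) ** P s ** bA1 s) (PI s)) ** K ** ric_L 0 (bB s) 0 (transpose (bB1 s) ** P s ** bA1 s) (PI s))"
      using z[OF D(2)] unfolding b riccati_Pi_form[OF symPI[OF g0(1)[OF g]] symP[OF g0(1)[OF g]] symK] .
    then have "D = PI' s"
      unfolding tL matrix_mul_assoc[symmetric, of _ K] KL by (simp add: PI'_def g0[OF g] matrix_mul_assoc add.assoc)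
    with D(1) show "(PI has_vector_derivative PI' s) (at s within {0..T})" by simp
  qed
  then obtain N where N: "negligible N" "\<And>s. s \<in> {0..T} - N \<Longrightarrow> (PI has_vector_derivative PI' s) (at s within {0..T})"
    by (rule AE_lebesgue_onD) blast
  have pr: "primitive_on 0 T PI PI'"
    by (rule primitive_on_abs_continuousI[OF ac N(1) bounded_measurable_absolutely_integrable[OF bPI'] N(2)])
  have 2: "PI' s = - (PI s ** bA s + transpose (bA s) ** PI s + transpose (bA1 s) ** P s ** bA1 s + bQ s
         - (PI s ** bB s + transpose (bA1 s) ** P s ** bB1 s) ** \<Theta> s)" if "s \<in> good" for s
    by (simp add: PI'_def g0[OF that])
  show thesis by (rule that[OF b\<Theta> bPI' pr g1 inv 1 2])
qed

end

section \<open>Square-integrable functions\<close>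

definition sq_int :: "'a measure \<Rightarrow> ('a \<Rightarrow> real) \<Rightarrow> bool" where
  "sq_int N f \<longleftrightarrow> f \<in> borel_measurable N \<and> integrable N (\<lambda>x. (f x)\<^sup>2)"

lemma sq_int_measurable[measurable_dest]: "sq_int N f \<Longrightarrow> f \<in> borel_measurable N"
  by (simp add: sq_int_def)

lemma sq_int_mult:
  assumes "sq_int N f" "sq_int N g"
  shows "integrable N (\<lambda>x. f x * g x)"
proof (rule Bochner_Integration.integrable_bound)
  show "integrable N (\<lambda>x. (f x)\<^sup>2 + (g x)\<^sup>2)" using assms by (auto simp: sq_int_def)
  show "(\<lambda>x. f x * g x) \<in> borel_measurable N" using assms by (auto simp: sq_int_def)
  have "\<bar>a * b\<bar> \<le> a\<^sup>2 + b\<^sup>2" for a b :: real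
  proof -
    have "0 \<le> (\<bar>a\<bar> - \<bar>b\<bar>)\<^sup>2" by simp
    then have "2 * (\<bar>a\<bar> * \<bar>b\<bar>) \<le> a\<^sup>2 + b\<^sup>2" by (simp add: power2_diff)
    moreover have "0 \<le> \<bar>a\<bar> * \<bar>b\<bar>" by simp
    ultimately show ?thesis unfolding abs_mult by linarith
  qed
  then show "AE x in N. norm (f x * g x) \<le> norm ((f x)\<^sup>2 + (g x)\<^sup>2)" by simp
qed

lemma sq_int_add:
  assumes "sq_int N f" "sq_int N g"
  shows "sq_int N (\<lambda>x. f x + g x)"
proof -
  have "integrable N (\<lambda>x. (f x)\<^sup>2 + (g x)\<^sup>2 + 2 * (f x * g x))"
    using assms sq_int_mult[OF assms] by (auto simp: sq_int_def)
  then show ?thesis using assms by (auto simp: sq_int_def power2_sum mult.assoc)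
qed

lemma sq_int_scale: "sq_int N f \<Longrightarrow> sq_int N (\<lambda>x. c * f x)"
  by (auto simp: sq_int_def power_mult_distrib)

lemma sq_int_diff: "sq_int N f \<Longrightarrow> sq_int N g \<Longrightarrow> sq_int N (\<lambda>x. f x - g x)"
  using sq_int_add[of N f "\<lambda>x. (-1) * g x"] sq_int_scale[of N g "-1"] by simp

lemma sq_int_zero: "sq_int N (\<lambda>x. 0)"
  by (simp add: sq_int_def)

lemma sq_int_sum: "(\<And>i. i \<in> I \<Longrightarrow> sq_int N (f i)) \<Longrightarrow> sq_int N (\<lambda>x. \<Sum>i\<in>I. f i x)"
  by (induction I rule: infinite_finite_induct) (auto simp: sq_int_zero intro: sq_int_add)

lemma sq_int_bounded_mult:
  assumes f: "sq_int N f" and h: "h \<in> borel_measurable N" and C: "AE x in N. \<bar>h x\<bar> \<le> C"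
  shows "sq_int N (\<lambda>x. h x * f x)"
  unfolding sq_int_def
proof
  show "(\<lambda>x. h x * f x) \<in> borel_measurable N" using f h by (auto simp: sq_int_def)
  show "integrable N (\<lambda>x. (h x * f x)\<^sup>2)"
  proof (rule Bochner_Integration.integrable_bound)
    show "integrable N (\<lambda>x. C\<^sup>2 * (f x)\<^sup>2)" using f by (auto simp: sq_int_def)
    show "(\<lambda>x. (h x * f x)\<^sup>2) \<in> borel_measurable N" using f h by (auto simp: sq_int_def)
    show "AE x in N. norm ((h x * f x)\<^sup>2) \<le> norm (C\<^sup>2 * (f x)\<^sup>2)"
      using C
    proof eventually_elim
      case (elim x)
      have "\<bar>h x\<bar>\<^sup>2 \<le> C\<^sup>2" using elim by (intro power_mono) auto
      then have "(h x)\<^sup>2 * (f x)\<^sup>2 \<le> C\<^sup>2 * (f x)\<^sup>2" by (intro mult_right_mono) auto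
      then show ?case by (simp add: power_mult_distrib)
    qed
  qed
qed

lemma sq_int_finite_integrable:
  assumes "finite_measure N" "sq_int N f"
  shows "integrable N f"
proof -
  interpret finite_measure N by fact
  have "sq_int N (\<lambda>_. 1)" by (simp add: sq_int_def)
  from sq_int_mult[OF assms(2) this] show ?thesis by simp
qed

lemma sq_int_bounded:
  assumes "finite_measure N" "f \<in> borel_measurable N" "\<And>x. x \<in> space N \<Longrightarrow> \<bar>f x\<bar> \<le> C"
  shows "sq_int N f"
proof -
  interpret finite_measure N by fact
  have "sq_int N (\<lambda>_. 1)" by (simp add: sq_int_def)
  from sq_int_bounded_mult[OF this assms(2), of C] assms(3) show ?thesis by (simp add: AE_I2)
qed

lemma integral_Cauchy_Schwarz:
  assumes f: "sq_int N f" and g: "sq_int N g"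
  shows "(\<integral>x. f x * g x \<partial>N)\<^sup>2 \<le> (\<integral>x. (f x)\<^sup>2 \<partial>N) * (\<integral>x. (g x)\<^sup>2 \<partial>N)"
proof -
  define A B C where "A = (\<integral>x. (f x)\<^sup>2 \<partial>N)" and "B = (\<integral>x. (g x)\<^sup>2 \<partial>N)" and "C = (\<integral>x. f x * g x \<partial>N)"
  have q: "0 \<le> t\<^sup>2 * A + 2 * t * C + B" for t
  proof -
    have "0 \<le> (\<integral>x. (t * f x + g x)\<^sup>2 \<partial>N)" by (intro integral_nonneg_AE) auto
    also have "\<dots> = (\<integral>x. t\<^sup>2 * (f x)\<^sup>2 + (2 * t) * (f x * g x) + (g x)\<^sup>2 \<partial>N)"
      by (intro Bochner_Integration.integral_cong) (auto simp: power2_sum power_mult_distrib algebra_simps)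
    also have "\<dots> = t\<^sup>2 * A + 2 * t * C + B"
      using f g sq_int_mult[OF f g] by (simp add: sq_int_def A_def B_def C_def)
    finally show ?thesis .
  qed
  have A: "A \<ge> 0" unfolding A_def by (intro integral_nonneg_AE) auto
  show ?thesis
  proof (cases "A = 0")
    case True
    have "C = 0"
    proof (rule ccontr)
      assume "C \<noteq> 0"
      then have "2 * (- (B + 1) / (2 * C)) * C = - (B + 1)" by simp
      then show False using q[of "- (B + 1) / (2 * C)"] True by simp
    qed
    then show ?thesis using True by (simp add: A_def[symmetric] C_def[symmetric])
  next
    case False
    then have "A > 0" using A by simp
    then have "(- C / A)\<^sup>2 * A + 2 * (- C / A) * C + B = B - C\<^sup>2 / A" by (simp add: field_simps power2_eq_square)
    then have "C\<^sup>2 / A \<le> B" using q[of "- C / A"] by simp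
    then have "C\<^sup>2 \<le> A * B" using \<open>A > 0\<close> by (simp add: field_simps)
    then show ?thesis by (simp add: A_def B_def C_def)
  qed
qed

lemma sq_int_nn_integral:
  assumes "sq_int N f"
  shows "(\<integral>\<^sup>+x. ennreal ((f x)\<^sup>2) \<partial>N) = ennreal (\<integral>x. (f x)\<^sup>2 \<partial>N)"
  using assms by (intro nn_integral_eq_integral) (auto simp: sq_int_def)

lemma sq_int_iff_nn_integral:
  "sq_int N f \<longleftrightarrow> f \<in> borel_measurable N \<and> (\<integral>\<^sup>+x. ennreal ((f x)\<^sup>2) \<partial>N) < \<infinity>"
  by (auto simp: sq_int_def integrable_iff_bounded)

text \<open>Expand \<open>f' g' - f g\<close> around the limits and use the Cauchy-Schwarz inequality.\<close>

lemma tendsto_integral_mult: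
  assumes f: "\<And>k. sq_int N (f k)" "sq_int N f'" "(\<lambda>k. \<integral>x. (f' x - f k x)\<^sup>2 \<partial>N) \<longlonglongrightarrow> 0"
    and g: "\<And>k. sq_int N (g k)" "sq_int N g'" "(\<lambda>k. \<integral>x. (g' x - g k x)\<^sup>2 \<partial>N) \<longlonglongrightarrow> 0"
  shows "(\<lambda>k. \<integral>x. f k x * g k x \<partial>N) \<longlonglongrightarrow> (\<integral>x. f' x * g' x \<partial>N)"
proof -
  have z: "(\<lambda>k. \<integral>x. a k x * b k x \<partial>N) \<longlonglongrightarrow> 0"
    if ab: "\<And>k. sq_int N (a k)" "\<And>k. sq_int N (b k)"
      and lim: "(\<lambda>k. (\<integral>x. (a k x)\<^sup>2 \<partial>N) * (\<integral>x. (b k x)\<^sup>2 \<partial>N)) \<longlonglongrightarrow> 0" for a b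
  proof -
    have "(\<lambda>k. (\<integral>x. a k x * b k x \<partial>N)\<^sup>2) \<longlonglongrightarrow> 0"
      by (rule tendsto_sandwich[OF _ _ tendsto_const lim])
         (auto intro!: always_eventually integral_Cauchy_Schwarz ab)
    then have "(\<lambda>k. sqrt ((\<integral>x. a k x * b k x \<partial>N)\<^sup>2)) \<longlonglongrightarrow> sqrt 0" by (intro tendsto_intros)
    then show ?thesis by (simp add: tendsto_rabs_zero_iff)
  qed
  have fd: "\<And>k. sq_int N (\<lambda>x. f' x - f k x)" and gd: "\<And>k. sq_int N (\<lambda>x. g' x - g k x)"
    using f g by (auto intro: sq_int_diff)
  have "(\<lambda>k. \<integral>x. (f' x - f k x) * (g' x - g k x) \<partial>N) \<longlonglongrightarrow> 0"
    using tendsto_mult[OF f(3) g(3)] by (intro z fd gd) simp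
  moreover have "(\<lambda>k. \<integral>x. (f' x - f k x) * g' x \<partial>N) \<longlonglongrightarrow> 0"
    using tendsto_mult[OF f(3) tendsto_const] by (intro z fd g) simp
  moreover have "(\<lambda>k. \<integral>x. f' x * (g' x - g k x) \<partial>N) \<longlonglongrightarrow> 0"
    using tendsto_mult[OF tendsto_const g(3)] by (intro z gd f) simp
  ultimately have "(\<lambda>k. (\<integral>x. f' x * g' x \<partial>N) + (\<integral>x. (f' x - f k x) * (g' x - g k x) \<partial>N)
       - (\<integral>x. (f' x - f k x) * g' x \<partial>N) - (\<integral>x. f' x * (g' x - g k x) \<partial>N)) \<longlonglongrightarrow> (\<integral>x. f' x * g' x \<partial>N) + 0 - 0 - 0"
    by (intro tendsto_intros)
  moreover have "(\<integral>x. f' x * g' x \<partial>N) + (\<integral>x. (f' x - f k x) * (g' x - g k x) \<partial>N)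
       - (\<integral>x. (f' x - f k x) * g' x \<partial>N) - (\<integral>x. f' x * (g' x - g k x) \<partial>N) = (\<integral>x. f k x * g k x \<partial>N)" for k
  proof -
    have "(\<integral>x. f k x * g k x \<partial>N) = (\<integral>x. f' x * g' x + (f' x - f k x) * (g' x - g k x)
       - (f' x - f k x) * g' x - f' x * (g' x - g k x) \<partial>N)"
      by (intro Bochner_Integration.integral_cong) (auto simp: algebra_simps)
    also have "\<dots> = (\<integral>x. f' x * g' x \<partial>N) + (\<integral>x. (f' x - f k x) * (g' x - g k x) \<partial>N)
       - (\<integral>x. (f' x - f k x) * g' x \<partial>N) - (\<integral>x. f' x * (g' x - g k x) \<partial>N)"
      using sq_int_mult[OF f(2) g(2)] sq_int_mult[OF fd gd] sq_int_mult[OF fd g(2)] sq_int_mult[OF f(2) gd]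
      by (subst Bochner_Integration.integral_diff Bochner_Integration.integral_add; simp)+
    finally show ?thesis by simp
  qed
  ultimately show ?thesis by simp
qed

section \<open>Brownian increments and the augmented filtration\<close>

context standard_brownian_motion
begin

abbreviation \<F> :: "real \<Rightarrow> 'w measure" where "\<F> \<equiv> augmented_filtration M W"

lemma augmented_generator: "natural_events M W t \<union> null_sets M \<subseteq> Pow (space M)"
  using sets.sets_into_space by (fastforce simp: natural_events_def null_sets_def)

lemma space_\<F>: "space (\<F> t) = space M"
  unfolding augmented_filtration_def by (rule space_measure_of[OF augmented_generator])

lemma sets_\<F>: "sets (\<F> t) = sigma_sets (space M) (natural_events M W t \<union> null_sets M)"
  unfolding augmented_filtration_def by (rule sets_measure_of[OF augmented_generator])

lemma natural_events_sets: "natural_events M W t \<subseteq> sets M"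
  using measurable_W by (auto simp: natural_events_def measurable_sets)

lemma sets_\<F>_subset: "sets (\<F> t) \<subseteq> sets M"
  unfolding sets_\<F> using natural_events_sets by (intro sets.sigma_sets_subset) auto

lemma \<F>_mono: "s \<le> t \<Longrightarrow> sets (\<F> s) \<subseteq> sets (\<F> t)"
  using filtration.sets_F_mono[OF filtration_augmented_filtration[of M W]] by blast

lemma measurable_\<F>_mono: "f \<in> borel_measurable (\<F> s) \<Longrightarrow> s \<le> t \<Longrightarrow> f \<in> borel_measurable (\<F> t)"
  using \<F>_mono[of s t] by (auto simp: measurable_def space_\<F>)

lemma measurable_\<F>: "f \<in> borel_measurable (\<F> s) \<Longrightarrow> f \<in> borel_measurable M"
  using sets_\<F>_subset[of s] by (auto simp: measurable_def space_\<F>)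

lemma W_measurable_\<F>:
  assumes "0 \<le> r" "r \<le> t"
  shows "W r \<in> borel_measurable (\<F> t)"
proof (rule measurableI)
  fix A :: "real set" assume "A \<in> sets borel"
  then have "W r -` A \<inter> space M \<in> natural_events M W t" using assms by (auto simp: natural_events_def)
  then show "W r -` A \<inter> space (\<F> t) \<in> sets (\<F> t)" unfolding sets_\<F> space_\<F> by (intro sigma_sets.Basic) auto
qed simp

text \<open>Augmentation changes events by null sets only, so it does not affect independence.\<close>

lemma augmented_event_AE_natural:
  assumes "A \<in> sets (\<F> t)"
  shows "\<exists>A0 \<in> sigma_sets (space M) (natural_events M W t). AE w in M. w \<in> A \<longleftrightarrow> w \<in> A0"
  using assms unfolding sets_\<F>
proof (induction rule: sigma_sets.induct)
  case (Basic A)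
  then show ?case
  proof
    assume "A \<in> null_sets M"
    then have "AE w in M. w \<in> A \<longleftrightarrow> w \<in> {}" by (auto dest: AE_not_in)
    then show ?case using sigma_sets.Empty by blast
  qed (auto intro: sigma_sets.Basic)
next
  case Empty
  show ?case by (rule bexI[OF _ sigma_sets.Empty]) simp
next
  case (Compl A)
  then obtain A0 where "A0 \<in> sigma_sets (space M) (natural_events M W t)" "AE w in M. w \<in> A \<longleftrightarrow> w \<in> A0" by blast
  then show ?case by (intro bexI[of _ "space M - A0"]) (auto intro: sigma_sets.Compl elim: eventually_mono)
next
  case (Union A)
  then have "\<forall>i. \<exists>A0 \<in> sigma_sets (space M) (natural_events M W t). AE w in M. w \<in> A i \<longleftrightarrow> w \<in> A0" by blast
  then obtain A0 where A0: "\<And>i. A0 i \<in> sigma_sets (space M) (natural_events M W t)" "\<And>i. AE w in M. w \<in> A i \<longleftrightarrow> w \<in> A0 i"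
    by metis
  have "AE w in M. \<forall>i. w \<in> A i \<longleftrightarrow> w \<in> A0 i" using A0(2) by (simp add: AE_all_countable)
  then have "AE w in M. w \<in> \<Union> (range A) \<longleftrightarrow> w \<in> \<Union> (range A0)" by eventually_elim auto
  then show ?case using A0(1) by (intro bexI[OF _ sigma_sets.Union[of A0]]) auto
qed

lemma indep_increment:
  fixes X :: "'w \<Rightarrow> real" and g :: "real \<Rightarrow> real"
  assumes s: "0 \<le> s" "s < t" and X: "X \<in> borel_measurable (\<F> s)" and g: "g \<in> borel_measurable borel"
  shows "indep_var borel X borel (\<lambda>w. g (W t w - W s w))"
  unfolding indep_var_eq
proof (intro conjI indep_set_sigma_sets)
  have mD: "(\<lambda>w. W t w - W s w) \<in> borel_measurable M" using s by (intro borel_measurable_diff measurable_W) auto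
  have mg: "(\<lambda>w. g (W t w - W s w)) \<in> borel_measurable M" using measurable_compose[OF mD g] .
  have mX: "X \<in> borel_measurable M" using X by (rule measurable_\<F>)
  show "X \<in> borel_measurable M" "(\<lambda>w. g (W t w - W s w)) \<in> borel_measurable M" by fact+
  have stable: "Int_stable {f -` A \<inter> space M |A. A \<in> sets borel}" for f :: "'w \<Rightarrow> real"
  proof (rule Int_stableI)
    fix a b assume "a \<in> {f -` A \<inter> space M |A. A \<in> sets borel}" "b \<in> {f -` A \<inter> space M |A. A \<in> sets borel}"
    then obtain A B where "a = f -` A \<inter> space M" "b = f -` B \<inter> space M" "A \<in> sets borel" "B \<in> sets borel" by blast
    then show "a \<inter> b \<in> {f -` A \<inter> space M |A. A \<in> sets borel}"
      by (intro CollectI exI[of _ "A \<inter> B"]) auto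
  qed
  show "Int_stable {X -` A \<inter> space M |A. A \<in> sets borel}" by (rule stable)
  show "Int_stable {(\<lambda>w. g (W t w - W s w)) -` A \<inter> space M |A. A \<in> sets borel}" by (rule stable)
  show "indep_set {X -` A \<inter> space M |A. A \<in> sets borel} {(\<lambda>w. g (W t w - W s w)) -` A \<inter> space M |A. A \<in> sets borel}"
  proof (rule indep_setI)
    show "{X -` A \<inter> space M |A. A \<in> sets borel} \<subseteq> events"
      "{(\<lambda>w. g (W t w - W s w)) -` A \<inter> space M |A. A \<in> sets borel} \<subseteq> events"
      using measurable_sets[OF mX] measurable_sets[OF mg] by auto
    fix a b assume a: "a \<in> {X -` A \<inter> space M |A. A \<in> sets borel}"
      and b: "b \<in> {(\<lambda>w. g (W t w - W s w)) -` A \<inter> space M |A. A \<in> sets borel}"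
    have aF: "a \<in> sets (\<F> s)" using a measurable_sets[OF X] by (auto simp: space_\<F>)
    obtain a0 where a0: "a0 \<in> sigma_sets (space M) (natural_events M W s)" "AE w in M. w \<in> a \<longleftrightarrow> w \<in> a0"
      using augmented_event_AE_natural[OF aF] by blast
    obtain B where B: "B \<in> sets borel" "b = (\<lambda>w. g (W t w - W s w)) -` B \<inter> space M" using b by auto
    have "b = (\<lambda>w. W t w - W s w) -` (g -` B) \<inter> space M" using B(2) by auto
    moreover have "g -` B \<in> sets borel" using measurable_sets[OF g B(1)] by simp
    ultimately have b0: "b \<in> {(\<lambda>w. W t w - W s w) -` S \<inter> space M | S. S \<in> sets borel}" by blast
    have "prob (a0 \<inter> b) = prob a0 * prob b"
      by (rule indep_setD[OF W_indep[OF s] a0(1) b0])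
    moreover have aM: "a \<in> events" using aF sets_\<F>_subset by blast
    moreover have a0M: "a0 \<in> events" using a0(1) sets.sigma_sets_subset[OF natural_events_sets] by blast
    moreover have bM: "b \<in> events" using B measurable_sets[OF mg] by auto
    moreover have "prob a = prob a0" using a0(2) aM a0M by (rule finite_measure_eq_AE)
    moreover have "prob (a \<inter> b) = prob (a0 \<inter> b)"
    proof (rule finite_measure_eq_AE)
      show "AE w in M. w \<in> a \<inter> b \<longleftrightarrow> w \<in> a0 \<inter> b" using a0(2) by eventually_elim auto
    qed (use aM a0M bM in auto)
    ultimately show "prob (a \<inter> b) = prob a * prob b" by simp
  qed
qed

lemma increment_moments:
  assumes s: "0 \<le> s" "s \<le> t"
  shows "sq_int M (\<lambda>w. W t w - W s w)" "expectation (\<lambda>w. W t w - W s w) = 0"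
    "expectation (\<lambda>w. (W t w - W s w)\<^sup>2) = t - s"
proof -
  have "sq_int M (\<lambda>w. W t w - W s w) \<and> expectation (\<lambda>w. W t w - W s w) = 0 \<and>
    expectation (\<lambda>w. (W t w - W s w)\<^sup>2) = t - s"
  proof (cases "s = t")
    case False
    then have st: "s < t" "0 < sqrt (t - s)" using s by auto
    note D = W_gaussian[OF s(1) st(1)]
    have m: "(\<lambda>w. W t w - W s w) \<in> borel_measurable M" using s by (intro borel_measurable_diff measurable_W) auto
    have "integrable lborel (\<lambda>x. normal_density 0 (sqrt (t - s)) x * x\<^sup>2)"
      using integrable_normal_moment[OF st(2), of 0 2] by simp
    then have i: "integrable M (\<lambda>w. (W t w - W s w)\<^sup>2)"
      using distributed_integrable[OF D, of "\<lambda>x. x\<^sup>2"] by simp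
    have e: "expectation (\<lambda>w. W t w - W s w) = 0" by (rule normal_distributed_expectation[OF st(2) D])
    have "variance (\<lambda>w. W t w - W s w) = (sqrt (t - s))\<^sup>2" by (rule normal_distributed_variance[OF st(2) D])
    then have "expectation (\<lambda>w. (W t w - W s w)\<^sup>2) = t - s" using st unfolding e by simp
    with i e m show ?thesis by (simp add: sq_int_def)
  qed (simp add: sq_int_zero)
  then show "sq_int M (\<lambda>w. W t w - W s w)" "expectation (\<lambda>w. W t w - W s w) = 0"
    "expectation (\<lambda>w. (W t w - W s w)\<^sup>2) = t - s" by auto
qed

lemma expectation_mult_increment:
  assumes s: "0 \<le> s" "s \<le> t" and X: "X \<in> borel_measurable (\<F> s)" "integrable M X"
  shows "expectation (\<lambda>w. X w * (W t w - W s w)) = 0"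
proof (cases "s = t")
  case False
  then have st: "s < t" using s by simp
  have "expectation (\<lambda>w. X w * (W t w - W s w)) = expectation X * expectation (\<lambda>w. W t w - W s w)"
    using indep_var_lebesgue_integral[OF indep_increment[OF s(1) st X(1), of "\<lambda>x. x"] X(2)]
      sq_int_finite_integrable[OF finite_measure_axioms increment_moments(1)[OF s]] by simp
  then show ?thesis using increment_moments(2)[OF s] by simp
qed simp

lemma sq_int_mult_increment:
  assumes s: "0 \<le> s" "s \<le> t" and X: "X \<in> borel_measurable (\<F> s)" "sq_int M X"
  shows "sq_int M (\<lambda>w. X w * (W t w - W s w))"
proof (cases "s = t")
  case False
  then have st: "s < t" using s by simp
  have X2: "(\<lambda>w. (X w)\<^sup>2) \<in> borel_measurable (\<F> s)" using X(1) by simp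
  have "integrable M (\<lambda>w. (X w)\<^sup>2 * (W t w - W s w)\<^sup>2)"
    using indep_var_integrable[OF indep_increment[OF s(1) st X2, of "\<lambda>x. x\<^sup>2"]]
      X(2) increment_moments(1)[OF s] by (simp add: sq_int_def)
  moreover have "(\<lambda>w. X w * (W t w - W s w)) \<in> borel_measurable M"
    using X(2) increment_moments(1)[OF s] by (auto simp: sq_int_def)
  ultimately show ?thesis by (simp add: sq_int_def power_mult_distrib)
qed (simp add: sq_int_zero)

lemma expectation_mult_increment_square:
  assumes s: "0 \<le> s" "s \<le> t" and X: "X \<in> borel_measurable (\<F> s)" "integrable M X"
  shows "expectation (\<lambda>w. X w * (W t w - W s w)\<^sup>2) = expectation X * (t - s)"
proof (cases "s = t")
  case False
  then have st: "s < t" using s by simp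
  have "expectation (\<lambda>w. X w * (W t w - W s w)\<^sup>2) = expectation X * expectation (\<lambda>w. (W t w - W s w)\<^sup>2)"
    using indep_var_lebesgue_integral[OF indep_increment[OF s(1) st X(1), of "\<lambda>x. x\<^sup>2"] X(2)]
      increment_moments(1)[OF s] by (simp add: sq_int_def)
  then show ?thesis using increment_moments(3)[OF s] by simp
qed simp

text \<open>On the overlap of the two intervals the square of an increment contributes its length; increments
  of \<open>W\<close> over disjoint intervals contribute nothing, since the later one is independent of all other
  factors.\<close>

lemma increment_covariance_aux:
  assumes a: "0 \<le> a" "a \<le> b" and c: "a \<le> c" "c \<le> d"
    and X: "X \<in> borel_measurable (\<F> a)" "\<And>w. w \<in> space M \<Longrightarrow> \<bar>X w\<bar> \<le> C1"
    and Y: "Y \<in> borel_measurable (\<F> c)" "\<And>w. w \<in> space M \<Longrightarrow> \<bar>Y w\<bar> \<le> C2"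
  shows "expectation (\<lambda>w. (X w * (W b w - W a w)) * (Y w * (W d w - W c w)))
     = expectation (\<lambda>w. X w * Y w) * max 0 (min b d - c)"
proof -
  define Z where "Z w = X w * Y w" for w
  have ZF: "Z \<in> borel_measurable (\<F> c)"
    unfolding Z_def using measurable_\<F>_mono[OF X(1) c(1)] Y(1) by (rule borel_measurable_times)
  have Zb: "\<bar>Z w\<bar> \<le> C1 * C2" if "w \<in> space M" for w
    using X(2)[OF that] Y(2)[OF that] unfolding Z_def abs_mult by (intro mult_mono) auto
  have ZM: "Z \<in> borel_measurable M" using ZF by (rule measurable_\<F>)
  have Zsq: "sq_int M (\<lambda>w. Z w * f w)" if "sq_int M f" for f
    using Zb by (intro sq_int_bounded_mult[OF that ZM, of "C1 * C2"]) (auto intro: AE_I2)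
  have Zi: "integrable M Z"
    using sq_int_finite_integrable[OF finite_measure_axioms sq_int_bounded[OF finite_measure_axioms ZM Zb]] .
  have inc: "(\<lambda>w. W r w - W q w) \<in> borel_measurable (\<F> t)" if "0 \<le> q" "q \<le> t" "0 \<le> r" "r \<le> t" for q r t
    using that by (intro borel_measurable_diff W_measurable_\<F>) auto
  have disj: "expectation (\<lambda>w. Z w * (W r w - W q w) * (W t w - W u w)) = 0"
    if "0 \<le> q" "q \<le> r" "r \<le> u" "c \<le> u" "u \<le> t" for q r u t
  proof (rule expectation_mult_increment)
    show "(\<lambda>w. Z w * (W r w - W q w)) \<in> borel_measurable (\<F> u)"
      using that by (intro borel_measurable_times measurable_\<F>_mono[OF ZF] inc) auto
    show "integrable M (\<lambda>w. Z w * (W r w - W q w))"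
      using that by (intro sq_int_finite_integrable[OF finite_measure_axioms] Zsq increment_moments) auto
  qed (use that in auto)
  have int: "integrable M (\<lambda>w. Z w * (W r w - W q w) * (W t w - W u w))"
    if "0 \<le> q" "q \<le> r" "0 \<le> u" "u \<le> t" for q r t u
    using that by (intro sq_int_mult Zsq increment_moments) auto
  have rew: "(X w * (W b w - W a w)) * (Y w * (W d w - W c w)) = Z w * (W b w - W a w) * (W d w - W c w)" for w
    by (simp add: Z_def)
  show ?thesis
  proof (cases "b \<le> c")
    case True
    then show ?thesis using disj[of a b c d] a c by (simp add: rew)
  next
    case False
    then have bc: "c < b" by simp
    define m where "m = min b d"
    have m: "c \<le> m" "m \<le> b" "m \<le> d" using bc c by (auto simp: m_def)
    have "expectation (\<lambda>w. Z w * (W b w - W a w) * (W d w - W c w))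
       = expectation (\<lambda>w. Z w * (W c w - W a w) * (W d w - W c w) + Z w * (W m w - W c w) * (W m w - W c w)
          + Z w * (W m w - W c w) * (W d w - W m w) + Z w * (W d w - W c w) * (W b w - W m w))"
      by (intro Bochner_Integration.integral_cong) (auto simp: algebra_simps)
    also have "\<dots> = expectation (\<lambda>w. Z w * (W c w - W a w) * (W d w - W c w)) + expectation (\<lambda>w. Z w * (W m w - W c w) * (W m w - W c w))
        + expectation (\<lambda>w. Z w * (W m w - W c w) * (W d w - W m w)) + expectation (\<lambda>w. Z w * (W d w - W c w) * (W b w - W m w))"
      using int[of a c c d] int[of c m c m] int[of c m m d] int[of c d m b] a c m by simp
    also have "expectation (\<lambda>w. Z w * (W d w - W c w) * (W b w - W m w)) = 0"
    proof (cases "b \<le> d")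
      case True
      then have "m = b" by (simp add: m_def)
      then show ?thesis by simp
    next
      case False
      then have "m = d" by (simp add: m_def)
      then show ?thesis using disj[of c d d b] False a c by simp
    qed
    also have "expectation (\<lambda>w. Z w * (W m w - W c w) * (W m w - W c w)) = expectation Z * (m - c)"
      using expectation_mult_increment_square[OF _ _ ZF Zi, of m] a c m by (simp add: power2_eq_square mult.assoc)
    finally show ?thesis
      using disj[of a c c d] disj[of c m m d] a c m by (simp add: rew Z_def[abs_def] m_def)
  qed
qed

lemma increment_covariance:
  assumes a: "0 \<le> a" "a \<le> b" and c: "0 \<le> c" "c \<le> d"
    and X: "X \<in> borel_measurable (\<F> a)" "\<And>w. w \<in> space M \<Longrightarrow> \<bar>X w\<bar> \<le> C1"
    and Y: "Y \<in> borel_measurable (\<F> c)" "\<And>w. w \<in> space M \<Longrightarrow> \<bar>Y w\<bar> \<le> C2"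
  shows "expectation (\<lambda>w. (X w * (W b w - W a w)) * (Y w * (W d w - W c w)))
     = expectation (\<lambda>w. X w * Y w) * max 0 (min b d - max a c)"
proof (cases "a \<le> c")
  case True
  then show ?thesis using increment_covariance_aux[OF a True c(2) X Y] by (simp add: max_def)
next
  case False
  then have "c \<le> a" by simp
  from increment_covariance_aux[OF c this a(2) Y X] show ?thesis
    using False by (simp add: max_def min.commute mult.commute[of "X _ * _"] mult.commute[of "Y _"])
qed

end

section \<open>Covariances of Ito integrals\<close>

abbreviation joint :: "('a \<Rightarrow> 'b \<Rightarrow> 'c) \<Rightarrow> 'a \<times> 'b \<Rightarrow> 'c" where
  "joint f \<equiv> \<lambda>z. f (fst z) (snd z)"

locale brownian_horizon = standard_brownian_motion M W for M :: "'w measure" and W +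
  fixes T :: real
  assumes T: "0 < T"
begin

abbreviation L :: "real measure" where "L \<equiv> lebesgue_on {0..T}"
abbreviation LM :: "(real \<times> 'w) measure" where "LM \<equiv> L \<Otimes>\<^sub>M M"

sublocale L: finite_measure L
  by (rule finite_measure_lebesgue_on) simp

sublocale LM: pair_sigma_finite L M ..

lemma emeasure_space_LM: "emeasure LM (space LM) = ennreal T"
proof -
  have "emeasure LM (space LM) = emeasure L (space L) * emeasure M (space M)"
    unfolding space_pair_measure by (rule emeasure_pair_measure_Times) auto
  then show ?thesis using T by (simp add: emeasure_space_1 emeasure_restrict_space)
qed

sublocale LM: finite_measure LM
  by (rule finite_measureI) (simp add: emeasure_space_LM)

lemma ennreal_tendsto_integral:
  assumes "\<And>k. sq_int N (f k)" "(\<lambda>k. \<integral>\<^sup>+x. ennreal ((f k x)\<^sup>2) \<partial>N) \<longlonglongrightarrow> 0"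
  shows "(\<lambda>k. \<integral>x. (f k x)\<^sup>2 \<partial>N) \<longlonglongrightarrow> 0"
proof -
  have "(\<lambda>k. ennreal (\<integral>x. (f k x)\<^sup>2 \<partial>N)) \<longlonglongrightarrow> ennreal 0"
    using assms(2) sq_int_nn_integral[OF assms(1)] by simp
  then show ?thesis by (subst (asm) tendsto_ennreal_iff) (auto intro!: always_eventually integral_nonneg_AE)
qed

lemma nn_integral_LM:
  assumes "(\<lambda>(s, w). f s w) \<in> borel_measurable LM"
  shows "(\<integral>\<^sup>+w. (\<integral>\<^sup>+s. ennreal ((norm (f s w))\<^sup>2) \<partial>L) \<partial>M) = (\<integral>\<^sup>+z. ennreal ((norm (f (fst z) (snd z)))\<^sup>2) \<partial>LM)"
proof -
  have "(\<lambda>z. ennreal ((norm (f (fst z) (snd z)))\<^sup>2)) \<in> borel_measurable LM"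
    using assms by (simp add: case_prod_unfold)
  from LM.nn_integral_snd[OF this] show ?thesis by simp
qed

lemma L2F_sq_int:
  fixes \<phi> :: "real \<Rightarrow> 'w \<Rightarrow> real"
  assumes "L2F M W T \<phi>"
  shows "sq_int LM (joint \<phi>)"
  using assms nn_integral_LM[of \<phi>]
  unfolding L2F_def sq_int_iff_nn_integral by (auto simp: case_prod_unfold)

lemma integral_LM_product:
  fixes h :: "real \<Rightarrow> real" and k :: "'w \<Rightarrow> real"
  assumes h: "h \<in> borel_measurable L" "\<And>u. \<bar>h u\<bar> \<le> C1" and k: "k \<in> borel_measurable M" "\<And>w. w \<in> space M \<Longrightarrow> \<bar>k w\<bar> \<le> C2"
  shows "sq_int LM (\<lambda>z. h (fst z) * k (snd z))" "integrable LM (\<lambda>z. h (fst z) * k (snd z))"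
    "(\<integral>z. h (fst z) * k (snd z) \<partial>LM) = (\<integral>u. h u \<partial>L) * expectation k"
proof -
  show sq: "sq_int LM (\<lambda>z. h (fst z) * k (snd z))"
  proof (rule sq_int_bounded[OF LM.finite_measure_axioms])
    show "(\<lambda>z. h (fst z) * k (snd z)) \<in> borel_measurable LM"
      using h(1) k(1) by measurable
    fix z assume "z \<in> space LM"
    then have "snd z \<in> space M" by (auto simp: space_pair_measure)
    then show "\<bar>h (fst z) * k (snd z)\<bar> \<le> C1 * C2"
      unfolding abs_mult using h(2)[of "fst z"] k(2)[of "snd z"] by (intro mult_mono) auto
  qed
  then show i: "integrable LM (\<lambda>z. h (fst z) * k (snd z))"
    by (rule sq_int_finite_integrable[OF LM.finite_measure_axioms])
  from LM.integral_fst'[OF i] show "(\<integral>z. h (fst z) * k (snd z) \<partial>LM) = (\<integral>u. h u \<partial>L) * expectation k" by simp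
qed

lemma indicator_measurable_L: "S \<in> sets borel \<Longrightarrow> (\<lambda>u. indicator S u :: real) \<in> borel_measurable L"
  by (intro measurable_restrict_space1 borel_measurable_indicator) (simp add: sets_completionI_sets)

lemma indicator_Ioc_measurable: "(\<lambda>u. indicator {p<..q} u :: real) \<in> borel_measurable L"
  by (rule indicator_measurable_L) simp

lemma indicator_fst_measurable: "S \<in> sets borel \<Longrightarrow> (\<lambda>z. indicator S (fst z) :: real) \<in> borel_measurable LM"
  by (rule measurable_compose[OF measurable_fst indicator_measurable_L])

lemma integral_indicator_Ioc:
  assumes "0 \<le> p" "q \<le> T"
  shows "(\<integral>u. indicator {p<..q} u \<partial>L) = max 0 (q - p)"
proof -
  have "(\<integral>u. indicator {p<..q} u \<partial>L) = measure L ({p<..q} \<inter> space L)"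
    by (rule Bochner_Integration.integral_indicator)
  also have "{p<..q} \<inter> space L = {p<..q}" using assms by auto
  also have "measure L {p<..q} = measure lebesgue {p<..q}"
    using assms by (intro measure_restrict_space) auto
  finally show ?thesis by (cases "p \<le> q") (auto simp: max_def)
qed

context
  fixes N :: nat and \<tau> :: "nat \<Rightarrow> real" and \<xi> :: "nat \<Rightarrow> 'w \<Rightarrow> real"
  assumes simple: "simple_integrand M W T N \<tau> \<xi>"
begin

lemma simple_times: "i \<le> N \<Longrightarrow> 0 \<le> \<tau> i" "i \<le> N \<Longrightarrow> \<tau> i \<le> T" "i < N \<Longrightarrow> \<tau> i \<le> \<tau> (Suc i)"
proof -
  have step: "\<And>i. i < N \<Longrightarrow> \<tau> i \<le> \<tau> (Suc i)" and e: "0 \<le> \<tau> 0" "\<tau> N \<le> T"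
    using simple by (auto simp: simple_integrand_def)
  show "i < N \<Longrightarrow> \<tau> i \<le> \<tau> (Suc i)" by (rule step)
  show "i \<le> N \<Longrightarrow> 0 \<le> \<tau> i"
  proof (induction i)
    case (Suc i) then show ?case using step[of i] by simp
  qed (use e in simp)
  show "i \<le> N \<Longrightarrow> \<tau> i \<le> T"
  proof (induction "N - i" arbitrary: i)
    case 0 then show ?case using e by simp
  next
    case (Suc k)
    then have "\<tau> (Suc i) \<le> T" by (intro Suc.hyps(1)) auto
    moreover have "i < N" using Suc.hyps(2) by simp
    ultimately show ?case using step[of i] by linarith
  qed
qed

lemma simple_weights: "i < N \<Longrightarrow> \<xi> i \<in> borel_measurable (\<F> (\<tau> i))" "i < N \<Longrightarrow> \<xi> i \<in> borel_measurable M"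
  "\<exists>C. \<forall>i<N. \<forall>w\<in>space M. \<bar>\<xi> i w\<bar> \<le> C"
  using simple measurable_\<F> by (auto simp: simple_integrand_def)

lemma simple_process_sq_int: "sq_int LM (\<lambda>z. simple_process N \<tau> \<xi> (fst z) (snd z))"
proof -
  obtain C where C: "\<And>i w. i < N \<Longrightarrow> w \<in> space M \<Longrightarrow> \<bar>\<xi> i w\<bar> \<le> C" using simple_weights(3) by blast
  have "sq_int LM (\<lambda>z. indicator {\<tau> i<..\<tau> (Suc i)} (fst z) * \<xi> i (snd z))" if "i < N" for i
  proof (rule integral_LM_product(1)[where ?C1.0=1 and ?C2.0=C, OF indicator_Ioc_measurable _ simple_weights(2)[OF that]])
    show "\<bar>indicator {\<tau> i<..\<tau> (Suc i)} u :: real\<bar> \<le> 1" for u by (simp add: indicator_def)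
  qed (rule C[OF that])
  then show ?thesis unfolding simple_process_def by (intro sq_int_sum) auto
qed

lemma simple_ito_sq_int:
  assumes t: "0 \<le> t"
  shows "sq_int M (simple_ito W N \<tau> \<xi> t)"
proof -
  obtain C where C: "\<And>i w. i < N \<Longrightarrow> w \<in> space M \<Longrightarrow> \<bar>\<xi> i w\<bar> \<le> C" using simple_weights(3) by blast
  have "sq_int M (\<lambda>w. \<xi> i w * (W (min (\<tau> (Suc i)) t) w - W (min (\<tau> i) t) w))" if i: "i < N" for i
    using C i t simple_times(1)[of i] simple_times(3)[OF i]
    by (intro sq_int_bounded_mult[where C=C] simple_weights increment_moments) (auto intro: AE_I2 min.mono)
  then have "sq_int M (\<lambda>w. \<Sum>i<N. \<xi> i w * (W (min (\<tau> (Suc i)) t) w - W (min (\<tau> i) t) w))"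
    by (intro sq_int_sum) auto
  then show ?thesis by (simp add: simple_ito_def[abs_def] mult.commute)
qed

lemma simple_ito_orthogonal:
  assumes st: "0 \<le> t" "t \<le> s" and Z: "Z \<in> borel_measurable (\<F> t)" "sq_int M Z"
  shows "expectation (\<lambda>w. Z w * (simple_ito W N \<tau> \<xi> s w - simple_ito W N \<tau> \<xi> t w)) = 0"
proof -
  obtain C where C: "\<And>i w. i < N \<Longrightarrow> w \<in> space M \<Longrightarrow> \<bar>\<xi> i w\<bar> \<le> C" using simple_weights(3) by blast
  define a where "a i = max t (min (\<tau> i) s)" for i
  have shift: "W (min x s) w - W (min x t) w = W (max t (min x s)) w - W t w" for x w
    using st by (cases "x \<le> t") (auto simp: min_def max_def)
  have eq: "Z w * (simple_ito W N \<tau> \<xi> s w - simple_ito W N \<tau> \<xi> t w)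
     = (\<Sum>i<N. (\<xi> i w * Z w) * (W (a (Suc i)) w - W (a i) w))" for w
  proof -
    have "simple_ito W N \<tau> \<xi> s w - simple_ito W N \<tau> \<xi> t w
      = (\<Sum>i<N. ((W (min (\<tau> (Suc i)) s) w - W (min (\<tau> (Suc i)) t) w) - (W (min (\<tau> i) s) w - W (min (\<tau> i) t) w)) * \<xi> i w)"
      unfolding simple_ito_def by (simp add: sum_subtractf[symmetric] algebra_simps)
    also have "\<dots> = (\<Sum>i<N. (W (a (Suc i)) w - W (a i) w) * \<xi> i w)"
      unfolding shift a_def by simp
    finally show ?thesis by (simp add: sum_distrib_left mult_ac)
  qed
  have summand: "integrable M (\<lambda>w. (\<xi> i w * Z w) * (W (a (Suc i)) w - W (a i) w))
      \<and> expectation (\<lambda>w. (\<xi> i w * Z w) * (W (a (Suc i)) w - W (a i) w)) = 0" if i: "i < N" for i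
  proof (cases "\<tau> i \<le> s")
    case True
    have a: "0 \<le> a i" "a i \<le> a (Suc i)" "t \<le> a i" "\<tau> i \<le> a i"
      using st simple_times(3)[OF i] True by (auto simp: a_def min_def max_def)
    have sq: "sq_int M (\<lambda>w. \<xi> i w * Z w)"
      using C[OF i] by (intro sq_int_bounded_mult[OF Z(2) simple_weights(2)[OF i], where C=C]) (auto intro: AE_I2)
    have m: "(\<lambda>w. \<xi> i w * Z w) \<in> borel_measurable (\<F> (a i))"
      using a by (intro borel_measurable_times measurable_\<F>_mono[OF simple_weights(1)[OF i]] measurable_\<F>_mono[OF Z(1)]) auto
    show ?thesis
      using sq_int_mult_increment[OF a(1,2) m sq] expectation_mult_increment[OF a(1,2) m]
        sq_int_finite_integrable[OF finite_measure_axioms] sq by blast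
  next
    case False
    then have "a i = a (Suc i)" using simple_times(3)[OF i] by (simp add: a_def min_def)
    then show ?thesis by simp
  qed
  show ?thesis unfolding eq using summand by (subst Bochner_Integration.integral_sum) auto
qed

end

lemma integral_double_sum:
  fixes f :: "'i \<Rightarrow> 'j \<Rightarrow> 'x \<Rightarrow> real"
  assumes "\<And>i j. i \<in> A \<Longrightarrow> j \<in> B \<Longrightarrow> integrable K (f i j)"
  shows "(\<integral>x. (\<Sum>i\<in>A. \<Sum>j\<in>B. f i j x) \<partial>K) = (\<Sum>i\<in>A. \<Sum>j\<in>B. \<integral>x. f i j x \<partial>K)"
proof -
  have "(\<integral>x. (\<Sum>i\<in>A. \<Sum>j\<in>B. f i j x) \<partial>K) = (\<Sum>i\<in>A. \<integral>x. (\<Sum>j\<in>B. f i j x) \<partial>K)"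
    using assms by (intro Bochner_Integration.integral_sum Bochner_Integration.integrable_sum) auto
  also have "\<dots> = (\<Sum>i\<in>A. \<Sum>j\<in>B. \<integral>x. f i j x \<partial>K)"
    using assms by (intro sum.cong refl Bochner_Integration.integral_sum) auto
  finally show ?thesis .
qed

lemma simple_ito_covariance:
  fixes \<xi> \<xi>' :: "nat \<Rightarrow> 'w \<Rightarrow> real"
  assumes simple: "simple_integrand M W T N \<tau> \<xi>" and simple': "simple_integrand M W T N' \<tau>' \<xi>'"
    and s: "0 \<le> s" "s \<le> T" and r: "0 \<le> r" "r \<le> T"
  shows "expectation (\<lambda>w. simple_ito W N \<tau> \<xi> s w * simple_ito W N' \<tau>' \<xi>' r w)
   = (\<integral>z. (indicator {..min s r} (fst z) * simple_process N \<tau> \<xi> (fst z) (snd z)) * simple_process N' \<tau>' \<xi>' (fst z) (snd z) \<partial>LM)"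
proof -
  obtain C where C: "\<And>i w. i < N \<Longrightarrow> w \<in> space M \<Longrightarrow> \<bar>\<xi> i w\<bar> \<le> C" using simple_weights(3)[OF simple] by blast
  obtain C' where C': "\<And>i w. i < N' \<Longrightarrow> w \<in> space M \<Longrightarrow> \<bar>\<xi>' i w\<bar> \<le> C'" using simple_weights(3)[OF simple'] by blast
  define e where "e i j = expectation (\<lambda>w. \<xi> i w * \<xi>' j w)" for i j
  \<comment> \<open>\<open>l i j\<close> is the length of the overlap of the \<open>i\<close>-th and \<open>j\<close>-th intervals up to time \<open>min s r\<close>\<close>
  define l where "l i j = max 0 (min (min (\<tau> (Suc i)) (\<tau>' (Suc j))) (min s r) - max (\<tau> i) (\<tau>' j))" for i j
  define D where "D i w = \<xi> i w * (W (min (\<tau> (Suc i)) s) w - W (min (\<tau> i) s) w)" for i w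
  define D' where "D' j w = \<xi>' j w * (W (min (\<tau>' (Suc j)) r) w - W (min (\<tau>' j) r) w)" for j w
  have Dsq: "sq_int M (D i)" if i: "i < N" for i
    unfolding D_def using C i s simple_times(1)[OF simple, of i] simple_times(3)[OF simple i]
    by (intro sq_int_bounded_mult[where C=C] simple_weights(2)[OF simple] increment_moments) (auto intro: AE_I2 min.mono)
  have D'sq: "sq_int M (D' j)" if j: "j < N'" for j
    unfolding D'_def using C' j r simple_times(1)[OF simple', of j] simple_times(3)[OF simple' j]
    by (intro sq_int_bounded_mult[where C=C'] simple_weights(2)[OF simple'] increment_moments) (auto intro: AE_I2 min.mono)
  have DD: "expectation (\<lambda>w. D i w * D' j w) = e i j * l i j" if ij: "i < N" "j < N'" for i j
  proof (cases "\<tau> i \<le> s \<and> \<tau>' j \<le> r")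
    case True
    note t = simple_times[OF simple, of i] simple_times[OF simple', of j]
    have "expectation (\<lambda>w. D i w * D' j w) = e i j * max 0 (min (min (\<tau> (Suc i)) s) (min (\<tau>' (Suc j)) r) - max (min (\<tau> i) s) (min (\<tau>' j) r))"
      unfolding D_def D'_def e_def
    proof (rule increment_covariance)
      show "\<xi> i \<in> borel_measurable (\<F> (min (\<tau> i) s))" "\<xi>' j \<in> borel_measurable (\<F> (min (\<tau>' j) r))"
        using True simple_weights(1)[OF simple ij(1)] simple_weights(1)[OF simple' ij(2)] by (auto simp: min_def)
      show "\<And>w. w \<in> space M \<Longrightarrow> \<bar>\<xi> i w\<bar> \<le> C" "\<And>w. w \<in> space M \<Longrightarrow> \<bar>\<xi>' j w\<bar> \<le> C'" using C C' ij by auto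
    qed (use t ij s r in \<open>auto simp: min_def\<close>)
    moreover have "max (min (\<tau> i) s) (min (\<tau>' j) r) = max (\<tau> i) (\<tau>' j)" using True by (simp add: min_def)
    moreover have "min (min (\<tau> (Suc i)) s) (min (\<tau>' (Suc j)) r) = min (min (\<tau> (Suc i)) (\<tau>' (Suc j))) (min s r)"
      by (simp add: min.assoc min.left_commute)
    ultimately show ?thesis by (simp add: l_def)
  next
    case False
    then have l: "l i j = 0" unfolding l_def by (auto simp: max_def min_def)
    have z: "D i w * D' j w = 0" for w
      using False simple_times(3)[OF simple ij(1)] simple_times(3)[OF simple' ij(2)] by (auto simp: D_def D'_def min_def)
    show ?thesis by (simp only: z l) simp
  qed
  have "expectation (\<lambda>w. simple_ito W N \<tau> \<xi> s w * simple_ito W N' \<tau>' \<xi>' r w)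
    = expectation (\<lambda>w. \<Sum>i<N. \<Sum>j<N'. D i w * D' j w)"
    by (simp add: simple_ito_def D_def D'_def sum_product mult_ac)
  also have "\<dots> = (\<Sum>i<N. \<Sum>j<N'. expectation (\<lambda>w. D i w * D' j w))"
    by (rule integral_double_sum) (simp add: sq_int_mult Dsq D'sq)
  also have "\<dots> = (\<Sum>i<N. \<Sum>j<N'. e i j * l i j)" by (simp add: DD)
  finally have 1: "expectation (\<lambda>w. simple_ito W N \<tau> \<xi> s w * simple_ito W N' \<tau>' \<xi>' r w) = (\<Sum>i<N. \<Sum>j<N'. e i j * l i j)" .
  define h where "h i j u = (indicator {max (\<tau> i) (\<tau>' j)<..min (min (\<tau> (Suc i)) (\<tau>' (Suc j))) (min s r)} u :: real)" for i j and u :: real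
  define k where "k i j w = \<xi> i w * \<xi>' j w" for i j w
  have hk: "integrable LM (\<lambda>z. h i j (fst z) * k i j (snd z))"
    "(\<integral>z. h i j (fst z) * k i j (snd z) \<partial>LM) = e i j * l i j" if ij: "i < N" "j < N'" for i j
  proof -
    have hm: "h i j \<in> borel_measurable L" unfolding h_def by (rule indicator_Ioc_measurable)
    have hb: "\<bar>h i j u\<bar> \<le> 1" for u by (simp add: h_def indicator_def)
    have km: "k i j \<in> borel_measurable M"
      unfolding k_def using simple_weights(2)[OF simple ij(1)] simple_weights(2)[OF simple' ij(2)] by measurable
    have kb: "\<bar>k i j w\<bar> \<le> C * C'" if "w \<in> space M" for w
      unfolding k_def abs_mult using C[OF ij(1) that] C'[OF ij(2) that] by (intro mult_mono) auto
    show "integrable LM (\<lambda>z. h i j (fst z) * k i j (snd z))" by (rule integral_LM_product(2)[OF hm hb km kb])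
    have "(\<integral>u. h i j u \<partial>L) = l i j"
      unfolding h_def l_def using simple_times(1)[OF simple, of i] ij s by (intro integral_indicator_Ioc) auto
    then show "(\<integral>z. h i j (fst z) * k i j (snd z) \<partial>LM) = e i j * l i j"
      using integral_LM_product(3)[OF hm hb km kb] by (simp add: e_def k_def mult.commute)
  qed
  have "(\<integral>z. (indicator {..min s r} (fst z) * simple_process N \<tau> \<xi> (fst z) (snd z)) * simple_process N' \<tau>' \<xi>' (fst z) (snd z) \<partial>LM)
    = (\<integral>z. (\<Sum>i<N. \<Sum>j<N'. h i j (fst z) * k i j (snd z)) \<partial>LM)"
  proof (rule Bochner_Integration.integral_cong[OF refl])
    fix z
    have hh: "indicator {..min s r} u * (indicator {\<tau> i<..\<tau> (Suc i)} u * indicator {\<tau>' j<..\<tau>' (Suc j)} u) = h i j u" for i j and u :: real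
      by (auto simp: h_def indicator_def)
    have ind: "indicator {..min s r} u * ((indicator {\<tau> i<..\<tau> (Suc i)} u * x) * (indicator {\<tau>' j<..\<tau>' (Suc j)} u * y)) = h i j u * (x * y)"
      for i j and u x y :: real unfolding hh[symmetric] by (simp only: mult_ac)
    have prod: "(c * (\<Sum>i<N. a i)) * (\<Sum>j<N'. b j) = (\<Sum>i<N. \<Sum>j<N'. c * (a i * b j))" for c :: real and a b
    proof -
      have "(c * (\<Sum>i<N. a i)) * (\<Sum>j<N'. b j) = (\<Sum>i<N. c * a i) * (\<Sum>j<N'. b j)"
        by (simp only: sum_distrib_left)
      also have "\<dots> = (\<Sum>i<N. \<Sum>j<N'. (c * a i) * b j)" by (rule sum_product)
      finally show ?thesis by (simp only: mult.assoc)
    qed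
    show "(indicator {..min s r} (fst z) * simple_process N \<tau> \<xi> (fst z) (snd z)) * simple_process N' \<tau>' \<xi>' (fst z) (snd z)
       = (\<Sum>i<N. \<Sum>j<N'. h i j (fst z) * k i j (snd z))"
      unfolding simple_process_def real_scaleR_def prod ind k_def ..
  qed
  also have "\<dots> = (\<Sum>i<N. \<Sum>j<N'. e i j * l i j)"
    by (subst integral_double_sum) (use hk in auto)
  finally show ?thesis using 1 by simp
qed

lemma has_ito_approximation:
  fixes \<phi> I :: "real \<Rightarrow> 'w \<Rightarrow> real"
  assumes "has_ito_integral M W T \<phi> I"
  obtains N \<tau> \<xi> where "\<And>k. simple_integrand M W T (N k) (\<tau> k) (\<xi> k)"
    "(\<lambda>k. \<integral>z. (\<phi> (fst z) (snd z) - simple_process (N k) (\<tau> k) (\<xi> k) (fst z) (snd z))\<^sup>2 \<partial>LM) \<longlonglongrightarrow> 0"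
    "\<And>t. 0 \<le> t \<Longrightarrow> t \<le> T \<Longrightarrow> sq_int M (I t)"
    "\<And>t. 0 \<le> t \<Longrightarrow> t \<le> T \<Longrightarrow> (\<lambda>k. \<integral>w. (I t w - simple_ito W (N k) (\<tau> k) (\<xi> k) t w)\<^sup>2 \<partial>M) \<longlonglongrightarrow> 0"
proof -
  obtain N \<tau> \<xi> where s: "\<And>k. simple_integrand M W T (N k) (\<tau> k) (\<xi> k)"
    and p: "(\<lambda>k. \<integral>\<^sup>+w. (\<integral>\<^sup>+s. ennreal ((norm (\<phi> s w - simple_process (N k) (\<tau> k) (\<xi> k) s w))\<^sup>2) \<partial>L) \<partial>M) \<longlonglongrightarrow> 0"
    and i: "\<And>t. t \<in> {0..T} \<Longrightarrow> (\<lambda>k. \<integral>\<^sup>+w. ennreal ((norm (I t w - simple_ito W (N k) (\<tau> k) (\<xi> k) t w))\<^sup>2) \<partial>M) \<longlonglongrightarrow> 0"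
    using assms unfolding has_ito_integral_def by blast
  have phi: "sq_int LM (joint \<phi>)" using assms L2F_sq_int by (simp add: has_ito_integral_def)
  have d: "sq_int LM (\<lambda>z. \<phi> (fst z) (snd z) - simple_process (N k) (\<tau> k) (\<xi> k) (fst z) (snd z))" for k
    by (intro sq_int_diff phi simple_process_sq_int s)
  have "(\<lambda>k. \<integral>z. (\<phi> (fst z) (snd z) - simple_process (N k) (\<tau> k) (\<xi> k) (fst z) (snd z))\<^sup>2 \<partial>LM) \<longlonglongrightarrow> 0"
  proof (rule ennreal_tendsto_integral[OF d])
    have "(\<integral>\<^sup>+w. (\<integral>\<^sup>+s. ennreal ((norm (\<phi> s w - simple_process (N k) (\<tau> k) (\<xi> k) s w))\<^sup>2) \<partial>L) \<partial>M)
      = (\<integral>\<^sup>+z. ennreal ((norm (\<phi> (fst z) (snd z) - simple_process (N k) (\<tau> k) (\<xi> k) (fst z) (snd z)))\<^sup>2) \<partial>LM)" for k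
      using d[of k] by (intro nn_integral_LM) (simp add: sq_int_def case_prod_unfold)
    then show "(\<lambda>k. \<integral>\<^sup>+z. ennreal ((\<phi> (fst z) (snd z) - simple_process (N k) (\<tau> k) (\<xi> k) (fst z) (snd z))\<^sup>2) \<partial>LM) \<longlonglongrightarrow> 0"
      using p by simp
  qed
  moreover have Isq: "sq_int M (I t)" if t: "0 \<le> t" "t \<le> T" for t
  proof -
    have m: "I t \<in> borel_measurable M" using assms t by (simp add: has_ito_integral_def)
    have "\<forall>\<^sub>F k in sequentially. (\<integral>\<^sup>+w. ennreal ((norm (I t w - simple_ito W (N k) (\<tau> k) (\<xi> k) t w))\<^sup>2) \<partial>M) < 1"
      using i[of t] t by (intro order_tendstoD(2)[of _ 0]) auto
    then obtain k where k: "(\<integral>\<^sup>+w. ennreal ((norm (I t w - simple_ito W (N k) (\<tau> k) (\<xi> k) t w))\<^sup>2) \<partial>M) < 1"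
      by (auto simp: eventually_sequentially)
    note sk = simple_ito_sq_int[OF s[of k] t(1)]
    have "sq_int M (\<lambda>w. I t w - simple_ito W (N k) (\<tau> k) (\<xi> k) t w)"
      using k m sk unfolding sq_int_iff_nn_integral by (auto intro: order.strict_trans simp: ennreal_one_less_top)
    from sq_int_add[OF this sk] show ?thesis by simp
  qed
  moreover have "(\<lambda>k. \<integral>w. (I t w - simple_ito W (N k) (\<tau> k) (\<xi> k) t w)\<^sup>2 \<partial>M) \<longlonglongrightarrow> 0" if t: "0 \<le> t" "t \<le> T" for t
    using i[of t] t by (intro ennreal_tendsto_integral sq_int_diff Isq simple_ito_sq_int s) auto
  ultimately show thesis using that s by blast
qed

lemma ito_sq_int:
  fixes \<phi> I :: "real \<Rightarrow> 'w \<Rightarrow> real"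
  assumes "has_ito_integral M W T \<phi> I" "0 \<le> t" "t \<le> T"
  shows "sq_int M (I t)"
  by (rule has_ito_approximation[OF assms(1)]) (use assms(2,3) in blast)

text \<open>The Ito isometry in polarized form, for integrals up to different times; it passes to the limit from
  simple processes.\<close>

lemma ito_covariance:
  fixes \<phi> \<psi> I J :: "real \<Rightarrow> 'w \<Rightarrow> real"
  assumes I: "has_ito_integral M W T \<phi> I" and J: "has_ito_integral M W T \<psi> J"
    and s: "0 \<le> s" "s \<le> T" and r: "0 \<le> r" "r \<le> T"
  shows "expectation (\<lambda>w. I s w * J r w)
    = (\<integral>z. (indicator {..min s r} (fst z) * \<phi> (fst z) (snd z)) * \<psi> (fst z) (snd z) \<partial>LM)"
proof -
  obtain N \<tau> \<xi> where a: "\<And>k. simple_integrand M W T (N k) (\<tau> k) (\<xi> k)"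
    "(\<lambda>k. \<integral>z. (\<phi> (fst z) (snd z) - simple_process (N k) (\<tau> k) (\<xi> k) (fst z) (snd z))\<^sup>2 \<partial>LM) \<longlonglongrightarrow> 0"
    "\<And>t. 0 \<le> t \<Longrightarrow> t \<le> T \<Longrightarrow> sq_int M (I t)"
    "\<And>t. 0 \<le> t \<Longrightarrow> t \<le> T \<Longrightarrow> (\<lambda>k. \<integral>w. (I t w - simple_ito W (N k) (\<tau> k) (\<xi> k) t w)\<^sup>2 \<partial>M) \<longlonglongrightarrow> 0"
    by (rule has_ito_approximation[OF I]) blast
  obtain N' \<tau>' \<xi>' where b: "\<And>k. simple_integrand M W T (N' k) (\<tau>' k) (\<xi>' k)"
    "(\<lambda>k. \<integral>z. (\<psi> (fst z) (snd z) - simple_process (N' k) (\<tau>' k) (\<xi>' k) (fst z) (snd z))\<^sup>2 \<partial>LM) \<longlonglongrightarrow> 0"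
    "\<And>t. 0 \<le> t \<Longrightarrow> t \<le> T \<Longrightarrow> sq_int M (J t)"
    "\<And>t. 0 \<le> t \<Longrightarrow> t \<le> T \<Longrightarrow> (\<lambda>k. \<integral>w. (J t w - simple_ito W (N' k) (\<tau>' k) (\<xi>' k) t w)\<^sup>2 \<partial>M) \<longlonglongrightarrow> 0"
    by (rule has_ito_approximation[OF J]) blast
  have phi: "sq_int LM (joint \<phi>)" and psi: "sq_int LM (joint \<psi>)"
    using I J L2F_sq_int by (simp_all add: has_ito_integral_def)
  have ind: "sq_int LM (\<lambda>z. indicator {..min s r} (fst z) * f z)" if "sq_int LM f" for f
    by (rule sq_int_bounded_mult[OF that indicator_fst_measurable, where C=1]) (auto simp: indicator_def)
  have 1: "(\<lambda>k. expectation (\<lambda>w. simple_ito W (N k) (\<tau> k) (\<xi> k) s w * simple_ito W (N' k) (\<tau>' k) (\<xi>' k) r w))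
     \<longlonglongrightarrow> expectation (\<lambda>w. I s w * J r w)"
    using s r by (intro tendsto_integral_mult simple_ito_sq_int a b) auto
  have lim: "(\<lambda>k. \<integral>z. (indicator {..min s r} (fst z) * \<phi> (fst z) (snd z) - indicator {..min s r} (fst z) * simple_process (N k) (\<tau> k) (\<xi> k) (fst z) (snd z))\<^sup>2 \<partial>LM) \<longlonglongrightarrow> 0"
  proof (rule tendsto_sandwich[OF _ _ tendsto_const a(2)])
    have "(\<integral>z. (indicator {..min s r} (fst z) * \<phi> (fst z) (snd z) - indicator {..min s r} (fst z) * simple_process (N k) (\<tau> k) (\<xi> k) (fst z) (snd z))\<^sup>2 \<partial>LM)
      \<le> (\<integral>z. (\<phi> (fst z) (snd z) - simple_process (N k) (\<tau> k) (\<xi> k) (fst z) (snd z))\<^sup>2 \<partial>LM)" for k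
      using sq_int_diff[OF phi simple_process_sq_int[OF a(1)[of k]]] sq_int_diff[OF ind[OF phi] ind[OF simple_process_sq_int[OF a(1)[of k]]]]
      by (intro integral_mono) (auto simp: sq_int_def indicator_def)
    then show "\<forall>\<^sub>F k in sequentially. (\<integral>z. (indicator {..min s r} (fst z) * \<phi> (fst z) (snd z) - indicator {..min s r} (fst z) * simple_process (N k) (\<tau> k) (\<xi> k) (fst z) (snd z))\<^sup>2 \<partial>LM)
      \<le> (\<integral>z. (\<phi> (fst z) (snd z) - simple_process (N k) (\<tau> k) (\<xi> k) (fst z) (snd z))\<^sup>2 \<partial>LM)" by simp
  qed (auto intro!: always_eventually integral_nonneg_AE)
  have 2: "(\<lambda>k. \<integral>z. (indicator {..min s r} (fst z) * simple_process (N k) (\<tau> k) (\<xi> k) (fst z) (snd z)) * simple_process (N' k) (\<tau>' k) (\<xi>' k) (fst z) (snd z) \<partial>LM)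
     \<longlonglongrightarrow> (\<integral>z. (indicator {..min s r} (fst z) * \<phi> (fst z) (snd z)) * \<psi> (fst z) (snd z) \<partial>LM)"
    by (intro tendsto_integral_mult ind phi psi simple_process_sq_int a b lim)
  show ?thesis
    using LIMSEQ_unique[OF 1 2[folded simple_ito_covariance[OF a(1) b(1) s r]]] .
qed

text \<open>The martingale property, tested against square-integrable variables of the past.\<close>

lemma ito_orthogonal:
  fixes \<phi> I :: "real \<Rightarrow> 'w \<Rightarrow> real"
  assumes I: "has_ito_integral M W T \<phi> I" and st: "0 \<le> t" "t \<le> s" "s \<le> T"
    and Z: "Z \<in> borel_measurable (\<F> t)" "sq_int M Z"
  shows "expectation (\<lambda>w. Z w * (I s w - I t w)) = 0"
proof -
  obtain N \<tau> \<xi> where a: "\<And>k. simple_integrand M W T (N k) (\<tau> k) (\<xi> k)"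
    "(\<lambda>k. \<integral>z. (\<phi> (fst z) (snd z) - simple_process (N k) (\<tau> k) (\<xi> k) (fst z) (snd z))\<^sup>2 \<partial>LM) \<longlonglongrightarrow> 0"
    "\<And>t. 0 \<le> t \<Longrightarrow> t \<le> T \<Longrightarrow> sq_int M (I t)"
    "\<And>t. 0 \<le> t \<Longrightarrow> t \<le> T \<Longrightarrow> (\<lambda>k. \<integral>w. (I t w - simple_ito W (N k) (\<tau> k) (\<xi> k) t w)\<^sup>2 \<partial>M) \<longlonglongrightarrow> 0"
    by (rule has_ito_approximation[OF I]) blast
  have lim: "(\<lambda>k. expectation (\<lambda>w. Z w * simple_ito W (N k) (\<tau> k) (\<xi> k) u w)) \<longlonglongrightarrow> expectation (\<lambda>w. Z w * I u w)"
    if "0 \<le> u" "u \<le> T" for u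
    using that by (intro tendsto_integral_mult simple_ito_sq_int a Z) auto
  have split: "expectation (\<lambda>w. Z w * (f w - g w)) = expectation (\<lambda>w. Z w * f w) - expectation (\<lambda>w. Z w * g w)"
    if "sq_int M f" "sq_int M g" for f g
    using sq_int_mult[OF Z(2) that(1)] sq_int_mult[OF Z(2) that(2)] by (simp add: right_diff_distrib)
  have "(\<lambda>k. expectation (\<lambda>w. Z w * (simple_ito W (N k) (\<tau> k) (\<xi> k) s w - simple_ito W (N k) (\<tau> k) (\<xi> k) t w))) \<longlonglongrightarrow> expectation (\<lambda>w. Z w * (I s w - I t w))"
    using st by (simp add: split a simple_ito_sq_int[OF a(1)]) (intro tendsto_diff lim; simp)
  then show ?thesis
    using simple_ito_orthogonal[OF a(1) st(1,2) Z] by (simp add: LIMSEQ_const_iff)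
qed

end

section \<open>Time integrals and integration by parts\<close>

context brownian_horizon
begin

text \<open>The half-open interval makes the integrals additive under subdivision without
  exceptional points and matches the intervals of simple processes.\<close>

definition IL :: "real \<Rightarrow> real \<Rightarrow> (real \<Rightarrow> real) \<Rightarrow> real" where
  "IL t r f = (\<integral>s. indicator {t<..r} s * f s \<partial>L)"

lemma emeasure_space_L: "emeasure L (space L) < \<top>"
  using T by (simp add: emeasure_restrict_space)

lemma integrable_L_iff: "integrable L f \<longleftrightarrow> f absolutely_integrable_on {0..T}"
  for f :: "real \<Rightarrow> 'x::euclidean_space"
  unfolding set_integrable_def by (rule integrable_restrict_space) simp

lemma integrable_L_bounded_mult:
  assumes f: "integrable L f" and h: "h \<in> borel_measurable L" and C: "\<And>s. s \<in> {0..T} \<Longrightarrow> \<bar>h s\<bar> \<le> C"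
  shows "integrable L (\<lambda>s. h s * f s :: real)"
proof (rule Bochner_Integration.integrable_bound)
  show "integrable L (\<lambda>s. C * f s)" using f by simp
  show "(\<lambda>s. h s * f s) \<in> borel_measurable L" using f h by auto
  show "AE s in L. norm (h s * f s) \<le> norm (C * f s)"
  proof (rule AE_I2)
    fix s assume "s \<in> space L"
    then have "\<bar>h s\<bar> \<le> \<bar>C\<bar>" using C[of s] by simp
    then show "norm (h s * f s) \<le> norm (C * f s)" by (simp add: abs_mult mult_right_mono)
  qed
qed

lemma integrable_IL: "integrable L f \<Longrightarrow> integrable L (\<lambda>s. indicator {t<..r} s * f s :: real)"
  by (rule integrable_L_bounded_mult[OF _ indicator_Ioc_measurable, where C=1]) (auto simp: indicator_def)

lemma IL_eq_integral:
  assumes f: "integrable L f" and t: "0 \<le> t" "t \<le> r" "r \<le> T"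
  shows "IL t r f = integral {t..r} f"
proof -
  have fa: "f absolutely_integrable_on {t..r}"
    using f t unfolding integrable_L_iff by (auto intro: absolutely_integrable_on_subinterval)
  have "IL t r f = (\<integral>s. indicator {0..T} s *\<^sub>R (indicator {t<..r} s * f s) \<partial>lebesgue)"
    unfolding IL_def by (rule integral_restrict_space) simp
  also have "\<dots> = (\<integral>s. indicator {t..r} s *\<^sub>R f s \<partial>lebesgue)"
  proof (rule integral_cong_AE)
    show "(\<lambda>s. indicator {0..T} s *\<^sub>R (indicator {t<..r} s * f s)) \<in> borel_measurable lebesgue"
      using integrable_IL[OF f, of t r] integrable_restrict_space[of "{0..T}" lebesgue "\<lambda>s. indicator {t<..r} s * f s"]
      by (auto dest: borel_measurable_integrable)
    show "(\<lambda>s. indicator {t..r} s *\<^sub>R f s) \<in> borel_measurable lebesgue"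
      using fa by (auto simp: set_integrable_def dest: borel_measurable_integrable)
    have "AE s in lebesgue. s \<notin> {t}" by (intro AE_not_in) (simp add: negligible_iff_null_sets[symmetric])
    then show "AE s in lebesgue. indicator {0..T} s *\<^sub>R (indicator {t<..r} s * f s) = indicator {t..r} s *\<^sub>R f s"
      by eventually_elim (use t in \<open>auto simp: indicator_def\<close>)
  qed
  also have "\<dots> = integral {t..r} f"
    using set_lebesgue_integral_eq_integral(2)[OF fa] by (simp add: set_lebesgue_integral_def)
  finally show ?thesis .
qed

lemma IL_le: "integrable L f \<Longrightarrow> \<bar>IL t r f\<bar> \<le> (\<integral>s. \<bar>f s\<bar> \<partial>L)"
  unfolding IL_def
proof -
  assume f: "integrable L f"
  have "\<bar>\<integral>s. indicator {t<..r} s * f s \<partial>L\<bar> \<le> (\<integral>s. \<bar>indicator {t<..r} s * f s\<bar> \<partial>L)" by (rule integral_abs_bound)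
  also have "\<dots> \<le> (\<integral>s. \<bar>f s\<bar> \<partial>L)"
    using f integrable_IL[OF f, of t r] by (intro integral_mono) (auto simp: indicator_def)
  finally show "\<bar>\<integral>s. indicator {t<..r} s * f s \<partial>L\<bar> \<le> (\<integral>s. \<bar>f s\<bar> \<partial>L)" .
qed

lemma IL_measurable:
  assumes "f \<in> borel_measurable L"
  shows "(\<lambda>s. IL s r f) \<in> borel_measurable L"
proof -
  have id: "(\<lambda>u. u) \<in> borel_measurable L" by (intro measurable_restrict_space1 borel_measurable_lebesgue_continuous continuous_on_id)
  have 1: "(\<lambda>z. fst z) \<in> borel_measurable (L \<Otimes>\<^sub>M L)" "(\<lambda>z. snd z) \<in> borel_measurable (L \<Otimes>\<^sub>M L)"
    by (rule measurable_compose[OF measurable_fst id] measurable_compose[OF measurable_snd id])+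
  have 2: "(\<lambda>z. f (snd z)) \<in> borel_measurable (L \<Otimes>\<^sub>M L)" by (rule measurable_compose[OF measurable_snd assms])
  have "(\<lambda>z. if fst z < snd z \<and> snd z \<le> r then f (snd z) else 0) \<in> borel_measurable (L \<Otimes>\<^sub>M L)"
    using 1 2 by measurable
  moreover have "(\<lambda>z. if fst z < snd z \<and> snd z \<le> r then f (snd z) else 0) = (\<lambda>(s, u). indicator {s<..r} u * f u)"
    by (auto simp: fun_eq_iff indicator_def)
  ultimately have "(\<lambda>(s, u). indicator {s<..r} u * f u) \<in> borel_measurable (L \<Otimes>\<^sub>M L)" by simp
  then show ?thesis unfolding IL_def by (rule L.borel_measurable_lebesgue_integral)
qed

text \<open>Integration by parts, with the boundary terms arranged so that only increments up to the right
  end point appear.\<close>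

lemma IL_by_parts:
  assumes p: "primitive_on 0 T p p'" and bp: "bounded_measurable p'" and g: "integrable L g"
    and t: "0 \<le> t" "t \<le> r" "r \<le> T"
  shows "p t * IL t r g + IL t r (\<lambda>s. p' s * IL s r g) = IL t r (\<lambda>s. p s * g s)"
    "integrable L (\<lambda>s. p' s * IL s r g)" "integrable L (\<lambda>s. p s * g s)"
proof -
  have cp: "continuous_on {0..T} p" using primitive_on_continuous[OF p] .
  obtain C where C: "\<And>s. s \<in> {0..T} \<Longrightarrow> \<bar>p s\<bar> \<le> C"
    using compact_imp_bounded[OF compact_continuous_image[OF cp compact_Icc]] unfolding bounded_iff real_norm_def by blast
  obtain C' where C': "\<And>s. \<bar>p' s\<bar> \<le> C'" using bp unfolding bounded_measurable_def bounded_iff by auto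
  show i2: "integrable L (\<lambda>s. p s * g s)"
    by (rule integrable_L_bounded_mult[OF g _ C]) (use cp in \<open>auto intro: continuous_imp_measurable_on_sets_lebesgue\<close>)
  have q: "integrable L (\<lambda>s. IL s r g)"
    by (rule L.integrable_const_bound[where B="\<integral>s. \<bar>g s\<bar> \<partial>L"])
      (use IL_le[OF g] IL_measurable g in auto)
  show i1: "integrable L (\<lambda>s. p' s * IL s r g)"
    by (rule integrable_L_bounded_mult[OF q _ C']) (use bp in \<open>auto simp: bounded_measurable_def intro: measurable_restrict_space1\<close>)
  define G where "G s = integral {s..r} g" for s
  have ga: "g absolutely_integrable_on {0..T}" using g by (simp add: integrable_L_iff)
  then have gi: "g integrable_on {0..T}" using set_lebesgue_integral_eq_integral(1) by blast
  have "primitive_on t r (\<lambda>s. integral {t..s} g) g"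
  proof (rule primitive_onI[where y=0])
    show "g absolutely_integrable_on {t..r}" using ga t by (auto intro: absolutely_integrable_on_subinterval)
  qed simp
  from primitive_on_minus[OF this]
  have "primitive_on t r (\<lambda>s. - integral {t..s} g) (\<lambda>s. - g s)" .
  moreover have "primitive_on t r (\<lambda>s. integral {t..r} g) (\<lambda>s. 0)"
    unfolding primitive_on_def by (auto simp: set_integrable_def)
  ultimately have "primitive_on t r (\<lambda>s. integral {t..r} g + - integral {t..s} g) (\<lambda>s. 0 + - g s)"
    by (intro primitive_on_add)
  then have "primitive_on t r (\<lambda>s. integral {t..r} g + - integral {t..s} g) (\<lambda>s. - g s)" by simp
  then have prG: "primitive_on t r G (\<lambda>s. - g s)"
  proof (rule primitive_on_cong)
    fix s assume s: "s \<in> {t..r}"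
    have "integral {t..s} g + integral {s..r} g = integral {t..r} g"
      using s t by (intro Henstock_Kurzweil_Integration.integral_combine integrable_subinterval_real[OF gi]) auto
    then show "integral {t..r} g + - integral {t..s} g = G s" by (simp add: G_def)
  qed
  have pr: "primitive_on t r (\<lambda>s. p s * G s) (\<lambda>s. p s * (- g s) + p' s * G s)"
    by (rule primitive_on_bilinear[OF bounded_bilinear_mult primitive_on_subset[OF p t(1,3)] prG])
  have GI: "G s = IL s r g" if "s \<in> {t..r}" for s
    using IL_eq_integral[OF g, of s r] that t by (simp add: G_def)
  have "p r * G r - p t * G t = integral {t..r} (\<lambda>s. p s * (- g s) + p' s * G s)"
    using primitive_on_diff[OF pr, of t r] t by simp
  also have "\<dots> = integral {t..r} (\<lambda>s. p' s * IL s r g - p s * g s)"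
    by (rule integral_cong) (simp add: GI)
  also have "\<dots> = integral {t..r} (\<lambda>s. p' s * IL s r g) - integral {t..r} (\<lambda>s. p s * g s)"
  proof (rule integral_diff)
    show "(\<lambda>s. p' s * IL s r g) integrable_on {t..r}" "(\<lambda>s. p s * g s) integrable_on {t..r}"
      using i1 i2 t unfolding integrable_L_iff
      by (auto intro: integrable_subinterval_real dest!: set_lebesgue_integral_eq_integral(1))
  qed
  also have "\<dots> = IL t r (\<lambda>s. p' s * IL s r g) - IL t r (\<lambda>s. p s * g s)"
    using IL_eq_integral[OF i1 t] IL_eq_integral[OF i2 t] by simp
  finally show "p t * IL t r g + IL t r (\<lambda>s. p' s * IL s r g) = IL t r (\<lambda>s. p s * g s)"
    using t by (simp add: GI[symmetric]) (simp add: G_def)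
qed

lemma AE_section_sq_int:
  assumes "sq_int LM (joint f)"
  shows "AE w in M. sq_int L (\<lambda>s. f s w)" "AE s in L. sq_int M (\<lambda>w. f s w)"
proof -
  have m: "(joint f) \<in> borel_measurable LM" using assms by (simp add: sq_int_def)
  have i: "integrable LM (\<lambda>(s, w). (f s w)\<^sup>2)" using assms by (simp add: sq_int_def case_prod_unfold)
  have "AE w in M. integrable L (\<lambda>s. (f s w)\<^sup>2)" using LM.AE_integrable_snd[OF i] .
  then show "AE w in M. sq_int L (\<lambda>s. f s w)"
    using AE_space
  proof eventually_elim
    case (elim w)
    have "(\<lambda>s. f s w) \<in> borel_measurable L"
      using measurable_compose[OF measurable_Pair2'[OF elim(2), of L] m] by simp
    then show ?case using elim by (simp add: sq_int_def)
  qed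
  have "AE s in L. integrable M (\<lambda>w. (f s w)\<^sup>2)" using LM.AE_integrable_fst[OF i] .
  then show "AE s in L. sq_int M (\<lambda>w. f s w)"
    using AE_space
  proof eventually_elim
    case (elim s)
    have "(\<lambda>w. f s w) \<in> borel_measurable M"
      using measurable_compose[OF measurable_Pair1'[OF elim(2), of M] m] by simp
    then show ?case using elim by (simp add: sq_int_def)
  qed
qed

lemma time_integral_measurable:
  fixes f :: "real \<Rightarrow> 'w \<Rightarrow> real"
  assumes "(joint f) \<in> borel_measurable LM"
  shows "(\<lambda>w. \<integral>s. f s w \<partial>L) \<in> borel_measurable M"
proof -
  have "(\<lambda>(w, s). f s w) \<in> borel_measurable (M \<Otimes>\<^sub>M L)"
    using measurable_pair_swap[OF assms] by (simp add: case_prod_unfold)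
  then show ?thesis by (rule L.borel_measurable_lebesgue_integral)
qed

lemma sq_int_indicator: "sq_int LM f \<Longrightarrow> S \<in> sets borel \<Longrightarrow> sq_int LM (\<lambda>z. indicator S (fst z) * f z)"
  by (rule sq_int_bounded_mult[OF _ indicator_fst_measurable, where C=1]) (auto simp: indicator_def)

lemma sq_int_bounded_time:
  assumes "sq_int LM f" "h \<in> borel_measurable L" "\<And>s. s \<in> {0..T} \<Longrightarrow> \<bar>h s\<bar> \<le> C"
  shows "sq_int LM (\<lambda>z. h (fst z) * f z)"
  using assms by (intro sq_int_bounded_mult[where C=C] measurable_compose[OF measurable_fst])
    (auto simp: space_pair_measure intro!: AE_I2)

text \<open>Cauchy-Schwarz in time produces the factor \<open>r - t\<close> that makes short intervals contractive.\<close>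

lemma time_integral_bound:
  assumes f: "sq_int LM (joint f)" and t: "0 \<le> t" "t \<le> r" "r \<le> T"
  shows "sq_int M (\<lambda>w. IL t r (\<lambda>s. f s w))"
    "expectation (\<lambda>w. (IL t r (\<lambda>s. f s w))\<^sup>2) \<le> (r - t) * (\<integral>z. indicator {t<..r} (fst z) * (f (fst z) (snd z))\<^sup>2 \<partial>LM)"
proof -
  define g where "g s w = indicator {t<..r} s * f s w" for s w
  have g: "sq_int LM (joint g)" unfolding g_def using f by (rule sq_int_indicator) simp
  have g2: "(g s w)\<^sup>2 = indicator {t<..r} s * (f s w)\<^sup>2" for s w by (simp add: g_def indicator_def)
  have ind: "sq_int L (\<lambda>s. indicator {t<..r} s)"
    by (rule sq_int_bounded[OF L.finite_measure_axioms indicator_Ioc_measurable, where C=1]) (simp add: indicator_def)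
  have ind2: "(\<integral>s. (indicator {t<..r} s :: real)\<^sup>2 \<partial>L) = r - t"
  proof -
    have "(\<lambda>s. (indicator {t<..r} s :: real)\<^sup>2) = indicator {t<..r}" by (auto simp: fun_eq_iff indicator_def)
    then show ?thesis using integral_indicator_Ioc[of t r] t by (simp add: max_def)
  qed
  have ILg: "IL t r (\<lambda>s. f s w) = (\<integral>s. g s w \<partial>L)" for w by (simp add: IL_def g_def)
  have bound: "AE w in M. (IL t r (\<lambda>s. f s w))\<^sup>2 \<le> (r - t) * (\<integral>s. (g s w)\<^sup>2 \<partial>L)"
    using AE_section_sq_int(1)[OF g]
  proof eventually_elim
    case (elim w)
    have "(\<integral>s. indicator {t<..r} s * g s w \<partial>L)\<^sup>2 \<le> (r - t) * (\<integral>s. (g s w)\<^sup>2 \<partial>L)"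
      using integral_Cauchy_Schwarz[OF ind elim] unfolding ind2 .
    moreover have "(\<lambda>s. indicator {t<..r} s * g s w) = (\<lambda>s. g s w)" by (auto simp: fun_eq_iff g_def indicator_def)
    ultimately show ?case by (simp add: ILg)
  qed
  have i: "integrable LM (\<lambda>(s, w). (g s w)\<^sup>2)" using g by (simp add: sq_int_def case_prod_unfold)
  have iM: "integrable M (\<lambda>w. (r - t) * (\<integral>s. (g s w)\<^sup>2 \<partial>L))"
    using LM.integrable_snd[OF i] by simp
  have m: "(\<lambda>w. IL t r (\<lambda>s. f s w)) \<in> borel_measurable M"
    unfolding ILg using g by (intro time_integral_measurable) (simp add: sq_int_def)
  have iI: "integrable M (\<lambda>w. (IL t r (\<lambda>s. f s w))\<^sup>2)"
  proof (rule Bochner_Integration.integrable_bound[OF iM])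
    show "AE w in M. norm ((IL t r (\<lambda>s. f s w))\<^sup>2) \<le> norm ((r - t) * (\<integral>s. (g s w)\<^sup>2 \<partial>L))"
      using bound by eventually_elim simp
  qed (use m in simp)
  then show "sq_int M (\<lambda>w. IL t r (\<lambda>s. f s w))" using m by (simp add: sq_int_def)
  have "expectation (\<lambda>w. (IL t r (\<lambda>s. f s w))\<^sup>2) \<le> expectation (\<lambda>w. (r - t) * (\<integral>s. (g s w)\<^sup>2 \<partial>L))"
    by (rule integral_mono_AE[OF iI iM bound])
  also have "\<dots> = (r - t) * (\<integral>z. (g (fst z) (snd z))\<^sup>2 \<partial>LM)"
    using LM.integral_snd[OF i] by (simp add: case_prod_unfold)
  finally show "expectation (\<lambda>w. (IL t r (\<lambda>s. f s w))\<^sup>2) \<le> (r - t) * (\<integral>z. indicator {t<..r} (fst z) * (f (fst z) (snd z))\<^sup>2 \<partial>LM)"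
    by (simp add: g2)
qed

lemma sq_int_snd: "sq_int M H \<Longrightarrow> sq_int LM (\<lambda>z. H (snd z))"
proof -
  assume H: "sq_int M H"
  have m: "(\<lambda>z. H (snd z)) \<in> borel_measurable LM" using H by (intro measurable_compose[OF measurable_snd]) (simp add: sq_int_def)
  have "(\<integral>\<^sup>+z. ennreal ((H (snd z))\<^sup>2) \<partial>LM) = (\<integral>\<^sup>+w. (\<integral>\<^sup>+s. ennreal ((H w)\<^sup>2) \<partial>L) \<partial>M)"
    using LM.nn_integral_snd[of "\<lambda>z. ennreal ((H (snd z))\<^sup>2)"] m by simp
  also have "\<dots> = (\<integral>\<^sup>+w. ennreal ((H w)\<^sup>2) * emeasure L (space L) \<partial>M)" by (simp add: nn_integral_const)
  also have "\<dots> = (\<integral>\<^sup>+w. ennreal ((H w)\<^sup>2) \<partial>M) * emeasure L (space L)"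
    using H by (intro nn_integral_multc) (auto simp: sq_int_def intro!: borel_measurable_power)
  also have "\<dots> < \<infinity>"
  proof -
    note emeasure_space_L
    moreover have "(\<integral>\<^sup>+w. ennreal ((H w)\<^sup>2) \<partial>M) < \<top>" using H by (simp add: sq_int_iff_nn_integral)
    ultimately show ?thesis unfolding infinity_ennreal_def ennreal_mult_less_top by blast
  qed
  finally show ?thesis using m by (simp add: sq_int_iff_nn_integral)
qed

lemma expectation_time_integral:
  assumes f: "sq_int LM (joint f)" and H: "sq_int M H"
  shows "expectation (\<lambda>w. IL t r (\<lambda>s. f s w) * H w) = IL t r (\<lambda>s. expectation (\<lambda>w. f s w * H w))"
proof -
  have "sq_int LM (\<lambda>z. indicator {t<..r} (fst z) * f (fst z) (snd z))" using f by (rule sq_int_indicator) simp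
  from sq_int_mult[OF this sq_int_snd[OF H]]
  have i: "integrable LM (\<lambda>(s, w). indicator {t<..r} s * f s w * H w)" by (simp add: case_prod_unfold)
  have "expectation (\<lambda>w. IL t r (\<lambda>s. f s w) * H w) = expectation (\<lambda>w. \<integral>s. indicator {t<..r} s * f s w * H w \<partial>L)"
    unfolding IL_def by simp
  also have "\<dots> = (\<integral>s. expectation (\<lambda>w. indicator {t<..r} s * f s w * H w) \<partial>L)"
    by (rule LM.Fubini_integral[OF i])
  finally show ?thesis unfolding IL_def by (simp add: mult.assoc)
qed

text \<open>With \<open>Y s = I r - I s\<close> the variable \<open>p t (Y t) + \<integral> p' Y\<close> represents \<open>\<integral> p dI\<close>.  Its covariance with \<open>H\<close> is
  computed from those of the increments, \<open>E (Y s H) = \<integral> g\<close> over \<open>(s,r]\<close>, by the same integration by parts.\<close>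

lemma weighted_increment_covariance:
  assumes p: "primitive_on 0 T p p'" and bp: "bounded_measurable p'" and t: "0 \<le> t" "t \<le> r" "r \<le> T"
    and Y: "sq_int LM (joint Y)" "sq_int M (Y t)" and H: "sq_int M H" and g: "integrable L g"
    and cov: "\<And>s. t \<le> s \<Longrightarrow> s \<le> r \<Longrightarrow> expectation (\<lambda>w. Y s w * H w) = IL s r g"
  shows "expectation (\<lambda>w. (p t * Y t w + IL t r (\<lambda>s. p' s * Y s w)) * H w) = IL t r (\<lambda>s. p s * g s)"
    and "sq_int M (\<lambda>w. p t * Y t w + IL t r (\<lambda>s. p' s * Y s w))"
proof -
  obtain C' where C': "\<And>s. \<bar>p' s\<bar> \<le> C'" using bp unfolding bounded_measurable_def bounded_iff by auto
  have pY: "sq_int LM (\<lambda>z. p' (fst z) * Y (fst z) (snd z))"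
    by (rule sq_int_bounded_time[OF Y(1)]) (use bp C' in \<open>auto simp: bounded_measurable_def intro: measurable_restrict_space1\<close>)
  note sqI = time_integral_bound(1)[OF pY t]
  show "sq_int M (\<lambda>w. p t * Y t w + IL t r (\<lambda>s. p' s * Y s w))"
    by (intro sq_int_add sq_int_scale Y(2) sqI)
  have "expectation (\<lambda>w. (p t * Y t w + IL t r (\<lambda>s. p' s * Y s w)) * H w)
      = p t * expectation (\<lambda>w. Y t w * H w) + expectation (\<lambda>w. IL t r (\<lambda>s. p' s * Y s w) * H w)"
    using sq_int_mult[OF Y(2) H] sq_int_mult[OF sqI H] by (simp add: distrib_right mult.assoc)
  also have "expectation (\<lambda>w. IL t r (\<lambda>s. p' s * Y s w) * H w) = IL t r (\<lambda>s. p' s * expectation (\<lambda>w. Y s w * H w))"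
    unfolding expectation_time_integral[OF pY H] by (simp add: mult.assoc)
  also have "\<dots> = IL t r (\<lambda>s. p' s * IL s r g)"
    unfolding IL_def[of t r] by (intro Bochner_Integration.integral_cong refl) (auto simp: indicator_def cov)
  also have "expectation (\<lambda>w. Y t w * H w) = IL t r g" using cov[of t] t by simp
  finally show "expectation (\<lambda>w. (p t * Y t w + IL t r (\<lambda>s. p' s * Y s w)) * H w) = IL t r (\<lambda>s. p s * g s)"
    using IL_by_parts(1)[OF p bp g t] by simp
qed

end

section \<open>The product rule for Ito processes with deterministic weights\<close>

context brownian_horizon
begin

lemma ito_jointly_sq_int:
  fixes \<phi> I :: "real \<Rightarrow> 'w \<Rightarrow> real"
  assumes I: "has_ito_integral M W T \<phi> I" and m: "(joint I) \<in> borel_measurable LM"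
  shows "sq_int LM (joint I)"
proof -
  have phi: "sq_int LM (joint \<phi>)" using I L2F_sq_int by (simp add: has_ito_integral_def)
  define K where "K = (\<integral>z. (\<phi> (fst z) (snd z))\<^sup>2 \<partial>LM)"
  have le: "(\<integral>\<^sup>+w. ennreal ((I s w)\<^sup>2) \<partial>M) \<le> ennreal K" if s: "s \<in> {0..T}" for s
  proof -
    have sq: "sq_int M (I s)" using ito_sq_int[OF I] s by simp
    have "expectation (\<lambda>w. (I s w)\<^sup>2) = (\<integral>z. (indicator {..s} (fst z) * \<phi> (fst z) (snd z)) * \<phi> (fst z) (snd z) \<partial>LM)"
      using ito_covariance[OF I I, of s s] s by (simp add: power2_eq_square)
    also have "\<dots> \<le> K"
      unfolding K_def
    proof (rule integral_mono)
      show "integrable LM (\<lambda>z. (indicator {..s} (fst z) * \<phi> (fst z) (snd z)) * \<phi> (fst z) (snd z))"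
        by (intro sq_int_mult sq_int_indicator phi) simp
      show "integrable LM (\<lambda>z. (\<phi> (fst z) (snd z))\<^sup>2)" using phi by (simp add: sq_int_def)
    qed (simp add: indicator_def power2_eq_square)
    finally show ?thesis using sq_int_nn_integral[OF sq] by (simp add: ennreal_leI)
  qed
  have mm: "(\<lambda>z. ennreal ((I (fst z) (snd z))\<^sup>2)) \<in> borel_measurable LM" using m by measurable
  have "(\<integral>\<^sup>+z. ennreal ((I (fst z) (snd z))\<^sup>2) \<partial>LM) = (\<integral>\<^sup>+s. (\<integral>\<^sup>+w. ennreal ((I s w)\<^sup>2) \<partial>M) \<partial>L)"
    using nn_integral_fst[OF mm] by simp
  also have "\<dots> \<le> (\<integral>\<^sup>+s. ennreal K \<partial>L)"
    by (rule nn_integral_mono) (use le in simp)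
  also have "\<dots> < \<infinity>"
    using emeasure_space_L unfolding nn_integral_const infinity_ennreal_def ennreal_mult_less_top by simp
  finally show ?thesis using m by (simp add: sq_int_iff_nn_integral)
qed

text \<open>The covariance in the form required by \<open>weighted_increment_covariance\<close>, for both factors in turn.\<close>

lemma increment_covariance_density:
  fixes \<phi> \<psi> I J :: "real \<Rightarrow> 'w \<Rightarrow> real"
  assumes I: "has_ito_integral M W T \<phi> I" and J: "has_ito_integral M W T \<psi> J"
    and s: "0 \<le> s" "s \<le> r" and q: "0 \<le> q" "q \<le> r" and r: "r \<le> T"
  shows "expectation (\<lambda>w. (I r w - I s w) * (J r w - J q w))
     = IL s r (\<lambda>u. indicator {q<..r} u * expectation (\<lambda>w. \<phi> u w * \<psi> u w))"
proof -
  have phi: "sq_int LM (joint \<phi>)" and psi: "sq_int LM (joint \<psi>)"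
    using I J L2F_sq_int by (simp_all add: has_ito_integral_def)
  define F where "F m z = indicator {..m} (fst z) * \<phi> (fst z) (snd z) * \<psi> (fst z) (snd z)" for m :: real and z
  have Fi: "integrable LM (F m)" for m
    unfolding F_def by (intro sq_int_mult sq_int_indicator phi psi) simp
  have C: "expectation (\<lambda>w. I a w * J b w) = integral\<^sup>L LM (F (min a b))"
    if "0 \<le> a" "a \<le> T" "0 \<le> b" "b \<le> T" for a b
    using ito_covariance[OF I J that] by (simp add: F_def[abs_def])
  have i: "integrable M (\<lambda>w. I a w * J b w)" if "0 \<le> a" "a \<le> T" "0 \<le> b" "b \<le> T" for a b
    using that by (intro sq_int_mult ito_sq_int[OF I] ito_sq_int[OF J])
  have "expectation (\<lambda>w. (I r w - I s w) * (J r w - J q w))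
    = expectation (\<lambda>w. I r w * J r w - I r w * J q w - I s w * J r w + I s w * J q w)"
    by (intro Bochner_Integration.integral_cong) (auto simp: algebra_simps)
  also have "\<dots> = expectation (\<lambda>w. I r w * J r w) - expectation (\<lambda>w. I r w * J q w)
      - expectation (\<lambda>w. I s w * J r w) + expectation (\<lambda>w. I s w * J q w)"
    using i[of r r] i[of r q] i[of s r] i[of s q] s q r by simp
  also have "\<dots> = integral\<^sup>L LM (F r) - integral\<^sup>L LM (F q) - integral\<^sup>L LM (F s) + integral\<^sup>L LM (F (min s q))"
    using s q r by (simp add: C min_def)
  also have "\<dots> = (\<integral>z. F r z - F q z - F s z + F (min s q) z \<partial>LM)"
    using Fi by simp
  also have "\<dots> = (\<integral>z. indicator {s<..r} (fst z) * (indicator {q<..r} (fst z) * \<phi> (fst z) (snd z)) * \<psi> (fst z) (snd z) \<partial>LM)"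
    by (intro Bochner_Integration.integral_cong) (use s q in \<open>auto simp: F_def indicator_def min_def\<close>)
  also have "\<dots> = (\<integral>u. expectation (\<lambda>w. indicator {s<..r} u * (indicator {q<..r} u * \<phi> u w) * \<psi> u w) \<partial>L)"
  proof -
    have "integrable LM (\<lambda>z. indicator {s<..r} (fst z) * (indicator {q<..r} (fst z) * \<phi> (fst z) (snd z)) * \<psi> (fst z) (snd z))"
      by (intro sq_int_mult sq_int_indicator phi psi) auto
    from LM.integral_fst'[OF this] show ?thesis by simp
  qed
  finally show ?thesis unfolding IL_def by (simp add: mult.assoc)
qed

lemma integrable_density:
  fixes \<phi> \<psi> :: "real \<Rightarrow> 'w \<Rightarrow> real"
  assumes "sq_int LM (joint \<phi>)" "sq_int LM (joint \<psi>)"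
  shows "integrable L (\<lambda>u. expectation (\<lambda>w. \<phi> u w * \<psi> u w))"
  using LM.integrable_fst'[OF sq_int_mult[OF assms]] by simp

text \<open>The integral of the deterministic function \<open>p\<close>, with derivative \<open>p'\<close>, against \<open>dI\<close> over \<open>[t,r]\<close>,
  defined by integration by parts so that only the process \<open>I\<close> itself enters.\<close>

definition weighted :: "(real \<Rightarrow> real) \<Rightarrow> (real \<Rightarrow> real) \<Rightarrow> (real \<Rightarrow> 'w \<Rightarrow> real) \<Rightarrow> real \<Rightarrow> real \<Rightarrow> 'w \<Rightarrow> real" where
  "weighted p p' I t r w = p t * (I r w - I t w) + IL t r (\<lambda>s. p' s * (I r w - I s w))"

lemma weighted_sq_int:
  assumes p: "primitive_on 0 T p p'" "bounded_measurable p'" and t: "0 \<le> t" "t \<le> r" "r \<le> T"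
    and I: "has_ito_integral M W T \<phi> I" "(joint I) \<in> borel_measurable LM"
  shows "sq_int M (weighted p p' I t r)"
    and "\<lbrakk>H \<in> borel_measurable (\<F> t); sq_int M H\<rbrakk> \<Longrightarrow> expectation (\<lambda>w. H w * weighted p p' I t r w) = 0"
proof -
  have Y: "sq_int LM (\<lambda>z. I r (snd z) - I (fst z) (snd z))" "sq_int M (\<lambda>w. I r w - I t w)"
    using t by (intro sq_int_diff sq_int_snd ito_jointly_sq_int[OF I] ito_sq_int[OF I(1)]; simp)+
  have z: "integrable L (\<lambda>_. 0)" by simp
  show "sq_int M (weighted p p' I t r)"
    unfolding weighted_def
    using weighted_increment_covariance(2)[OF p t Y, of "\<lambda>_. 0" "\<lambda>_. 0"] by (simp add: sq_int_zero IL_def)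
  assume H: "H \<in> borel_measurable (\<F> t)" "sq_int M H"
  have "expectation (\<lambda>w. (I r w - I s w) * H w) = IL s r (\<lambda>_. 0)" if s: "t \<le> s" "s \<le> r" for s
    using ito_orthogonal[OF I(1) _ s(2) t(3) measurable_\<F>_mono[OF H(1) s(1)] H(2)] s t
    by (simp add: IL_def mult.commute)
  from weighted_increment_covariance(1)[OF p t Y H(2) z this]
  show "expectation (\<lambda>w. H w * weighted p p' I t r w) = 0"
    by (simp add: weighted_def IL_def mult.commute)
qed

text \<open>The covariance rule is applied twice, once in each factor.\<close>

lemma weighted_covariance:
  fixes \<phi> \<psi> I J :: "real \<Rightarrow> 'w \<Rightarrow> real"
  assumes p: "primitive_on 0 T p p'" "bounded_measurable p'" and q: "primitive_on 0 T q q'" "bounded_measurable q'"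
    and t: "0 \<le> t" "t \<le> r" "r \<le> T"
    and I: "has_ito_integral M W T \<phi> I" "(joint I) \<in> borel_measurable LM"
    and J: "has_ito_integral M W T \<psi> J" "(joint J) \<in> borel_measurable LM"
  shows "expectation (\<lambda>w. weighted q q' J t r w * weighted p p' I t r w)
    = IL t r (\<lambda>u. q u * (p u * expectation (\<lambda>w. \<phi> u w * \<psi> u w)))"
proof -
  define G where "G u = expectation (\<lambda>w. \<phi> u w * \<psi> u w)" for u
  have phi: "sq_int LM (joint \<phi>)" and psi: "sq_int LM (joint \<psi>)"
    using I J L2F_sq_int by (simp_all add: has_ito_integral_def)
  have G: "integrable L G" unfolding G_def by (rule integrable_density[OF phi psi])
  have YI: "sq_int LM (\<lambda>z. I r (snd z) - I (fst z) (snd z))" "sq_int M (\<lambda>w. I r w - I t w)"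
    using t by (intro sq_int_diff sq_int_snd ito_jointly_sq_int[OF I] ito_sq_int[OF I(1)]; simp)+
  have YJ: "sq_int LM (\<lambda>z. J r (snd z) - J (fst z) (snd z))" "sq_int M (\<lambda>w. J r w - J t w)"
    using t by (intro sq_int_diff sq_int_snd ito_jointly_sq_int[OF J] ito_sq_int[OF J(1)]; simp)+
  have A: "expectation (\<lambda>w. (J r w - J s0 w) * weighted p p' I t r w) = IL s0 r (\<lambda>u. p u * G u)"
    if s0: "t \<le> s0" "s0 \<le> r" for s0
  proof -
    have H: "sq_int M (\<lambda>w. J r w - J s0 w)"
      using t s0 by (intro sq_int_diff ito_sq_int[OF J(1)]; simp)
    have g: "integrable L (\<lambda>u. indicator {s0<..r} u * G u)" by (rule integrable_IL[OF G])
    have cov: "expectation (\<lambda>w. (I r w - I s w) * (J r w - J s0 w)) = IL s r (\<lambda>u. indicator {s0<..r} u * G u)"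
      if "t \<le> s" "s \<le> r" for s
      unfolding G_def using that s0 t by (intro increment_covariance_density[OF I(1) J(1)]) auto
    have "expectation (\<lambda>w. weighted p p' I t r w * (J r w - J s0 w)) = IL t r (\<lambda>u. p u * (indicator {s0<..r} u * G u))"
      unfolding weighted_def by (rule weighted_increment_covariance(1)[OF p t YI H g cov])
    also have "\<dots> = IL s0 r (\<lambda>u. p u * G u)"
      unfolding IL_def by (intro Bochner_Integration.integral_cong refl) (use s0 in \<open>auto simp: indicator_def\<close>)
    finally show ?thesis by (simp add: mult.commute)
  qed
  show ?thesis
    unfolding G_def[symmetric] weighted_def[of q]
    by (rule weighted_increment_covariance(1)[OF q t YJ weighted_sq_int(1)[OF p t I] IL_by_parts(3)[OF p G t] A])
qed

text \<open>An Ito integral depends on the integrand up to null sets of \<open>LM\<close> only.\<close>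

lemma has_ito_integral_cong:
  fixes \<phi> :: "real \<Rightarrow> 'w \<Rightarrow> 'b::euclidean_space"
  assumes I: "has_ito_integral M W T \<phi> I" and \<psi>: "L2F M W T \<psi>" "AE z in LM. \<phi> (fst z) (snd z) = \<psi> (fst z) (snd z)"
    and J: "\<And>t. t \<in> {0..T} \<Longrightarrow> J t \<in> borel_measurable M" "\<And>t. t \<in> {0..T} \<Longrightarrow> AE w in M. J t w = I t w"
  shows "has_ito_integral M W T \<psi> J"
proof -
  obtain N \<tau> \<xi> where s: "\<And>k. simple_integrand M W T (N k) (\<tau> k) (\<xi> k)"
    and p: "(\<lambda>k. \<integral>\<^sup>+w. (\<integral>\<^sup>+s. ennreal ((norm (\<phi> s w - simple_process (N k) (\<tau> k) (\<xi> k) s w))\<^sup>2) \<partial>L) \<partial>M) \<longlonglongrightarrow> 0"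
    and i: "\<And>t. t \<in> {0..T} \<Longrightarrow> (\<lambda>k. \<integral>\<^sup>+w. ennreal ((norm (I t w - simple_ito W (N k) (\<tau> k) (\<xi> k) t w))\<^sup>2) \<partial>M) \<longlonglongrightarrow> 0"
    using I unfolding has_ito_integral_def by blast
  have phi: "(\<lambda>(s, w). \<phi> s w) \<in> borel_measurable LM" using I by (simp add: has_ito_integral_def L2F_def)
  have psi: "(\<lambda>(s, w). \<psi> s w) \<in> borel_measurable LM" using \<psi>(1) by (simp add: L2F_def)
  have sp: "(\<lambda>(s, w). simple_process (N k) (\<tau> k) (\<xi> k) s w) \<in> borel_measurable LM" for k
  proof -
    have "\<xi> k i \<in> borel_measurable M" if "i < N k" for i
      using s[of k] that measurable_\<F> by (auto simp: simple_integrand_def)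
    then have "(\<lambda>z. \<Sum>i<N k. indicator {\<tau> k i<..\<tau> k (Suc i)} (fst z) *\<^sub>R \<xi> k i (snd z)) \<in> borel_measurable LM"
      by (intro borel_measurable_sum borel_measurable_scaleR indicator_fst_measurable measurable_compose[OF measurable_snd]) auto
    then show ?thesis by (simp add: simple_process_def case_prod_unfold)
  qed
  have "(\<integral>\<^sup>+w. (\<integral>\<^sup>+s. ennreal ((norm (\<phi> s w - simple_process (N k) (\<tau> k) (\<xi> k) s w))\<^sup>2) \<partial>L) \<partial>M)
    = (\<integral>\<^sup>+w. (\<integral>\<^sup>+s. ennreal ((norm (\<psi> s w - simple_process (N k) (\<tau> k) (\<xi> k) s w))\<^sup>2) \<partial>L) \<partial>M)" for k
  proof -
    have "(\<integral>\<^sup>+z. ennreal ((norm (\<phi> (fst z) (snd z) - simple_process (N k) (\<tau> k) (\<xi> k) (fst z) (snd z)))\<^sup>2) \<partial>LM)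
      = (\<integral>\<^sup>+z. ennreal ((norm (\<psi> (fst z) (snd z) - simple_process (N k) (\<tau> k) (\<xi> k) (fst z) (snd z)))\<^sup>2) \<partial>LM)"
      by (rule nn_integral_cong_AE) (use \<psi>(2) in \<open>auto elim: eventually_mono\<close>)
    moreover have "(\<lambda>(s, w). \<phi> s w - simple_process (N k) (\<tau> k) (\<xi> k) s w) \<in> borel_measurable LM"
      "(\<lambda>(s, w). \<psi> s w - simple_process (N k) (\<tau> k) (\<xi> k) s w) \<in> borel_measurable LM"
      using borel_measurable_diff[OF phi[unfolded case_prod_unfold] sp[of k, unfolded case_prod_unfold]]
        borel_measurable_diff[OF psi[unfolded case_prod_unfold] sp[of k, unfolded case_prod_unfold]]
      by (simp_all add: case_prod_unfold)
    ultimately show ?thesis by (simp only: nn_integral_LM)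
  qed
  with p have p': "(\<lambda>k. \<integral>\<^sup>+w. (\<integral>\<^sup>+s. ennreal ((norm (\<psi> s w - simple_process (N k) (\<tau> k) (\<xi> k) s w))\<^sup>2) \<partial>L) \<partial>M) \<longlonglongrightarrow> 0"
    by simp
  have i': "(\<lambda>k. \<integral>\<^sup>+w. ennreal ((norm (J t w - simple_ito W (N k) (\<tau> k) (\<xi> k) t w))\<^sup>2) \<partial>M) \<longlonglongrightarrow> 0" if t: "t \<in> {0..T}" for t
  proof -
    have "(\<integral>\<^sup>+w. ennreal ((norm (J t w - simple_ito W (N k) (\<tau> k) (\<xi> k) t w))\<^sup>2) \<partial>M)
      = (\<integral>\<^sup>+w. ennreal ((norm (I t w - simple_ito W (N k) (\<tau> k) (\<xi> k) t w))\<^sup>2) \<partial>M)" for k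
      by (rule nn_integral_cong_AE) (use J(2)[OF t] in \<open>auto elim: eventually_mono\<close>)
    then show ?thesis using i[OF t] by simp
  qed
  show ?thesis
    unfolding has_ito_integral_def using \<psi>(1) J(1) s p' i' by blast
qed

text \<open>Square integrability of all data ensures that every term of the product rule has a second moment.\<close>

definition ito_process :: "(real \<Rightarrow> 'w \<Rightarrow> real) \<Rightarrow> (real \<Rightarrow> 'w \<Rightarrow> real) \<Rightarrow> (real \<Rightarrow> 'w \<Rightarrow> real) \<Rightarrow> bool" where
  "ito_process V b \<phi> \<longleftrightarrow> sq_int LM (joint V) \<and> (\<forall>t\<in>{0..T}. V t \<in> borel_measurable M)
    \<and> sq_int LM (joint b) \<and>
     (\<exists>I. has_ito_integral M W T \<phi> I \<and> (AE w in M. \<forall>t\<in>{0..T}. V t w = V 0 w + IL 0 t (\<lambda>s. b s w) + I t w))"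

lemma IL_jointly_measurable:
  fixes b :: "real \<Rightarrow> 'w \<Rightarrow> real"
  assumes "(joint b) \<in> borel_measurable LM"
  shows "(\<lambda>z. IL 0 (fst z) (\<lambda>s. b s (snd z))) \<in> borel_measurable LM"
proof -
  have id: "(\<lambda>u. u) \<in> borel_measurable L"
    by (intro measurable_restrict_space1 borel_measurable_lebesgue_continuous continuous_on_id)
  have 1: "(\<lambda>z. fst (fst z)) \<in> borel_measurable (LM \<Otimes>\<^sub>M L)"
    by (rule measurable_compose[OF measurable_fst measurable_compose[OF measurable_fst id]])
  have 2: "(\<lambda>z. snd z) \<in> borel_measurable (LM \<Otimes>\<^sub>M L)"
    by (rule measurable_compose[OF measurable_snd id])
  have "(\<lambda>z. (snd z, snd (fst z))) \<in> measurable (LM \<Otimes>\<^sub>M L) LM" by measurable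
  from measurable_compose[OF this assms]
  have 3: "(\<lambda>z. b (snd z) (snd (fst z))) \<in> borel_measurable (LM \<Otimes>\<^sub>M L)" by simp
  have "(\<lambda>z. if 0 < snd z \<and> snd z \<le> fst (fst z) then b (snd z) (snd (fst z)) else 0) \<in> borel_measurable (LM \<Otimes>\<^sub>M L)"
    using 1 2 3 by measurable
  moreover have "(\<lambda>z. if 0 < snd z \<and> snd z \<le> fst (fst z) then b (snd z) (snd (fst z)) else 0)
     = (\<lambda>(z, s). indicator {0<..fst z} s * b s (snd z))"
    by (auto simp: fun_eq_iff indicator_def)
  ultimately have "(\<lambda>(z, s). indicator {0<..fst z} s * b s (snd z)) \<in> borel_measurable (LM \<Otimes>\<^sub>M L)" by simp
  then show ?thesis unfolding IL_def by (rule L.borel_measurable_lebesgue_integral)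
qed

text \<open>The Ito integral in the definition is known at each time up to a null set only.  Defining it from the
  other terms of the equation makes it jointly measurable and the equation true everywhere.\<close>

lemma ito_process_measurable_version:
  assumes V: "ito_process V b \<phi>"
  obtains I where "has_ito_integral M W T \<phi> I" "(joint I) \<in> borel_measurable LM"
    "\<And>t w. V t w = V 0 w + IL 0 t (\<lambda>s. b s w) + I t w"
proof -
  obtain I where I: "has_ito_integral M W T \<phi> I"
    "AE w in M. \<forall>t\<in>{0..T}. V t w = V 0 w + IL 0 t (\<lambda>s. b s w) + I t w"
    using V unfolding ito_process_def by blast
  have Vm: "\<And>t. t \<in> {0..T} \<Longrightarrow> V t \<in> borel_measurable M" and b: "sq_int LM (joint b)"
    and Vj: "(joint V) \<in> borel_measurable LM"
    using V by (auto simp: ito_process_def sq_int_def)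
  define J where "J t w = V t w - V 0 w - IL 0 t (\<lambda>s. b s w)" for t w
  have "has_ito_integral M W T \<phi> J"
  proof (rule has_ito_integral_cong[OF I(1)])
    show "L2F M W T \<phi>" using I(1) by (simp add: has_ito_integral_def)
    fix t assume t: "t \<in> {0..T}"
    show "J t \<in> borel_measurable M"
      unfolding J_def using time_integral_bound(1)[OF b, of 0 t] t T
      by (intro borel_measurable_diff Vm) (auto simp: sq_int_def)
    show "AE w in M. J t w = I t w" using I(2)
    proof eventually_elim
      case (elim w)
      from bspec[OF elim t] show ?case unfolding J_def by linarith
    qed
  qed simp
  moreover have "(joint J) \<in> borel_measurable LM"
  proof -
    have "V 0 \<in> borel_measurable M" using Vm[of 0] T by simp
    from measurable_compose[OF measurable_snd this]
    have "(\<lambda>z. V 0 (snd z)) \<in> borel_measurable LM" .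
    moreover have "(\<lambda>z. IL 0 (fst z) (\<lambda>s. b s (snd z))) \<in> borel_measurable LM"
      using b by (intro IL_jointly_measurable) (simp add: sq_int_def)
    ultimately show ?thesis unfolding J_def using Vj by (intro borel_measurable_diff)
  qed
  moreover have "V t w = V 0 w + IL 0 t (\<lambda>s. b s w) + J t w" for t w by (simp add: J_def)
  ultimately show thesis using that by blast
qed

lemma ito_process_product:
  assumes p: "primitive_on 0 T p p'" "bounded_measurable p'" and t: "0 \<le> t" "t \<le> r" "r \<le> T"
    and V: "V t w = V 0 w + IL 0 t b + I t" "V r w = V 0 w + IL 0 r b + I r"
      "\<And>s. V s w = V 0 w + IL 0 s b + I s"
    and b: "integrable L b" and Vi: "integrable L (\<lambda>s. V s w)"
  shows "p r * V r w - p t * V t w = IL t r (\<lambda>s. p' s * V s w + p s * b s)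
     + (p t * (I r - I t) + IL t r (\<lambda>s. p' s * (I r - I s)))"
proof -
  obtain C' where C': "\<And>s. \<bar>p' s\<bar> \<le> C'" using p(2) unfolding bounded_measurable_def bounded_iff by auto
  have p'm: "p' \<in> borel_measurable L" using p(2) by (simp add: bounded_measurable_def measurable_restrict_space1)
  have p'i: "integrable L p'"
    by (rule L.integrable_const_bound[where B=C']) (use C' p'm in auto)
  have split: "IL 0 r b - IL 0 s b = IL s r b" if "0 \<le> s" "s \<le> r" for s
  proof -
    have "IL 0 r b - IL 0 s b = (\<integral>u. indicator {0<..r} u * b u - indicator {0<..s} u * b u \<partial>L)"
      unfolding IL_def using integrable_IL[OF b] by simp
    also have "\<dots> = IL s r b"
      unfolding IL_def by (intro Bochner_Integration.integral_cong refl) (use that in \<open>auto simp: indicator_def\<close>)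
    finally show ?thesis .
  qed
  have Vr: "V r w - V s w = IL s r b + (I r - I s)" if "0 \<le> s" "s \<le> r" for s
    using V(3)[of r] V(3)[of s] split[OF that] by linarith
  have i1: "integrable L (\<lambda>s. p' s * V s w)" by (rule integrable_L_bounded_mult[OF Vi p'm C'])
  note parts = IL_by_parts[OF p b t]
  have Ii: "integrable L (\<lambda>s. p' s * (V r w - V s w))"
    using p'i i1 by (simp add: right_diff_distrib)
  have IL_add: "IL t r (\<lambda>s. f s + g s) = IL t r f + IL t r g" if "integrable L f" "integrable L g" for f g
    unfolding IL_def using integrable_IL[OF that(1)] integrable_IL[OF that(2)] by (simp add: distrib_left)
  have ILc: "IL t r (\<lambda>s. p' s * (I r - I s)) = IL t r (\<lambda>s. p' s * (V r w - V s w) + (-1) * (p' s * IL s r b))"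
    unfolding IL_def[of t r]
  proof (intro Bochner_Integration.integral_cong refl)
    fix s
    show "indicator {t<..r} s * (p' s * (I r - I s)) = indicator {t<..r} s * (p' s * (V r w - V s w) + - 1 * (p' s * IL s r b))"
    proof (cases "s \<in> {t<..r}")
      case True
      then have e: "I r - I s = (V r w - V s w) - IL s r b" using Vr[of s] t by simp
      show ?thesis unfolding e by (simp add: algebra_simps)
    qed simp
  qed
  have "IL t r (\<lambda>s. p' s * (V r w - V s w) + (-1) * (p' s * IL s r b)) = IL t r (\<lambda>s. p' s * (V r w - V s w)) + IL t r (\<lambda>s. (-1) * (p' s * IL s r b))"
    by (rule IL_add) (use Ii parts(2) in auto)
  moreover have "IL t r (\<lambda>s. (-1) * (p' s * IL s r b)) = - IL t r (\<lambda>s. p' s * IL s r b)"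
    unfolding IL_def by simp
  moreover have "IL t r (\<lambda>s. p' s * (V r w - V s w)) = (p r - p t) * V r w - IL t r (\<lambda>s. p' s * V s w)"
  proof -
    have "IL t r (\<lambda>s. p' s * (V r w - V s w)) = IL t r p' * V r w - IL t r (\<lambda>s. p' s * V s w)"
      unfolding IL_def using integrable_IL[OF p'i, of t r] integrable_IL[OF i1, of t r]
      by (simp add: right_diff_distrib mult.assoc[symmetric])
    moreover have "IL t r p' = p r - p t"
      using IL_eq_integral[OF p'i t] primitive_on_diff[OF p(1) t] by simp
    ultimately show ?thesis by simp
  qed
  moreover have "IL t r (\<lambda>s. p' s * V s w + p s * b s) = IL t r (\<lambda>s. p' s * V s w) + IL t r (\<lambda>s. p s * b s)"
    by (rule IL_add[OF i1 parts(3)])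
  moreover have "p t * IL t r b = p t * (V r w - V t w) - p t * (I r - I t)"
  proof -
    have e: "IL t r b = (V r w - V t w) - (I r - I t)" using Vr[of t] t by simp
    show ?thesis unfolding e by (simp add: right_diff_distrib)
  qed
  moreover have "(p r - p t) * V r w = p r * V r w - p t * V r w" "p t * (V r w - V t w) = p t * V r w - p t * V t w"
    by (simp_all only: left_diff_distrib right_diff_distrib)
  ultimately show ?thesis using parts(1) ILc by linarith
qed

text \<open>The process \<open>D = \<Sum> p l * V l\<close> satisfies \<open>dD = f ds + \<zeta> dW\<close> in the weak sense that the energy
  argument requires: \<open>N\<close> is the increment of the martingale part, of which only the variance and
  the orthogonality to the past are recorded.\<close>

lemma ito_weighted_sum:
  fixes A :: "'l set"
  assumes A: "finite A" and V: "\<And>l. l \<in> A \<Longrightarrow> ito_process (V l) (b l) (\<phi> l)"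
    and p: "\<And>l. l \<in> A \<Longrightarrow> primitive_on 0 T (p l) (p' l)" "\<And>l. l \<in> A \<Longrightarrow> bounded_measurable (p' l)"
    and t: "0 \<le> t" "t \<le> r" "r \<le> T"
  obtains N where "sq_int M N"
    "AE w in M. (\<Sum>l\<in>A. p l r * V l r w) - (\<Sum>l\<in>A. p l t * V l t w)
        = IL t r (\<lambda>s. \<Sum>l\<in>A. p' l s * V l s w + p l s * b l s w) + N w"
    "expectation (\<lambda>w. (N w)\<^sup>2) = (\<integral>z. indicator {t<..r} (fst z) * (\<Sum>l\<in>A. p l (fst z) * \<phi> l (fst z) (snd z))\<^sup>2 \<partial>LM)"
    "\<And>H. H \<in> borel_measurable (\<F> t) \<Longrightarrow> sq_int M H \<Longrightarrow> expectation (\<lambda>w. H w * N w) = 0"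
proof -
  have "\<forall>l\<in>A. \<exists>I. has_ito_integral M W T (\<phi> l) I \<and> (joint I) \<in> borel_measurable LM \<and>
    (\<forall>t w. V l t w = V l 0 w + IL 0 t (\<lambda>s. b l s w) + I t w)"
  proof
    fix l assume "l \<in> A"
    show "\<exists>I. has_ito_integral M W T (\<phi> l) I \<and> (joint I) \<in> borel_measurable LM \<and>
      (\<forall>t w. V l t w = V l 0 w + IL 0 t (\<lambda>s. b l s w) + I t w)"
      by (rule ito_process_measurable_version[OF V[OF \<open>l \<in> A\<close>]]) blast
  qed
  from bchoice[OF this]
  obtain I where I: "\<And>l. l \<in> A \<Longrightarrow> has_ito_integral M W T (\<phi> l) (I l)"
    "\<And>l. l \<in> A \<Longrightarrow> (\<lambda>z. I l (fst z) (snd z)) \<in> borel_measurable LM"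
    "\<And>l t w. l \<in> A \<Longrightarrow> V l t w = V l 0 w + IL 0 t (\<lambda>s. b l s w) + I l t w" by blast
  define n where "n l = weighted (p l) (p' l) (I l) t r" for l
  define N where "N w = (\<Sum>l\<in>A. n l w)" for w
  have nsq: "sq_int M (n l)" if "l \<in> A" for l
    unfolding n_def using weighted_sq_int(1)[OF p[OF that] t I(1,2)[OF that]] .
  have Nsq: "sq_int M N" unfolding N_def by (intro sq_int_sum nsq)
  have phi: "sq_int LM (\<lambda>z. \<phi> l (fst z) (snd z))" if "l \<in> A" for l
    using I(1)[OF that] L2F_sq_int by (simp add: has_ito_integral_def)
  have "AE w in M. \<forall>l\<in>A. sq_int L (\<lambda>s. V l s w)" "AE w in M. \<forall>l\<in>A. sq_int L (\<lambda>s. b l s w)"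
    using V A by (auto intro!: AE_finite_allI AE_section_sq_int(1) simp: ito_process_def)
  then have path: "AE w in M. (\<Sum>l\<in>A. p l r * V l r w) - (\<Sum>l\<in>A. p l t * V l t w)
        = IL t r (\<lambda>s. \<Sum>l\<in>A. p' l s * V l s w + p l s * b l s w) + N w"
  proof eventually_elim
    case (elim w)
    have Vi: "integrable L (\<lambda>s. V l s w)" and bi: "integrable L (\<lambda>s. b l s w)" if "l \<in> A" for l
      using elim that by (auto intro: sq_int_finite_integrable[OF L.finite_measure_axioms])
    have fi: "integrable L (\<lambda>s. p' l s * V l s w + p l s * b l s w)" if l: "l \<in> A" for l
    proof -
      obtain C' where C': "\<And>s. \<bar>p' l s\<bar> \<le> C'" using p(2)[OF l] unfolding bounded_measurable_def bounded_iff by auto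
      have "p' l \<in> borel_measurable L" using p(2)[OF l] by (simp add: bounded_measurable_def measurable_restrict_space1)
      from integrable_L_bounded_mult[OF Vi[OF l] this C'] IL_by_parts(3)[OF p[OF l] bi[OF l] t]
      show ?thesis by simp
    qed
    have "(\<Sum>l\<in>A. p l r * V l r w) - (\<Sum>l\<in>A. p l t * V l t w) = (\<Sum>l\<in>A. p l r * V l r w - p l t * V l t w)"
      by (simp add: sum_subtractf)
    also have "\<dots> = (\<Sum>l\<in>A. IL t r (\<lambda>s. p' l s * V l s w + p l s * b l s w) + n l w)"
    proof (rule sum.cong[OF refl])
      fix l assume l: "l \<in> A"
      show "p l r * V l r w - p l t * V l t w = IL t r (\<lambda>s. p' l s * V l s w + p l s * b l s w) + n l w"
        unfolding n_def weighted_def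
        by (rule ito_process_product[OF p[OF l] t, where V="V l" and b="\<lambda>s. b l s w" and I="\<lambda>s. I l s w" and w=w,
              OF I(3)[OF l] I(3)[OF l] I(3)[OF l] bi[OF l] Vi[OF l]])
    qed
    also have "\<dots> = IL t r (\<lambda>s. \<Sum>l\<in>A. p' l s * V l s w + p l s * b l s w) + N w"
    proof -
      have "(\<Sum>l\<in>A. IL t r (\<lambda>s. p' l s * V l s w + p l s * b l s w)) = IL t r (\<lambda>s. \<Sum>l\<in>A. p' l s * V l s w + p l s * b l s w)"
        unfolding IL_def sum_distrib_left
        by (rule Bochner_Integration.integral_sum[symmetric]) (rule integrable_IL[OF fi])
      then show ?thesis by (simp add: sum.distrib N_def)
    qed
    finally show ?case .
  qed
  have cov: "expectation (\<lambda>w. n m w * n l w)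
     = (\<integral>z. (indicator {t<..r} (fst z) * (p m (fst z) * \<phi> m (fst z) (snd z))) * (p l (fst z) * \<phi> l (fst z) (snd z)) \<partial>LM)"
    and int: "integrable LM (\<lambda>z. (indicator {t<..r} (fst z) * (p m (fst z) * \<phi> m (fst z) (snd z))) * (p l (fst z) * \<phi> l (fst z) (snd z)))"
    if lm: "l \<in> A" "m \<in> A" for l m
  proof -
    have pphi: "sq_int LM (\<lambda>z. p k (fst z) * \<phi> k (fst z) (snd z))" if k: "k \<in> A" for k
    proof -
      have cp: "continuous_on {0..T} (p k)" using primitive_on_continuous[OF p(1)[OF k]] .
      obtain C where "\<And>s. s \<in> {0..T} \<Longrightarrow> \<bar>p k s\<bar> \<le> C"
        using compact_imp_bounded[OF compact_continuous_image[OF cp compact_Icc]] unfolding bounded_iff real_norm_def by blast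
      then show ?thesis
        using cp by (intro sq_int_bounded_time[OF phi[OF k]]) (auto intro: continuous_imp_measurable_on_sets_lebesgue)
    qed
    show i: "integrable LM (\<lambda>z. (indicator {t<..r} (fst z) * (p m (fst z) * \<phi> m (fst z) (snd z))) * (p l (fst z) * \<phi> l (fst z) (snd z)))"
      by (intro sq_int_mult sq_int_indicator pphi lm) simp
    have "expectation (\<lambda>w. n m w * n l w) = IL t r (\<lambda>u. p m u * (p l u * expectation (\<lambda>w. \<phi> l u w * \<phi> m u w)))"
      unfolding n_def by (rule weighted_covariance[OF p[OF lm(1)] p[OF lm(2)] t I(1,2)[OF lm(1)] I(1,2)[OF lm(2)]])
    also have "\<dots> = (\<integral>u. expectation (\<lambda>w. (indicator {t<..r} u * (p m u * \<phi> m u w)) * (p l u * \<phi> l u w)) \<partial>L)"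
    proof -
      have "expectation (\<lambda>w. (indicator {t<..r} u * (p m u * \<phi> m u w)) * (p l u * \<phi> l u w))
        = indicator {t<..r} u * (p m u * (p l u * expectation (\<lambda>w. \<phi> l u w * \<phi> m u w)))" for u
      proof -
        have "(indicator {t<..r} u * (p m u * \<phi> m u w)) * (p l u * \<phi> l u w)
          = (indicator {t<..r} u * (p m u * p l u)) * (\<phi> l u w * \<phi> m u w)" for w by (simp only: mult_ac)
        then show ?thesis by (simp only: integral_mult_right_zero mult.assoc)
      qed
      then show ?thesis unfolding IL_def by (simp only:)
    qed
    also have "\<dots> = (\<integral>z. (indicator {t<..r} (fst z) * (p m (fst z) * \<phi> m (fst z) (snd z))) * (p l (fst z) * \<phi> l (fst z) (snd z)) \<partial>LM)"
      using LM.integral_fst'[OF i] by simp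
    finally show "expectation (\<lambda>w. n m w * n l w)
     = (\<integral>z. (indicator {t<..r} (fst z) * (p m (fst z) * \<phi> m (fst z) (snd z))) * (p l (fst z) * \<phi> l (fst z) (snd z)) \<partial>LM)" .
  qed
  have "expectation (\<lambda>w. (N w)\<^sup>2) = expectation (\<lambda>w. \<Sum>m\<in>A. \<Sum>l\<in>A. n m w * n l w)"
    by (simp add: N_def power2_eq_square sum_product)
  also have "\<dots> = (\<Sum>m\<in>A. \<Sum>l\<in>A. expectation (\<lambda>w. n m w * n l w))"
    by (rule integral_double_sum) (rule sq_int_mult[OF nsq nsq])
  also have "\<dots> = (\<Sum>m\<in>A. \<Sum>l\<in>A. \<integral>z. (indicator {t<..r} (fst z) * (p m (fst z) * \<phi> m (fst z) (snd z))) * (p l (fst z) * \<phi> l (fst z) (snd z)) \<partial>LM)"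
    by (intro sum.cong refl cov)
  also have "\<dots> = (\<integral>z. (\<Sum>m\<in>A. \<Sum>l\<in>A. (indicator {t<..r} (fst z) * (p m (fst z) * \<phi> m (fst z) (snd z))) * (p l (fst z) * \<phi> l (fst z) (snd z))) \<partial>LM)"
    by (rule integral_double_sum[symmetric]) (rule int)
  also have "\<dots> = (\<integral>z. indicator {t<..r} (fst z) * (\<Sum>l\<in>A. p l (fst z) * \<phi> l (fst z) (snd z))\<^sup>2 \<partial>LM)"
  proof -
    have "(\<Sum>m\<in>A. \<Sum>l\<in>A. (c * a m) * a l) = c * (\<Sum>l\<in>A. a l)\<^sup>2" for c :: real and a
    proof -
      have "(\<Sum>m\<in>A. \<Sum>l\<in>A. (c * a m) * a l) = (\<Sum>m\<in>A. c * a m) * (\<Sum>l\<in>A. a l)" by (rule sum_product[symmetric])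
      then show ?thesis by (simp only: sum_distrib_left[symmetric] power2_eq_square mult.assoc)
    qed
    then show ?thesis by (simp only:)
  qed
  finally have energy: "expectation (\<lambda>w. (N w)\<^sup>2) = (\<integral>z. indicator {t<..r} (fst z) * (\<Sum>l\<in>A. p l (fst z) * \<phi> l (fst z) (snd z))\<^sup>2 \<partial>LM)" .
  have "expectation (\<lambda>w. H w * N w) = 0" if H: "H \<in> borel_measurable (\<F> t)" "sq_int M H" for H
  proof -
    have "expectation (\<lambda>w. H w * N w) = (\<Sum>l\<in>A. expectation (\<lambda>w. H w * n l w))"
      unfolding N_def sum_distrib_left by (rule Bochner_Integration.integral_sum) (rule sq_int_mult[OF H(2) nsq])
    also have "\<dots> = 0"
      unfolding n_def by (intro sum.neutral ballI weighted_sq_int(2)[OF p t I(1,2)] H)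
    finally show ?thesis .
  qed
  with Nsq path energy show thesis using that by blast
qed

end

section \<open>Vector-valued square-integrable processes\<close>

lemma integrable_vec_components:
  fixes f :: "'x \<Rightarrow> real^'k"
  assumes "\<And>i. integrable N (\<lambda>x. f x $ i)"
  shows "integrable N f"
proof -
  have "integrable N (\<lambda>x. \<Sum>i\<in>UNIV. (f x $ i) *\<^sub>R axis i (1::real))"
    using assms by (intro Bochner_Integration.integrable_sum integrable_scaleR_left) auto
  then show ?thesis by (simp add: basis_expansion scalar_mult_eq_scaleR[symmetric])
qed

lemma borel_measurable_vec_components:
  fixes f :: "'x \<Rightarrow> real^'k"
  assumes "\<And>i. (\<lambda>x. f x $ i) \<in> borel_measurable N"
  shows "f \<in> borel_measurable N"
  using assms by (subst borel_measurable_euclidean_space) (auto simp: Basis_vec_def inner_axis)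

lemma borel_measurable_component:
  fixes f :: "'x \<Rightarrow> ('a::euclidean_space)^'k"
  assumes "f \<in> borel_measurable N"
  shows "(\<lambda>x. f x $ i) \<in> borel_measurable N"
  using measurable_compose[OF assms borel_measurable_continuous_onI[where f="\<lambda>x. x $ i"]]
  by (simp add: continuous_intros continuous_on_id)

lemma component_square_le: "(x $ i)\<^sup>2 \<le> (norm x)\<^sup>2" for x :: "real^'k"
  using power_mono[OF component_le_norm_cart[of x i], of 2] by simp

lemma norm_square_components: "(norm x)\<^sup>2 = (\<Sum>i\<in>UNIV. (x $ i)\<^sup>2)" for x :: "real^'k"
  by (simp add: norm_vec_def L2_set_def sum_nonneg)

context brownian_horizon
begin

text \<open>Componentwise, because the Ito integrals treated above are real.\<close>

definition L2_process :: "(real \<Rightarrow> 'w \<Rightarrow> real^'k) \<Rightarrow> bool" where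
  "L2_process \<phi> \<longleftrightarrow> (\<forall>i. sq_int LM (\<lambda>z. \<phi> (fst z) (snd z) $ i))"

definition L2_variable :: "('w \<Rightarrow> real^'k) \<Rightarrow> bool" where
  "L2_variable \<xi> \<longleftrightarrow> (\<forall>i. sq_int M (\<lambda>w. \<xi> w $ i))"

definition bounded_coefficient :: "(real \<Rightarrow> real^'k^'l) \<Rightarrow> bool" where
  "bounded_coefficient K \<longleftrightarrow> K \<in> borel_measurable L \<and> bounded (K ` {0..T})"

lemma bounded_coefficient_bounded_measurable: "bounded_measurable K \<Longrightarrow> bounded_coefficient K"
  unfolding bounded_measurable_def bounded_coefficient_def
  by (auto intro: measurable_restrict_space1 bounded_subset)

lemma bounded_coefficient_continuous:
  assumes "continuous_on {0..T} K"
  shows "bounded_coefficient K"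
  unfolding bounded_coefficient_def
proof
  show "K \<in> borel_measurable L" using assms by (rule continuous_imp_measurable_on_sets_lebesgue) simp
  show "bounded (K ` {0..T})" using compact_imp_bounded[OF compact_continuous_image[OF assms compact_Icc]] .
qed

lemma L2_process_add: "L2_process \<phi> \<Longrightarrow> L2_process \<psi> \<Longrightarrow> L2_process (\<lambda>s w. \<phi> s w + \<psi> s w)"
  by (simp add: L2_process_def sq_int_add)

lemma L2_process_diff: "L2_process \<phi> \<Longrightarrow> L2_process \<psi> \<Longrightarrow> L2_process (\<lambda>s w. \<phi> s w - \<psi> s w)"
  by (simp add: L2_process_def sq_int_diff)

lemma L2_process_minus: "L2_process \<phi> \<Longrightarrow> L2_process (\<lambda>s w. - \<phi> s w)"
  using sq_int_scale[of LM _ "-1"] by (simp add: L2_process_def)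

lemma L2_process_matrix:
  fixes K :: "real \<Rightarrow> real^'k^'l"
  assumes K: "bounded_coefficient K" and \<phi>: "L2_process \<phi>"
  shows "L2_process (\<lambda>s w. K s *v \<phi> s w)"
proof -
  obtain C where C: "\<And>s. s \<in> {0..T} \<Longrightarrow> norm (K s) \<le> C"
    using K unfolding bounded_coefficient_def bounded_iff by blast
  have Km: "K \<in> borel_measurable L" using K by (simp add: bounded_coefficient_def)
  have "sq_int LM (\<lambda>z. K (fst z) $ i $ j * \<phi> (fst z) (snd z) $ j)" for i j
  proof (rule sq_int_bounded_time[where C=C])
    show "sq_int LM (\<lambda>z. \<phi> (fst z) (snd z) $ j)" using \<phi> by (simp add: L2_process_def)
    show "(\<lambda>s. K s $ i $ j) \<in> borel_measurable L"
      by (intro borel_measurable_component Km)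
    show "\<bar>K s $ i $ j\<bar> \<le> C" if "s \<in> {0..T}" for s
      using component_le_norm_cart[of "K s $ i" j] Finite_Cartesian_Product.norm_nth_le[of "K s" i] C[OF that] by linarith
  qed
  then show ?thesis
    unfolding L2_process_def matrix_vector_mult_def by (simp add: sq_int_sum)
qed

lemma L2_variable_add: "L2_variable \<phi> \<Longrightarrow> L2_variable \<psi> \<Longrightarrow> L2_variable (\<lambda>w. \<phi> w + \<psi> w)"
  by (simp add: L2_variable_def sq_int_add)

lemma L2_variable_diff: "L2_variable \<phi> \<Longrightarrow> L2_variable \<psi> \<Longrightarrow> L2_variable (\<lambda>w. \<phi> w - \<psi> w)"
  by (simp add: L2_variable_def sq_int_diff)

lemma L2_variable_minus: "L2_variable \<phi> \<Longrightarrow> L2_variable (\<lambda>w. - \<phi> w)"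
  using sq_int_scale[of M _ "-1"] by (simp add: L2_variable_def)

lemma L2_variable_const: "L2_variable (\<lambda>w. a)"
  unfolding L2_variable_def by (rule allI, rule sq_int_bounded[OF finite_measure_axioms _ order_refl]) simp

lemma L2_variable_matrix: "L2_variable \<phi> \<Longrightarrow> L2_variable (\<lambda>w. K *v \<phi> w)"
  by (simp add: L2_variable_def matrix_vector_mult_def sq_int_sum sq_int_scale)

lemma L2_variable_integrable: "L2_variable \<phi> \<Longrightarrow> integrable M \<phi>"
  unfolding L2_variable_def by (intro integrable_vec_components sq_int_finite_integrable finite_measure_axioms) auto

lemma L2_variable_component_expectation:
  "L2_variable \<xi> \<Longrightarrow> expectation (\<lambda>w. \<xi> w $ i) = expectation \<xi> $ i"
  by (rule integral_bounded_linear[OF bounded_linear_vec_nth L2_variable_integrable])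

lemma L2_variable_expectation_matrix:
  fixes K :: "real^'k^'l"
  shows "L2_variable \<xi> \<Longrightarrow> expectation (\<lambda>w. K *v \<xi> w) = K *v expectation \<xi>"
  using integral_bounded_linear[OF bounded_bilinear.bounded_linear_right[OF bounded_bilinear_matrix_vector_mult] L2_variable_integrable] .

lemma L2_process_AE_variable: "L2_process \<phi> \<Longrightarrow> AE s in L. L2_variable (\<phi> s)"
  unfolding L2_process_def L2_variable_def AE_all_countable
  by (intro allI AE_section_sq_int(2)) blast

lemma L2_process_measurable: "L2_process \<phi> \<Longrightarrow> (joint \<phi>) \<in> borel_measurable LM"
  unfolding L2_process_def sq_int_def by (intro borel_measurable_vec_components) auto

lemma variance_le_second_moment:
  assumes "sq_int M f"
  shows "expectation (\<lambda>w. (f w - expectation f)\<^sup>2) \<le> expectation (\<lambda>w. (f w)\<^sup>2)"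
    "(expectation f)\<^sup>2 \<le> expectation (\<lambda>w. (f w)\<^sup>2)"
proof -
  have i: "integrable M f" "integrable M (\<lambda>w. (f w)\<^sup>2)"
    using sq_int_finite_integrable[OF finite_measure_axioms assms] assms by (auto simp: sq_int_def)
  have "variance f = expectation (\<lambda>w. (f w)\<^sup>2) - (expectation f)\<^sup>2" by (rule variance_eq[OF i])
  moreover have "0 \<le> variance f" by (rule variance_positive)
  moreover have "0 \<le> (expectation f)\<^sup>2" by simp
  ultimately show "expectation (\<lambda>w. (f w - expectation f)\<^sup>2) \<le> expectation (\<lambda>w. (f w)\<^sup>2)"
    "(expectation f)\<^sup>2 \<le> expectation (\<lambda>w. (f w)\<^sup>2)" by linarith+
qed

lemma integrable_second_moment: "sq_int LM (joint f) \<Longrightarrow> integrable L (\<lambda>s. expectation (\<lambda>w. (f s w)\<^sup>2))"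
  using integrable_density[of f f] by (simp add: power2_eq_square)

lemma mean_measurable: "L2_process \<phi> \<Longrightarrow> mean M \<phi> \<in> borel_measurable L"
  using L2_process_measurable[of \<phi>] borel_measurable_lebesgue_integral[of \<phi> L]
  by (simp add: mean_def[abs_def] case_prod_unfold)

lemma mean_square_integrable:
  assumes \<phi>: "L2_process \<phi>"
  shows "integrable L (\<lambda>s. (mean M \<phi> s $ i)\<^sup>2)"
proof (rule Bochner_Integration.integrable_bound)
  have sq: "sq_int LM (\<lambda>z. \<phi> (fst z) (snd z) $ i)" using \<phi> by (simp add: L2_process_def)
  show "integrable L (\<lambda>s. expectation (\<lambda>w. (\<phi> s w $ i)\<^sup>2))"
    using integrable_second_moment[OF sq] .
  show "(\<lambda>s. (mean M \<phi> s $ i)\<^sup>2) \<in> borel_measurable L"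
    using borel_measurable_component[OF mean_measurable[OF \<phi>]] by measurable
  show "AE s in L. norm ((mean M \<phi> s $ i)\<^sup>2) \<le> norm (expectation (\<lambda>w. (\<phi> s w $ i)\<^sup>2))"
    using L2_process_AE_variable[OF \<phi>]
  proof eventually_elim
    case (elim s)
    then have "sq_int M (\<lambda>w. \<phi> s w $ i)" by (simp add: L2_variable_def)
    from variance_le_second_moment(2)[OF this] show ?case
      using L2_variable_component_expectation[OF elim, of i] by (simp add: mean_def)
  qed
qed

lemma L2_process_deterministic:
  fixes g :: "real \<Rightarrow> real^'k"
  assumes "g \<in> borel_measurable L" "\<And>i. integrable L (\<lambda>s. (g s $ i)\<^sup>2)"
  shows "L2_process (\<lambda>s w. g s)"
  unfolding L2_process_def sq_int_iff_nn_integral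
proof (intro allI conjI)
  fix i
  show m: "(\<lambda>z. g (fst z) $ i) \<in> borel_measurable LM"
    by (rule measurable_compose[OF measurable_fst borel_measurable_component[OF assms(1)]])
  have "(\<integral>\<^sup>+z. ennreal ((g (fst z) $ i)\<^sup>2) \<partial>LM) = (\<integral>\<^sup>+s. (\<integral>\<^sup>+w. ennreal ((g s $ i)\<^sup>2) \<partial>M) \<partial>L)"
    using nn_integral_fst[of "\<lambda>z. ennreal ((g (fst z) $ i)\<^sup>2)" L] m by simp
  also have "\<dots> = (\<integral>\<^sup>+s. ennreal ((g s $ i)\<^sup>2) \<partial>L)" by (simp add: emeasure_space_1)
  also have "\<dots> < \<infinity>" using assms(2)[of i] by (simp add: integrable_iff_bounded)
  finally show "(\<integral>\<^sup>+z. ennreal ((g (fst z) $ i)\<^sup>2) \<partial>LM) < \<infinity>" .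
qed

lemma L2_process_mean: "L2_process \<phi> \<Longrightarrow> L2_process (\<lambda>s w. mean M \<phi> s)"
  by (intro L2_process_deterministic mean_measurable mean_square_integrable)

lemma L2_process_L2F:
  fixes \<phi> :: "real \<Rightarrow> 'w \<Rightarrow> real^'k"
  assumes "L2F M W T \<phi>"
  shows "L2_process \<phi>"
  unfolding L2_process_def sq_int_iff_nn_integral
proof (intro allI conjI)
  fix i
  have m: "(joint \<phi>) \<in> borel_measurable LM"
    using assms by (simp add: L2F_def case_prod_unfold)
  show "(\<lambda>z. \<phi> (fst z) (snd z) $ i) \<in> borel_measurable LM" by (rule borel_measurable_component[OF m])
  have "(\<integral>\<^sup>+z. ennreal ((\<phi> (fst z) (snd z) $ i)\<^sup>2) \<partial>LM) \<le> (\<integral>\<^sup>+z. ennreal ((norm (\<phi> (fst z) (snd z)))\<^sup>2) \<partial>LM)"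
    by (intro nn_integral_mono ennreal_leI component_square_le)
  also have "\<dots> < \<infinity>" using assms nn_integral_LM[of \<phi>] m by (simp add: L2F_def case_prod_unfold)
  finally show "(\<integral>\<^sup>+z. ennreal ((\<phi> (fst z) (snd z) $ i)\<^sup>2) \<partial>LM) < \<infinity>" .
qed

lemma L2F_L2_process:
  fixes \<phi> :: "real \<Rightarrow> 'w \<Rightarrow> real^'k"
  assumes ad: "adapted M W T \<phi>" and \<phi>: "L2_process \<phi>"
  shows "L2F M W T \<phi>"
  unfolding L2F_def
proof (intro conjI ad)
  have m: "(joint \<phi>) \<in> borel_measurable LM" by (rule L2_process_measurable[OF \<phi>])
  then show m': "(\<lambda>(s, w). \<phi> s w) \<in> borel_measurable LM" by (simp add: case_prod_unfold)
  have i: "integrable LM (\<lambda>z. \<Sum>i\<in>UNIV. (\<phi> (fst z) (snd z) $ i)\<^sup>2)"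
    using \<phi> by (intro Bochner_Integration.integrable_sum) (simp add: L2_process_def sq_int_def)
  have "(\<integral>\<^sup>+w. (\<integral>\<^sup>+s. ennreal ((norm (\<phi> s w))\<^sup>2) \<partial>L) \<partial>M)
      = (\<integral>\<^sup>+z. ennreal (\<Sum>i\<in>UNIV. (\<phi> (fst z) (snd z) $ i)\<^sup>2) \<partial>LM)"
    using nn_integral_LM[OF m'] by (simp only: norm_square_components)
  also have "\<dots> < \<infinity>" using i by (simp add: integrable_iff_bounded sum_nonneg)
  finally show "(\<integral>\<^sup>+w. (\<integral>\<^sup>+s. ennreal ((norm (\<phi> s w))\<^sup>2) \<partial>L) \<partial>M) < \<infinity>" .
qed

text \<open>A process with continuous paths is the pointwise limit of the processes frozen on a grid.\<close>

lemma continuous_paths_jointly_measurable: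
  fixes X :: "real \<Rightarrow> 'w \<Rightarrow> real^'k"
  assumes m: "\<And>s. s \<in> {0..T} \<Longrightarrow> X s \<in> borel_measurable M"
    and c: "\<And>w. w \<in> space M \<Longrightarrow> continuous_on {0..T} (\<lambda>s. X s w)"
  shows "(joint X) \<in> borel_measurable LM"
proof -
  define g where "g k s = nat \<lfloor>real (Suc k) * s\<rfloor>" for k s
  \<comment> \<open>\<open>min T\<close> keeps the grid points in \<open>[0,T]\<close> whatever the index is\<close>
  define q where "q k i = min T (real i / real (Suc k))" for k and i :: nat
  have qT: "q k i \<in> {0..T}" for k i using T by (simp add: q_def)
  have id: "(\<lambda>u. u) \<in> borel_measurable L"
    by (intro measurable_restrict_space1 borel_measurable_lebesgue_continuous continuous_on_id)
  have gm: "(\<lambda>z. g k (fst z)) \<in> measurable LM (count_space UNIV)" for k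
    unfolding g_def using measurable_compose[OF measurable_fst[of L M] id] by measurable
  have Xm: "(\<lambda>z. X (q k i) (snd z)) \<in> borel_measurable LM" for k i
    by (rule measurable_compose[OF measurable_snd m[OF qT]])
  have "(\<lambda>z. X (q k (g k (fst z))) (snd z)) \<in> borel_measurable LM" for k
    by (rule measurable_compose_countable[OF Xm gm])
  moreover have "(\<lambda>k. X (q k (g k (fst z))) (snd z)) \<longlonglongrightarrow> X (fst z) (snd z)" if z: "z \<in> space LM" for z
  proof -
    obtain s w where s: "z = (s, w)" "s \<in> {0..T}" "w \<in> space M" using z by (auto simp: space_pair_measure)
    have "(\<lambda>k. q k (g k s)) \<longlonglongrightarrow> s"
    proof (rule LIMSEQ_I)
      fix e :: real assume "0 < e"
      then obtain k0 where k0: "inverse (real (Suc k0)) < e" using reals_Archimedean by blast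
      show "\<exists>k0. \<forall>k\<ge>k0. norm (q k (g k s) - s) < e"
      proof (intro exI allI impI)
        fix k assume "k0 \<le> k"
        then have k: "inverse (real (Suc k)) < e" using k0 by (smt (verit) inverse_le_iff_le of_nat_0_less_iff of_nat_mono Suc_le_mono zero_less_Suc)
        define n where "n = real (Suc k)"
        have n: "n > 0" by (simp add: n_def)
        have "0 \<le> n * s" using s n by simp
        then have fl: "real (g k s) \<le> n * s" "n * s < real (g k s) + 1" unfolding g_def n_def by linarith+
        then have "real (g k s) / n \<le> s" "s < real (g k s) / n + inverse n"
          using n by (simp_all add: field_simps)
        moreover have "real (g k s) / n \<le> T" using calculation(1) s by simp
        ultimately show "norm (q k (g k s) - s) < e" using k unfolding q_def n_def[symmetric] by simp
      qed
    qed
    then show ?thesis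
      using continuous_on_tendsto_compose[OF c[OF s(3)], of "\<lambda>k. q k (g k s)" s sequentially] s qT by simp
  qed
  ultimately show ?thesis by (rule borel_measurable_LIMSEQ_metric)
qed

lemma state_space_properties:
  fixes X :: "real \<Rightarrow> 'w \<Rightarrow> real^'k"
  assumes X: "state_space M W T X"
  shows "L2_process X" "\<And>s. s \<in> {0..T} \<Longrightarrow> L2_variable (X s)"
    "\<And>s i. s \<in> {0..T} \<Longrightarrow> (\<lambda>w. X s w $ i) \<in> borel_measurable (\<F> s)"
proof -
  have ad: "X s \<in> borel_measurable (\<F> s)" if "s \<in> {0..T}" for s using X that by (simp add: state_space_def adapted_def)
  then show "(\<lambda>w. X s w $ i) \<in> borel_measurable (\<F> s)" if "s \<in> {0..T}" for s i
    using borel_measurable_component that by blast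
  have m: "X s \<in> borel_measurable M" if "s \<in> {0..T}" for s using ad[OF that] by (rule measurable_\<F>)
  define S where "S w = (SUP s\<in>{0..T}. ennreal ((norm (X s w))\<^sup>2))" for w
  have S: "(\<integral>\<^sup>+w. S w \<partial>M) < \<infinity>" using X by (simp add: state_space_def S_def)
  have le: "ennreal ((X s w $ i)\<^sup>2) \<le> S w" if "s \<in> {0..T}" for s w i
  proof -
    have "ennreal ((X s w $ i)\<^sup>2) \<le> ennreal ((norm (X s w))\<^sup>2)" by (intro ennreal_leI component_square_le)
    also have "\<dots> \<le> S w" unfolding S_def using that by (rule SUP_upper)
    finally show ?thesis .
  qed
  show "L2_variable (X s)" if s: "s \<in> {0..T}" for s
    unfolding L2_variable_def sq_int_iff_nn_integral
  proof (intro allI conjI)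
    fix i
    show "(\<lambda>w. X s w $ i) \<in> borel_measurable M" by (rule borel_measurable_component[OF m[OF s]])
    have "(\<integral>\<^sup>+w. ennreal ((X s w $ i)\<^sup>2) \<partial>M) \<le> (\<integral>\<^sup>+w. S w \<partial>M)" by (intro nn_integral_mono le s)
    then show "(\<integral>\<^sup>+w. ennreal ((X s w $ i)\<^sup>2) \<partial>M) < \<infinity>" using S by (rule le_less_trans)
  qed
  have Xm: "(joint X) \<in> borel_measurable LM"
    using X by (intro continuous_paths_jointly_measurable m) (auto simp: state_space_def)
  show "L2_process X"
    unfolding L2_process_def sq_int_iff_nn_integral
  proof (intro allI conjI)
    fix i
    show mi: "(\<lambda>z. X (fst z) (snd z) $ i) \<in> borel_measurable LM" by (rule borel_measurable_component[OF Xm])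
    have "(\<integral>\<^sup>+z. ennreal ((X (fst z) (snd z) $ i)\<^sup>2) \<partial>LM) = (\<integral>\<^sup>+s. (\<integral>\<^sup>+w. ennreal ((X s w $ i)\<^sup>2) \<partial>M) \<partial>L)"
      using nn_integral_fst[of "\<lambda>z. ennreal ((X (fst z) (snd z) $ i)\<^sup>2)" L] mi by simp
    also have "\<dots> \<le> (\<integral>\<^sup>+s. (\<integral>\<^sup>+w. S w \<partial>M) \<partial>L)" by (intro nn_integral_mono le) simp
    also have "\<dots> = (\<integral>\<^sup>+w. S w \<partial>M) * emeasure L (space L)" by simp
    also have "\<dots> < \<infinity>" using S emeasure_space_L by (simp add: ennreal_mult_less_top)
    finally show "(\<integral>\<^sup>+z. ennreal ((X (fst z) (snd z) $ i)\<^sup>2) \<partial>LM) < \<infinity>" .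
  qed
qed

definition fluctuation :: "(real \<Rightarrow> 'w \<Rightarrow> real^'k) \<Rightarrow> real \<Rightarrow> 'w \<Rightarrow> real^'k" where
  "fluctuation \<phi> s w = \<phi> s w - mean M \<phi> s"

lemma L2_process_fluctuation: "L2_process \<phi> \<Longrightarrow> L2_process (fluctuation \<phi>)"
  unfolding fluctuation_def[abs_def] by (intro L2_process_diff L2_process_mean)

definition energy :: "(real \<Rightarrow> 'w \<Rightarrow> real^'k) \<Rightarrow> real \<Rightarrow> real \<Rightarrow> 'k \<Rightarrow> real" where
  "energy \<phi> t r i = (\<integral>z. indicator {t<..r} (fst z) * (\<phi> (fst z) (snd z) $ i)\<^sup>2 \<partial>LM)"

lemma integrable_energy: "L2_process \<phi> \<Longrightarrow> integrable LM (\<lambda>z. indicator {t<..r} (fst z) * (\<phi> (fst z) (snd z) $ i)\<^sup>2)"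
proof -
  assume "L2_process \<phi>"
  then have sq: "sq_int LM (\<lambda>z. \<phi> (fst z) (snd z) $ i)" by (simp add: L2_process_def)
  from sq_int_mult[OF sq_int_indicator[OF sq, of "{t<..r}"] sq] show ?thesis
    by (simp add: power2_eq_square mult.assoc)
qed

lemma energy_nonneg: "0 \<le> energy \<phi> t r i"
  unfolding energy_def by (intro integral_nonneg_AE) auto

lemma energy_IL:
  assumes "L2_process \<phi>"
  shows "energy \<phi> t r i = IL t r (\<lambda>s. expectation (\<lambda>w. (\<phi> s w $ i)\<^sup>2))"
  using LM.integral_fst'[OF integrable_energy[OF assms, of t r i]] by (simp add: energy_def IL_def)

text \<open>At almost every time a variance is bounded by the second moment.\<close>

lemma energy_fluctuation_le:
  assumes \<phi>: "L2_process \<phi>"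
  shows "energy (fluctuation \<phi>) t r i \<le> energy \<phi> t r i"
  unfolding energy_IL[OF \<phi>] energy_IL[OF L2_process_fluctuation[OF \<phi>]] IL_def
proof (rule integral_mono_AE)
  show "integrable L (\<lambda>s. indicator {t<..r} s * expectation (\<lambda>w. (\<phi> s w $ i)\<^sup>2))"
    using \<phi> by (intro integrable_IL integrable_second_moment) (simp add: L2_process_def)
  show "integrable L (\<lambda>s. indicator {t<..r} s * expectation (\<lambda>w. (fluctuation \<phi> s w $ i)\<^sup>2))"
    using L2_process_fluctuation[OF \<phi>] by (intro integrable_IL integrable_second_moment) (simp add: L2_process_def)
  show "AE s in L. indicator {t<..r} s * expectation (\<lambda>w. (fluctuation \<phi> s w $ i)\<^sup>2)
      \<le> indicator {t<..r} s * expectation (\<lambda>w. (\<phi> s w $ i)\<^sup>2)"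
    using L2_process_AE_variable[OF \<phi>]
  proof eventually_elim
    case (elim s)
    then have "sq_int M (\<lambda>w. \<phi> s w $ i)" by (simp add: L2_variable_def)
    from variance_le_second_moment(1)[OF this] L2_variable_component_expectation[OF elim, of i] show ?case
      by (intro mult_left_mono) (simp_all add: fluctuation_def mean_def)
  qed
qed

end

section \<open>Uniqueness for backward stochastic equations\<close>

context brownian_horizon
begin

lemma energy_split:
  assumes \<phi>: "L2_process \<phi>" and t: "t \<le> r" "r \<le> q"
  shows "energy \<phi> t q i = energy \<phi> t r i + energy \<phi> r q i"
proof -
  have "energy \<phi> t q i = (\<integral>z. indicator {t<..r} (fst z) * (\<phi> (fst z) (snd z) $ i)\<^sup>2
      + indicator {r<..q} (fst z) * (\<phi> (fst z) (snd z) $ i)\<^sup>2 \<partial>LM)"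
    unfolding energy_def using t by (intro Bochner_Integration.integral_cong) (auto simp: indicator_def)
  also have "\<dots> = energy \<phi> t r i + energy \<phi> r q i"
    unfolding energy_def by (rule Bochner_Integration.integral_add[OF integrable_energy[OF \<phi>] integrable_energy[OF \<phi>]])
  finally show ?thesis .
qed

lemma energy_mono:
  assumes \<phi>: "L2_process \<phi>" and t: "q \<le> t" "t \<le> r"
  shows "energy \<phi> t r i \<le> energy \<phi> q r i"
  using energy_split[OF \<phi> t] energy_nonneg[of \<phi> q t i] by simp

lemma AE_L_LM:
  assumes "AE s in L. P s"
  shows "AE z in LM. P (fst z)"
proof -
  obtain N where N: "{s \<in> space L. \<not> P s} \<subseteq> N" "N \<in> null_sets L"
    using assms unfolding eventually_ae_filter by blast
  have "N \<times> space M \<in> null_sets LM"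
    using N(2) by (intro null_setsI) (auto simp: emeasure_pair_measure_Times null_sets_def)
  then show ?thesis
    by (rule AE_I') (use N(1) in \<open>auto simp: space_pair_measure\<close>)
qed

lemma energy_zero_AE:
  assumes \<phi>: "L2_process \<phi>" and 0: "\<And>i. energy \<phi> 0 T i = 0"
  shows "AE z in LM. \<phi> (fst z) (snd z) = 0"
proof -
  have "AE z in LM. indicator {0<..T} (fst z) * (\<phi> (fst z) (snd z) $ i)\<^sup>2 = 0" for i
    using 0[of i] integral_nonneg_eq_0_iff_AE[OF integrable_energy[OF \<phi>, of 0 T i]] by (simp add: energy_def)
  then have A: "AE z in LM. \<forall>i. indicator {0<..T} (fst z) * (\<phi> (fst z) (snd z) $ i)\<^sup>2 = 0"
    unfolding AE_all_countable by blast
  have "AE s in L. s \<noteq> 0" by (rule AE_lebesgue_onI[of "{0}"]) auto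
  then have B: "AE z in LM. fst z \<noteq> 0" by (rule AE_L_LM)
  show ?thesis using A B AE_space
  proof eventually_elim
    case (elim z)
    then have "indicator {0<..T} (fst z) = (1::real)" by (auto simp: space_pair_measure)
    then show ?case using elim by (simp add: vec_eq_iff)
  qed
qed

lemma second_moment_AE_zero:
  assumes "sq_int M h" "expectation (\<lambda>w. (h w)\<^sup>2) \<le> 0"
  shows "AE w in M. h w = 0"
proof -
  have i: "integrable M (\<lambda>w. (h w)\<^sup>2)" using assms by (simp add: sq_int_def)
  have "expectation (\<lambda>w. (h w)\<^sup>2) = 0"
    by (intro antisym assms(2) integral_nonneg_AE) simp
  then show ?thesis using integral_nonneg_eq_0_iff_AE[OF i] by simp
qed

text \<open>The weak form of \<open>d\<eta> = f ds + \<zeta> dW\<close> delivered by \<open>ito_weighted_sum\<close>.\<close>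

definition martingale_dynamics :: "(real \<Rightarrow> 'w \<Rightarrow> real^'k) \<Rightarrow> (real \<Rightarrow> 'w \<Rightarrow> real^'k) \<Rightarrow> (real \<Rightarrow> 'w \<Rightarrow> real^'k) \<Rightarrow> bool" where
  "martingale_dynamics \<eta> f \<zeta> \<longleftrightarrow> (\<forall>t r i. 0 \<le> t \<longrightarrow> t \<le> r \<longrightarrow> r \<le> T \<longrightarrow> (\<exists>N. sq_int M N \<and>
      (AE w in M. \<eta> r w $ i - \<eta> t w $ i = IL t r (\<lambda>s. f s w $ i) + N w) \<and>
      expectation (\<lambda>w. (N w)\<^sup>2) = energy \<zeta> t r i \<and>
      (\<forall>H. H \<in> borel_measurable (\<F> t) \<longrightarrow> sq_int M H \<longrightarrow> expectation (\<lambda>w. H w * N w) = 0)))"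

text \<open>Over a short interval ending where \<open>\<eta>\<close> vanishes, \<open>\<eta> t\<close> and the martingale increment \<open>N\<close>
  are orthogonal and add up to \<open>- \<integral> f\<close>, so that \<open>E|\<eta> t|\<^sup>2 + E|N|\<^sup>2 = E|\<integral> f|\<^sup>2\<close>.\<close>

lemma backward_energy_bound:
  fixes \<eta> f \<zeta> :: "real \<Rightarrow> 'w \<Rightarrow> real^'k"
  assumes f: "L2_process f" and t: "0 \<le> t" "t \<le> r" "r \<le> T"
    and \<eta>: "(\<lambda>w. \<eta> t w $ i) \<in> borel_measurable (\<F> t)" "sq_int M (\<lambda>w. \<eta> t w $ i)"
    and N: "sq_int M N" "AE w in M. \<eta> r w $ i - \<eta> t w $ i = IL t r (\<lambda>s. f s w $ i) + N w"
      "expectation (\<lambda>w. (N w)\<^sup>2) = energy \<zeta> t r i"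
      "\<And>H. H \<in> borel_measurable (\<F> t) \<Longrightarrow> sq_int M H \<Longrightarrow> expectation (\<lambda>w. H w * N w) = 0"
    and z: "AE w in M. \<eta> r w $ i = 0"
  shows "expectation (\<lambda>w. (\<eta> t w $ i)\<^sup>2) + energy \<zeta> t r i \<le> (r - t) * energy f t r i"
proof -
  have fi: "sq_int LM (\<lambda>z. f (fst z) (snd z) $ i)" using f by (simp add: L2_process_def)
  have i: "integrable M (\<lambda>w. (\<eta> t w $ i)\<^sup>2)" "integrable M (\<lambda>w. (N w)\<^sup>2)" "integrable M (\<lambda>w. \<eta> t w $ i * N w)"
    using \<eta>(2) N(1) sq_int_mult[OF \<eta>(2) N(1)] by (simp_all add: sq_int_def)
  have "expectation (\<lambda>w. (\<eta> t w $ i)\<^sup>2) + energy \<zeta> t r i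
      = expectation (\<lambda>w. (\<eta> t w $ i)\<^sup>2) + expectation (\<lambda>w. (N w)\<^sup>2) + 2 * expectation (\<lambda>w. \<eta> t w $ i * N w)"
    using N(3) N(4)[OF \<eta>] by simp
  also have "\<dots> = expectation (\<lambda>w. (\<eta> t w $ i)\<^sup>2 + (N w)\<^sup>2 + 2 * (\<eta> t w $ i * N w))"
    using i by simp
  also have "\<dots> = expectation (\<lambda>w. (IL t r (\<lambda>s. f s w $ i))\<^sup>2)"
  proof (rule integral_cong_AE)
    show "AE w in M. (\<eta> t w $ i)\<^sup>2 + (N w)\<^sup>2 + 2 * (\<eta> t w $ i * N w) = (IL t r (\<lambda>s. f s w $ i))\<^sup>2"
      using N(2) z
    proof eventually_elim
      case (elim w)
      then have "IL t r (\<lambda>s. f s w $ i) = - (\<eta> t w $ i + N w)" by linarith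
      then show ?case by (simp only: power2_minus power2_sum mult.assoc)
    qed
    show "(\<lambda>w. (\<eta> t w $ i)\<^sup>2 + (N w)\<^sup>2 + 2 * (\<eta> t w $ i * N w)) \<in> borel_measurable M"
      using \<eta>(2) N(1)
      by (intro borel_measurable_add borel_measurable_times borel_measurable_power borel_measurable_const)
         (simp_all add: sq_int_def)
    show "(\<lambda>w. (IL t r (\<lambda>s. f s w $ i))\<^sup>2) \<in> borel_measurable M"
      using time_integral_bound(1)[OF fi t] by (intro borel_measurable_power) (simp add: sq_int_def)
  qed
  also have "\<dots> \<le> (r - t) * energy f t r i"
    using time_integral_bound(2)[OF fi t] by (simp add: energy_def)
  finally show ?thesis .
qed

text \<open>A backward equation \<open>d\<eta> = f ds + \<zeta> dW\<close> with zero terminal value whose drift is controlled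
  by \<open>\<eta>\<close> and \<open>\<zeta>\<close> in mean square has only the zero solution: on intervals of a fixed small length
  the energy bound is a contraction, and finitely many of them cover \<open>[0,T]\<close>.\<close>

theorem backward_equation_unique:
  fixes \<eta> f \<zeta> :: "real \<Rightarrow> 'w \<Rightarrow> real^'k"
  assumes L2: "L2_process \<eta>" "L2_process f" "L2_process \<zeta>"
    and \<eta>: "\<And>t i. t \<in> {0..T} \<Longrightarrow> (\<lambda>w. \<eta> t w $ i) \<in> borel_measurable (\<F> t)"
      "\<And>t. t \<in> {0..T} \<Longrightarrow> L2_variable (\<eta> t)"
    and dyn: "martingale_dynamics \<eta> f \<zeta>"
    and bound: "\<And>t r. 0 \<le> t \<Longrightarrow> t \<le> r \<Longrightarrow> r \<le> T \<Longrightarrow>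
      (\<Sum>i\<in>UNIV. energy f t r i) \<le> C * ((\<Sum>i\<in>UNIV. energy \<eta> t r i) + (\<Sum>i\<in>UNIV. energy \<zeta> t r i))"
    and C: "0 \<le> C" and terminal: "\<And>i. AE w in M. \<eta> T w $ i = 0"
  shows "\<And>t. t \<in> {0..T} \<Longrightarrow> AE w in M. \<eta> t w = 0" "AE z in LM. \<zeta> (fst z) (snd z) = 0"
proof -
  define e where "e t = (\<Sum>i\<in>UNIV. expectation (\<lambda>w. (\<eta> t w $ i)\<^sup>2))" for t
  define Eta where "Eta t r = (\<Sum>i\<in>UNIV. energy \<eta> t r i)" for t r
  define Zeta where "Zeta t r = (\<Sum>i\<in>UNIV. energy \<zeta> t r i)" for t r
  \<comment> \<open>then \<open>h * C \<le> 1/2\<close> and \<open>h \<le> 1\<close>, which absorbs both energies\<close>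
  define h where "h = 1 / (2 * C + 2)"
  have h: "0 < h" "h * C \<le> 1/2" "h \<le> 1" using C by (simp_all add: h_def field_simps)
  have nn: "0 \<le> e t \<and> 0 \<le> Eta t r \<and> 0 \<le> Zeta t r" for t r
    unfolding e_def Eta_def Zeta_def by (intro conjI sum_nonneg energy_nonneg integral_nonneg_AE AE_I2) simp_all
  have step: "e t + Zeta t r \<le> (r - t) * C * (Eta t r + Zeta t r)"
    if t: "0 \<le> t" "t \<le> r" "r \<le> T" and z: "\<And>i. AE w in M. \<eta> r w $ i = 0" for t r
  proof -
    have "expectation (\<lambda>w. (\<eta> t w $ i)\<^sup>2) + energy \<zeta> t r i \<le> (r - t) * energy f t r i" for i
    proof -
      obtain N where N: "sq_int M N"
        "AE w in M. \<eta> r w $ i - \<eta> t w $ i = IL t r (\<lambda>s. f s w $ i) + N w"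
        "expectation (\<lambda>w. (N w)\<^sup>2) = energy \<zeta> t r i"
        "\<And>H. H \<in> borel_measurable (\<F> t) \<Longrightarrow> sq_int M H \<Longrightarrow> expectation (\<lambda>w. H w * N w) = 0"
        using dyn t unfolding martingale_dynamics_def by meson
      have tT: "t \<in> {0..T}" using t by simp
      have "sq_int M (\<lambda>w. \<eta> t w $ i)" using \<eta>(2)[OF tT] by (simp add: L2_variable_def)
      from backward_energy_bound[OF L2(2) t \<eta>(1)[OF tT] this N z[of i]] show ?thesis .
    qed
    then have "(\<Sum>i\<in>UNIV. expectation (\<lambda>w. (\<eta> t w $ i)\<^sup>2) + energy \<zeta> t r i) \<le> (\<Sum>i\<in>UNIV. (r - t) * energy f t r i)"
      by (rule sum_mono)
    then have "e t + Zeta t r \<le> (r - t) * (\<Sum>i\<in>UNIV. energy f t r i)"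
      by (simp add: sum.distrib e_def Zeta_def sum_distrib_left)
    also have "\<dots> \<le> (r - t) * (C * (Eta t r + Zeta t r))"
      using bound[OF t] t unfolding Eta_def Zeta_def by (intro mult_left_mono) auto
    finally show ?thesis by (simp add: mult.assoc)
  qed
  note nne = nn[THEN conjunct1] and nnz = nn[THEN conjunct2, THEN conjunct2]
  have Eta_le: "Eta q r \<le> (r - q) * b" if q: "0 \<le> q" "q \<le> r" "r \<le> T" and b: "0 \<le> b" "\<And>t. q \<le> t \<Longrightarrow> t \<le> r \<Longrightarrow> e t \<le> b" for q r b
  proof -
    have i: "integrable L (\<lambda>s. expectation (\<lambda>w. (\<eta> s w $ i)\<^sup>2))" for i
      using L2(1) by (intro integrable_second_moment) (simp add: L2_process_def)
    have "Eta q r = (\<integral>s. (\<Sum>i\<in>UNIV. indicator {q<..r} s * expectation (\<lambda>w. (\<eta> s w $ i)\<^sup>2)) \<partial>L)"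
      unfolding Eta_def energy_IL[OF L2(1)] IL_def
      by (rule Bochner_Integration.integral_sum[symmetric]) (rule integrable_IL[OF i])
    also have "\<dots> \<le> (\<integral>s. indicator {q<..r} s * b \<partial>L)"
    proof (rule integral_mono)
      show "integrable L (\<lambda>s. \<Sum>i\<in>UNIV. indicator {q<..r} s * expectation (\<lambda>w. (\<eta> s w $ i)\<^sup>2))"
        by (intro Bochner_Integration.integrable_sum integrable_IL i)
      show "integrable L (\<lambda>s. indicator {q<..r} s * b)" by (rule integrable_IL) simp
      fix s
      show "(\<Sum>i\<in>UNIV. indicator {q<..r} s * expectation (\<lambda>w. (\<eta> s w $ i)\<^sup>2)) \<le> indicator {q<..r} s * b"
        unfolding sum_distrib_left[symmetric] e_def[symmetric]
        using b(2)[of s] by (cases "s \<in> {q<..r}") auto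
    qed
    also have "\<dots> = (r - q) * b" using integral_indicator_Ioc[of q r] q by (simp add: max_def)
    finally show ?thesis .
  qed
  define Z where "Z r \<longleftrightarrow> (\<forall>t\<in>{r..T}. e t = 0) \<and> Zeta r T = 0" for r
  have e0: "AE w in M. \<eta> t w $ i = 0" if "e t = 0" "t \<in> {0..T}" for t i
  proof (rule second_moment_AE_zero)
    show "sq_int M (\<lambda>w. \<eta> t w $ i)" using \<eta>(2)[OF that(2)] by (simp add: L2_variable_def)
    have "(\<Sum>i\<in>UNIV. expectation (\<lambda>w. (\<eta> t w $ i)\<^sup>2)) = 0" using that(1) by (simp add: e_def)
    then show "expectation (\<lambda>w. (\<eta> t w $ i)\<^sup>2) \<le> 0" by (subst (asm) sum_nonneg_eq_0_iff) auto
  qed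
  have "Z 0"
  proof (rule backward_steps[of h Z T])
    show "0 < h" "0 \<le> T" using h T by simp_all
    have "expectation (\<lambda>w. (\<eta> T w $ i)\<^sup>2) = 0" for i
    proof -
      have "expectation (\<lambda>w. (\<eta> T w $ i)\<^sup>2) = expectation (\<lambda>w. 0)"
      proof (rule integral_cong_AE)
        show "(\<lambda>w. (\<eta> T w $ i)\<^sup>2) \<in> borel_measurable M" using \<eta>(2)[of T] T by (intro borel_measurable_power) (simp add: L2_variable_def sq_int_def)
        show "AE w in M. (\<eta> T w $ i)\<^sup>2 = 0" using terminal[of i] by eventually_elim simp
      qed simp
      then show ?thesis by simp
    qed
    then show "Z T" by (simp add: Z_def e_def Zeta_def energy_def)
    fix r assume r: "0 \<le> r" "r \<le> T" "Z r"
    define q where "q = max 0 (r - h)"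
    have q: "0 \<le> q" "q \<le> r" "r - q \<le> h" using h r by (auto simp: q_def)
    have er: "e r = 0" using r by (simp add: Z_def)
    have z: "AE w in M. \<eta> r w $ i = 0" for i using e0[OF er] r by simp
    have half: "e t + Zeta t r \<le> (Eta q r + Zeta t r) / 2" if t: "q \<le> t" "t \<le> r" for t
    proof -
      have t0: "0 \<le> t" using t q by simp
      have "Eta t r \<le> Eta q r" unfolding Eta_def by (intro sum_mono energy_mono L2 t)
      moreover have "(r - t) * C \<le> 1/2"
      proof -
        have "(r - t) * C \<le> h * C" using t q C by (intro mult_right_mono) auto
        then show ?thesis using h by simp
      qed
      ultimately have "(r - t) * C * (Eta t r + Zeta t r) \<le> 1/2 * (Eta q r + Zeta t r)"
        using nn[of t r] t C by (intro mult_mono) auto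
      then show ?thesis using step[OF t0 t(2) r(2) z] by simp
    qed
    have "Eta q r \<le> (r - q) * (Eta q r / 2)"
    proof (rule Eta_le[OF q(1,2) r(2)])
      show "0 \<le> Eta q r / 2" using nn by simp
      show "e t \<le> Eta q r / 2" if "q \<le> t" "t \<le> r" for t using half[OF that] nn[of t r] by simp
    qed
    also have "\<dots> \<le> 1 * (Eta q r / 2)" using q h nn by (intro mult_right_mono) auto
    finally have "Eta q r = 0" using nn[of q r] by simp
    then have "e t = 0" if "q \<le> t" "t \<le> r" for t
      using half[OF that] nne[of t] nnz[of t r] \<open>Eta q r = 0\<close>
      by (intro antisym) simp_all
    moreover have "e t = 0" if "r \<le> t" "t \<le> T" for t using r that by (simp add: Z_def)
    moreover have "Zeta q T = 0"
    proof -
      have "Zeta q T = Zeta q r + Zeta r T"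
        unfolding Zeta_def using energy_split[OF L2(3) q(2) r(2)] by (simp add: sum.distrib)
      moreover have "Zeta q r = 0" using half[OF order_refl q(2)] \<open>Eta q r = 0\<close> nne[of q] nnz[of q r]
        by (intro antisym) simp_all
      ultimately show ?thesis using r by (simp add: Z_def)
    qed
    ultimately show "Z (max 0 (r - h))" unfolding q_def[symmetric] Z_def by (metis atLeastAtMost_iff linear)
  qed
  then show "AE w in M. \<eta> t w = 0" if "t \<in> {0..T}" for t
    using e0[of t] that by (simp add: Z_def vec_eq_iff AE_all_countable)
  have "energy \<zeta> 0 T i = 0" for i
    using \<open>Z 0\<close> energy_nonneg[of \<zeta> 0 T] by (simp add: Z_def Zeta_def sum_nonneg_eq_0_iff)
  then show "AE z in LM. \<zeta> (fst z) (snd z) = 0" by (rule energy_zero_AE[OF L2(3)])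
qed

end

section \<open>Vector Ito processes and their fluctuations\<close>

context brownian_horizon
begin

lemma L2F_component:
  fixes \<phi> :: "real \<Rightarrow> 'w \<Rightarrow> real^'k"
  assumes "L2F M W T \<phi>"
  shows "L2F M W T (\<lambda>s w. \<phi> s w $ i)"
  unfolding L2F_def
proof (intro conjI)
  show "adapted M W T (\<lambda>s w. \<phi> s w $ i)"
    using assms by (auto simp: L2F_def adapted_def intro: borel_measurable_component)
  show "(\<lambda>(s, w). \<phi> s w $ i) \<in> borel_measurable LM"
    using borel_measurable_component[of "\<lambda>(s, w). \<phi> s w" LM i] assms by (simp add: L2F_def case_prod_unfold)
  have "(\<integral>\<^sup>+w. (\<integral>\<^sup>+s. ennreal ((norm (\<phi> s w $ i))\<^sup>2) \<partial>L) \<partial>M) \<le> (\<integral>\<^sup>+w. (\<integral>\<^sup>+s. ennreal ((norm (\<phi> s w))\<^sup>2) \<partial>L) \<partial>M)"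
    by (intro nn_integral_mono ennreal_leI) (simp add: component_square_le)
  also have "\<dots> < \<infinity>" using assms by (simp add: L2F_def)
  finally show "(\<integral>\<^sup>+w. (\<integral>\<^sup>+s. ennreal ((norm (\<phi> s w $ i))\<^sup>2) \<partial>L) \<partial>M) < \<infinity>" .
qed

lemma has_ito_integral_component:
  fixes \<phi> :: "real \<Rightarrow> 'w \<Rightarrow> real^'k"
  assumes "has_ito_integral M W T \<phi> I"
  shows "has_ito_integral M W T (\<lambda>s w. \<phi> s w $ i) (\<lambda>t w. I t w $ i)"
proof -
  obtain N \<tau> \<xi> where s: "\<And>k. simple_integrand M W T (N k) (\<tau> k) (\<xi> k)"
    and p: "(\<lambda>k. \<integral>\<^sup>+w. (\<integral>\<^sup>+s. ennreal ((norm (\<phi> s w - simple_process (N k) (\<tau> k) (\<xi> k) s w))\<^sup>2) \<partial>L) \<partial>M) \<longlonglongrightarrow> 0"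
    and q: "\<And>t. t \<in> {0..T} \<Longrightarrow> (\<lambda>k. \<integral>\<^sup>+w. ennreal ((norm (I t w - simple_ito W (N k) (\<tau> k) (\<xi> k) t w))\<^sup>2) \<partial>M) \<longlonglongrightarrow> 0"
    using assms unfolding has_ito_integral_def by blast
  define \<xi>' where "\<xi>' k j w = \<xi> k j w $ i" for k j w
  have sp: "simple_process (N k) (\<tau> k) (\<xi>' k) s w = simple_process (N k) (\<tau> k) (\<xi> k) s w $ i" for k s w
    by (simp add: simple_process_def \<xi>'_def)
  have si: "simple_ito W (N k) (\<tau> k) (\<xi>' k) t w = simple_ito W (N k) (\<tau> k) (\<xi> k) t w $ i" for k t w
    by (simp add: simple_ito_def \<xi>'_def)
  have s': "simple_integrand M W T (N k) (\<tau> k) (\<xi>' k)" for k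
  proof -
    obtain C where "\<forall>j<N k. \<forall>w\<in>space M. norm (\<xi> k j w) \<le> C" using s[of k] unfolding simple_integrand_def by blast
    then have "\<forall>j<N k. \<forall>w\<in>space M. norm (\<xi>' k j w) \<le> C"
      unfolding \<xi>'_def using component_le_norm_cart order_trans by (metis real_norm_def)
    then show ?thesis
      using s[of k] unfolding simple_integrand_def \<xi>'_def by (auto intro: borel_measurable_component)
  qed
  have le: "(x $ i - y $ i)\<^sup>2 \<le> (norm (x - y))\<^sup>2" for x y :: "real^'k"
    using component_square_le[of "x - y" i] by simp
  show ?thesis
    unfolding has_ito_integral_def
  proof (intro conjI exI[of _ N] exI[of _ \<tau>] exI[of _ \<xi>'] allI ballI s')
    show "L2F M W T (\<lambda>s w. \<phi> s w $ i)" using assms by (intro L2F_component) (simp add: has_ito_integral_def)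
    show "(\<lambda>w. I t w $ i) \<in> borel_measurable M" if "t \<in> {0..T}" for t
      using assms that by (auto simp: has_ito_integral_def intro: borel_measurable_component)
    show "(\<lambda>k. \<integral>\<^sup>+w. (\<integral>\<^sup>+s. ennreal ((norm (\<phi> s w $ i - simple_process (N k) (\<tau> k) (\<xi>' k) s w))\<^sup>2) \<partial>L) \<partial>M) \<longlonglongrightarrow> 0"
      unfolding sp by (rule tendsto_sandwich[OF _ _ tendsto_const p]) (auto intro!: always_eventually nn_integral_mono simp: le)
    show "(\<lambda>k. \<integral>\<^sup>+w. ennreal ((norm (I t w $ i - simple_ito W (N k) (\<tau> k) (\<xi>' k) t w))\<^sup>2) \<partial>M) \<longlonglongrightarrow> 0"
      if "t \<in> {0..T}" for t
      unfolding si by (rule tendsto_sandwich[OF _ _ tendsto_const q[OF that]]) (auto intro!: always_eventually nn_integral_mono simp: le)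
  qed
qed

definition vector_ito :: "(real \<Rightarrow> 'w \<Rightarrow> real^'k) \<Rightarrow> (real \<Rightarrow> 'w \<Rightarrow> real^'k) \<Rightarrow> (real \<Rightarrow> 'w \<Rightarrow> real^'k) \<Rightarrow> bool" where
  "vector_ito V b \<sigma> \<longleftrightarrow> (\<forall>i. ito_process (\<lambda>s w. V s w $ i) (\<lambda>s w. b s w $ i) (\<lambda>s w. \<sigma> s w $ i))"

lemma integral_lebesgue_on_Icc:
  fixes f :: "real \<Rightarrow> 'x::euclidean_space"
  assumes f: "integrable L f" and t: "t \<in> {0..T}"
  shows "(\<integral>s. f s \<partial>lebesgue_on {0..t}) = integral {0..t} f"
proof (rule lebesgue_integral_eq_integral)
  have "f absolutely_integrable_on {0..T}" using f by (simp add: integrable_L_iff)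
  then have "f absolutely_integrable_on {0..t}" by (rule absolutely_integrable_on_subinterval) (use t in auto)
  then show "integrable (lebesgue_on {0..t}) f"
    unfolding set_integrable_def by (subst integrable_restrict_space) auto
qed simp

text \<open>The drift may be changed at a null set of times, which allows for the modified coefficients.\<close>

lemma ito_differential_vector_ito:
  fixes V b b' \<sigma> :: "real \<Rightarrow> 'w \<Rightarrow> real^'k"
  assumes d: "ito_differential M W T V b \<sigma>" and V: "L2_process V" "\<And>s. s \<in> {0..T} \<Longrightarrow> L2_variable (V s)"
    and b': "L2_process b'" and eq: "AE s in L. \<forall>w. b s w = b' s w"
  shows "vector_ito V b' \<sigma>"
  unfolding vector_ito_def ito_process_def
proof (intro allI conjI ballI)
  fix i
  show "sq_int LM (\<lambda>z. V (fst z) (snd z) $ i)" "sq_int LM (\<lambda>z. b' (fst z) (snd z) $ i)"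
    using V(1) b' by (simp_all add: L2_process_def)
  show "(\<lambda>w. V t w $ i) \<in> borel_measurable M" if "t \<in> {0..T}" for t
    using V(2)[OF that] by (simp add: L2_variable_def sq_int_def)
  obtain I where I: "has_ito_integral M W T \<sigma> I"
    "AE w in M. integrable L (\<lambda>s. b s w) \<and> (\<forall>t\<in>{0..T}. V t w = V 0 w + (\<integral>s. b s w \<partial>lebesgue_on {0..t}) + I t w)"
    using d unfolding ito_differential_def by blast
  obtain N where N: "negligible N" "\<And>s. s \<in> {0..T} - N \<Longrightarrow> \<forall>w. b s w = b' s w"
    using AE_lebesgue_onD[OF eq] by blast
  have "AE w in M. \<forall>t\<in>{0..T}. V t w $ i = V 0 w $ i + IL 0 t (\<lambda>s. b' s w $ i) + I t w $ i"
    using I(2) AE_space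
  proof eventually_elim
    case (elim w)
    show ?case
    proof
      fix t assume t: "t \<in> {0..T}"
      have bi: "integrable L (\<lambda>s. b s w)" using elim by simp
      then have bi': "integrable L (\<lambda>s. b s w $ i)"
        by (rule integrable_bounded_linear[OF bounded_linear_vec_nth])
      have ai: "(\<lambda>s. b s w) absolutely_integrable_on {0..T}" using bi by (simp add: integrable_L_iff)
      have "(\<lambda>s. b s w) absolutely_integrable_on {0..t}"
        by (rule absolutely_integrable_on_subinterval[OF ai]) (use t in auto)
      then have iT: "(\<lambda>s. b s w) integrable_on {0..t}" using set_lebesgue_integral_eq_integral(1) by blast
      have "(\<integral>s. b s w \<partial>lebesgue_on {0..t}) $ i = integral {0..t} (\<lambda>s. b s w) $ i"
        by (simp only: integral_lebesgue_on_Icc[OF bi t])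
      also have "\<dots> = integral {0..t} (\<lambda>s. b s w $ i)" by (rule integral_component_eq_cart[OF iT, symmetric])
      also have "\<dots> = IL 0 t (\<lambda>s. b s w $ i)"
        using IL_eq_integral[OF bi', of 0 t] t by simp
      also have "\<dots> = IL 0 t (\<lambda>s. b' s w $ i)"
      proof -
        have "AE s in L. b s w $ i = b' s w $ i"
          by (rule AE_lebesgue_onI[OF N(1)]) (use N(2) in metis)
        moreover have "(\<lambda>s. b' s w $ i) \<in> borel_measurable L"
          using measurable_compose[OF measurable_Pair2'[OF elim(2), of L] borel_measurable_component[OF L2_process_measurable[OF b']]]
          by simp
        ultimately show ?thesis
          unfolding IL_def using bi' indicator_Ioc_measurable[of 0 t]
          by (intro integral_cong_AE borel_measurable_times) (auto elim: eventually_mono)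
      qed
      finally have E: "(\<integral>s. b s w \<partial>lebesgue_on {0..t}) $ i = IL 0 t (\<lambda>s. b' s w $ i)" .
      have "V t w = V 0 w + (\<integral>s. b s w \<partial>lebesgue_on {0..t}) + I t w" using elim t by blast
      then have "V t w $ i = V 0 w $ i + (\<integral>s. b s w \<partial>lebesgue_on {0..t}) $ i + I t w $ i"
        by (metis vector_add_component)
      then show "V t w $ i = V 0 w $ i + IL 0 t (\<lambda>s. b' s w $ i) + I t w $ i" unfolding E .
    qed
  qed
  then show "\<exists>J. has_ito_integral M W T (\<lambda>s w. \<sigma> s w $ i) J \<and>
     (AE w in M. \<forall>t\<in>{0..T}. V t w $ i = V 0 w $ i + IL 0 t (\<lambda>s. b' s w $ i) + J t w)"
    using has_ito_integral_component[OF I(1)] by blast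
qed

lemma primitive_on_component:
  fixes P :: "real \<Rightarrow> 'a::euclidean_space^'k"
  assumes "primitive_on a b P P'"
  shows "primitive_on a b (\<lambda>s. P s $ i) (\<lambda>s. P' s $ i)"
  by (rule primitive_on_bounded_linear[OF bounded_linear_vec_nth assms])

lemma bounded_measurable_component:
  fixes P :: "real \<Rightarrow> 'a::euclidean_space^'k"
  assumes "bounded_measurable P"
  shows "bounded_measurable (\<lambda>s. P s $ i)"
  unfolding bounded_measurable_def
proof
  show "(\<lambda>s. P s $ i) \<in> borel_measurable lebesgue"
    using assms by (intro borel_measurable_component) (simp add: bounded_measurable_def)
  obtain C where "\<And>s. norm (P s) \<le> C" using assms unfolding bounded_measurable_def bounded_iff by blast
  then have "norm (P s $ i) \<le> C" for s using Finite_Cartesian_Product.norm_nth_le[of "P s" i] order_trans by blast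
  then show "bounded (range (\<lambda>s. P s $ i))" unfolding bounded_iff by blast
qed

lemma sum_option_UNIV: "(\<Sum>l\<in>UNIV. g l) = g None + (\<Sum>j\<in>UNIV. g (Some j))"
  for g :: "'k::finite option \<Rightarrow> real"
  unfolding UNIV_option_conv by (simp add: sum.reindex)

text \<open>Component \<open>i\<close> of \<open>Y - P X\<close> is a weighted sum indexed by \<open>None\<close>, for the component of \<open>Y\<close> with weight 1,
  and \<open>Some j\<close>, for the components of \<open>X\<close> with weights \<open>- P i j\<close>.\<close>

lemma affine_combination_dynamics:
  fixes X Y :: "real \<Rightarrow> 'w \<Rightarrow> real^'k"
  assumes X: "vector_ito X a \<sigma>" and Y: "vector_ito Y b Z"
    and P: "primitive_on 0 T P P'" "bounded_measurable P'"
  shows "martingale_dynamics (\<lambda>s w. Y s w - P s *v X s w)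
     (\<lambda>s w. b s w - (P' s *v X s w + P s *v a s w)) (\<lambda>s w. Z s w - P s *v \<sigma> s w)"
  unfolding martingale_dynamics_def
proof (intro allI impI)
  fix t r i assume t: "0 \<le> t" "t \<le> r" "r \<le> T"
  define V where "V l s w = (case l of None \<Rightarrow> Y s w $ i | Some j \<Rightarrow> X s w $ j)" for l s w
  define d where "d l s w = (case l of None \<Rightarrow> b s w $ i | Some j \<Rightarrow> a s w $ j)" for l s w
  define \<phi> where "\<phi> l s w = (case l of None \<Rightarrow> Z s w $ i | Some j \<Rightarrow> \<sigma> s w $ j)" for l s w
  define p where "p l s = (case l of None \<Rightarrow> 1 | Some j \<Rightarrow> - P s $ i $ j)" for l s
  define p' where "p' l s = (case l of None \<Rightarrow> 0 | Some j \<Rightarrow> - P' s $ i $ j)" for l s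
  have 1: "ito_process (V l) (d l) (\<phi> l)" for l
    using X Y by (cases l) (simp_all add: vector_ito_def V_def[abs_def] d_def[abs_def] \<phi>_def[abs_def])
  have 2: "primitive_on 0 T (p l) (p' l)" for l
  proof (cases l)
    case None
    have "primitive_on 0 T (\<lambda>s. 1::real) (\<lambda>s. 0)" by (simp add: primitive_on_def)
    then show ?thesis using None by (simp add: p_def[abs_def] p'_def[abs_def])
  next
    case (Some j)
    then show ?thesis
      using primitive_on_minus[OF primitive_on_component[OF primitive_on_component[OF P(1)], of i j]]
      by (simp add: p_def[abs_def] p'_def[abs_def])
  qed
  have 3: "bounded_measurable (p' l)" for l
  proof (cases l)
    case None
    then show ?thesis by (simp add: p'_def[abs_def] bounded_measurable_const)
  next
    case (Some j)
    then show ?thesis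
      using bounded_measurable_minus[OF bounded_measurable_component[OF bounded_measurable_component[OF P(2)], of i j]]
      by (simp add: p'_def[abs_def])
  qed
  obtain N where N: "sq_int M N"
    "AE w in M. (\<Sum>l\<in>UNIV. p l r * V l r w) - (\<Sum>l\<in>UNIV. p l t * V l t w)
        = IL t r (\<lambda>s. \<Sum>l\<in>UNIV. p' l s * V l s w + p l s * d l s w) + N w"
    "expectation (\<lambda>w. (N w)\<^sup>2) = (\<integral>z. indicator {t<..r} (fst z) * (\<Sum>l\<in>UNIV. p l (fst z) * \<phi> l (fst z) (snd z))\<^sup>2 \<partial>LM)"
    "\<And>H. H \<in> borel_measurable (\<F> t) \<Longrightarrow> sq_int M H \<Longrightarrow> expectation (\<lambda>w. H w * N w) = 0"
    by (rule ito_weighted_sum[of UNIV V d \<phi> p p', OF finite 1 2 3 t]) blast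
  have e1: "(\<Sum>l\<in>UNIV. p l s * V l s w) = (Y s w - P s *v X s w) $ i" for s w
    by (simp add: sum_option_UNIV p_def V_def matrix_vector_mult_def sum_negf)
  have e2: "(\<Sum>l\<in>UNIV. p l s * \<phi> l s w) = (Z s w - P s *v \<sigma> s w) $ i" for s w
    by (simp add: sum_option_UNIV p_def \<phi>_def matrix_vector_mult_def sum_negf)
  have e3: "(\<Sum>l\<in>UNIV. p' l s * V l s w + p l s * d l s w) = (b s w - (P' s *v X s w + P s *v a s w)) $ i" for s w
    by (simp add: sum_option_UNIV p_def p'_def V_def d_def matrix_vector_mult_def sum.distrib sum_negf sum_subtractf)
  show "\<exists>N. sq_int M N \<and>
      (AE w in M. (Y r w - P r *v X r w) $ i - (Y t w - P t *v X t w) $ i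
          = IL t r (\<lambda>s. (b s w - (P' s *v X s w + P s *v a s w)) $ i) + N w) \<and>
      expectation (\<lambda>w. (N w)\<^sup>2) = energy (\<lambda>s w. Z s w - P s *v \<sigma> s w) t r i \<and>
      (\<forall>H. H \<in> borel_measurable (\<F> t) \<longrightarrow> sq_int M H \<longrightarrow> expectation (\<lambda>w. H w * N w) = 0)"
    using N unfolding e1 e2 e3 energy_def by blast
qed

text \<open>Martingale increments have mean zero: taking expectations and subtracting separates the
  mean of \<open>\<eta>\<close>, which follows an ordinary differential equation, from its fluctuation.\<close>

lemma martingale_dynamics_mean:
  fixes \<eta> f \<zeta> :: "real \<Rightarrow> 'w \<Rightarrow> real^'k"
  assumes dyn: "martingale_dynamics \<eta> f \<zeta>" and f: "L2_process f"
    and \<eta>: "\<And>s. s \<in> {0..T} \<Longrightarrow> L2_variable (\<eta> s)"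
  shows "martingale_dynamics (fluctuation \<eta>) (fluctuation f) \<zeta>" "primitive_on 0 T (mean M \<eta>) (mean M f)"
proof -
  have mi: "integrable L (\<lambda>s. mean M f s $ i)" for i
  proof (rule sq_int_finite_integrable[OF L.finite_measure_axioms])
    show "sq_int L (\<lambda>s. mean M f s $ i)"
      using borel_measurable_component[OF mean_measurable[OF f]] mean_square_integrable[OF f] by (simp add: sq_int_def)
  qed
  have main: "mean M \<eta> r $ i - mean M \<eta> t $ i = IL t r (\<lambda>s. mean M f s $ i) \<and>
     (\<exists>N. sq_int M N \<and>
      (AE w in M. fluctuation \<eta> r w $ i - fluctuation \<eta> t w $ i = IL t r (\<lambda>s. fluctuation f s w $ i) + N w) \<and>
      expectation (\<lambda>w. (N w)\<^sup>2) = energy \<zeta> t r i \<and>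
      (\<forall>H. H \<in> borel_measurable (\<F> t) \<longrightarrow> sq_int M H \<longrightarrow> expectation (\<lambda>w. H w * N w) = 0))"
    if t: "0 \<le> t" "t \<le> r" "r \<le> T" for t r i
  proof -
    obtain N where N: "sq_int M N"
      "AE w in M. \<eta> r w $ i - \<eta> t w $ i = IL t r (\<lambda>s. f s w $ i) + N w"
      "expectation (\<lambda>w. (N w)\<^sup>2) = energy \<zeta> t r i"
      "\<And>H. H \<in> borel_measurable (\<F> t) \<Longrightarrow> sq_int M H \<Longrightarrow> expectation (\<lambda>w. H w * N w) = 0"
      using dyn t unfolding martingale_dynamics_def by meson
    have one: "sq_int M (\<lambda>w. 1)" by (simp add: sq_int_def)
    have fi: "sq_int LM (\<lambda>z. f (fst z) (snd z) $ i)" using f by (simp add: L2_process_def)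
    have vr: "L2_variable (\<eta> r)" and vt: "L2_variable (\<eta> t)" using \<eta> t by auto
    note int = sq_int_finite_integrable[OF finite_measure_axioms]
    have ii: "integrable M (\<lambda>w. \<eta> r w $ i)" "integrable M (\<lambda>w. \<eta> t w $ i)" "integrable M N"
      "integrable M (\<lambda>w. IL t r (\<lambda>s. f s w $ i))"
      using vr vt N(1) time_integral_bound(1)[OF fi t] by (auto simp: L2_variable_def intro: int)
    have "mean M \<eta> r $ i - mean M \<eta> t $ i = expectation (\<lambda>w. \<eta> r w $ i - \<eta> t w $ i)"
      using ii L2_variable_component_expectation[OF vr, of i] L2_variable_component_expectation[OF vt, of i]
      by (simp add: mean_def)
    also have "\<dots> = expectation (\<lambda>w. IL t r (\<lambda>s. f s w $ i) + N w)"
      using ii N(2) by (intro integral_cong_AE) auto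
    also have "\<dots> = expectation (\<lambda>w. IL t r (\<lambda>s. f s w $ i)) + expectation N" using ii by simp
    also have "expectation N = 0" using N(4)[OF _ one] by simp
    also have "expectation (\<lambda>w. IL t r (\<lambda>s. f s w $ i)) = IL t r (\<lambda>s. expectation (\<lambda>w. f s w $ i))"
      using expectation_time_integral[OF fi one] by simp
    also have "\<dots> = IL t r (\<lambda>s. mean M f s $ i)"
    proof -
      have "AE s in L. expectation (\<lambda>w. f s w $ i) = mean M f s $ i"
        using L2_process_AE_variable[OF f] by eventually_elim (simp add: L2_variable_component_expectation mean_def)
      moreover have "(\<lambda>s. expectation (\<lambda>w. f s w $ i)) \<in> borel_measurable L"
        using LM.integrable_fst'[OF sq_int_finite_integrable[OF LM.finite_measure_axioms fi]] by simp
      ultimately show ?thesis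
        unfolding IL_def using mi[of i] indicator_Ioc_measurable[of t r]
        by (intro integral_cong_AE borel_measurable_times) (auto elim: eventually_mono)
    qed
    finally have m: "mean M \<eta> r $ i - mean M \<eta> t $ i = IL t r (\<lambda>s. mean M f s $ i)" by simp
    have "AE w in M. fluctuation \<eta> r w $ i - fluctuation \<eta> t w $ i = IL t r (\<lambda>s. fluctuation f s w $ i) + N w"
      using N(2) AE_section_sq_int(1)[OF fi]
    proof eventually_elim
      case (elim w)
      have "integrable L (\<lambda>s. f s w $ i)" using elim(2) by (rule sq_int_finite_integrable[OF L.finite_measure_axioms])
      then have "IL t r (\<lambda>s. fluctuation f s w $ i) = IL t r (\<lambda>s. f s w $ i) - IL t r (\<lambda>s. mean M f s $ i)"
        unfolding IL_def fluctuation_def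
        by (subst Bochner_Integration.integral_diff[symmetric]) (auto intro!: integrable_IL mi simp: right_diff_distrib)
      then show ?case using elim(1) m by (simp add: fluctuation_def)
    qed
    then show ?thesis using m N by blast
  qed
  show "martingale_dynamics (fluctuation \<eta>) (fluctuation f) \<zeta>"
    unfolding martingale_dynamics_def using main by blast
  have iv: "integrable L (mean M f)" by (rule integrable_vec_components[OF mi])
  show "primitive_on 0 T (mean M \<eta>) (mean M f)"
    unfolding primitive_on_def
  proof (intro conjI allI impI)
    show a: "mean M f absolutely_integrable_on {0..T}" using iv by (simp add: integrable_L_iff)
    fix s t assume st: "0 \<le> s" "s \<le> t" "t \<le> T"
    have "mean M f absolutely_integrable_on {s..t}" by (rule absolutely_integrable_on_subinterval[OF a]) (use st in auto)
    then have i: "mean M f integrable_on {s..t}" using set_lebesgue_integral_eq_integral(1) by blast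
    have "integral {s..t} (mean M f) $ i = mean M \<eta> t $ i - mean M \<eta> s $ i" for i
      using main[OF st, of i] IL_eq_integral[OF mi st] integral_component_eq_cart[OF i, of i] by simp
    then have "integral {s..t} (mean M f) = mean M \<eta> t - mean M \<eta> s" by (simp add: vec_eq_iff)
    then show "(mean M f has_integral mean M \<eta> t - mean M \<eta> s) {s..t}"
      using integrable_integral[OF i] by simp
  qed
qed

lemma energy_norm:
  fixes \<phi> :: "real \<Rightarrow> 'w \<Rightarrow> real^'k"
  assumes "L2_process \<phi>"
  shows "(\<Sum>i\<in>UNIV. energy \<phi> t r i) = (\<integral>z. indicator {t<..r} (fst z) * (norm (\<phi> (fst z) (snd z)))\<^sup>2 \<partial>LM)"
    "integrable LM (\<lambda>z. indicator {t<..r} (fst z) * (norm (\<phi> (fst z) (snd z)))\<^sup>2)"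
proof -
  have eq: "indicator {t<..r} (fst z) * (norm (\<phi> (fst z) (snd z)))\<^sup>2
    = (\<Sum>i\<in>UNIV. indicator {t<..r} (fst z) * (\<phi> (fst z) (snd z) $ i)\<^sup>2)" for z
    by (simp add: norm_square_components sum_distrib_left)
  show "(\<Sum>i\<in>UNIV. energy \<phi> t r i) = (\<integral>z. indicator {t<..r} (fst z) * (norm (\<phi> (fst z) (snd z)))\<^sup>2 \<partial>LM)"
    unfolding eq energy_def by (rule Bochner_Integration.integral_sum[symmetric]) (rule integrable_energy[OF assms])
  show "integrable LM (\<lambda>z. indicator {t<..r} (fst z) * (norm (\<phi> (fst z) (snd z)))\<^sup>2)"
    unfolding eq by (intro Bochner_Integration.integrable_sum integrable_energy assms)
qed

lemma energy_linear_combination: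
  fixes f \<eta> \<zeta> :: "real \<Rightarrow> 'w \<Rightarrow> real^'k"
  assumes L2: "L2_process f" "L2_process \<eta>" "L2_process \<zeta>"
    and eq: "AE z in LM. f (fst z) (snd z) = H (fst z) *v \<eta> (fst z) (snd z) + K (fst z) *v \<zeta> (fst z) (snd z)"
    and C: "\<And>s. norm (H s) \<le> C" "\<And>s. norm (K s) \<le> C"
  shows "(\<Sum>i\<in>UNIV. energy f t r i) \<le> 2 * C\<^sup>2 * ((\<Sum>i\<in>UNIV. energy \<eta> t r i) + (\<Sum>i\<in>UNIV. energy \<zeta> t r i))"
proof -
  have "(\<Sum>i\<in>UNIV. energy f t r i) \<le> (\<integral>z. 2 * C\<^sup>2 * (indicator {t<..r} (fst z) * (norm (\<eta> (fst z) (snd z)))\<^sup>2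
       + indicator {t<..r} (fst z) * (norm (\<zeta> (fst z) (snd z)))\<^sup>2) \<partial>LM)"
    unfolding energy_norm(1)[OF L2(1)]
  proof (rule integral_mono_AE[OF energy_norm(2)[OF L2(1)]])
    show "integrable LM (\<lambda>z. 2 * C\<^sup>2 * (indicator {t<..r} (fst z) * (norm (\<eta> (fst z) (snd z)))\<^sup>2
       + indicator {t<..r} (fst z) * (norm (\<zeta> (fst z) (snd z)))\<^sup>2))"
      by (intro integrable_mult_right Bochner_Integration.integrable_add energy_norm(2) L2)
    show "AE z in LM. indicator {t<..r} (fst z) * (norm (f (fst z) (snd z)))\<^sup>2 \<le> 2 * C\<^sup>2 *
       (indicator {t<..r} (fst z) * (norm (\<eta> (fst z) (snd z)))\<^sup>2 + indicator {t<..r} (fst z) * (norm (\<zeta> (fst z) (snd z)))\<^sup>2)"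
      using eq
    proof eventually_elim
      case (elim z)
      define a b where "a = norm (\<eta> (fst z) (snd z))" and "b = norm (\<zeta> (fst z) (snd z))"
      have "norm (f (fst z) (snd z)) \<le> norm (H (fst z) *v \<eta> (fst z) (snd z)) + norm (K (fst z) *v \<zeta> (fst z) (snd z))"
        unfolding elim by (rule norm_triangle_ineq)
      also have "\<dots> \<le> C * a + C * b"
        unfolding a_def b_def
        by (intro add_mono order_trans[OF norm_matrix_vector_mult_le] mult_right_mono C norm_ge_zero)
      finally have "(norm (f (fst z) (snd z)))\<^sup>2 \<le> (C * a + C * b)\<^sup>2" by (intro power_mono) simp_all
      also have "\<dots> = C\<^sup>2 * (a + b)\<^sup>2" by (simp add: algebra_simps power2_eq_square)
      also have "\<dots> \<le> C\<^sup>2 * (2 * (a\<^sup>2 + b\<^sup>2))"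
      proof (rule mult_left_mono)
        have "0 \<le> (a - b)\<^sup>2" by simp
        then show "(a + b)\<^sup>2 \<le> 2 * (a\<^sup>2 + b\<^sup>2)" by (simp add: power2_sum power2_diff)
      qed simp
      finally have "(norm (f (fst z) (snd z)))\<^sup>2 \<le> 2 * C\<^sup>2 * (a\<^sup>2 + b\<^sup>2)" by (simp add: algebra_simps)
      then show ?case unfolding a_def b_def by (cases "fst z \<in> {t<..r}") auto
    qed
  qed
  also have "\<dots> = 2 * C\<^sup>2 * ((\<Sum>i\<in>UNIV. energy \<eta> t r i) + (\<Sum>i\<in>UNIV. energy \<zeta> t r i))"
    unfolding energy_norm(1)[OF L2(2)] energy_norm(1)[OF L2(3)]
    using energy_norm(2)[OF L2(2), of t r] energy_norm(2)[OF L2(3), of t r] by simp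
  finally show ?thesis .
qed

end

section \<open>Decoupling the forward-backward system\<close>

lemmas matrix_vector_simps = matrix_vector_mul_assoc[symmetric] matrix_vector_right_distrib
  matrix_vector_mult_diff_distrib matrix_vector_mult_add_rdistrib matrix_vector_mult_diff_rdistrib
  matrix_vector_mult_minus_left matrix_vector_mult_minus_right

text \<open>The algebra behind the Riccati equations.  It is used for the deviations, with \<open>S = P\<close>, and for the
  means with the summed coefficients, where \<open>S\<close> is the second Riccati solution and \<open>\<zeta> = 0\<close>.  The optimality
  relation says that the gap \<open>u + \<Theta> x\<close> between \<open>u\<close> and the feedback is determined by \<open>\<eta>\<close> and
  \<open>\<zeta>\<close>, and by the equation for \<open>S\<close> the terms of the drift other than those in \<open>\<eta>\<close> and \<open>\<zeta>\<close> add up to a multiple of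
  this gap.\<close>

lemma feedback_decoupling:
  fixes A A1 Q P S S' :: "real^'n^'n" and B B1 :: "real^'m^'n" and R :: "real^'m^'m" and \<Theta> :: "real^'n^'m"
    and x y z \<eta> \<zeta> :: "real^'n" and u :: "real^'m"
  assumes sym: "transpose P = P" "transpose S = S" "transpose R = R"
    and K: "(R + transpose B1 ** P ** B1) ** \<Theta> = transpose B ** S + transpose B1 ** P ** A1"
    and S': "S' = - (S ** A + transpose A ** S + transpose A1 ** P ** A1 + Q - (S ** B + transpose A1 ** P ** B1) ** \<Theta>)"
    and y: "y = \<eta> + S *v x" and z: "z = \<zeta> + P *v (A1 *v x + B1 *v u)"
    and opt: "R *v u + transpose B *v y + transpose B1 *v z = 0"
  shows "(R + transpose B1 ** P ** B1) *v (u + \<Theta> *v x) = - (transpose B *v \<eta> + transpose B1 *v \<zeta>)" (is ?gain)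
    "- (transpose A *v y + transpose A1 *v z + Q *v x) - (S' *v x + S *v (A *v x + B *v u))
      = (transpose \<Theta> ** transpose B - transpose A) *v \<eta> + (transpose \<Theta> ** transpose B1 - transpose A1) *v \<zeta>" (is ?drift)
proof -
  define K' where "K' = R + transpose B1 ** P ** B1"
  have K\<Theta>: "K' *v (\<Theta> *v v) = transpose B *v (S *v v) + transpose B1 *v (P *v (A1 *v v))" for v
    using arg_cong[OF K, of "\<lambda>N. N *v v"] by (simp only: K'_def matrix_vector_simps)
  have Ku: "K' *v u = R *v u + transpose B1 *v (P *v (B1 *v u))" by (simp only: K'_def matrix_vector_simps)
  have gain: "K' *v (u + \<Theta> *v x) = - (transpose B *v \<eta> + transpose B1 *v \<zeta>)"
  proof -
    have "K' *v (u + \<Theta> *v x) + (transpose B *v \<eta> + transpose B1 *v \<zeta>) = R *v u + transpose B *v y + transpose B1 *v z"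
      by (simp only: matrix_vector_right_distrib Ku K\<Theta> y z) (simp add: algebra_simps)
    then show ?thesis using opt by (simp only: eq_neg_iff_add_eq_0)
  qed
  then show ?gain by (simp add: K'_def)
  have TK: "transpose \<Theta> ** K' = S ** B + transpose A1 ** P ** B1"
    using arg_cong[OF K, of transpose] sym
    by (simp add: K'_def matrix_transpose_mul transpose_add matrix_mul_assoc)
  have T: "transpose \<Theta> *v (K' *v v) = S *v (B *v v) + transpose A1 *v (P *v (B1 *v v))" for v
    using arg_cong[OF TK, of "\<lambda>N. N *v v"] by (simp only: matrix_vector_simps)
  have P': "S' *v x = - (S *v (A *v x) + transpose A *v (S *v x) + transpose A1 *v (P *v (A1 *v x)) + Q *v x
      - (S *v (B *v (\<Theta> *v x)) + transpose A1 *v (P *v (B1 *v (\<Theta> *v x)))))"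
    by (simp only: S' matrix_vector_simps)
  have "- (transpose A *v y + transpose A1 *v z + Q *v x) - (S' *v x + S *v (A *v x + B *v u))
      = - (transpose A *v \<eta>) - transpose A1 *v \<zeta>
        - (S *v (B *v (u + \<Theta> *v x)) + transpose A1 *v (P *v (B1 *v (u + \<Theta> *v x))))"
    by (simp only: P' y z matrix_vector_simps) (simp add: algebra_simps)
  also have "\<dots> = - (transpose A *v \<eta>) - transpose A1 *v \<zeta> + transpose \<Theta> *v (transpose B *v \<eta> + transpose B1 *v \<zeta>)"
    by (simp only: T[symmetric] gain matrix_vector_mult_minus_right diff_minus_eq_add)
  finally show ?drift by (simp add: matrix_vector_simps algebra_simps)
qed

context brownian_horizon
begin

text \<open>Joint measurability lets null sets of times and of paths be exchanged.\<close>

lemma AE_eq_iff: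
  fixes g h :: "real \<Rightarrow> 'w \<Rightarrow> real^'k"
  assumes g: "(joint g) \<in> borel_measurable LM" and h: "(joint h) \<in> borel_measurable LM"
  shows "(AE s in L. AE w in M. g s w = h s w) \<longleftrightarrow> (AE z in LM. g (fst z) (snd z) = h (fst z) (snd z))"
    "(AE w in M. AE s in L. g s w = h s w) \<longleftrightarrow> (AE z in LM. g (fst z) (snd z) = h (fst z) (snd z))"
proof -
  have "{z \<in> space LM. g (fst z) (snd z) = h (fst z) (snd z)} = (\<lambda>z. g (fst z) (snd z) - h (fst z) (snd z)) -` {0} \<inter> space LM"
    by auto
  moreover have "\<dots> \<in> sets LM"
    using borel_measurable_diff[OF g h] by (rule measurable_sets) simp
  ultimately have m: "{z \<in> space LM. g (fst z) (snd z) = h (fst z) (snd z)} \<in> sets LM" by simp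
  show 1: "(AE s in L. AE w in M. g s w = h s w) \<longleftrightarrow> (AE z in LM. g (fst z) (snd z) = h (fst z) (snd z))"
    using LM.AE_pair_iff[of "\<lambda>s w. g s w = h s w"] m by blast
  show "(AE w in M. AE s in L. g s w = h s w) \<longleftrightarrow> (AE z in LM. g (fst z) (snd z) = h (fst z) (snd z))"
    using LM.AE_commute[of "\<lambda>s w. g s w = h s w"] m 1 by blast
qed

lemma mean_rules:
  fixes \<phi> \<psi> :: "real \<Rightarrow> 'w \<Rightarrow> real^'k" and K :: "real \<Rightarrow> real^'k^'l"
  shows "L2_variable (\<phi> s) \<Longrightarrow> L2_variable (\<psi> s) \<Longrightarrow> mean M (\<lambda>s w. \<phi> s w + \<psi> s w) s = mean M \<phi> s + mean M \<psi> s"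
    "L2_variable (\<phi> s) \<Longrightarrow> L2_variable (\<psi> s) \<Longrightarrow> mean M (\<lambda>s w. \<phi> s w - \<psi> s w) s = mean M \<phi> s - mean M \<psi> s"
    "L2_variable (\<phi> s) \<Longrightarrow> mean M (\<lambda>s w. - \<phi> s w) s = - mean M \<phi> s"
    "L2_variable (\<phi> s) \<Longrightarrow> mean M (\<lambda>s w. K s *v \<phi> s w) s = K s *v mean M \<phi> s"
    "mean M (\<lambda>s w. q s) s = (q s :: real^'k)"
  by (simp_all add: mean_def L2_variable_integrable L2_variable_expectation_matrix prob_space)

lemmas L2_variable_rules = L2_variable_add L2_variable_diff L2_variable_minus L2_variable_matrix L2_variable_const

lemmas L2_process_rules = L2_process_add L2_process_diff L2_process_minus L2_process_matrix L2_process_mean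

lemma vector_ito_mean:
  fixes V b \<sigma> :: "real \<Rightarrow> 'w \<Rightarrow> real^'k"
  assumes V: "vector_ito V b \<sigma>" and b: "L2_process b" and v: "\<And>s. s \<in> {0..T} \<Longrightarrow> L2_variable (V s)"
  shows "primitive_on 0 T (mean M V) (mean M b)"
proof -
  \<comment> \<open>written as \<open>V - 0 V\<close>, a combination to which \<open>affine_combination_dynamics\<close> applies\<close>
  have "primitive_on 0 T (\<lambda>s. 0 :: real^'k^'k) (\<lambda>s. 0)" by (simp add: primitive_on_def)
  from affine_combination_dynamics[OF V V this bounded_measurable_const]
  have "martingale_dynamics V b \<sigma>" by simp
  from martingale_dynamics_mean(2)[OF this b v] show ?thesis .
qed

end

text \<open>Gronwall's inequality, run backwards from the terminal value.\<close>

lemma linear_backward_zero: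
  fixes y :: "real \<Rightarrow> real^'k"
  assumes y: "primitive_on 0 T y (\<lambda>s. H s *v y s)" and H: "bounded_measurable H" and T: "y T = 0" and t: "t \<in> {0..T}"
  shows "y t = 0"
proof -
  obtain C where C: "\<And>s. norm (H s) \<le> C" using H unfolding bounded_measurable_def bounded_iff by blast
  have C0: "0 \<le> C" using C[of 0] norm_ge_zero order_trans by blast
  have yc: "continuous_on {0..T} y" by (rule primitive_on_continuous[OF y])
  have "norm (y t) = 0"
  proof (rule gronwall_backward_zero[of 0 T "\<lambda>s. norm (y s)" C t])
    show "continuous_on {0..T} (\<lambda>s. norm (y s))" using yc by (intro continuous_intros)
    fix r assume r: "r \<in> {0..T}"
    have ni: "(\<lambda>s. norm (y s)) integrable_on {r..T}"
      by (intro integrable_continuous_interval continuous_intros continuous_on_subset[OF yc]) (use r in auto)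
    have "y T - y r = integral {r..T} (\<lambda>s. H s *v y s)" using primitive_on_diff[OF y] r by simp
    then have "norm (y r) = norm (integral {r..T} (\<lambda>s. H s *v y s))" using T by (metis diff_0 norm_minus_cancel)
    also have "\<dots> \<le> integral {r..T} (\<lambda>s. C * norm (y s))"
    proof (rule integral_norm_bound_integral)
      show "(\<lambda>s. H s *v y s) integrable_on {r..T}" using primitive_on_integrable(2)[OF y] r by simp
      show "(\<lambda>s. C * norm (y s)) integrable_on {r..T}" using ni by (rule integrable_on_mult_right)
      show "norm (H s *v y s) \<le> C * norm (y s)" for s
        by (rule order_trans[OF norm_matrix_vector_mult_le mult_right_mono[OF C norm_ge_zero]])
    qed
    also have "\<dots> = C * integral {r..T} (\<lambda>s. norm (y s))" by simp
    finally show "norm (y r) \<le> C * integral {r..T} (\<lambda>s. norm (y s))" .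
  qed (use C0 t in auto)
  then show ?thesis by simp
qed

locale mean_field_brownian = mf_problem T \<delta> c + brownian_horizon M W T
  for T \<delta> :: real and c :: "('n::finite, 'm::finite) mf_coeffs" and M :: "'w measure" and W
begin

context
  fixes x :: "real^'n" and X u Y Z and P PI :: "real \<Rightarrow> real^'n^'n"
  assumes solP: "riccati_P_solution T c P" and solPI: "riccati_Pi_solution T c P PI"
    and sol: "mf_fbsde_solution M W T c x X u Y Z"
begin

text \<open>The system with the modified coefficients; the hatted ones appear as differences of the summed and
  the unhatted ones.\<close>

definition "forward_drift s w = kA s *v X s w + kB s *v u s w + ((bA s - kA s) *v mean M X s + (bB s - kB s) *v mean M u s)"

definition "diffusion s w = cA1 c s *v X s w + cB1 c s *v u s w + cA1h c s *v mean M X s + cB1h c s *v mean M u s"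

definition "backward_drift s w = - (transpose (kA s) *v Y s w + transpose (kA1 s) *v Z s w + kQ s *v X s w
   + (transpose (bA s - kA s) *v mean M Y s + transpose (bA1 s - kA1 s) *v mean M Z s + (bQ s - kQ s) *v mean M X s))"

definition "optimality s w = kR s *v u s w + transpose (kB s) *v Y s w + transpose (kB1 s) *v Z s w
   + ((bR s - kR s) *v mean M u s + transpose (bB s - kB s) *v mean M Y s + transpose (bB1 s - kB1 s) *v mean M Z s)"

lemma processes: "state_space M W T X" "L2F M W T u" "state_space M W T Y" "L2F M W T Z"
  using sol by (simp_all add: mf_fbsde_solution_def)

lemma L2_processes: "L2_process X" "L2_process u" "L2_process Y" "L2_process Z"
  using processes by (auto intro: state_space_properties(1) L2_process_L2F)

lemma L2_variables: "s \<in> {0..T} \<Longrightarrow> L2_variable (X s)" "s \<in> {0..T} \<Longrightarrow> L2_variable (Y s)"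
  using processes by (auto intro!: state_space_properties(2))

lemma bounded_coefficients: "bounded_coefficient kA" "bounded_coefficient kB" "bounded_coefficient kQ"
  "bounded_coefficient kR"
  "bounded_coefficient (\<lambda>s. bA s - kA s)" "bounded_coefficient (\<lambda>s. bB s - kB s)"
  "bounded_coefficient (\<lambda>s. bQ s - kQ s)" "bounded_coefficient (\<lambda>s. bR s - kR s)"
  "bounded_coefficient (\<lambda>s. transpose (kA s))" "bounded_coefficient (\<lambda>s. transpose (kA1 s))"
  "bounded_coefficient (\<lambda>s. transpose (kB s))" "bounded_coefficient (\<lambda>s. transpose (kB1 s))"
  "bounded_coefficient (\<lambda>s. transpose (bA s - kA s))" "bounded_coefficient (\<lambda>s. transpose (bA1 s - kA1 s))"
  "bounded_coefficient (\<lambda>s. transpose (bB s - kB s))" "bounded_coefficient (\<lambda>s. transpose (bB1 s - kB1 s))"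
  by (intro bounded_coefficient_bounded_measurable bounded_measurable_intros bounded_measurable_coefficients)+

lemma bounded_coefficient_P: "bounded_coefficient P"
  using solP by (intro bounded_coefficient_continuous abs_continuous_on_Icc_continuous) (simp add: riccati_P_solution_def)

lemma L2_coefficients: "L2_process forward_drift" "L2_process backward_drift" "L2_process optimality"
  unfolding forward_drift_def[abs_def] backward_drift_def[abs_def] optimality_def[abs_def]
  by (intro L2_process_rules L2_processes bounded_coefficients)+

lemma forward_ito: "vector_ito X forward_drift diffusion" and L2_diffusion: "L2_process diffusion"
proof -
  have d: "ito_differential M W T X
     (\<lambda>s w. cA c s *v X s w + cB c s *v u s w + cAh c s *v mean M X s + cBh c s *v mean M u s) diffusion"
    using sol by (simp add: mf_fbsde_solution_def diffusion_def[abs_def])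
  show "vector_ito X forward_drift diffusion"
  proof (rule ito_differential_vector_ito[OF d L2_processes(1) L2_variables(1) L2_coefficients(1)])
    show "AE s in L. \<forall>w. cA c s *v X s w + cB c s *v u s w + cAh c s *v mean M X s + cBh c s *v mean M u s = forward_drift s w"
      using AE_good by eventually_elim (simp add: forward_drift_def k_defs add.assoc)
  qed
  show "L2_process diffusion"
    using d by (auto simp: ito_differential_def has_ito_integral_def intro: L2_process_L2F)
qed

lemma backward_ito: "vector_ito Y backward_drift Z"
proof -
  have d: "ito_differential M W T Y
       (\<lambda>s w. - (transpose (cA c s) *v Y s w + transpose (cA1 c s) *v Z s w + cQ c s *v X s w
               + transpose (cAh c s) *v mean M Y s + transpose (cA1h c s) *v mean M Z s
               + cQh c s *v mean M X s)) Z"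
    using sol by (simp add: mf_fbsde_solution_def)
  show ?thesis
  proof (rule ito_differential_vector_ito[OF d L2_processes(3) L2_variables(2) L2_coefficients(2)])
    show "AE s in L. \<forall>w. - (transpose (cA c s) *v Y s w + transpose (cA1 c s) *v Z s w + cQ c s *v X s w
               + transpose (cAh c s) *v mean M Y s + transpose (cA1h c s) *v mean M Z s
               + cQh c s *v mean M X s) = backward_drift s w"
      using AE_good by eventually_elim (simp add: backward_drift_def k_defs add.assoc)
  qed
qed

lemma optimality_zero: "AE s in L. AE w in M. optimality s w = 0"
proof -
  have "AE w in M. AE s in L. optimality s w = 0"
    using sol unfolding mf_fbsde_solution_def
  proof (elim conjE)
    assume "AE w in M. AE s in L. cR c s *v u s w + cRh c s *v mean M u s
        + transpose (cB c s) *v Y s w + transpose (cB1 c s) *v Z s w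
        + transpose (cBh c s) *v mean M Y s + transpose (cB1h c s) *v mean M Z s = 0"
    then show ?thesis
    proof eventually_elim
      case (elim w)
      from elim AE_good show ?case by eventually_elim (simp add: optimality_def k_defs algebra_simps)
    qed
  qed
  then show ?thesis
    using AE_eq_iff[of optimality "\<lambda>s w. 0"] L2_process_measurable[OF L2_coefficients(3)] by simp
qed

text \<open>The times at which everything needed for the pointwise algebra is available.\<close>

definition "regular s \<longleftrightarrow> s \<in> good \<and> L2_variable (u s) \<and> L2_variable (Z s) \<and> (AE w in M. optimality s w = 0)"

lemma AE_regular: "AE s in L. regular s"
  unfolding regular_def
  using AE_good L2_process_AE_variable[OF L2_processes(2)] L2_process_AE_variable[OF L2_processes(4)] optimality_zero
  by eventually_elim simp

lemma regularD:
  assumes "regular s"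
  shows "s \<in> good" "s \<in> {0..T}" "L2_variable (X s)" "L2_variable (u s)" "L2_variable (Y s)" "L2_variable (Z s)"
    "AE w in M. optimality s w = 0" "transpose (P s) = P s" "transpose (PI s) = PI s"
proof -
  show s: "s \<in> good" "L2_variable (u s)" "L2_variable (Z s)" "AE w in M. optimality s w = 0"
    using assms by (simp_all add: regular_def)
  then show T: "s \<in> {0..T}" by (auto simp: good_def)
  then show "L2_variable (X s)" "L2_variable (Y s)" by (auto intro: L2_variables)
  show "transpose (P s) = P s" "transpose (PI s) = PI s"
    using T solP solPI by (auto simp: riccati_P_solution_def riccati_Pi_solution_def)
qed

lemma optimality_mean:
  assumes "regular s"
  shows "bR s *v mean M u s + transpose (bB s) *v mean M Y s + transpose (bB1 s) *v mean M Z s = 0"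
    "AE w in M. kR s *v fluctuation u s w + transpose (kB s) *v fluctuation Y s w + transpose (kB1 s) *v fluctuation Z s w = 0"
proof -
  note r = regularD[OF assms]
  have "mean M optimality s = (\<integral>w. 0 \<partial>M)"
    unfolding mean_def using r(7)
    by (intro integral_cong_AE) (auto simp: optimality_def[abs_def] intro!: borel_measurable_integrable L2_variable_integrable L2_variable_rules r)
  then have 0: "mean M optimality s = 0" by simp
  then show 1: "bR s *v mean M u s + transpose (bB s) *v mean M Y s + transpose (bB1 s) *v mean M Z s = 0"
    unfolding optimality_def[abs_def]
    by (simp add: mean_rules L2_variable_rules r transpose_diff matrix_vector_simps)
       (simp add: algebra_simps)
  show "AE w in M. kR s *v fluctuation u s w + transpose (kB s) *v fluctuation Y s w + transpose (kB1 s) *v fluctuation Z s w = 0"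
    using r(7)
  proof eventually_elim
    case (elim w)
    have "kR s *v fluctuation u s w + transpose (kB s) *v fluctuation Y s w + transpose (kB1 s) *v fluctuation Z s w
      = optimality s w - (bR s *v mean M u s + transpose (bB s) *v mean M Y s + transpose (bB1 s) *v mean M Z s)"
      by (simp add: fluctuation_def optimality_def transpose_diff matrix_vector_simps)
    then show ?case using elim 1 by simp
  qed
qed

text \<open>The estimate pairs the deviation of \<open>\<eta> = Y - P X\<close> with \<open>\<zeta> = Z - P \<sigma>\<close> itself and not with its
  deviation, since the variance of the martingale increments involves the full \<open>\<zeta>\<close>; hence \<open>Z = P \<sigma>\<close>
  including the mean.\<close>

lemma fluctuations_vanish:
  shows "\<And>t. t \<in> {0..T} \<Longrightarrow> AE w in M. fluctuation Y t w = P t *v fluctuation X t w"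
    "AE z in LM. Z (fst z) (snd z) = P (fst z) *v diffusion (fst z) (snd z)"
    "AE s in L. AE w in M. fluctuation u s w = - (gain0 c P s *v fluctuation X s w)"
proof -
  obtain \<Theta> P' where \<Theta>: "bounded_measurable \<Theta>" and P': "bounded_measurable P'" "primitive_on 0 T P P'"
    and gain: "\<And>s. s \<in> good \<Longrightarrow> gain0 c P s = \<Theta> s" and inv: "\<And>s. s \<in> good \<Longrightarrow> invertible (K0 c P s)"
    and K: "\<And>s. s \<in> good \<Longrightarrow> K0 c P s ** \<Theta> s = transpose (cB c s) ** P s + transpose (cB1 c s) ** P s ** cA1 c s"
    and R: "\<And>s. s \<in> good \<Longrightarrow> P' s = - (P s ** cA c s + transpose (cA c s) ** P s + transpose (cA1 c s) ** P s ** cA1 c s + cQ c s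
         - (P s ** cB c s + transpose (cA1 c s) ** P s ** cB1 c s) ** \<Theta> s)"
    using riccati_P_feedback[OF solP] by blast
  have bPs: "bounded_coefficient P" "bounded_coefficient P'" "bounded_coefficient \<Theta>"
    using primitive_on_continuous[OF P'(2)] P'(1) \<Theta>
    by (auto intro: bounded_coefficient_continuous bounded_coefficient_bounded_measurable)
  define \<eta> where "\<eta> s w = Y s w - P s *v X s w" for s w
  define f where "f s w = backward_drift s w - (P' s *v X s w + P s *v forward_drift s w)" for s w
  define \<zeta> where "\<zeta> s w = Z s w - P s *v diffusion s w" for s w
  define H where "H s = transpose (\<Theta> s) ** transpose (kB s) - transpose (kA s)" for s
  define K' where "K' s = transpose (\<Theta> s) ** transpose (kB1 s) - transpose (kA1 s)" for s
  have bm: "bounded_measurable H" "bounded_measurable K'"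
    unfolding H_def[abs_def] K'_def[abs_def] by (intro bounded_measurable_intros bounded_measurable_coefficients \<Theta>)+
  have L2: "L2_process \<eta>" "L2_process f" "L2_process \<zeta>"
    unfolding \<eta>_def[abs_def] f_def[abs_def] \<zeta>_def[abs_def]
    by (intro L2_process_rules L2_processes L2_coefficients L2_diffusion bPs)+
  have L2v: "L2_variable (\<eta> s)" if "s \<in> {0..T}" for s
    unfolding \<eta>_def[abs_def] using that by (intro L2_variable_rules L2_variables)
  have dyn: "martingale_dynamics \<eta> f \<zeta>"
    unfolding \<eta>_def[abs_def] f_def[abs_def] \<zeta>_def[abs_def]
    by (rule affine_combination_dynamics[OF forward_ito backward_ito P'(2,1)])
  have alg: "AE w in M. fluctuation f s w = H s *v fluctuation \<eta> s w + K' s *v fluctuation \<zeta> s w \<and>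
      K0 c P s *v (fluctuation u s w + \<Theta> s *v fluctuation X s w)
        = - (transpose (kB s) *v fluctuation \<eta> s w + transpose (kB1 s) *v fluctuation \<zeta> s w)"
    if s: "regular s" for s
    using optimality_mean(2)[OF s]
  proof eventually_elim
    case (elim w)
    note r = regularD[OF s]
    have k: "cA c s = kA s" "cA1 c s = kA1 s" "cB c s = kB s" "cB1 c s = kB1 s" "cQ c s = kQ s" "cR c s = kR s"
      using r(1) by (simp_all add: k_defs)
    note [simp] = mean_rules L2_variable_rules r
    have y: "fluctuation Y s w = fluctuation \<eta> s w + P s *v fluctuation X s w"
      by (simp add: fluctuation_def \<eta>_def[abs_def] matrix_vector_simps)
    have z: "fluctuation Z s w = fluctuation \<zeta> s w + P s *v (kA1 s *v fluctuation X s w + kB1 s *v fluctuation u s w)"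
      by (simp add: fluctuation_def \<zeta>_def[abs_def] diffusion_def[abs_def] k matrix_vector_simps)
    have f: "fluctuation f s w = - (transpose (kA s) *v fluctuation Y s w + transpose (kA1 s) *v fluctuation Z s w + kQ s *v fluctuation X s w)
       - (P' s *v fluctuation X s w + P s *v (kA s *v fluctuation X s w + kB s *v fluctuation u s w))"
      by (simp add: fluctuation_def f_def[abs_def] forward_drift_def[abs_def] backward_drift_def[abs_def] matrix_vector_simps)
    note D = feedback_decoupling[OF r(8) r(8) coefficients_symmetric(2)[of s]
        K[OF r(1), unfolded K0_def k] R[OF r(1), unfolded k] y z elim]
    show ?case using D unfolding f H_def K'_def K0_def k by blast
  qed
  have L2f: "L2_process (fluctuation \<eta>)" "L2_process (fluctuation f)" "L2_process (fluctuation \<zeta>)"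
    by (intro L2_process_fluctuation L2)+
  have eq: "AE z in LM. fluctuation f (fst z) (snd z) = H (fst z) *v fluctuation \<eta> (fst z) (snd z) + K' (fst z) *v fluctuation \<zeta> (fst z) (snd z)"
  proof -
    have "AE s in L. AE w in M. fluctuation f s w = H s *v fluctuation \<eta> s w + K' s *v fluctuation \<zeta> s w"
      using AE_regular
    proof eventually_elim
      case (elim s)
      from alg[OF elim] show ?case by eventually_elim blast
    qed
    then show ?thesis
      using AE_eq_iff(1)[of "fluctuation f" "\<lambda>s w. H s *v fluctuation \<eta> s w + K' s *v fluctuation \<zeta> s w"]
        L2_process_measurable[OF L2f(2)]
        L2_process_measurable[OF L2_process_add[OF L2_process_matrix[OF _ L2f(1), of H] L2_process_matrix[OF _ L2f(3), of K']]]
        bm[THEN bounded_coefficient_bounded_measurable] by blast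
  qed
  obtain C1 C2 where "\<And>s. norm (H s) \<le> C1" "\<And>s. norm (K' s) \<le> C2"
    using bm unfolding bounded_measurable_def bounded_iff by blast
  then have C: "norm (H s) \<le> max C1 C2" "norm (K' s) \<le> max C1 C2" for s by (auto simp: le_max_iff_disj)
  have terminal: "AE w in M. fluctuation \<eta> T w $ i = 0" for i
  proof -
    have TT: "T \<in> {0..T}" using T by simp
    have PT: "P T = cG c" using solP by (simp add: riccati_P_solution_def)
    have "AE w in M. Y T w = cG c *v X T w + cGh c *v mean M X T" using sol by (simp add: mf_fbsde_solution_def)
    then have a: "AE w in M. \<eta> T w = cGh c *v mean M X T" unfolding \<eta>_def by eventually_elim (simp add: PT)
    have "mean M \<eta> T = (\<integral>w. cGh c *v mean M X T \<partial>M)"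
      unfolding mean_def[of M \<eta>] using a L2_variable_integrable[OF L2v[OF TT]] by (intro integral_cong_AE) auto
    then have m: "mean M \<eta> T = cGh c *v mean M X T" by (simp add: prob_space)
    from a show ?thesis unfolding fluctuation_def by eventually_elim (simp add: m)
  qed
  have ad: "(\<lambda>w. fluctuation \<eta> t w $ i) \<in> borel_measurable (\<F> t)" if t: "t \<in> {0..T}" for t i
  proof -
    have "X t \<in> borel_measurable (\<F> t)" "Y t \<in> borel_measurable (\<F> t)"
      using processes(1,3) t by (simp_all add: state_space_def adapted_def)
    then show ?thesis unfolding fluctuation_def \<eta>_def
      by (intro borel_measurable_component borel_measurable_diff measurable_matrix_vector_mult borel_measurable_const)
  qed
  have v: "L2_variable (fluctuation \<eta> t)" if "t \<in> {0..T}" for t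
    unfolding fluctuation_def[abs_def] by (intro L2_variable_rules L2v that)
  have bound: "(\<Sum>i\<in>UNIV. energy (fluctuation f) t r i) \<le> 2 * (max C1 C2)\<^sup>2 *
      ((\<Sum>i\<in>UNIV. energy (fluctuation \<eta>) t r i) + (\<Sum>i\<in>UNIV. energy \<zeta> t r i))" for t r
  proof -
    have "(\<Sum>i\<in>UNIV. energy (fluctuation \<zeta>) t r i) \<le> (\<Sum>i\<in>UNIV. energy \<zeta> t r i)"
      by (intro sum_mono energy_fluctuation_le L2)
    then show ?thesis
      using energy_linear_combination[OF L2f(2,1,3) eq C, of t r]
      by (elim order_trans) (intro mult_left_mono add_left_mono; simp)
  qed
  note B = backward_equation_unique[OF L2f(1,2) L2(3) ad v
      martingale_dynamics_mean(1)[OF dyn L2(2) L2v] bound _ terminal]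
  have U: "AE w in M. fluctuation \<eta> t w = 0" if "t \<in> {0..T}" for t by (rule B(1)) (use that in auto)
  have zeta: "AE z in LM. \<zeta> (fst z) (snd z) = 0" by (rule B(2)) auto
  show "AE w in M. fluctuation Y t w = P t *v fluctuation X t w" if t: "t \<in> {0..T}" for t
    using U[OF t]
  proof eventually_elim
    case (elim w)
    then show ?case using L2_variables[OF t]
      by (simp add: fluctuation_def \<eta>_def[abs_def] mean_rules L2_variable_rules matrix_vector_simps algebra_simps)
  qed
  show "AE z in LM. Z (fst z) (snd z) = P (fst z) *v diffusion (fst z) (snd z)"
    using zeta by eventually_elim (simp add: \<zeta>_def)
  have "AE s in L. AE w in M. \<zeta> s w = 0"
    using zeta AE_eq_iff(1)[of \<zeta> "\<lambda>s w. 0"] L2_process_measurable[OF L2(3)] by simp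
  then show "AE s in L. AE w in M. fluctuation u s w = - (gain0 c P s *v fluctuation X s w)"
    using AE_regular
  proof eventually_elim
    case (elim s)
    note r = regularD[OF elim(2)]
    have "mean M \<zeta> s = (\<integral>w. 0 \<partial>M)"
      unfolding mean_def using elim(1)
      by (intro integral_cong_AE) (auto simp: \<zeta>_def[abs_def] diffusion_def[abs_def] intro!: borel_measurable_integrable L2_variable_integrable L2_variable_rules r)
    then have m: "mean M \<zeta> s = 0" by simp
    show ?case using alg[OF elim(2)] U[OF r(2)] elim(1)
    proof eventually_elim
      case (elim w)
      then have "fluctuation \<zeta> s w = 0" by (simp add: fluctuation_def m)
      then have "K0 c P s *v (fluctuation u s w + \<Theta> s *v fluctuation X s w) = 0" using elim by simp
      then have "fluctuation u s w + \<Theta> s *v fluctuation X s w = 0"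
        using matrix_inv_mult_vector(2)[OF inv[OF r(1)]] by (metis matrix_vector_mult_0_right)
      then show ?case using gain[OF r(1)] by (simp add: eq_neg_iff_add_eq_0)
    qed
  qed
qed

lemma mean_diffusion:
  assumes "regular s"
  shows "mean M diffusion s = bA1 s *v mean M X s + bB1 s *v mean M u s"
  using regularD[OF assms] unfolding diffusion_def[abs_def]
  by (simp add: mean_rules L2_variable_rules k_defs matrix_vector_simps)

text \<open>\<open>Z = P \<sigma>\<close> closes the system of the means, which is then an ordinary differential equation.\<close>

lemma means_decouple:
  shows "\<And>t. t \<in> {0..T} \<Longrightarrow> mean M Y t = PI t *v mean M X t"
    "AE s in L. mean M u s = - (gain1 c P PI s *v mean M X s)"
proof -
  obtain \<Theta> PI' where \<Theta>: "bounded_measurable \<Theta>" and PI': "bounded_measurable PI'" "primitive_on 0 T PI PI'"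
    and gain: "\<And>s. s \<in> good \<Longrightarrow> gain1 c P PI s = \<Theta> s" and inv: "\<And>s. s \<in> good \<Longrightarrow> invertible (K1 c P s)"
    and K: "\<And>s. s \<in> good \<Longrightarrow> K1 c P s ** \<Theta> s = transpose (bB s) ** PI s + transpose (bB1 s) ** P s ** bA1 s"
    and R: "\<And>s. s \<in> good \<Longrightarrow> PI' s = - (PI s ** bA s + transpose (bA s) ** PI s + transpose (bA1 s) ** P s ** bA1 s + bQ s
         - (PI s ** bB s + transpose (bA1 s) ** P s ** bB1 s) ** \<Theta> s)"
    using riccati_Pi_feedback[OF solP solPI] by blast
  define y where "y s = mean M Y s - PI s *v mean M X s" for s
  define H where "H s = transpose (\<Theta> s) ** transpose (bB s) - transpose (bA s)" for s
  have bm: "bounded_measurable H"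
    unfolding H_def[abs_def] by (intro bounded_measurable_intros bounded_measurable_coefficients \<Theta>)
  have Z: "AE s in L. AE w in M. Z s w = P s *v diffusion s w"
  proof -
    show ?thesis
      using fluctuations_vanish(2) AE_eq_iff(1)[of Z "\<lambda>s w. P s *v diffusion s w"]
        L2_process_measurable[OF L2_processes(4)] L2_process_measurable[OF L2_process_matrix[OF bounded_coefficient_P L2_diffusion]] by blast
  qed
  have alg: "AE s in L. K1 c P s *v (mean M u s + \<Theta> s *v mean M X s) = - (transpose (bB s) *v y s) \<and>
      mean M backward_drift s - (PI' s *v mean M X s + PI s *v mean M forward_drift s) = H s *v y s \<and> s \<in> good"
    using AE_regular Z
  proof eventually_elim
    case (elim s)
    note r = regularD[OF elim(1)]
    have b: "K1 c P s = bR s + transpose (bB1 s) ** P s ** bB1 s"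
      using r(1) by (simp add: K1_def k_defs)
    have dv: "L2_variable (diffusion s)"
      unfolding diffusion_def[abs_def] by (intro L2_variable_rules r)
    have "mean M Z s = (\<integral>w. P s *v diffusion s w \<partial>M)"
      unfolding mean_def using elim(2)
      by (intro integral_cong_AE) (auto intro!: borel_measurable_integrable L2_variable_integrable L2_variable_rules r dv)
    also have "\<dots> = P s *v mean M diffusion s" by (simp add: mean_def L2_variable_expectation_matrix[OF dv])
    finally have z: "mean M Z s = 0 + P s *v (bA1 s *v mean M X s + bB1 s *v mean M u s)"
      by (simp add: mean_diffusion[OF elim(1)])
    have yy: "mean M Y s = y s + PI s *v mean M X s" by (simp add: y_def)
    note D = feedback_decoupling[OF r(8,9) coefficients_symmetric(4)[of s] K[OF r(1), unfolded b] R[OF r(1)] yy z optimality_mean(1)[OF elim(1)]]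
    note [simp] = mean_rules L2_variable_rules r
    have "mean M backward_drift s = - (transpose (bA s) *v mean M Y s + transpose (bA1 s) *v mean M Z s + bQ s *v mean M X s)"
      by (simp add: backward_drift_def[abs_def] transpose_diff matrix_vector_simps)
    moreover have "mean M forward_drift s = bA s *v mean M X s + bB s *v mean M u s"
      by (simp add: forward_drift_def[abs_def] matrix_vector_simps)
    ultimately show ?case using D r(1) by (simp add: b H_def)
  qed
  have "AE s in L. mean M backward_drift s - (PI' s *v mean M X s + PI s *v mean M forward_drift s) = H s *v y s"
    using alg by eventually_elim blast
  then obtain N where N: "negligible N" "\<And>s. s \<in> {0..T} - N \<Longrightarrow>
      mean M backward_drift s - (PI' s *v mean M X s + PI s *v mean M forward_drift s) = H s *v y s"
    by (rule AE_lebesgue_onD) blast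
  have "primitive_on 0 T y (\<lambda>s. mean M backward_drift s - (PI s *v mean M forward_drift s + PI' s *v mean M X s))"
    unfolding y_def[abs_def]
    by (intro primitive_on_sub primitive_on_bilinear[OF bounded_bilinear_matrix_vector_mult] PI'
        vector_ito_mean[OF forward_ito L2_coefficients(1) L2_variables(1)]
        vector_ito_mean[OF backward_ito L2_coefficients(2) L2_variables(2)])
  then have prim: "primitive_on 0 T y (\<lambda>s. H s *v y s)"
    by (rule primitive_on_AE_cong[OF _ N(1)]) (use N(2) in \<open>simp add: add.commute\<close>)
  have yT: "y T = 0"
  proof -
    have TT: "T \<in> {0..T}" using T by simp
    have Y: "AE w in M. Y T w = cG c *v X T w + cGh c *v mean M X T" using sol by (simp add: mf_fbsde_solution_def)
    have i: "L2_variable (\<lambda>w. cG c *v X T w)" by (intro L2_variable_rules L2_variables TT)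
    have "mean M Y T = (\<integral>w. cG c *v X T w + cGh c *v mean M X T \<partial>M)"
      unfolding mean_def[of M Y] using Y L2_variable_integrable[OF L2_variables(2)[OF TT]] L2_variable_integrable[OF i]
      by (intro integral_cong_AE) auto
    also have "\<dots> = cG c *v mean M X T + cGh c *v mean M X T"
      using L2_variable_integrable[OF i] L2_variable_expectation_matrix[OF L2_variables(1)[OF TT], of "cG c"]
      by (simp add: mean_def prob_space)
    finally show ?thesis
      using solPI by (simp add: y_def riccati_Pi_solution_def matrix_vector_mult_add_rdistrib)
  qed
  have y0: "y t = 0" if "t \<in> {0..T}" for t by (rule linear_backward_zero[OF prim bm yT that])
  then show "mean M Y t = PI t *v mean M X t" if "t \<in> {0..T}" for t using that by (simp add: y_def)
  show "AE s in L. mean M u s = - (gain1 c P PI s *v mean M X s)"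
    using alg AE_space
  proof eventually_elim
    case (elim s)
    then have "K1 c P s *v (mean M u s + \<Theta> s *v mean M X s) = 0" using y0[of s] by simp
    then have "mean M u s + \<Theta> s *v mean M X s = 0"
      using matrix_inv_mult_vector(2)[OF inv] elim by (metis matrix_vector_mult_0_right)
    then show ?case using gain elim by (simp add: eq_neg_iff_add_eq_0)
  qed
qed

lemma fluctuation_split: "\<phi> s w = fluctuation \<phi> s w + mean M \<phi> s"
  by (simp add: fluctuation_def)

lemma AE_feedback: "AE s in L. AE w in M. u s w = - (gain0 c P s *v fluctuation X s w) - gain1 c P PI s *v mean M X s"
  using fluctuations_vanish(3) means_decouple(2)
proof eventually_elim
  case (elim s)
  from elim(1) show ?case
  proof eventually_elim
    case (elim w)
    then show ?case using \<open>mean M u s = _\<close> fluctuation_split[of u s w] by simp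
  qed
qed

lemma measurable_coefficients:
  "cA c \<in> borel_measurable L" "cAh c \<in> borel_measurable L" "cA1 c \<in> borel_measurable L" "cA1h c \<in> borel_measurable L"
  "cB c \<in> borel_measurable L" "cBh c \<in> borel_measurable L" "cB1 c \<in> borel_measurable L" "cB1h c \<in> borel_measurable L"
  "cR c \<in> borel_measurable L" "cRh c \<in> borel_measurable L" "P \<in> borel_measurable L" "PI \<in> borel_measurable L"
proof -
  show "cA c \<in> borel_measurable L" "cAh c \<in> borel_measurable L" "cA1 c \<in> borel_measurable L" "cA1h c \<in> borel_measurable L"
    "cB c \<in> borel_measurable L" "cBh c \<in> borel_measurable L" "cB1 c \<in> borel_measurable L" "cB1h c \<in> borel_measurable L"
    "cR c \<in> borel_measurable L" "cRh c \<in> borel_measurable L"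
    using Linf by (simp_all add: Linfty_sym_def Linfty_def)
  have "bounded_coefficient PI"
    using solPI by (intro bounded_coefficient_continuous abs_continuous_on_Icc_continuous) (simp add: riccati_Pi_solution_def)
  with bounded_coefficient_P show "P \<in> borel_measurable L" "PI \<in> borel_measurable L" by (simp_all add: bounded_coefficient_def)
qed

lemma measurable_gains: "gain0 c P \<in> borel_measurable L" "gain1 c P PI \<in> borel_measurable L"
  unfolding gain0_def[abs_def] gain1_def[abs_def] K0_def K1_def
  by (intro measurable_matrix_mult measurable_matrix_inv borel_measurable_add measurable_transpose measurable_coefficients)+

lemma measurable_affine:
  fixes F F' :: "real \<Rightarrow> real^'n^'k"
  assumes "F \<in> borel_measurable L" "F' \<in> borel_measurable L"
  shows "(\<lambda>z. F (fst z) *v (X (fst z) (snd z) - mean M X (fst z)) + F' (fst z) *v mean M X (fst z)) \<in> borel_measurable LM"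
  using measurable_compose[OF measurable_fst assms(1)] measurable_compose[OF measurable_fst assms(2)]
    L2_process_measurable[OF L2_processes(1)] L2_process_measurable[OF L2_process_mean[OF L2_processes(1)]]
  by (intro borel_measurable_add borel_measurable_diff measurable_matrix_vector_mult)

lemma feedback_representation:
  "AE w in M. AE s in L. u s w = - (gain0 c P s *v (X s w - mean M X s)) - gain1 c P PI s *v mean M X s"
proof -
  have m: "(\<lambda>z. (- gain0 c P (fst z)) *v (X (fst z) (snd z) - mean M X (fst z)) + (- gain1 c P PI (fst z)) *v mean M X (fst z)) \<in> borel_measurable LM"
    by (intro measurable_affine borel_measurable_uminus measurable_gains)
  have "(AE s in L. AE w in M. u s w = (- gain0 c P s) *v (X s w - mean M X s) + (- gain1 c P PI s) *v mean M X s)"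
    using AE_feedback by (simp add: fluctuation_def matrix_vector_mult_minus_left)
  then have "AE w in M. AE s in L. u s w = (- gain0 c P s) *v (X s w - mean M X s) + (- gain1 c P PI s) *v mean M X s"
    using AE_eq_iff[OF L2_process_measurable[OF L2_processes(2)] m] by blast
  then show ?thesis by (simp add: matrix_vector_mult_minus_left)
qed

lemma diffusion_feedback:
  assumes "u s w = - (gain0 c P s *v (X s w - mean M X s)) - gain1 c P PI s *v mean M X s"
    "mean M u s = - (gain1 c P PI s *v mean M X s)"
  shows "diffusion s w = (cA1 c s - cB1 c s ** gain0 c P s) *v (X s w - mean M X s)
            + (cA1 c s + cA1h c s - (cB1 c s + cB1h c s) ** gain1 c P PI s) *v mean M X s"
  unfolding diffusion_def assms by (simp add: matrix_vector_simps)

lemma Z_representation: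
  "AE w in M. AE s in L. Z s w = (P s ** cA1 c s - P s ** cB1 c s ** gain0 c P s) *v (X s w - mean M X s)
               + (P s ** (cA1 c s + cA1h c s) - P s ** (cB1 c s + cB1h c s) ** gain1 c P PI s) *v mean M X s"
proof -
  have "AE w in M. AE s in L. Z s w = P s *v diffusion s w"
    using fluctuations_vanish(2) AE_eq_iff(2)[of Z "\<lambda>s w. P s *v diffusion s w"]
        L2_process_measurable[OF L2_processes(4)] L2_process_measurable[OF L2_process_matrix[OF bounded_coefficient_P L2_diffusion]] by blast
  then show ?thesis
    using feedback_representation
  proof eventually_elim
    case (elim w)
    from elim means_decouple(2) show ?case
    proof eventually_elim
      case (elim s)
      show ?case unfolding elim(1) diffusion_feedback[OF elim(2,3)] by (simp add: matrix_vector_simps)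
    qed
  qed
qed

text \<open>For each fixed time the identity holds almost surely; both sides are continuous, so rational times
  suffice.\<close>

lemma Y_representation:
  "AE w in M. \<forall>s\<in>{0..T}. Y s w = P s *v (X s w - mean M X s) + PI s *v mean M X s"
proof -
  define D where "D = {0<..<T} \<inter> \<rat>"
  have "countable D" unfolding D_def by (intro countable_Int2 countable_rat)
  have clD: "closure D = {0..T}"
    using closure_open_Int_superset[of "{0<..<T}" \<rat>] T unfolding D_def by (simp add: Rats_closure_real)
  have D: "s \<in> {0..T}" if "s \<in> D" for s using that by (simp add: D_def)
  have "AE w in M. Y s w = P s *v (X s w - mean M X s) + PI s *v mean M X s" if "s \<in> D" for s
    using fluctuations_vanish(1)[OF D[OF that]]
  proof eventually_elim
    case (elim w)
    then show ?case using means_decouple(1)[OF D[OF that]] by (simp add: fluctuation_def algebra_simps)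
  qed
  then have "AE w in M. \<forall>s\<in>D. Y s w = P s *v (X s w - mean M X s) + PI s *v mean M X s"
    using \<open>countable D\<close> by (subst AE_ball_countable) auto
  then show ?thesis using AE_space
  proof eventually_elim
    case (elim w)
    have c: "continuous_on {0..T} (\<lambda>s. X s w)" "continuous_on {0..T} (\<lambda>s. Y s w)"
      using processes(1,3) elim(2) by (simp_all add: state_space_def)
    have cP: "continuous_on {0..T} P" "continuous_on {0..T} PI"
      using solP solPI abs_continuous_on_Icc_continuous by (auto simp: riccati_P_solution_def riccati_Pi_solution_def)
    have cX: "continuous_on {0..T} (mean M X)"
      by (rule primitive_on_continuous[OF vector_ito_mean[OF forward_ito L2_coefficients(1) L2_variables(1)]])
    have "continuous_on (closure D) (\<lambda>s. Y s w - (P s *v (X s w - mean M X s) + PI s *v mean M X s))"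
      unfolding clD
      by (intro continuous_intros c cP cX bounded_bilinear.continuous_on[OF bounded_bilinear_matrix_vector_mult])
    then have "Y s w - (P s *v (X s w - mean M X s) + PI s *v mean M X s) = 0" if "s \<in> {0..T}" for s
      by (rule continuous_constant_on_closure) (use elim(1) that clD in auto)
    then show ?case by simp
  qed
qed

text \<open>Along the feedback the coefficients of the forward equation agree almost everywhere with those
  of the closed loop, so the same Ito integral serves.\<close>

lemma closed_loop: "closed_loop_solution M W T c x P PI X"
proof -
  define \<sigma> where "\<sigma> s w = (cA1 c s - cB1 c s ** gain0 c P s) *v (X s w - mean M X s)
            + (cA1 c s + cA1h c s - (cB1 c s + cB1h c s) ** gain1 c P PI s) *v mean M X s" for s w
  define b where "b s w = (cA c s - cB c s ** gain0 c P s) *v (X s w - mean M X s)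
            + (cA c s + cAh c s - (cB c s + cBh c s) ** gain1 c P PI s) *v mean M X s" for s w
  define a where "a s w = cA c s *v X s w + cB c s *v u s w + cAh c s *v mean M X s + cBh c s *v mean M u s" for s w
  have d: "ito_differential M W T X a diffusion"
    using sol by (simp add: mf_fbsde_solution_def diffusion_def[abs_def] a_def[abs_def])
  have \<sigma>m: "(joint \<sigma>) \<in> borel_measurable LM"
    unfolding \<sigma>_def
    by (intro measurable_affine borel_measurable_add borel_measurable_diff measurable_matrix_mult measurable_coefficients measurable_gains)
  have bm: "(joint b) \<in> borel_measurable LM"
    unfolding b_def
    by (intro measurable_affine borel_measurable_add borel_measurable_diff measurable_matrix_mult measurable_coefficients measurable_gains)
  have \<sigma>eq: "AE z in LM. diffusion (fst z) (snd z) = \<sigma> (fst z) (snd z)"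
  proof -
    have "AE s in L. AE w in M. diffusion s w = \<sigma> s w"
      using AE_feedback means_decouple(2)
    proof eventually_elim
      case (elim s)
      from elim(1) show ?case
        by eventually_elim (simp add: diffusion_feedback[OF _ elim(2)] \<sigma>_def fluctuation_def)
    qed
    then show ?thesis using AE_eq_iff(1)[OF L2_process_measurable[OF L2_diffusion] \<sigma>m] by blast
  qed
  have beq: "AE w in M. AE s in L. a s w = b s w"
    using feedback_representation
  proof eventually_elim
    case (elim w)
    from elim means_decouple(2) show ?case
      by eventually_elim (simp add: a_def b_def matrix_vector_simps)
  qed
  have L2\<sigma>: "L2_process \<sigma>"
    unfolding L2_process_def sq_int_def
  proof (intro allI conjI)
    fix i
    show m: "(\<lambda>z. \<sigma> (fst z) (snd z) $ i) \<in> borel_measurable LM" by (rule borel_measurable_component[OF \<sigma>m])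
    show "integrable LM (\<lambda>z. (\<sigma> (fst z) (snd z) $ i)\<^sup>2)"
    proof (rule integrable_cong_AE_imp[OF _ borel_measurable_power[OF m]])
      show "integrable LM (\<lambda>z. (diffusion (fst z) (snd z) $ i)\<^sup>2)" using L2_diffusion by (simp add: L2_process_def sq_int_def)
      show "AE z in LM. (diffusion (fst z) (snd z) $ i)\<^sup>2 = (\<sigma> (fst z) (snd z) $ i)\<^sup>2" using \<sigma>eq by eventually_elim simp
    qed
  qed
  have L2F: "L2F M W T \<sigma>"
  proof (rule L2F_L2_process[OF _ L2\<sigma>])
    show "adapted M W T \<sigma>"
      unfolding adapted_def \<sigma>_def using processes(1)
      by (intro ballI borel_measurable_add borel_measurable_diff measurable_matrix_vector_mult borel_measurable_const)
         (simp add: state_space_def adapted_def)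
  qed
  obtain I where I: "has_ito_integral M W T diffusion I"
    "AE w in M. integrable L (\<lambda>s. a s w) \<and> (\<forall>t\<in>{0..T}. X t w = X 0 w + (\<integral>s. a s w \<partial>lebesgue_on {0..t}) + I t w)"
    using d unfolding ito_differential_def by blast
  have I': "has_ito_integral M W T \<sigma> I"
    by (rule has_ito_integral_cong[OF I(1) L2F \<sigma>eq]) (use I(1) in \<open>auto simp: has_ito_integral_def\<close>)
  have "AE w in M. integrable L (\<lambda>s. b s w) \<and> (\<forall>t\<in>{0..T}. X t w = X 0 w + (\<integral>s. b s w \<partial>lebesgue_on {0..t}) + I t w)"
    using I(2) beq AE_space
  proof eventually_elim
    case (elim w)
    have ai: "integrable L (\<lambda>s. a s w)" using elim(1) by blast
    have "(\<lambda>s. b s w) \<in> borel_measurable L"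
      using measurable_compose[OF measurable_Pair2'[OF elim(3), of L] bm] by simp
    then have bi: "integrable L (\<lambda>s. b s w)" using integrable_cong_AE_imp[OF ai _ elim(2)] by blast
    obtain N where N: "negligible N" "\<And>s. s \<in> {0..T} - N \<Longrightarrow> a s w = b s w"
      by (rule AE_lebesgue_onD[OF elim(2)]) blast
    have "(\<integral>s. a s w \<partial>lebesgue_on {0..t}) = (\<integral>s. b s w \<partial>lebesgue_on {0..t})" if t: "t \<in> {0..T}" for t
      unfolding integral_lebesgue_on_Icc[OF ai t] integral_lebesgue_on_Icc[OF bi t]
      by (rule integral_spike[OF N(1)]) (use N(2) t in auto)
    then show ?case using bi elim(1) by metis
  qed
  then have "ito_differential M W T X b \<sigma>"
    using I' unfolding ito_differential_def by blast
  then show ?thesis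
    using sol unfolding closed_loop_solution_def mf_fbsde_solution_def b_def[abs_def] \<sigma>_def[abs_def] by blast
qed

end

end

section \<open>The feedback representation\<close>

theorem theorem4p1:
  fixes M :: "'w measure" and W :: "real \<Rightarrow> 'w \<Rightarrow> real"
    and T \<delta> :: real and x :: "real^'n"
    and c :: "('n::finite, 'm::finite) mf_coeffs"
  assumes "0 < T"
    and "complete_measure M" and "standard_brownian_motion M W"
    and "Linfty T (cA c)" "Linfty T (cAh c)" "Linfty T (cA1 c)" "Linfty T (cA1h c)"
    and "Linfty T (cB c)" "Linfty T (cBh c)" "Linfty T (cB1 c)" "Linfty T (cB1h c)"
    and "Linfty_sym T (cQ c)" "Linfty_sym T (cQh c)"
    and "Linfty_sym T (cR c)" "Linfty_sym T (cRh c)"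
    and "transpose (cG c) = cG c" "transpose (cGh c) = cGh c"
    and "0 < \<delta>"
    and "AE s in lebesgue_on {0..T}. loewner_le 0 (cQ c s)"
    and "AE s in lebesgue_on {0..T}. loewner_le 0 (cQ c s + cQh c s)"
    and "AE s in lebesgue_on {0..T}. loewner_le (\<delta> *\<^sub>R mat 1) (cR c s)"
    and "AE s in lebesgue_on {0..T}. loewner_le (\<delta> *\<^sub>R mat 1) (cR c s + cRh c s)"
    and "loewner_le 0 (cG c)" "loewner_le 0 (cG c + cGh c)"
  shows "(\<exists>P PI. riccati_P_solution T c P \<and> riccati_Pi_solution T c P PI) \<and>
    (\<forall>P PI X u Y Z.
      riccati_P_solution T c P \<longrightarrow> riccati_Pi_solution T c P PI \<longrightarrow>
      mf_fbsde_solution M W T c x X u Y Z \<longrightarrow>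
      (AE \<omega> in M. AE s in lebesgue_on {0..T}.
         u s \<omega> = - (gain0 c P s *v (X s \<omega> - mean M X s)) - gain1 c P PI s *v mean M X s) \<and>
      (AE \<omega> in M. \<forall>s\<in>{0..T}.
         Y s \<omega> = P s *v (X s \<omega> - mean M X s) + PI s *v mean M X s) \<and>
      (AE \<omega> in M. AE s in lebesgue_on {0..T}.
         Z s \<omega> = (P s ** cA1 c s - P s ** cB1 c s ** gain0 c P s) *v (X s \<omega> - mean M X s)
               + (P s ** (cA1 c s + cA1h c s)
                  - P s ** (cB1 c s + cB1h c s) ** gain1 c P PI s) *v mean M X s) \<and>
      closed_loop_solution M W T c x P PI X)"
proof -
  interpret mf: mean_field_brownian T \<delta> c M W
    unfolding mean_field_brownian_def brownian_horizon_def brownian_horizon_axioms_def mf_problem_def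
    by (intro conjI assms)
  obtain P where P: "riccati_P_solution T c P" "\<And>s v. 0 \<le> v \<bullet> (P s *v v)" "\<And>s. transpose (P s) = P s" "bounded_measurable P"
    using mf.riccati_P_exists by blast
  obtain PI where "riccati_Pi_solution T c P PI" using mf.riccati_Pi_exists[OF P(2-4)] by blast
  with P(1) show ?thesis
    by (intro conjI allI impI exI) (assumption | rule mf.feedback_representation mf.Y_representation mf.Z_representation mf.closed_loop)+
qed

end
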